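(* The function $\mathcal W:\mathscr P(\mathbb R^d)\times\mathscr P(\mathbb R^d)\to[0,+\infty]$ is a (pseudo-)metric on $\mathscr P(\mathbb R^d)$, meaning a metric that may attain the value $+\infty$. The topology it induces is stronger than the topology of weak convergence. For each $\tau\in\mathscr P(\mathbb R^d)$ the set $\mathscr P_\tau:=\{\mu\in\mathscr P(\mathbb R^d): \mathcal W(\mu,\tau)<\infty\}$ equipped with the distance $\mathcal W$ is a complete geodesic space.
   Context: Notation. $\mathbb R_+=[0,\infty)$. $\mathscr P(\mathbb R^d)$ is the set of Borel probability measures on $\mathbb R^d$ with the topology of weak convergence (duality with bounded continuous functions). $G=\{(x,y)\in\mathbb R^d\times\mathbb R^d: x\neq y\}$, and $\mathcal M_{loc}(G)$ is the space of signed Radon measures on the open set $G$ with the weak* topology in duality with $C_c(G)$. For $\varphi:\mathbb R^d\to\mathbb R$ write $\bar\nabla\varphi(x,y)=\varphi(y)-\varphi(x)$. Jump kernel. For each $x\in\mathbb R^d$, $J(x,\cdot)$ is a (nonnegative) Radon measure on $\mathbb R^d\setminus\{x\}$ depending measurably on $x$, such that for every bounded continuous $f:\mathbb R^d\to\mathbb R$ the map $x\mapsto\int f(y)(1\wedge|x-y|^2)J(x,\mathrm dy)$ is bounded and continuous. $m$ is a Radon measure on $\mathbb R^d$ and $J$ is reversible w.r.t. $m$, i.e. the measure $J(x,\mathrm dy)m(\mathrm dx)$ on $G$ is symmetric. Mean function. $\theta:\mathbb R_+\times\mathbb R_+\to\mathbb R_+$ is fixed and satisfies: continuous on $\mathbb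 R_+\times\mathbb R_+$ and $C^1$ on $(0,\infty)^2$; $\theta(s,t)=\theta(t,s)$; $\theta(s,t)>0$ for $s,t>0$ and $\theta(1,1)=1$; $\theta(0,t)=0$ for $t\ge0$; $\theta(r,t)\le\theta(s,t)$ for $0\le r\le s$, $t\ge0$; $\theta(\lambda s,\lambda t)=\lambda\theta(s,t)$ for $\lambda>0$, $s,t\ge0$; $\theta$ is concave. Action. Let $\alpha(w,s,t)=\frac{w^2}{2\theta(s,t)}$ if $\theta(s,t)\ne0$, $\alpha(w,s,t)=0$ if $\theta(s,t)=0$ and $w=0$, $\alpha(w,s,t)=+\infty$ if $\theta(s,t)=0$ and $w\ne0$. For $\mu\in\mathscr P(\mathbb R^d)$ let $\mu^1(\mathrm dx,\mathrm dy)=J(x,\mathrm dy)\mu(\mathrm dx)$ and $\mu^2(\mathrm dx,\mathrm dy)=J(y,\mathrm dx)\mu(\mathrm dy)$, measures on $G$. For $\boldsymbol\nu\in\mathcal M_{loc}(G)$ choose a nonnegative $\sigma\in\mathcal M_{loc}(G)$ with $\mu^i=\rho^i\sigma$ ($i=1,2$) and $\boldsymbol\nu=w\sigma$, and set $\mathcal A(\mu,\boldsymbol\nu)=\int_G\alpha(w,\rho^1,\rho^2)\,\mathrm d\sigma\in[0,\infty]$ (independent of the choice of $\sigma$ by homogeneity). Continuity equation. For $T>0$ and $\bar\mu_0,\bar\mu_1\in\mathscr P(\mathbb R^d)$, $\mathcal{CE}_T(\bar\mu_0,\bar\mu_1)$ is the set of pairs $(\mu,\boldsymbol\nu)$ such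 that (i) $\mu:[0,T]\to\mathscr P(\mathbb R^d)$, $t\mapsto\mu_t$, is weakly continuous; (ii) $\mu_0=\bar\mu_0$, $\mu_T=\bar\mu_1$; (iii) $(\boldsymbol\nu_t)_{t\in[0,T]}$ is a Borel family in $\mathcal M_{loc}(G)$; (iv) $\int_0^T\int_G(1\wedge|x-y|)|\boldsymbol\nu_t|(\mathrm dx,\mathrm dy)\mathrm dt<\infty$; (v) $\int_0^T\int\partial_t\varphi_t\,\mathrm d\mu_t\,\mathrm dt+\frac12\int_0^T\int_G\bar\nabla\varphi_t\,\mathrm d\boldsymbol\nu_t\,\mathrm dt=0$ for all $\varphi\in C_c^\infty((0,T)\times\mathbb R^d)$. Distance. $\mathcal W(\bar\mu_0,\bar\mu_1)^2:=\inf\{\int_0^1\mathcal A(\mu_t,\boldsymbol\nu_t)\,\mathrm dt:\ (\mu,\boldsymbol\nu)\in\mathcal{CE}_1(\bar\mu_0,\bar\mu_1)\}$ (with $\inf\emptyset=+\infty$). A geodesic space is one in which any two points $\mu_0,\mu_1$ are joined by a curve $(\mu_t)_{t\in[0,1]}$ with $\mathcal W(\mu_s,\mu_t)=|t-s|\,\mathcal W(\mu_0,\mu_1)$ for all $s,t\in[0,1]$. *)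

theory Defs
  imports "HOL-Probability.Probability"
begin

section \<open>Measures and their topologies\<close>

text \<open>A Radon measure on a subset \<open>S\<close> of a Euclidean space is carried by the trace sigma-algebra of
  \<open>S\<close>, so integrals against it range over \<open>S\<close> only.  All uses below have \<open>S\<close> open, where every
  Borel measure that is finite on compact sets is automatically regular.\<close>

definition radon_on :: "'b::euclidean_space set \<Rightarrow> 'b measure \<Rightarrow> bool" where
  "radon_on S M \<longleftrightarrow> sets M = sets (restrict_space borel S) \<and>
     (\<forall>K. compact K \<and> K \<subseteq> S \<longrightarrow> emeasure M K < \<infinity>)"

definition prob_measures :: "'a::euclidean_space measure set" where
  "prob_measures = {\<mu>. sets \<mu> = sets borel \<and> prob_space \<mu>}"

definition weak_topology :: "'a::euclidean_space measure topology" where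
  "weak_topology = topology_generated_by
     {{\<mu> \<in> prob_measures. (\<integral>x. f x \<partial>\<mu>) \<in> U} | f U.
        continuous_on UNIV f \<and> bounded (range f) \<and> open (U :: real set)}"

text \<open>A signed Radon measure is in general not a real-valued set function on the whole
  sigma-algebra, because both its positive and its negative part may be infinite.  It is represented
  by its Jordan decomposition, the unique pair (positive part, negative part) of mutually singular
  Radon measures.\<close>

type_synonym 'b signed_radon = "'b measure \<times> 'b measure"

definition signed_radon_measures :: "'b::euclidean_space set \<Rightarrow> 'b signed_radon set" where
  "signed_radon_measures S = {(\<nu>p, \<nu>n). radon_on S \<nu>p \<and> radon_on S \<nu>n \<and>
     (\<exists>A \<in> sets (restrict_space borel S). emeasure \<nu>p (S - A) = 0 \<and> emeasure \<nu>n A = 0)}"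

definition signed_integral :: "'b signed_radon \<Rightarrow> ('b \<Rightarrow> real) \<Rightarrow> real" where
  "signed_integral \<nu> f = (\<integral>p. f p \<partial>(fst \<nu>)) - (\<integral>p. f p \<partial>(snd \<nu>))"

definition total_variation :: "'b signed_radon \<Rightarrow> 'b measure" where
  "total_variation \<nu> = measure_of (space (fst \<nu>)) (sets (fst \<nu>))
     (\<lambda>A. emeasure (fst \<nu>) A + emeasure (snd \<nu>) A)"

text \<open>Functions in \<open>C\<^sub>c(S)\<close>, \<open>S\<close> open, are extended by zero to the whole space.\<close>

definition compact_support_in :: "'b::euclidean_space set \<Rightarrow> ('b \<Rightarrow> real) \<Rightarrow> bool" where
  "compact_support_in S f \<longleftrightarrow> compact (closure {p. f p \<noteq> 0}) \<and> closure {p. f p \<noteq> 0} \<subseteq> S"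

definition weak_star_topology :: "'b::euclidean_space set \<Rightarrow> 'b signed_radon topology" where
  "weak_star_topology S = topology_generated_by
     {{\<nu> \<in> signed_radon_measures S. signed_integral \<nu> f \<in> U} | f U.
        continuous_on UNIV f \<and> compact_support_in S f \<and> open (U :: real set)}"

definition borel_of_topology :: "'c topology \<Rightarrow> 'c measure" where
  "borel_of_topology X = sigma (topspace X) {U. openin X U}"

section \<open>Differentiability classes\<close>

text \<open>Used for open \<open>S\<close> only.\<close>

fun Ck_on :: "nat \<Rightarrow> 'b::euclidean_space set \<Rightarrow> ('b \<Rightarrow> real) \<Rightarrow> bool" where
  "Ck_on 0 S f \<longleftrightarrow> continuous_on S f"
| "Ck_on (Suc k) S f \<longleftrightarrow> (\<forall>p\<in>S. f differentiable (at p)) \<and>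
     (\<forall>v. Ck_on k S (\<lambda>p. frechet_derivative f (at p) v))"

text \<open>\<open>C\<^sub>c\<^sup>\<infinity>((0,T) \<times> \<real>\<^sup>d)\<close>, again extended by zero.\<close>

definition test_function :: "real \<Rightarrow> (real \<times> 'a::euclidean_space \<Rightarrow> real) \<Rightarrow> bool" where
  "test_function T \<phi> \<longleftrightarrow> (\<forall>k. Ck_on k UNIV \<phi>) \<and> compact_support_in ({0<..<T} \<times> UNIV) \<phi>"

section \<open>Jump kernels\<close>

definition G :: "('a::euclidean_space \<times> 'a) set" where
  "G = {(x, y). x \<noteq> y}"

text \<open>The integrability clause excludes the default value \<open>0\<close> of the Bochner integral, for which
  the boundedness and continuity requirements would be void.\<close>

definition jump_kernel :: "('a::euclidean_space \<Rightarrow> 'a measure) \<Rightarrow> bool" where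
  "jump_kernel J \<longleftrightarrow>
     (\<forall>x. radon_on (- {x}) (J x)) \<and>
     (\<forall>B \<in> sets borel. (\<lambda>x. emeasure (J x) (B - {x})) \<in> borel_measurable borel) \<and>
     (\<forall>f. continuous_on UNIV f \<and> bounded (range f) \<longrightarrow>
        (\<forall>x. integrable (J x) (\<lambda>y. f y * min 1 ((norm (x - y))\<^sup>2))) \<and>
        bounded (range (\<lambda>x. \<integral>y. f y * min 1 ((norm (x - y))\<^sup>2) \<partial>(J x))) \<and>
        continuous_on UNIV (\<lambda>x. \<integral>y. f y * min 1 ((norm (x - y))\<^sup>2) \<partial>(J x)))"

text \<open>The measures \<open>J(x,dy) \<mu>(dx)\<close> and \<open>J(y,dx) \<mu>(dy)\<close> on \<open>G\<close>; the second one is the image of the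
  first under \<open>(x,y) \<mapsto> (y,x)\<close>.\<close>

definition jump_measure1 ::
  "('a::euclidean_space \<Rightarrow> 'a measure) \<Rightarrow> 'a measure \<Rightarrow> ('a \<times> 'a) measure" where
  "jump_measure1 J \<mu> = measure_of G (sets (restrict_space borel G))
     (\<lambda>B. \<integral>\<^sup>+x. emeasure (J x) {y. (x, y) \<in> B} \<partial>\<mu>)"

definition jump_measure2 ::
  "('a::euclidean_space \<Rightarrow> 'a measure) \<Rightarrow> 'a measure \<Rightarrow> ('a \<times> 'a) measure" where
  "jump_measure2 J \<mu> = distr (jump_measure1 J \<mu>) (restrict_space borel G) prod.swap"

definition reversible :: "('a::euclidean_space \<Rightarrow> 'a measure) \<Rightarrow> 'a measure \<Rightarrow> bool" where
  "reversible J m \<longleftrightarrow>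
     distr (jump_measure1 J m) (restrict_space borel G) prod.swap = jump_measure1 J m"

section \<open>Mean functions and the action\<close>

definition mean_function :: "(real \<Rightarrow> real \<Rightarrow> real) \<Rightarrow> bool" where
  "mean_function \<theta> \<longleftrightarrow>
     (\<forall>s\<ge>0. \<forall>t\<ge>0. \<theta> s t \<ge> 0) \<and>
     continuous_on ({0..} \<times> {0..}) (\<lambda>(s, t). \<theta> s t) \<and>
     Ck_on 1 ({0<..} \<times> {0<..}) (\<lambda>(s, t). \<theta> s t) \<and>
     (\<forall>s\<ge>0. \<forall>t\<ge>0. \<theta> s t = \<theta> t s) \<and>
     (\<forall>s>0. \<forall>t>0. \<theta> s t > 0) \<and> \<theta> 1 1 = 1 \<and>
     (\<forall>t\<ge>0. \<theta> 0 t = 0) \<and>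
     (\<forall>r s t. 0 \<le> r \<and> r \<le> s \<and> 0 \<le> t \<longrightarrow> \<theta> r t \<le> \<theta> s t) \<and>
     (\<forall>c>0. \<forall>s\<ge>0. \<forall>t\<ge>0. \<theta> (c * s) (c * t) = c * \<theta> s t) \<and>
     concave_on ({0..} \<times> {0..}) (\<lambda>(s, t). \<theta> s t)"

definition action_density :: "(real \<Rightarrow> real \<Rightarrow> real) \<Rightarrow> real \<Rightarrow> real \<Rightarrow> real \<Rightarrow> ennreal" where
  "action_density \<theta> w s t =
     (if \<theta> s t \<noteq> 0 then ennreal (w\<^sup>2 / (2 * \<theta> s t)) else if w = 0 then 0 else \<infinity>)"

text \<open>\<open>a\<close> is the value of the action computed with some dominating measure \<open>\<sigma>\<close>.  The last two
  density equations express \<open>\<nu> = w\<sigma>\<close>, since \<open>ennreal\<close> truncates negative numbers to \<open>0\<close>.\<close>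

definition action_value :: "(real \<Rightarrow> real \<Rightarrow> real) \<Rightarrow> ('a::euclidean_space \<Rightarrow> 'a measure) \<Rightarrow>
    'a measure \<Rightarrow> ('a \<times> 'a) signed_radon \<Rightarrow> ennreal \<Rightarrow> bool" where
  "action_value \<theta> J \<mu> \<nu> a \<longleftrightarrow> (\<exists>\<sigma> \<rho>1 \<rho>2 w.
     radon_on G \<sigma> \<and>
     \<rho>1 \<in> borel_measurable \<sigma> \<and> \<rho>2 \<in> borel_measurable \<sigma> \<and> w \<in> borel_measurable \<sigma> \<and>
     (\<forall>p. \<rho>1 p \<ge> 0 \<and> \<rho>2 p \<ge> 0) \<and>
     jump_measure1 J \<mu> = density \<sigma> (\<lambda>p. ennreal (\<rho>1 p)) \<and>
     jump_measure2 J \<mu> = density \<sigma> (\<lambda>p. ennreal (\<rho>2 p)) \<and>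
     fst \<nu> = density \<sigma> (\<lambda>p. ennreal (w p)) \<and>
     snd \<nu> = density \<sigma> (\<lambda>p. ennreal (- w p)) \<and>
     a = (\<integral>\<^sup>+p. action_density \<theta> (w p) (\<rho>1 p) (\<rho>2 p) \<partial>\<sigma>))"

definition action :: "(real \<Rightarrow> real \<Rightarrow> real) \<Rightarrow> ('a::euclidean_space \<Rightarrow> 'a measure) \<Rightarrow>
    'a measure \<Rightarrow> ('a \<times> 'a) signed_radon \<Rightarrow> ennreal" where
  "action \<theta> J \<mu> \<nu> = (SOME a. action_value \<theta> J \<mu> \<nu> a)"

section \<open>Continuity equation and distance\<close>

text \<open>Only the values of \<open>\<mu>\<close> and \<open>\<nu>\<close> at times in \<open>[0,T]\<close> matter.\<close>

definition CE :: "real \<Rightarrow> 'a::euclidean_space measure \<Rightarrow> 'a measure \<Rightarrow>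
    ((real \<Rightarrow> 'a measure) \<times> (real \<Rightarrow> ('a \<times> 'a) signed_radon)) set" where
  "CE T \<mu>0 \<mu>1 = {(\<mu>, \<nu>).
     (\<forall>t\<in>{0..T}. \<mu> t \<in> prob_measures) \<and>
     continuous_map (top_of_set {0..T}) weak_topology \<mu> \<and>
     \<mu> 0 = \<mu>0 \<and> \<mu> T = \<mu>1 \<and>
     \<nu> \<in> measurable (restrict_space borel {0..T}) (borel_of_topology (weak_star_topology G)) \<and>
     (\<integral>\<^sup>+t\<in>{0..T}. (\<integral>\<^sup>+(x, y). ennreal (min 1 (norm (x - y))) \<partial>(total_variation (\<nu> t))) \<partial>lborel)
       < \<infinity> \<and>
     (\<forall>\<phi>. test_function T \<phi> \<longrightarrow>
        (LINT t:{0..T}|lborel. (\<integral>x. deriv (\<lambda>s. \<phi> (s, x)) t \<partial>(\<mu> t))) +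
        1 / 2 * (LINT t:{0..T}|lborel. signed_integral (\<nu> t) (\<lambda>(x, y). \<phi> (t, y) - \<phi> (t, x)))
        = 0)}"

definition ennreal_sqrt :: "ennreal \<Rightarrow> ennreal" where
  "ennreal_sqrt a = (if a = \<infinity> then \<infinity> else ennreal (sqrt (enn2real a)))"

definition W :: "(real \<Rightarrow> real \<Rightarrow> real) \<Rightarrow> ('a::euclidean_space \<Rightarrow> 'a measure) \<Rightarrow>
    'a measure \<Rightarrow> 'a measure \<Rightarrow> ennreal" where
  "W \<theta> J \<mu>0 \<mu>1 = ennreal_sqrt
     (Inf {\<integral>\<^sup>+t\<in>{0..1}. action \<theta> J (\<mu> t) (\<nu> t) \<partial>lborel | \<mu> \<nu>. (\<mu>, \<nu>) \<in> CE 1 \<mu>0 \<mu>1})"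

section \<open>Extended metrics and geodesic spaces\<close>

definition extended_metric_on :: "'c set \<Rightarrow> ('c \<Rightarrow> 'c \<Rightarrow> ennreal) \<Rightarrow> bool" where
  "extended_metric_on X D \<longleftrightarrow>
     (\<forall>x\<in>X. \<forall>y\<in>X. D x y = 0 \<longleftrightarrow> x = y) \<and>
     (\<forall>x\<in>X. \<forall>y\<in>X. D x y = D y x) \<and>
     (\<forall>x\<in>X. \<forall>y\<in>X. \<forall>z\<in>X. D x z \<le> D x y + D y z)"

definition extended_metric_topology :: "'c set \<Rightarrow> ('c \<Rightarrow> 'c \<Rightarrow> ennreal) \<Rightarrow> 'c topology" where
  "extended_metric_topology X D =
     topology (\<lambda>U. U \<subseteq> X \<and> (\<forall>x\<in>U. \<exists>e>0. \<forall>y\<in>X. D x y < e \<longrightarrow> y \<in> U))"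

lemma openin_extended_metric_topology:
  "openin (extended_metric_topology X D) U \<longleftrightarrow>
     U \<subseteq> X \<and> (\<forall>x\<in>U. \<exists>e>0. \<forall>y\<in>X. D x y < e \<longrightarrow> y \<in> U)"
proof -
  define P where "P = (\<lambda>U. U \<subseteq> X \<and> (\<forall>x\<in>U. \<exists>e>0. \<forall>y\<in>X. D x y < e \<longrightarrow> y \<in> U))"
  have "P (S \<inter> U)" if S: "P S" and U: "P U" for S U
    unfolding P_def
  proof (intro conjI ballI)
    show "S \<inter> U \<subseteq> X" using S unfolding P_def by blast
    fix x assume x: "x \<in> S \<inter> U"
    obtain d where "d > 0" "\<forall>y\<in>X. D x y < d \<longrightarrow> y \<in> S"
      using S x unfolding P_def by blast
    moreover obtain e where "e > 0" "\<forall>y\<in>X. D x y < e \<longrightarrow> y \<in> U"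
      using U x unfolding P_def by blast
    ultimately have "min d e > 0 \<and> (\<forall>y\<in>X. D x y < min d e \<longrightarrow> y \<in> S \<inter> U)"
      by simp
    then show "\<exists>e>0. \<forall>y\<in>X. D x y < e \<longrightarrow> y \<in> S \<inter> U" by (rule exI)
  qed
  moreover have "P (\<Union>\<K>)" if K: "\<forall>S\<in>\<K>. P S" for \<K>
    unfolding P_def
  proof (intro conjI ballI)
    show "\<Union>\<K> \<subseteq> X" using K unfolding P_def by blast
    fix x assume "x \<in> \<Union>\<K>"
    then obtain S where S: "S \<in> \<K>" "x \<in> S" by blast
    then have "P S" using K by blast
    then obtain e where "e > 0" "\<forall>y\<in>X. D x y < e \<longrightarrow> y \<in> S"
      using S(2) unfolding P_def by blast
    then have "e > 0 \<and> (\<forall>y\<in>X. D x y < e \<longrightarrow> y \<in> \<Union>\<K>)" using S(1) by blast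
    then show "\<exists>e>0. \<forall>y\<in>X. D x y < e \<longrightarrow> y \<in> \<Union>\<K>" by (rule exI)
  qed
  ultimately have "istopology P" unfolding istopology_def by blast
  then have "openin (topology P) U = P U" by (simp only: topology_inverse')
  then show ?thesis by (simp only: P_def extended_metric_topology_def)
qed

definition geodesic_space :: "'c set \<Rightarrow> ('c \<Rightarrow> 'c \<Rightarrow> real) \<Rightarrow> bool" where
  "geodesic_space X d \<longleftrightarrow> (\<forall>x\<in>X. \<forall>y\<in>X. \<exists>c :: real \<Rightarrow> 'c.
     (\<forall>t\<in>{0..1}. c t \<in> X) \<and> c 0 = x \<and> c 1 = y \<and>
     (\<forall>s\<in>{0..1}. \<forall>t\<in>{0..1}. d (c s) (c t) = \<bar>t - s\<bar> * d x y))"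

definition finite_component :: "(real \<Rightarrow> real \<Rightarrow> real) \<Rightarrow> ('a::euclidean_space \<Rightarrow> 'a measure) \<Rightarrow>
    'a measure \<Rightarrow> 'a measure set" where
  "finite_component \<theta> J \<tau> = {\<mu> \<in> prob_measures. W \<theta> J \<mu> \<tau> < \<infinity>}"

end

(*
  The key device is to work with the dual, flux-free form of the action.  For a weakly continuous curve mu
  put 2 L(l) - Q(l)/2 for a finite list l of triples (s, t, phi), where L(l) sums the increments of the integral
  of phi over mu between s and t, and Q(l) is the time integral of the squared discrete gradient of the active
  test functions, weighted by theta(d mu^1, d mu^2).  The supremum over all l is the energy of the curve.
  Concavity of theta makes the weighted squared gradient upper semicontinuous in mu, so the energy is lower
  semicontinuous; it is additive in time, scales under reparametrisation, and bounds both the tails and the time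
  modulus of continuity, so Prokhorov's theorem gives compactness of curves of bounded energy.  Hence minimisers
  exist, and the metric, completeness and geodesic properties follow for the distance defined by the energy.

  This distance is W.  Along any solution of the continuity equation the energy is bounded by the action
  (Young's inequality, after testing the equation with products of time cutoffs and test functions).
  Conversely, for a curve of finite energy the gradients of a maximising sequence of lists form, for almost
  every t, a Cauchy sequence in L^2 of the weighted measure (parallelogram identity); the limit v is a velocity
  field, and nu = v theta(d mu^1, d mu^2) solves the continuity equation with action at most the energy.
*)
theory Submission
  imports Defs "HOL-Computational_Algebra.Polynomial"
begin

section \<open>Measures and densities\<close>

text \<open>The constants of the energy come from convex duality. The conjugate of
  \<open>w^2 / (2 * theta)\<close> is \<open>g^2 * theta / 2\<close>, hence the 1/2 in front of
  \<open>Q\<close>; the 1/2 in front of the flux term of the continuity equation makes an increment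
  of the integral of phi half a flux integral, hence the 2 in front of \<open>L\<close>. Lists are
  step functions in time, so cutting, joining, reversing and rescaling curves act on them directly,
  and no regularity in time of the weighted measure is involved. Two obstacles shape the rest.
  \<open>J\<close> may have infinite mass near the diagonal: it is replaced by a kernel
  \<open>K\<close> of mass at most 1, and the unbounded weight \<open>cc\<close> is restored inside
  the integrals, where integrands dominated by \<open>kk\<close> keep all products bounded. And
  integrals against theta(d mu^1, d mu^2) are only upper semicontinuous in time, whereas nu must be
  Borel for the weak* topology: the total mass is recorded as an additional coordinate, along which
  upper semicontinuity improves to convergence.\<close>

abbreviation (input) bm :: "'b measure => ('b => 'c::topological_space) set"
 where "bm M \<equiv> borel_measurable M"
abbreviation (input) PM :: "'a::euclidean_space measure set" where "PM \<equiv> prob_measures"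
abbreviation (input) SRM :: "'b::euclidean_space set => 'b signed_radon set" where "SRM \<equiv> signed_radon_measures"
abbreviation (input) I01 :: "real => 'c::zero_neq_one" where "I01 \<equiv> indicator {0..1}"
abbreviation (input) nint :: "'b measure => ('b => real) => ennreal" where "nint M f \<equiv> nn_integral M (%x. ennreal (f x))"
abbreviation (input) dens :: "'b measure => ('b => real) => 'b measure" where "dens M f \<equiv> density M (%x. ennreal (f x))"
abbreviation (input) cts :: "('b::topological_space => 'c::topological_space) => bool" where "cts f \<equiv> continuous_on UNIV f"
abbreviation (input) infty :: "'c::infinity" where "infty \<equiv> \<infinity>"
abbreviation (input) limto :: "('b => 'c::topological_space) => 'c => 'b filter => bool" (infixr "--->" 55)
 where "f ---> l \<equiv> (f \<longlongrightarrow> l)"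
abbreviation (input) seqlim :: "(nat => 'c::topological_space) => 'c => bool" ("_ ----> _" [60,60] 60)
 where "X ----> L \<equiv> X \<longlonglongrightarrow> L"

lemmas Bint_bound = Bochner_Integration.integrable_bound
lemmas Bint_add = Bochner_Integration.integrable_add
lemmas Bint_cong = Bochner_Integration.integral_cong
lemmas Bint_diff = Bochner_Integration.integral_diff
lemmas cts_bm = borel_measurable_continuous_onI

text \<open>The first argument fixes the sigma-algebra. The sum serves as a common dominating
  measure and, for the two parts of a Jordan decomposition, is the total variation.\<close>

definition summ :: "'a measure => 'a measure => 'a measure" where
 "summ M N = measure_of (space M) (sets M) (%A. emeasure M A + emeasure N A)"

lemma space_summ [simp]: "space (summ M N) = space M"
 and sets_summ [simp, measurable_cong]: "sets (summ M N) = sets M" by (simp_all add: summ_def)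

lemma emeasure_summ:
 assumes "sets N = sets M" "A : sets M"
 shows "emeasure (summ M N) A = emeasure M A + emeasure N A"
proof (rule emeasure_measure_of_sigma[OF _ _ _ assms(2), of "space M" "%A. emeasure M A + emeasure N A",
   folded summ_def])
 show "sigma_algebra (space M) (sets M)" ..
 show "positive (sets M) (%A. emeasure M A + emeasure N A)" by (simp add: positive_def)
 show "countably_additive (sets M) (%A. emeasure M A + emeasure N A)" unfolding countably_additive_def
 proof safe
  fix A :: "nat => _" assume A: "range A <= sets M" "disjoint_family A" "\<Union> (range A) : sets M"
  let ?X = "\<Union> (range A)"
  let ?Y = "\<Sum>i. emeasure M (A i) + emeasure N (A i)"
  have "?Y = (\<Sum>i. emeasure M (A i)) + (\<Sum>i. emeasure N (A i))"
   by (intro suminf_add[symmetric] summableI)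
  also have "... = emeasure M ?X + emeasure N ?X" using A assms by (simp add: suminf_emeasure)
  finally show "?Y = emeasure M ?X + emeasure N ?X" .
 qed
qed

lemma nn_integral_summ:
 assumes "sets N = sets M" and "f : bm M"
 shows "nn_integral (summ M N) (%x. f x) = nn_integral M (%x. f x) + nn_integral N (%x. f x)" using assms(2)
proof (induction rule: borel_measurable_induct)
 case (cong f g)
 have sp: "space N = space M" using assms(1) by (rule sets_eq_imp_space_eq)
 have "nn_integral (summ M N) (%x. f x) = nn_integral (summ M N) (%x. g x)"
  "nn_integral M (%x. f x) = nn_integral M (%x. g x)" "nn_integral N (%x. f x) = nn_integral N (%x. g x)"
  using cong(3) by (auto intro!: nn_integral_cong simp: sp)
 thus ?case using cong by simp
next
 case (set A)
 thus ?case using assms by (simp add: emeasure_summ)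
next
 case (mult u c)
 show ?case
  using `u : bm M` assms using mult by (simp add: nn_integral_cmult distrib_left)

next
 case (add u v)
 show ?case
  using `u : bm M` `v : bm M` assms using add by (simp add: nn_integral_add)

next
 case (seq U)
 have [measurable]: "U i : bm N" "U i : bm (summ M N)" for i using seq assms(1) by auto
 let ?X = "%x. (SUP i. U i) x"
 have eq: "nn_integral K ?X = (SUP i. nn_integral K (%x. U i x))" if "!!i. U i : bm K" for K
  unfolding SUP_apply by (rule nn_integral_monotone_convergence_SUP[OF seq(3) that])
 have inc: "incseq (%i. nn_integral K (%x. U i x))" for K using seq by (auto simp: incseq_def le_fun_def nn_integral_mono)
 have "(SUP i. nn_integral M (%x. U i x) + nn_integral N (%x. U i x)) = (SUP i. nn_integral M (%x. U i x)) + (SUP i. nn_integral N (%x. U i x))"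
  by (rule ennreal_SUP_add[OF inc inc])
 moreover have "nn_integral M ?X = (SUP i. nn_integral M (%x. U i x))"
  "nn_integral N ?X = (SUP i. nn_integral N (%x. U i x))"
  "nn_integral (summ M N) ?X = (SUP i. nn_integral (summ M N) (%x. U i x))" by (rule eq; measurable)+
 ultimately show ?case by (simp only: seq.IH)
qed

lemma finite_measure_summ:
 assumes "finite_measure M" "finite_measure N" "sets N = sets M"
 shows "finite_measure (summ M N)"
proof (rule finite_measureI)
 show "emeasure (summ M N) (space (summ M N)) ~= infty" using assms(3)
  using finite_measure.emeasure_finite[OF assms(1)] finite_measure.emeasure_finite[OF assms(2)] by (simp add: emeasure_summ assms)

qed

lemma ac_summ:
 assumes "sets N = sets M"
 shows "absolutely_continuous (summ M N) M" "absolutely_continuous (summ M N) N"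
 using assms by (auto simp: absolutely_continuous_def null_sets_def emeasure_summ)

lemma real_dens:
 assumes "sigma_finite_measure tau" "sigma_finite_measure sg" "sets sg = sets tau" "absolutely_continuous tau sg"
 obtains s :: "'a => real" where "s : bm tau" "!!p. s p >= 0" "dens tau s = sg"
proof -
 interpret sigma_finite_measure tau by fact
 let ?s = "%p. enn2real (RN_deriv tau sg p)"
 have "AE p in tau. RN_deriv tau sg p = ennreal (?s p)" using RN_deriv_finite[OF assms(2,4,3)] by (auto simp: less_top)
 hence "dens tau ?s = density tau (RN_deriv tau sg)" by (intro density_cong) auto
 also have "... = sg" by (rule density_RN_deriv[OF assms(4,3)])
 finally show ?thesis by (intro that) auto
qed

text \<open>Both integrals are moved to the dominating measure \<open>summ sg sg'\<close>: its
  densities \<open>s\<close> and \<open>s'\<close> can be pulled into the arguments of the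
  one-homogeneous \<open>H\<close>, where uniqueness of densities makes the arguments agree. With
  the action density for \<open>H\<close> this is the independence of the action from the reference
  measure; with the mean function it identifies the weighted measure.\<close>

lemma homogeneous_integral_unique:
 fixes H :: "'p => real => real => real => ennreal"
 assumes fin: "sigma_finite_measure sg" "sigma_finite_measure sg'" "sigma_finite_measure (summ sg sg')"
  and sets: "sets sg' = sets sg"
  and meas: "w : bm sg" "r1 : bm sg" "r2 : bm sg"
   "w' : bm sg" "r1' : bm sg" "r2' : bm sg"
  and pos: "!!p. r1 p >= 0" "!!p. r2 p >= 0" "!!p. r1' p >= 0" "!!p. r2' p >= 0"
  and eq: "dens sg r1 = dens sg' r1'"
   "dens sg r2 = dens sg' r2'"
   "dens sg w = dens sg' w'"
   "dens sg (%p. - w p) = dens sg' (%p. - w' p)"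
  and hom: "!!p c u s t. c >= 0 ==> s >= 0 ==> t >= 0 ==> H p (c * u) (c * s) (c * t) = ennreal c * H p u s t"
  and Hm: "!!u s t. u : bm sg ==> s : bm sg ==> t : bm sg ==>
   (!!p. s p >= 0) ==> (!!p. t p >= 0) ==> (%p. H p (u p) (s p) (t p)) : bm sg"
 shows "nn_integral sg (%p. H p (w p) (r1 p) (r2 p)) = nn_integral sg' (%p. H p (w' p) (r1' p) (r2' p))"
proof -
 let ?tau = "summ sg sg'"
 interpret tau: sigma_finite_measure ?tau by fact
 obtain s where s: "s : bm ?tau" "!!p. s p >= 0" "dens ?tau s = sg" using real_dens[OF fin(3) fin(1)] ac_summ[OF sets] by auto
 obtain s' where s': "s' : bm ?tau" "!!p. s' p >= 0" "dens ?tau s' = sg'" using real_dens[OF fin(3) fin(2)] ac_summ[OF sets] sets by auto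
 have [measurable]: "s : bm sg" "s' : bm sg" using s s'(1) by auto
 note meas[measurable]
 have step: "dens sg f = dens ?tau (%p. s p * f p)"
  if [measurable]: "f : bm sg" for f by (subst s(3)[symmetric]) (auto simp: density_density_eq ennreal_mult' s(2))
 have step': "dens sg' f = dens ?tau (%p. s' p * f p)"
  if [measurable]: "f : bm sg" for f by (subst s'(3)[symmetric]) (auto simp: density_density_eq ennreal_mult' s'(2))
 have ae: "AE p in ?tau. ennreal (s p * f p) = ennreal (s' p * f' p)"
  if [measurable]: "f : bm sg" "f' : bm sg"
   and "dens sg f = dens sg' f'" for f f' using that by (intro tau.density_unique) (auto simp: step step')
 have "nn_integral sg (%p. H p (w p) (r1 p) (r2 p)) = nn_integral ?tau (%p. ennreal (s p) * H p (w p) (r1 p) (r2 p))"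
  by (subst s(3)[symmetric], subst nn_integral_density) (auto intro!: Hm pos cong: measurable_cong_sets)
 also have "... = nn_integral ?tau (%p. H p (s p * w p) (s p * r1 p) (s p * r2 p))" by (simp add: hom s pos)
 also have "... = nn_integral ?tau (%p. H p (s' p * w' p) (s' p * r1' p) (s' p * r2' p))"
 proof (rule nn_integral_cong_AE)
  have "AE p in ?tau. ennreal (s p * r1 p) = ennreal (s' p * r1' p)"
   "AE p in ?tau. ennreal (s p * r2 p) = ennreal (s' p * r2' p)"
   "AE p in ?tau. ennreal (s p * w p) = ennreal (s' p * w' p)"
   "AE p in ?tau. ennreal (s p * - w p) = ennreal (s' p * - w' p)" by (rule ae; use eq in simp)+
  thus "AE p in ?tau. H p (s p * w p) (s p * r1 p) (s p * r2 p) = H p (s' p * w' p) (s' p * r1' p) (s' p * r2' p)"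
  proof eventually_elim
   case (elim p)
   \<comment> \<open>\<open>ennreal\<close> sends negative numbers to 0, so only the equations for
     \<open>w\<close> and for \<open>- w\<close> together determine the signed value.\<close>
   have "s p * w p = s' p * w' p"
   proof (cases "s p * w p >= 0")
    case True
    show ?thesis
    proof (cases "s' p * w' p >= 0")
     case False
     have "ennreal (s' p * - w' p) = 0" using elim True by (simp add: ennreal_neg)
     thus ?thesis using False by (simp only: ennreal_eq_0_iff)
    qed (use True elim(3) in simp)
   next
    case False
    hence "ennreal (s p * - w p) > 0" by simp
    hence "s' p * - w' p > 0" by (simp only: elim ennreal_less_zero_iff)
    thus ?thesis using False elim by simp
   qed
   thus ?case using elim pos s s' by simp
  qed
 qed
 also have "... = nn_integral ?tau (%p. ennreal (s' p) * H p (w' p) (r1' p) (r2' p))" by (simp add: hom s' pos)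
 also have "... = nn_integral sg' (%p. H p (w' p) (r1' p) (r2' p))"
  by (subst s'(3)[symmetric], subst nn_integral_density) (auto intro!: Hm pos cong: measurable_cong_sets)
 finally show ?thesis .
qed

text \<open>Regularity of \<open>N\<close> puts \<open>B\<close> between a compact \<open>K\<close>
  and an open \<open>U\<close> with small difference; a Urysohn function of this pair differs from
  the indicator only on \<open>U - K\<close>.\<close>

lemma continuous_approx_indicator:
 fixes N :: "'b::euclidean_space measure"
 assumes "finite_measure N" and sets: "sets N = sets borel" and B: "B : sets borel" and "e > 0"
 obtains f :: "'b => real" where "cts f" "!!p. 0 <= f p" "!!p. f p <= 1"
  "(LINT p|N. abs (f p - indicator B p)) < e"
proof -
 interpret finite_measure N by fact
 have fin: "emeasure N (space N) ~= infty" by simp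
 have "EX K:{K. K <= B & compact K}. emeasure N B < emeasure N K + ennreal (e/2)"
 proof (cases "measure N B = 0")
  case True
  hence "emeasure N B = 0" by (simp only: emeasure_eq_measure ennreal_0)
  thus ?thesis using `e > 0` by (intro bexI[of _ "{}"]) simp_all
 next
  case False
  hence "ennreal (measure N B - e/2) < emeasure N B"
   unfolding emeasure_eq_measure using `e > 0` measure_nonneg[of N B] by (intro ennreal_lessI) linarith+
  hence "ennreal (measure N B - e/2) < (SUP K\<in>{K. K <= B & compact K}. emeasure N K)" by (simp only: inner_regular[OF sets fin B])
  then obtain K where K: "K <= B" "compact K" "ennreal (measure N B - e/2) < emeasure N K" by (subst (asm) less_SUP_iff) blast
  have "measure N B < measure N K + e/2"
  proof (cases "measure N B - e/2 >= 0")
   case True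
   thus ?thesis
    using K by (simp only: emeasure_eq_measure ennreal_less_iff)
  next
   case False
   thus ?thesis using measure_nonneg[of N K] by linarith
  qed
  hence "ennreal (measure N B) < ennreal (measure N K) + ennreal (e/2)"
   using `e > 0` by (subst ennreal_plus[symmetric]) (simp_all add: ennreal_less_iff del: ennreal_plus)
  thus ?thesis using K by (intro bexI) (simp_all only: emeasure_eq_measure mem_Collect_eq)
 qed
 then obtain K where K: "K <= B" "compact K" "emeasure N B < emeasure N K + ennreal (e/2)" by auto
 have "emeasure N B < emeasure N B + ennreal (e/2)" using `e > 0` by simp
 hence "(INF U\<in>{U. B <= U & open U}. emeasure N U) < emeasure N B + ennreal (e/2)" by (subst (asm) outer_regular[OF sets fin B])
 then obtain U where U: "B <= U" "open U" "emeasure N U < emeasure N B + ennreal (e/2)" by (subst (asm) INF_less_iff) blast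
 have "closed K" "closed (- U)" "K Int - U = {}" using K U by (auto simp: compact_imp_closed)
 then obtain f :: "'b => real" where f: "cts f" "!!x. f x : closed_segment 1 0"
  "!!x. x : K ==> f x = 1" "!!x. x : - U ==> f x = 0" by (rule Urysohn) blast
 have f01: "0 <= f p" "f p <= 1" for p using f by (auto simp: closed_segment_eq_real_ivl)
 have [measurable]: "f : bm N" using f(1) cts_bm measurable_cong_sets[OF sets] by auto
 have [measurable]: "B : sets N" "K : sets N" "U : sets N" using B K U sets by (auto simp: borel_compact)
 have le: "abs (f p - indicator B p) <= indicator (U - K) p" for p using f01 f K(1) U(1) by (auto simp: indicator_def)
 have "(LINT p|N. abs (f p - indicator B p)) <= (LINT p|N. indicator (U - K) p)"
 proof (rule integral_mono)
  show "integrable N (%p. abs (f p - indicator B p))"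
  proof (rule integrable_const_bound[where B=1])
   show "AE p in N. norm (abs (f p - indicator B p)) <= 1" using order_trans[OF le] by simp
  qed measurable
  show "integrable N (indicator (U - K) :: _ => real)" by (auto simp: less_top[symmetric])
 qed (rule le)
 also have "... = measure N (U - K)" by simp
 also have "... = measure N U - measure N K" using K U by (intro finite_measure_Diff) auto
 also have "... < e" using K U `e > 0` by (simp add: emeasure_eq_measure ennreal_plus[symmetric] ennreal_less_iff del: ennreal_plus)
 finally show ?thesis using that f f01 by simp
qed

section \<open>Smooth test functions\<close>

definition smooth :: "('b::euclidean_space => real) => bool" where
 "smooth f \<longleftrightarrow> (ALL k. Ck_on k UNIV f)"

lemma Ck_SucI:
 assumes "!!x. (f has_derivative f' x) (at x)" "!!v. Ck_on k UNIV (%x. f' x v)"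
 shows "Ck_on (Suc k) UNIV f"
proof -
 show ?thesis
  using frechet_derivative_at[OF assms(1)] using assms by (auto simp: differentiable_def)

qed

lemma Ck_SucD:
 assumes "Ck_on (Suc k) UNIV f"
 shows "(f has_derivative frechet_derivative f (at x)) (at x)" "Ck_on k UNIV (%x. frechet_derivative f (at x) v)"
 using assms by (auto simp: frechet_derivative_works)

lemma Ck_Suc_imp: "Ck_on (Suc k) UNIV f ==> Ck_on k UNIV f"
proof (induction k arbitrary: f)
 case 0
 thus ?case by (auto simp: continuous_on_eq_continuous_within differentiable_imp_continuous_within)
next
 case (Suc k)
 thus ?case by simp
qed

lemma Ck_const: "Ck_on k UNIV (%x. c)"
proof (induction k arbitrary: c)
 case (Suc k)
 show ?case by (auto intro!: Suc)
qed auto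

lemma Ck_bounded_linear: "bounded_linear f ==> Ck_on k UNIV f"
proof (cases k)
 case 0
 assume "bounded_linear f"
 thus ?thesis using 0 by (auto simp: linear_continuous_on)
next
 case (Suc n)
 assume "bounded_linear f"
 thus ?thesis unfolding Suc by (intro Ck_SucI) (auto intro: bounded_linear_imp_has_derivative Ck_const)
qed

lemma Ck_add: "Ck_on k UNIV f ==> Ck_on k UNIV g ==> Ck_on k UNIV (%x. f x + g x)"
proof (induction k arbitrary: f g)
 case 0
 thus ?case by (auto intro: continuous_intros)
next
 case (Suc k)
 note f = Ck_SucD[OF Suc.prems(1)] and g = Ck_SucD[OF Suc.prems(2)]
 show ?case by (rule Ck_SucI[OF has_derivative_add[OF f(1) g(1)]]) (rule Suc.IH[OF f(2) g(2)])
qed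

lemma Ck_mult: "Ck_on k UNIV f ==> Ck_on k UNIV g ==> Ck_on k UNIV (%x. f x * g x)"
proof (induction k arbitrary: f g)
 case 0
 thus ?case by (auto intro: continuous_intros)
next
 case (Suc k)
 note f = Ck_SucD[OF Suc.prems(1)] and g = Ck_SucD[OF Suc.prems(2)]
 show ?case by (rule Ck_SucI[OF has_derivative_mult[OF f(1) g(1)]])
   (intro Ck_add Suc.IH f g Ck_Suc_imp[OF Suc.prems(1)] Ck_Suc_imp[OF Suc.prems(2)])
qed

lemma Ck_compose_real: "Ck_on k UNIV psi ==> Ck_on k UNIV f ==> Ck_on k UNIV (%x. psi (f x :: real))"
proof (induction k arbitrary: f psi)
 case 0
 thus ?case by (auto intro: continuous_on_compose2)
next
 case (Suc k)
 note p = Ck_SucD[OF Suc.prems(1)] and f = Ck_SucD[OF Suc.prems(2)]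
 have lin: "frechet_derivative psi (at u) z = frechet_derivative psi (at u) 1 * z" for u z
  using linear_cmul[OF has_derivative_linear[OF p(1)[of u]], of z 1] by simp
 have "((%x. psi (f x)) has_derivative (%v. frechet_derivative psi (at (f x)) 1 * frechet_derivative f (at x) v)) (at x)" for x
  using has_derivative_compose[OF f(1) p(1)] by (subst (asm) lin)
 thus ?case by (rule Ck_SucI) (intro Ck_mult f Suc.IH[OF p(2)] Ck_Suc_imp[OF Suc.prems(2)])
qed

lemma Ck_compose_affine:
 "bounded_linear h ==> Ck_on k UNIV f ==> Ck_on k UNIV (%x. f (a + h x))"
proof (induction k arbitrary: f)
 case 0
 hence "cts (%x. a + h x)" by (intro continuous_on_add continuous_on_const linear_continuous_on)
 from continuous_on_compose2[OF _ this, of UNIV f] 0 show ?case by simp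
next
 case (Suc k)
 note f = Ck_SucD[OF Suc.prems(2)]
 have d: "((%x. a + h x) has_derivative h) (at x)" for x
  using has_derivative_add[OF has_derivative_const bounded_linear_imp_has_derivative[OF Suc.prems(1)]] by simp
 show ?case by (rule Ck_SucI[OF has_derivative_compose[OF d f(1)]]) (rule Suc.IH[OF Suc.prems(1) f(2)])
qed

lemma smooth_const: "smooth (%x. c)"
 and smooth_bounded_linear: "bounded_linear f ==> smooth f"
 and smooth_add: "smooth f ==> smooth g ==> smooth (%x. f x + g x)"
 and smooth_mult: "smooth f ==> smooth g ==> smooth (%x. f x * g x)"
 and smooth_compose_real: "smooth psi ==> smooth f ==> smooth (%x. psi (f x :: real))"
 and smooth_compose_affine: "bounded_linear h ==> smooth f ==> smooth (%x. f (a + h x))"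
 by (auto simp: smooth_def Ck_const Ck_bounded_linear Ck_add Ck_mult Ck_compose_real Ck_compose_affine)

lemma smooth_polynomial: "real_polynomial_function p ==> smooth p" by (induction rule: real_polynomial_function.induct)
  (auto intro: smooth_const smooth_bounded_linear smooth_add smooth_mult)

lemma smooth_inner_self: "smooth (%x::'b::euclidean_space. x \<bullet> x)"
proof -
 have "Ck_on k UNIV (%x::'b. x \<bullet> x)" for k
 proof (cases k)
  case (Suc n)
  show ?thesis unfolding Suc
  proof (rule Ck_SucI)
   show "((%x::'b. x \<bullet> x) has_derivative (%v. x \<bullet> v + v \<bullet> x)) (at x)" for x by (auto intro!: derivative_eq_intros)
   show "Ck_on n UNIV (%x. x \<bullet> v + v \<bullet> x)" for v :: 'b
    by (intro Ck_add Ck_bounded_linear bounded_linear_inner_left bounded_linear_inner_right)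
  qed
 qed (auto intro: continuous_intros)
 thus ?thesis by (simp add: smooth_def)
qed

lemma smooth_continuous: "smooth f ==> cts f" unfolding smooth_def by (metis Ck_on.simps)

section \<open>A smooth step function and smooth cutoffs\<close>

definition Ep :: "real poly => real => real" where
 "Ep p x = (if x > 0 then poly p (inverse x) * exp (- inverse x) else 0)"

lemma poly_exp_tendsto_0: "((%u. poly p u * exp (- u)) ---> (0::real)) at_top"
proof -
 have "((%u. SUM i<=degree p. coeff p i * (u ^ i / exp u)) ---> (SUM i<=degree p. coeff p i * 0)) at_top"
  by (intro tendsto_intros tendsto_power_div_exp_0)
 thus ?thesis by (simp add: poly_altdef exp_minus divide_inverse sum_distrib_right mult.assoc)
qed

lemma Ep_tendsto: "((%h. Ep p h / h) ---> 0) (at 0)" unfolding filterlim_at_split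
proof
 have "eventually (%h. 0 = Ep p h / h) (at_left 0)" by (auto simp: eventually_at_filter Ep_def)
 thus "((%h. Ep p h / h) ---> 0) (at_left 0)" by (rule Lim_transform_eventually[OF tendsto_const])
 \<comment> \<open>For positive \<open>h\<close>, dividing by \<open>h\<close> multiplies the
   polynomial in \<open>inverse h\<close> by its variable, so the difference quotient at 0 is again
   a member of the family.\<close>
 have "((%h. poly (pCons 0 p) (inverse h) * exp (- inverse h)) ---> 0) (at_right 0)"
  by (rule filterlim_compose[OF poly_exp_tendsto_0 filterlim_inverse_at_top_right])
 moreover have "eventually (%h. poly (pCons 0 p) (inverse h) * exp (- inverse h) = Ep p h / h) (at_right 0)"
  by (auto simp: eventually_at_filter Ep_def divide_inverse)
 ultimately show "((%h. Ep p h / h) ---> 0) (at_right 0)" by (rule Lim_transform_eventually)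
qed

text \<open>The family \<open>Ep p\<close> is closed under differentiation: with u = 1/x, the
  derivative of p(u) exp(-u) is u^2 (p(u) - p'(u)) exp(-u), and \<open>[:0,0,1:]\<close> is u^2.
  Smoothness thus becomes an induction over the order with \<open>p\<close> arbitrary.\<close>

lemma Ep_deriv: "(Ep p has_real_derivative Ep ([:0,0,1:] * (p - pderiv p)) x) (at x)"
proof -
 consider "x > 0" | "x < 0" | "x = 0" by force
 thus ?thesis
 proof cases
  case 1
  have "((%x. poly p (inverse x) * exp (- inverse x)) has_real_derivative
   poly (pderiv p) (inverse x) * (- (inverse x * inverse x)) * exp (- inverse x)
   + poly p (inverse x) * (exp (- inverse x) * (inverse x * inverse x))) (at x)" using 1 by (auto intro!: derivative_eq_intros)
  hence "(Ep p has_real_derivative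
   poly (pderiv p) (inverse x) * (- (inverse x * inverse x)) * exp (- inverse x)
   + poly p (inverse x) * (exp (- inverse x) * (inverse x * inverse x))) (at x)"
   by (rule has_field_derivative_transform_within_open[where S="{0<..}"]) (use 1 in \<open>auto simp: Ep_def\<close>)
  moreover have "poly (pderiv p) (inverse x) * (- (inverse x * inverse x)) * exp (- inverse x)
   + poly p (inverse x) * (exp (- inverse x) * (inverse x * inverse x)) = Ep ([:0,0,1:] * (p - pderiv p)) x"
   using 1 by (simp add: Ep_def algebra_simps)
  ultimately show ?thesis by simp
 next
  case 2
  have "(Ep p has_real_derivative 0) (at x)"
    by (rule has_field_derivative_transform_within_open[where S="{..<0}"]) (use 2 in \<open>auto simp: Ep_def\<close>)
  thus ?thesis using 2 by (simp add: Ep_def)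
 next
  case 3
  thus ?thesis using Ep_tendsto by (simp add: DERIV_def Ep_def)
 qed
qed

lemma smooth_Ep: "smooth (Ep p)"
proof -
 have "Ck_on k UNIV (Ep p)" for k
 proof (induction k arbitrary: p)
  case 0
  thus ?case using DERIV_isCont[OF Ep_deriv] by (auto simp: continuous_on_eq_continuous_at)
 next
  case (Suc k)
  show ?case by (rule Ck_SucI[OF Ep_deriv[unfolded has_field_derivative_def]]) (intro Ck_mult Suc Ck_const)
 qed
 thus ?thesis by (simp add: smooth_def)
qed

text \<open>The inner function exceeds \<open>1 / exp 1\<close> exactly for arguments beyond \<open>1\<close>; nesting two copies
 of \<open>exp (- 1 / x)\<close> gives a plateau without any division.\<close>

definition stepd :: "real => real" where
 "stepd s = exp 1 * Ep 1 (1 - exp 1 * Ep 1 s)"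

lemma smooth_stepd: "smooth stepd"
proof -
 have "smooth (%s. exp 1 * Ep 1 (1 + (- exp 1) * Ep 1 s))" by (intro smooth_mult smooth_const smooth_compose_real[OF smooth_Ep] smooth_add smooth_Ep)
 thus ?thesis by (simp add: stepd_def[abs_def])
qed

lemma stepd_eq_1: "s <= 0 ==> stepd s = 1" by (simp add: stepd_def Ep_def exp_minus)

lemma stepd_eq_0: assumes "s >= 1" shows "stepd s = 0"
proof -
 have "exp 1 * Ep 1 s >= exp 1 * exp (-1)" using assms using assms by (simp add: inverse_le_1_iff Ep_def)
 thus ?thesis by (simp add: stepd_def Ep_def exp_minus)
qed

lemma stepd_bounds: "0 <= stepd s" "stepd s <= 1"
proof -
 have nn: "Ep 1 z >= 0" for z by (simp add: Ep_def)
 show "0 <= stepd s" by (simp add: stepd_def nn)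
 have "Ep 1 z <= exp (- 1)" if "z <= 1" for z using that by (auto simp: Ep_def one_le_inverse)
 moreover have "1 - exp 1 * Ep 1 s <= 1" using nn by simp
 ultimately have "exp 1 * Ep 1 (1 - exp 1 * Ep 1 s) <= exp 1 * exp (-1)" by simp
 thus "stepd s <= 1" by (simp add: stepd_def exp_minus)
qed

definition Ccs :: "('b::euclidean_space => real) => bool" where
 "Ccs phi \<longleftrightarrow> smooth phi & compact (closure {x. phi x ~= 0})"

lemma compact_support_iff: "compact (closure {x::'b::euclidean_space. phi x ~= 0}) \<longleftrightarrow> (EX R. ALL x. norm x > R --> phi x = 0)"
proof
 assume "compact (closure {x. phi x ~= 0})"
 hence "bounded {x. phi x ~= 0}" by simp
 then obtain R where "ALL x:{x. phi x ~= 0}. norm x <= R" unfolding bounded_iff by auto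
 thus "EX R. ALL x. norm x > R --> phi x = 0" by (intro exI[of _ R]) force
next
 assume "EX R. ALL x. norm x > R --> phi x = 0"
 then obtain R where "ALL x. norm x > R --> phi x = 0" by auto
 hence "ALL x:{x. phi x ~= 0}. norm x <= R" by force
 hence "bounded {x. phi x ~= 0}" unfolding bounded_iff by auto
 thus "compact (closure {x. phi x ~= 0})" by simp
qed

lemma Ccs_alt: "Ccs phi \<longleftrightarrow> smooth phi & (EX R. ALL x. norm x > R --> phi x = 0)" unfolding Ccs_def compact_support_iff ..

lemma Ccs_continuous: "Ccs phi ==> cts phi" by (simp add: Ccs_def smooth_continuous)

lemma Ccs_measurable [measurable_dest]: "Ccs phi ==> phi : bm borel" by (intro cts_bm Ccs_continuous)

lemma Ccs_zero: "Ccs (%x. 0)" by (auto simp: Ccs_alt smooth_const)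

lemma Ccs_add: "Ccs f ==> Ccs g ==> Ccs (%x. f x + g x)"
proof -
 assume *: "Ccs f" "Ccs g"
 then obtain R S where "ALL x. norm x > R --> f x = 0" "ALL x. norm x > S --> g x = 0" by (auto simp: Ccs_alt)
 hence "EX R. ALL x. norm x > R --> f x + g x = 0" by (intro exI[of _ "max R S"]) auto
 thus ?thesis using * unfolding Ccs_alt by (blast intro: smooth_add)
qed

lemma Ccs_smooth_mult: "smooth f ==> Ccs g ==> Ccs (%x. f x * g x)" by (auto simp: Ccs_alt smooth_mult)

lemma Ccs_cmult: "Ccs g ==> Ccs (%x. c * g x)" by (rule Ccs_smooth_mult[OF smooth_const])

lemma Ccs_sum: "(!!i. i : I ==> Ccs (f i)) ==> Ccs (%x. SUM i:I. f i x)" by (induction rule: infinite_finite_induct) (auto intro: Ccs_zero Ccs_add)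

text \<open>\<open>Ck_on\<close> provides continuity of each directional derivative only. The
  operator norm is therefore bounded by the sum, over the basis, of the maxima of the partial
  derivatives on the compact ball.\<close>

lemma Ck1_lipschitz_on_cball:
 fixes f :: "'b::euclidean_space => real"
 assumes "Ck_on (Suc 0) UNIV f"
 obtains M where "M >= 0" "!!x y. x : cball 0 R ==> y : cball 0 R ==> abs (f x - f y) <= M * norm (x - y)"
proof -
 note f = Ck_SucD[OF assms]
 have "EX B. ALL x:cball 0 R. abs (frechet_derivative f (at x) b) <= B" for b
 proof -
  have "continuous_on (cball 0 R) (%x. frechet_derivative f (at x) b)" using f by (auto intro: continuous_on_subset)
  hence "bounded ((%x. frechet_derivative f (at x) b) ` cball 0 R)" by (intro compact_imp_bounded compact_continuous_image) auto
  thus ?thesis by (auto simp: bounded_iff)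
 qed
 then obtain B where B: "!!b x. x : cball 0 R ==> abs (frechet_derivative f (at x) b) <= B b" by metis
 let ?X = "SUM b:Basis. abs (B b)"
 have "onorm (frechet_derivative f (at x)) <= ?X" if x: "x : cball 0 R" for x
 proof (rule onorm_le)
  fix v
  interpret bounded_linear "frechet_derivative f (at x)" using f by auto
  have "frechet_derivative f (at x) v = frechet_derivative f (at x) (SUM b:Basis. (v \<bullet> b) *\<^sub>R b)"
   by (simp add: euclidean_representation)
  also have "... = (SUM b:Basis. (v \<bullet> b) * frechet_derivative f (at x) b)" by (simp add: sum scale)
  finally have "norm (frechet_derivative f (at x) v) <= (SUM b:Basis. abs (v \<bullet> b) * abs (frechet_derivative f (at x) b))"
   by (simp add: abs_mult[symmetric])
  also have "... <= (SUM b:Basis. norm v * abs (B b))" by (intro sum_mono mult_mono Basis_le_norm order_trans[OF B[OF x]]) auto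
  finally show "norm (frechet_derivative f (at x) v) <= ?X * norm v" by (simp add: sum_distrib_left mult.commute)
 qed
 hence "abs (f x - f y) <= ?X * norm (x - y)" if "x : cball 0 R" "y : cball 0 R" for x y
  using that f differentiable_bound[of "cball 0 R" f "%x. frechet_derivative f (at x)" _] by (auto simp: has_derivative_at_withinI)
 thus ?thesis by (intro that[of "SUM b:Basis. abs (B b)"]) (auto)
qed

text \<open>Two points at distance below 1 either both lie outside the support or both lie in
  \<open>cball 0 (R+1)\<close>, where the derivative bound applies; at larger distance twice the
  supremum suffices. The truncation at 1 matches the integrability that the kernel and the flux
  have.\<close>

lemma Ccs_bounds:
 fixes phi :: "'b::euclidean_space => real"
 assumes "Ccs phi"
 obtains C where "C >= 0" "!!x. abs (phi x) <= C" "!!x y. abs (phi y - phi x) <= C * min 1 (norm (x - y))"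
proof -
 obtain R where R: "!!x. norm x > R ==> phi x = 0" and sm: "smooth phi" using assms by (auto simp: Ccs_alt)
 have "bounded (phi ` cball 0 R)" by (intro compact_imp_bounded compact_continuous_image) (auto intro: continuous_on_subset smooth_continuous[OF sm])
 then obtain B where "ALL y:phi ` cball 0 R. norm y <= B" unfolding bounded_iff by auto
 hence B: "!!x. x : cball 0 R ==> abs (phi x) <= B" by simp
 hence B': "abs (phi x) <= abs B" for x
 proof (cases "norm x > R")
  case False
  hence "abs (phi x) <= B" by (intro B) simp
  thus ?thesis by simp
 qed (simp add: R)
 obtain M where M: "M >= 0" "!!x y. x : cball 0 (R+1) ==> y : cball 0 (R+1) ==> abs (phi x - phi y) <= M * norm (x - y)"
  using Ck1_lipschitz_on_cball[of phi] sm unfolding smooth_def by auto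
 show ?thesis
 proof (rule that[of "M + 2 * abs B"])
  show "abs (phi x) <= M + 2 * abs B" for x using B'[of x] M by simp
  show "abs (phi y - phi x) <= (M + 2 * abs B) * min 1 (norm (x - y))" for x y
  proof (cases "norm (x - y) < 1")
   case True
   show ?thesis
   proof (cases "norm x > R & norm y > R")
    case True
    thus ?thesis using R M by simp
   next
    case False
    hence "x : cball 0 (R+1)" "y : cball 0 (R+1)"
     using `norm (x - y) < 1` norm_triangle_ineq2[of x y] norm_triangle_ineq2[of y x] by (auto simp: norm_minus_commute)
    hence "abs (phi x - phi y) <= M * norm (x - y)" by (rule M)
    also have "... <= (M + 2 * abs B) * norm (x - y)" by (intro mult_right_mono) auto
    finally show ?thesis using True by simp
   qed
  next
   case False
   thus ?thesis using B'[of x] B'[of y] M by simp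
  qed
 qed (use M in auto)
qed

lemma stepd_lipschitz:
 obtains L where "L >= 0" "!!s t. abs (stepd s - stepd t) <= L * abs (s - t)"
proof -
 obtain L where L: "L >= 0" "!!x y. x : cball 0 1 ==> y : cball 0 1 ==> abs (stepd x - stepd y) <= L * norm (x - y)"
  using Ck1_lipschitz_on_cball[of stepd] smooth_stepd unfolding smooth_def by auto
 have cl: "stepd s = stepd (min 1 (max 0 s))" for s by (auto simp: min_def max_def stepd_eq_0 stepd_eq_1)
 have "abs (stepd s - stepd t) <= L * abs (s - t)" for s t
 proof -
  have "abs (stepd s - stepd t) <= L * norm (min 1 (max 0 s) - min 1 (max 0 t))" by (subst cl, subst cl, rule L) auto
  also have "... <= L * abs (s - t)" by (intro mult_left_mono L) (auto)
  finally show ?thesis .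
 qed
 thus ?thesis using that L by simp
qed

text \<open>The squared norm avoids the singularity of the norm at the origin. The step is completed
  well before radius \<open>2 * R\<close>, where its argument is already 3.\<close>

definition cutoff :: "real => 'b::euclidean_space => real" where
 "cutoff R x = stepd ((x \<bullet> x - R^2) / R^2)"

lemma cutoff_bounds: "0 <= cutoff R x" "cutoff R x <= 1" by (simp_all add: cutoff_def stepd_bounds)

lemma cutoff_eq_1: "norm x <= R ==> cutoff R x = 1"
proof -
 assume "norm x <= R"
 hence "x \<bullet> x <= R^2" by (simp add: dot_square_norm power_mono)
 thus ?thesis unfolding cutoff_def by (intro stepd_eq_1) (simp add: divide_nonpos_nonneg)
qed

lemma cutoff_eq_0: "R > 0 ==> norm x >= 2 * R ==> cutoff R x = 0"
proof -
 assume R: "R > 0" "norm x >= 2 * R"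
 hence "(2 * R)^2 <= (norm x)^2" by (intro power_mono) auto
 hence "x \<bullet> x >= 4 * R^2" by (simp add: dot_square_norm)
 hence "1 <= (x \<bullet> x - R^2) / R^2" using R by (simp) (use zero_le_power2[of R] in linarith)
 thus ?thesis unfolding cutoff_def by (rule stepd_eq_0)
qed

lemma Ccs_cutoff: "R > 0 ==> Ccs (cutoff R :: 'a::euclidean_space => real)"
proof -
 assume R: "R > 0"
 let ?X = "%x::'a. stepd (inverse (R^2) * (x \<bullet> x) + (-1))"
 have "smooth ?X"
  by (intro smooth_compose_real[OF smooth_stepd] smooth_add smooth_mult smooth_const smooth_inner_self)
 moreover have "?X = cutoff R" using R by (auto simp: cutoff_def field_simps)
 moreover have "ALL x::'a. norm x > 2 * R --> cutoff R x = 0" using cutoff_eq_0[OF R] by force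
 ultimately show ?thesis unfolding Ccs_alt by auto
qed

text \<open>Norms may be clamped at \<open>2 * R\<close>, since the cutoff vanishes beyond; there
  the squared norm has Lipschitz constant \<open>4 * R\<close>, and division by \<open>R^2\<close>
  leaves at most 4. The uniformity in \<open>R\<close> is what allows cutoffs of very different
  radii to be averaged later.\<close>

lemma cutoff_lipschitz:
 obtains L where "L >= 0" "!!R x y. R >= 1 ==> abs (cutoff R x - cutoff R (y::'b::euclidean_space)) <= L * norm (x - y)"
proof -
 obtain L where L: "L >= 0" "!!s t. abs (stepd s - stepd t) <= L * abs (s - t)" by (rule stepd_lipschitz) blast
 have "abs (cutoff R x - cutoff R y) <= 4 * L * norm (x - y)" if R: "R >= 1" for R and x y :: 'b
 proof -
  define a where "a z = min (norm z) (2 * R)" for z :: 'b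
  have c: "cutoff R z = stepd (((a z)^2 - R^2) / R^2)" for z
  proof (cases "norm z <= 2 * R")
   case True
   thus ?thesis by (simp add: a_def cutoff_def dot_square_norm)
  next
   case False
   hence "((a z)^2 - R^2) / R^2 = 3" using R by (simp add: a_def)
   thus ?thesis using cutoff_eq_0[of R z] False R by (simp add: stepd_eq_0)
  qed
  have a: "0 <= a z" "a z <= 2 * R" for z using R by (auto simp: a_def)
  have "abs (cutoff R x - cutoff R y) <= L * abs (((a x)^2 - R^2) / R^2 - ((a y)^2 - R^2) / R^2)" unfolding c by (rule L)
  also have "((a x)^2 - R^2) / R^2 - ((a y)^2 - R^2) / R^2 = (a x + a y) * (a x - a y) / R^2"
   by (simp add: power2_eq_square algebra_simps diff_divide_distrib)
  also have "abs (...) = (a x + a y) / R^2 * abs (a x - a y)" using a by (simp add: abs_mult)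
  also have "... <= 4 * norm (x - y)"
  proof (rule mult_mono)
   have "(a x + a y) / R^2 <= (4 * R) / R^2" using a[of x] a[of y] by (intro divide_right_mono) auto
   also have "... <= 4" using R by (simp add: power2_eq_square divide_le_eq)
   finally show "(a x + a y) / R^2 <= 4" .
   show "abs (a x - a y) <= norm (x - y)" using norm_triangle_ineq3[of x y] unfolding a_def by simp
  qed (use a[of x] a[of y] in auto)
  finally show ?thesis using L by (simp add: mult_left_mono)
 qed
 thus ?thesis using L by (intro that[of "4 * L"]) auto
qed

section \<open>Weak convergence\<close>

definition finb :: "'b::euclidean_space measure => bool" where
 "finb M \<longleftrightarrow> finite_measure M & sets M = sets borel"

text \<open>Formulated for arbitrary filters, because limits are taken along sequences of curves as
  well as in time along one curve, and without unit mass, because the rescaled jump measures are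
  only subprobabilities.\<close>

definition wconv :: "('i => 'b::euclidean_space measure) => 'b measure => 'i filter => bool" where
 "wconv M N F \<longleftrightarrow> (ALL f. cts f --> bounded (range f) -->
  ((%i. LINT x|M i. f x) ---> ((LINT x|N. f x) :: real)) F)"

lemma bdd_iff: "bounded (range f) \<longleftrightarrow> (EX B>=0. ALL x. abs (f x :: real) <= B)"
proof
 assume "bounded (range f)"
 then obtain B where B: "!!x. abs (f x) <= B" by (auto simp: bounded_iff)
 hence "B >= 0" by force
 thus "EX B>=0. ALL x. abs (f x) <= B" using B by auto
qed (auto simp: bounded_iff)

lemma finb_integrable:
 assumes "finb M" "f : bm borel" "!!x. abs (f x :: real) <= B"
 shows "integrable M f"
proof -
 interpret finite_measure M using assms by (simp add: finb_def)
 have "f : bm M" using assms by (auto simp: finb_def)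
 thus ?thesis by (intro integrable_const_bound) (use assms in auto)
qed

lemma finb_space: "finb M ==> space M = UNIV" using sets_eq_imp_space_eq[of M] by (simp add: finb_def)

lemma PM_fb: "mu : PM ==> finb mu" by (auto simp: prob_measures_def finb_def prob_space_def)

lemma PM_mass: "mu : PM ==> measure mu UNIV = 1" using prob_space.prob_space[of mu] sets_eq_imp_space_eq[of mu] by (auto simp: prob_measures_def)

lemma wconv_subseq: "wconv M N sequentially ==> strict_mono r ==> wconv (%n. M (r n)) N sequentially"
 unfolding wconv_def using LIMSEQ_subseq_LIMSEQ[unfolded o_def] by auto

lemma cutoff_integral_tendsto:
 assumes "finb N"
 shows "(%n. LINT x|N. cutoff (real (Suc n)) x) ----> measure N (UNIV :: 'b::euclidean_space set)"
proof -
 interpret finite_measure N using assms by (simp add: finb_def)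
 have [simp]: "sets N = sets borel" "space N = UNIV" using assms by (auto simp: finb_def finb_space)
 have "(%n. LINT x|N. cutoff (real (Suc n)) x) ----> (LINT x|N. 1)"
 proof (rule integral_dominated_convergence[where w="%_. 1"])
  show "AE x in N. (%n. cutoff (real (Suc n)) x) ----> 1"
  proof (rule AE_I2)
   fix x :: 'b
   obtain n0 :: nat where "norm x <= real n0" using real_arch_simple by auto
   hence "eventually (%n. cutoff (real (Suc n)) x = 1) sequentially" by (intro eventually_sequentiallyI[of n0] cutoff_eq_1) auto
   thus "(%n. cutoff (real (Suc n)) x) ----> 1" by (rule tendsto_eventually)
  qed
  show "cutoff (real (Suc n)) : bm N" for n using Ccs_measurable[OF Ccs_cutoff[of "real (Suc n)"]] by (auto cong: measurable_cong_sets)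
  show "AE x in N. norm (cutoff (real (Suc n)) x) <= 1" for n by (auto simp: cutoff_bounds)
 qed auto
 thus ?thesis by simp
qed

text \<open>A Stone-Weierstrass polynomial is smooth, and multiplying it by the cutoff makes its
  support compact; the price is \<open>B\<close> where the cutoff is not 1.\<close>

lemma test_approx:
 fixes f :: "'b::euclidean_space => real"
 assumes f: "cts f" "!!x. abs (f x) <= B" and "eps > 0" "R > 0"
 obtains phi where "Ccs phi" "!!x. abs (f x - phi x) <= eps + B * (1 - cutoff R x)"
proof -
 obtain p where p: "real_polynomial_function p" "!!x. x : cball 0 (2 * R) ==> abs (f x - p x) < eps"
  using Stone_Weierstrass_real_polynomial_function f `eps > 0` by (metis compact_cball continuous_on_subset subset_UNIV)
 show ?thesis
 proof (rule that[of "%x. p x * cutoff R x"])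
  show "Ccs (%x. p x * cutoff R x)" by (intro Ccs_smooth_mult smooth_polynomial p Ccs_cutoff `R > 0`)
  show "abs (f x - p x * cutoff R x) <= eps + B * (1 - cutoff R x)" for x
  proof (cases "norm x <= 2 * R")
   case True
   have "f x - p x * cutoff R x = (f x - p x) * cutoff R x + f x * (1 - cutoff R x)" by (simp add: algebra_simps)
   also have "abs (...) <= abs (f x - p x) * cutoff R x + abs (f x) * (1 - cutoff R x)"
    by (rule order_trans[OF abs_triangle_ineq]) (simp add: abs_mult cutoff_bounds)
   also have "... <= eps * 1 + B * (1 - cutoff R x)" using p(2)[of x] True f(2)[of x] by (intro add_mono mult_mono) (auto simp: cutoff_bounds)
   finally show ?thesis by simp
  next
   case False
   thus ?thesis using cutoff_eq_0[of R x] `R > 0` using f(2)[of x] `eps > 0` by simp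
  qed
 qed
qed

text \<open>Convergence of the total masses excludes loss of mass at infinity: a cutoff that
  captures almost all of \<open>N\<close> eventually captures almost all of \<open>M i\<close>.
  Inside, \<open>f\<close> is replaced by a smooth compactly supported function.\<close>

lemma wconv_testI:
 fixes N :: "'b::euclidean_space measure"
 assumes fin: "eventually (%i. finb (M i)) F" "finb N"
  and mass: "((%i. measure (M i) UNIV) ---> measure N UNIV) F"
  and test: "!!phi. Ccs phi ==> ((%i. LINT x|M i. phi x) ---> (LINT x|N. phi x)) F"
 shows "wconv M N F" unfolding wconv_def
proof (intro allI impI)
 fix f :: "'b => real" assume f: "cts f" "bounded (range f)"
 then obtain B where B: "B >= 0" "!!x. abs (f x) <= B" by (auto simp: bdd_iff)
 show "((%i. LINT x|M i. f x) ---> (LINT x|N. f x)) F"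
 proof (rule tendstoI)
  fix e :: real assume "e > 0"
  define K where "K = measure N UNIV + 1"
  have K: "K > 0" unfolding K_def by (rule add_nonneg_pos) (rule measure_nonneg, simp)
  \<comment> \<open>Two replacement errors \<open>eps * K + B * eps\<close>, one for
    \<open>M i\<close> and one for \<open>N\<close>, and one test error \<open>eps\<close> must stay
    below \<open>e\<close>.\<close>
  define eps where "eps = e / (2 * K + 2 * B + 2)"
  have eps: "eps > 0" "eps * (2 * K + 2 * B + 2) = e" using K B `e > 0` by (auto simp: eps_def)
  have "eventually (%n. (LINT x|N. cutoff (real (Suc n)) x) > measure N UNIV - eps) sequentially"
   using order_tendstoD[OF cutoff_integral_tendsto[OF fin(2)]] eps by simp
  then obtain n0 where n0: "(LINT x|N. cutoff (real (Suc n0)) x) > measure N UNIV - eps" by force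
  define c :: "'b => real" where "c = cutoff (real (Suc n0))"
  have cm: "c : bm borel" "Ccs c" unfolding c_def by (auto intro!: Ccs_measurable Ccs_cutoff)
  have cb: "0 <= c x" "c x <= 1" for x unfolding c_def by (auto simp: cutoff_bounds)
  obtain phi where phi: "Ccs phi" "!!x. abs (f x - phi x) <= eps + B * (1 - c x)" unfolding c_def by (rule test_approx[OF f(1) B(2) eps(1)]) auto
  obtain C where C: "!!x. abs (phi x) <= C" using Ccs_bounds[OF phi(1)] by metis
  have main: "abs ((LINT x|Q. f x) - (LINT x|Q. phi x)) <= eps * K + B * eps"
   if Q: "finb Q" "measure Q UNIV <= K" "measure Q UNIV - (LINT x|Q. c x) <= eps" for Q
  proof -
   interpret Q: finite_measure Q using Q by (simp add: finb_def)
   have [measurable]: "f : bm borel" "phi : bm borel" using f phi by (auto intro: cts_bm)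
   have i: "integrable Q f" "integrable Q phi" "integrable Q c" by (rule finb_integrable[OF Q(1) _ B(2)], measurable)
     (rule finb_integrable[OF Q(1) _ C], measurable,
     rule finb_integrable[OF Q(1) cm(1), of 1], simp add: cb)
   have "abs ((LINT x|Q. f x) - (LINT x|Q. phi x)) = abs (\<integral>x. f x - phi x \<partial>Q)" using i by simp
   also have "... <= (LINT x|Q. abs (f x - phi x))" by simp
   also have "... <= (LINT x|Q. eps + B * (1 - c x))" using i phi by (intro integral_mono) auto
   also have "... = eps * measure Q UNIV + B * (measure Q UNIV - (LINT x|Q. c x))" using i finb_space[OF Q(1)] by simp
   also have "... <= eps * K + B * eps" using Q B eps by (intro add_mono mult_left_mono) auto
   finally show ?thesis .
  qed
  have "eventually (%i. measure (M i) UNIV < K) F" using order_tendstoD[OF mass] by (simp add: K_def)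
  moreover have "((%i. measure (M i) UNIV - (LINT x|M i. c x)) ---> measure N UNIV - (LINT x|N. c x)) F" by (intro tendsto_diff mass test cm)
  hence "eventually (%i. measure (M i) UNIV - (LINT x|M i. c x) < eps) F" using n0 by (intro order_tendstoD) (auto simp: c_def)
  moreover have "eventually (%i. dist (LINT x|M i. phi x) (LINT x|N. phi x) < eps) F" using tendstoD[OF test[OF phi(1)] eps(1)] .
  ultimately show "eventually (%i. dist (LINT x|M i. f x) (LINT x|N. f x) < e) F" using fin(1)
  proof eventually_elim
   case (elim i)
   have "abs ((LINT x|M i. f x) - (LINT x|M i. phi x)) <= eps * K + B * eps" using elim by (intro main) auto
   moreover have "abs ((LINT x|N. f x) - (LINT x|N. phi x)) <= eps * K + B * eps" using n0 fin by (intro main) (auto simp: c_def K_def)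
   moreover have "(eps * K + B * eps) + (eps * K + B * eps) + eps < e" using eps by (simp add: algebra_simps)
   ultimately show ?case using elim unfolding dist_real_def by linarith
  qed
 qed
qed

text \<open>The factor \<open>ch k\<close> vanishes on \<open>D\<close> and makes
  \<open>h * ch k\<close> continuous. The error is at most \<open>B\<close> times the integral of
  the continuous function \<open>1 - ch k\<close>; this is small for \<open>N\<close>, which does
  not charge \<open>D\<close>, and by weak convergence eventually for \<open>M i\<close>. It is
  applied with the diagonal for \<open>D\<close>.\<close>

lemma wconv_null_discont:
 fixes N :: "'b::euclidean_space measure"
 assumes wc: "wconv M N F" and fin: "eventually (%i. finb (M i)) F" "finb N"
  and D: "closed D" "D ~= {}" "measure N D = 0"
  and h: "h : bm borel" "!!x. abs (h x :: real) <= B" "!!x. x ~: D ==> isCont h x"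
 shows "((%i. LINT x|M i. h x) ---> (LINT x|N. h x)) F"
proof (rule tendstoI)
 fix e :: real assume "e > 0"
 have B: "B >= 0" using h(2)[of undefined] by simp
 define ch where "ch k x = min 1 (real k * infdist x D)" for k x
 have chib: "0 <= ch k x" "ch k x <= 1" for k x by (auto simp: ch_def infdist_nonneg)
 have chic: "cts (ch k)" for k unfolding ch_def by (intro continuous_intros)
 have [measurable]: "ch k : bm borel" "h : bm borel" for k using chic h by (auto intro: cts_bm)
 have hc: "cts (%x. h x * ch k x)" for k
 proof (rule continuous_at_imp_continuous_on, rule ballI)
  fix x :: 'b
  show "isCont (%x. h x * ch k x) x"
  proof (cases "x : D")
   case False
   thus ?thesis using h chic by (auto simp: continuous_on_eq_continuous_at)
  next
   case True
   have "((%y. h y * ch k y) ---> 0) (at x)"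
   proof (rule Lim_null_comparison)
    show "eventually (%y. norm (h y * ch k y) <= B * (real k * infdist y D)) (at x)"
    proof (intro always_eventually allI)
     fix y
     have "norm (h y * ch k y) = abs (h y) * ch k y" using chib by (simp add: abs_mult)
     also have "... <= B * (real k * infdist y D)" using B h by (intro mult_mono) (auto simp: ch_def infdist_nonneg)
     finally show "norm (h y * ch k y) <= B * (real k * infdist y D)" .
    qed
    hence "((%y. B * (real k * infdist y D)) ---> B * (real k * infdist x D)) (at x)" by (intro tendsto_intros)
    thus "((%y. B * (real k * infdist y D)) ---> 0) (at x)" using True by simp
   qed
   thus ?thesis using True by (simp add: isCont_def ch_def)
  qed
 qed
 have hb: "abs (h x * ch k x) <= B" for k x using mult_mono[OF h(2) chib(2) B] chib by (simp add: abs_mult)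
 interpret N: finite_measure N using fin by (simp add: finb_def)
 have sN [simp]: "sets N = sets borel" "space N = UNIV" using fin by (auto simp: finb_def finb_space)
 let ?X = "4 * (B + 1)"
 have "(%k. LINT x|N. 1 - ch k x) ----> (LINT x|N. 0)"
 proof (rule integral_dominated_convergence[where w="%_. 1"])
  have "AE x in N. x ~: D" using D by (intro AE_not_in) (auto simp: N.emeasure_eq_measure)
  thus "AE x in N. (%k. 1 - ch k x) ----> 0"
  proof eventually_elim
   case (elim x)
   hence "infdist x D > 0" using D infdist_pos_not_in_closed by auto
   then obtain n0 :: nat where n0: "1 < real n0 * infdist x D" using reals_Archimedean3 by auto
   have "eventually (%k. 1 - ch k x = 0) sequentially"
   proof (rule eventually_sequentiallyI[of n0])
    fix k assume "n0 <= k"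
    hence "real n0 * infdist x D <= real k * infdist x D" by (intro mult_right_mono) (auto simp: infdist_nonneg)
    thus "1 - ch k x = 0" using n0 by (simp add: ch_def)
   qed
   thus ?case by (rule tendsto_eventually)
  qed
  show "AE x in N. norm (1 - ch k x) <= 1" for k using chib by auto
 qed (auto cong: measurable_cong_sets)
 hence "eventually (%k. (LINT x|N. 1 - ch k x) < e / ?X) sequentially" using B `e > 0` by (intro order_tendstoD) auto
 then obtain k where k: "(LINT x|N. 1 - ch k x) < e / ?X" by force
 have conv1: "((%i. LINT x|M i. 1 - ch k x) ---> (LINT x|N. 1 - ch k x)) F" using wc unfolding wconv_def
  by (elim allE[of _ "%x. 1 - ch k x"]) (use chic chib in \<open>auto intro!: continuous_intros simp: bdd_iff intro: exI[of _ 1]\<close>)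
 have conv2: "((%i. LINT x|M i. h x * ch k x) ---> (LINT x|N. h x * ch k x)) F" using wc unfolding wconv_def
  by (elim allE) (use hc[of k] hb B in \<open>auto simp: bdd_iff intro: exI[of _ B]\<close>)
 have main: "abs ((LINT x|Q. h x) - (LINT x|Q. h x * ch k x)) <= e / 4"
  if Q: "finb Q" "(LINT x|Q. 1 - ch k x) < e / ?X" for Q
 proof -
  have i: "integrable Q h" "integrable Q (%x. h x * ch k x)" "integrable Q (%x. 1 - ch k x)" by (rule finb_integrable[OF Q(1) _ h(2)], measurable)
    (rule finb_integrable[OF Q(1) _ hb], measurable,
    rule finb_integrable[OF Q(1), of _ 1], use chib in auto)
  have "abs ((LINT x|Q. h x) - (LINT x|Q. h x * ch k x)) = abs (\<integral>x. h x - h x * ch k x \<partial>Q)" using i by simp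
  also have "... <= (LINT x|Q. abs (h x - h x * ch k x))" by simp
  also have "... <= (LINT x|Q. B * (1 - ch k x))"
  proof (rule integral_mono)
   show "abs (h x - h x * ch k x) <= B * (1 - ch k x)" for x
   proof -
    have "abs (h x - h x * ch k x) = abs (h x * (1 - ch k x))" by (simp add: algebra_simps)
    also have "... = abs (h x) * (1 - ch k x)" using chib by (simp add: abs_mult)
    also have "... <= B * (1 - ch k x)" using chib h by (intro mult_right_mono) auto
    finally show ?thesis .
   qed
  qed (use i in auto)
  also have "... = B * (LINT x|Q. 1 - ch k x)" by simp
  also have "... <= (B + 1) * (e / ?X)" using B Q chib by (intro mult_mono) (auto)
  also have "... = e / 4" using B by (simp add: field_simps)
  finally show ?thesis .
 qed
 have "eventually (%i. (LINT x|M i. 1 - ch k x) < e / ?X) F" using order_tendstoD(2)[OF conv1 k] .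
 moreover have "eventually (%i. dist (LINT x|M i. h x * ch k x) (LINT x|N. h x * ch k x) < e / 4) F"
  using tendstoD[OF conv2, of "e/4"] `e > 0` by simp
 ultimately show "eventually (%i. dist (LINT x|M i. h x) (LINT x|N. h x) < e) F" using fin(1)
 proof eventually_elim
  case (elim i)
  have "abs ((LINT x|M i. h x) - (LINT x|M i. h x * ch k x)) <= e / 4" using elim by (intro main)
  moreover have "abs ((LINT x|N. h x) - (LINT x|N. h x * ch k x)) <= e / 4" using fin k by (intro main)
  ultimately show ?case using elim unfolding dist_real_def by linarith
 qed
qed

text \<open>Closed sets generate the Borel sets and are stable under intersection, and the indicator
  of a closed set is a pointwise limit of the bounded continuous functions
  \<open>f k\<close>.\<close>

lemma measurable_kernel_test:
 fixes kappa :: "'x => 'b::euclidean_space measure"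
 assumes sub: "!!x. x : space M ==> subprob_space (kappa x)" "!!x. x : space M ==> sets (kappa x) = sets borel"
  and test: "!!f. cts f ==> bounded (range f) ==> (%x. \<integral>y. f y \<partial>kappa x :: real) : bm M"
 shows "kappa : measurable M (subprob_algebra borel)"
proof (rule measurable_subprob_algebra_generated[where \<Omega>=UNIV and G="Collect closed"])
 show "sets borel = sigma_sets UNIV (Collect closed :: 'b set set)" by (subst borel_eq_closed) simp
 show "Int_stable (Collect closed :: 'b set set)" by (auto simp: Int_stable_def)
 have clo: "(%a. emeasure (kappa a) A) : bm M" if "closed A" for A
 proof (cases "A = {}")
  case False
  define f where "f k x = 1 - min 1 (real k * infdist x A)" for k x
  have fb: "0 <= f k x" "f k x <= 1" for k x by (auto simp: f_def infdist_nonneg)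
  have fc: "cts (f k)" for k unfolding f_def by (intro continuous_intros)
  have "(%a. measure (kappa a) A) : bm M"
  proof (rule borel_measurable_LIMSEQ_real)
   show "(%a. LINT y|kappa a. f k y) : bm M" for k by (intro test fc) (use fb in \<open>auto simp: bdd_iff intro!: exI[of _ 1]\<close>)
   fix a assume a: "a : space M"
   interpret subprob_space "kappa a" using sub a by auto
   have [simp]: "space (kappa a) = UNIV" "sets (kappa a) = sets borel" using sets_eq_imp_space_eq[OF sub(2)[OF a]] sub[OF a] by auto
   have "(%k. LINT y|kappa a. f k y) ----> (LINT y|kappa a. indicator A y)"
   proof (rule integral_dominated_convergence[where w="%_. 1"])
    show "AE x in kappa a. (%k. f k x) ----> indicator A x"
    proof (rule AE_I2)
     fix x
     show "(%k. f k x) ----> indicator A x"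
     proof (cases "x : A")
      case True
      thus ?thesis by (simp add: f_def)
     next
      case xA: False
      hence "infdist x A > 0" using `closed A` False infdist_pos_not_in_closed by auto
      then obtain n0 :: nat where n0: "1 < real n0 * infdist x A" using reals_Archimedean3 by auto
      have "eventually (%k. f k x = 0) sequentially"
      proof (rule eventually_sequentiallyI[of n0])
       fix k assume "n0 <= k"
       hence "real n0 * infdist x A <= real k * infdist x A" by (intro mult_right_mono) (auto simp: infdist_nonneg)
       thus "f k x = 0" using n0 by (simp add: f_def)
      qed
      thus ?thesis using xA by (simp add: tendsto_eventually)
     qed
    qed
    show "f k : bm (kappa a)" for k using cts_bm[OF fc] by (auto cong: measurable_cong_sets)
    show "AE x in kappa a. norm (f k x) <= 1" for k using fb by auto
    show "(indicator A :: 'b => real) : bm (kappa a)" using borel_closed[OF `closed A`] `sets (kappa a) = sets borel` by measurable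
   qed auto
   thus "(%k. LINT y|kappa a. f k y) ----> measure (kappa a) A" by simp
  qed
  hence "(%a. ennreal (measure (kappa a) A)) : bm M" by simp
  moreover have "emeasure (kappa a) A = ennreal (measure (kappa a) A)" if "a : space M" for a
  proof -
   interpret subprob_space "kappa a" using sub that by auto
   show ?thesis by (rule emeasure_eq_measure)
  qed
  ultimately show ?thesis by (simp cong: measurable_cong)
 qed simp
 thus "A : Collect closed ==> (%a. emeasure (kappa a) A) : bm M" for A by simp
 show "(%a. emeasure (kappa a) UNIV) : bm M" by (rule clo) simp
qed (use sub in auto)

section \<open>Prokhorov's theorem by way of a Schoenberg curve\<close>

definition sch :: "real => real" where "sch u = min 1 (max 0 (1/2 - cos (pi * u)))"

lemma sch_bounds: "0 <= sch u" "sch u <= 1" by (auto simp: sch_def)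

lemma cos_shift: "cos (pi * (u + 2 * of_int n)) = cos (pi * u)"
proof -
 have "pi * (u + 2 * of_int n) = pi * u + 2 * pi * of_int n" by (simp add: algebra_simps)
 thus ?thesis by (simp only: cos_add sin_int_2pin cos_int_2pin)
qed

lemma sch_periodic: "sch (u + 2 * of_int n) = sch u" by (simp only: sch_def cos_shift)

lemma sch_eq_0: assumes "0 <= v" "v <= 1/3" shows "sch v = 0"
proof -
 have "cos (pi / 3) <= cos (pi * v)" using assms by (intro cos_monotone_0_pi_le) auto
 thus ?thesis by (simp add: sch_def cos_60)
qed

lemma sch_eq_1: assumes "2/3 <= v" "v <= 1" shows "sch v = 1"
proof -
 have "cos (pi * v) <= cos (pi - pi / 3)" using assms by (intro cos_monotone_0_pi_le) auto
 thus ?thesis by (simp add: sch_def cos_120)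
qed

lemma ternary_bounds:
 assumes "!!k. beta k : {0, 1::real}"
 shows "summable (%j. 2 * beta j / 3 ^ Suc j)" "0 <= (\<Sum>j. 2 * beta j / 3 ^ Suc j)" "(\<Sum>j. 2 * beta j / 3 ^ Suc j) <= 1"
proof -
 have g: "(%j. 2 / 3 * (1/3) ^ j) sums (2/3 * (1 / (1 - 1/3 :: real)))" by (intro sums_mult geometric_sums) auto
 have le: "norm (2 * beta j / 3 ^ Suc j) <= 2 / 3 * (1/3) ^ j" for j using assms[of j] by (auto simp: power_one_over)
 have le2: "2 * beta j / 3 ^ Suc j <= 2 / 3 * (1/3) ^ j" for j using order_trans[OF abs_ge_self le[of j, unfolded real_norm_def]] .
 show s: "summable (%j. 2 * beta j / 3 ^ Suc j)"
  by (rule summable_comparison_test'[where N=0 and g="%j. 2 / 3 * (1/3) ^ j"]) (use le in \<open>auto simp: sums_iff\<close>)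
 let ?X = "\<Sum>j. 2 * beta j / 3 ^ Suc j"
 have nn: "0 <= 2 * beta j / 3 ^ Suc j" for j using assms[of j] by auto
 thus "0 <= ?X" by (intro suminf_nonneg s)
 have "?X <= (\<Sum>j. 2 / 3 * (1/3) ^ j)" by (rule suminf_le[OF le2 s]) (use in \<open>simp add: sums_iff\<close>)
 also have "... = 1" using g by (simp add: sums_iff)
 finally show "?X <= 1" .
qed

text \<open>The digits of a ternary expansion with digits in \<open>{0, 2}\<close> are read off by a continuous
 function, as in Schoenberg's space-filling curve.\<close>

lemma sch_ternary:
 assumes beta: "!!k. beta k : {0, 1::real}"
 shows "sch (3 ^ k * (\<Sum>j. 2 * beta j / 3 ^ Suc j)) = beta k"
proof -
 define a where "a j = 2 * beta j / 3 ^ Suc j" for j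
 have sa: "summable a" unfolding a_def by (rule ternary_bounds[OF beta])
 \<comment> \<open>After scaling by \<open>3 ^ k\<close> the first \<open>k\<close> terms form an
   even integer, which the period 2 of \<open>sch\<close> absorbs. Term \<open>k\<close> contributes
   0 or 2/3 and the tail at most 1/3, so the argument lands where \<open>sch\<close> is
   constant.\<close>
 have int: "EX n::int. 3 ^ k * (SUM j<k. a j) = 2 * of_int n"
 proof (induction k)
  case (Suc k)
  then obtain n :: int where n: "3 ^ k * (SUM j<k. a j) = 2 * of_int n" by auto
  have "3 ^ Suc k * (SUM j<Suc k. a j) = 3 * (3 ^ k * (SUM j<k. a j)) + 2 * beta k" by (simp add: a_def algebra_simps)
  thus ?case using beta[of k] n by (auto intro: exI[of _ "3 * n"] exI[of _ "3 * n + 1"])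
 qed simp
 then obtain n :: int where n: "3 ^ k * (SUM j<k. a j) = 2 * of_int n" by auto
 define t where "t = (\<Sum>j. 2 * beta (j + Suc k) / 3 ^ Suc j)"
 have t: "0 <= t" "t <= 1" unfolding t_def using ternary_bounds beta by auto
 have "suminf a = (\<Sum>j. a (j + Suc k)) + (SUM j<Suc k. a j)" by (rule suminf_split_initial_segment[OF sa])
 also have "(\<Sum>j. a (j + Suc k)) = (\<Sum>j. (1 / 3 ^ Suc k) * (2 * beta (j + Suc k) / 3 ^ Suc j))" by (simp add: a_def power_add mult_ac)
 also have "... = (1 / 3 ^ Suc k) * t" unfolding t_def by (rule suminf_mult, rule ternary_bounds) (rule beta)
 finally have "3 ^ k * suminf a = 3 ^ k * ((1 / 3 ^ Suc k) * t) + (3 ^ k * (SUM j<k. a j) + 3 ^ k * a k)"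
  by (simp only: distrib_left sum.lessThan_Suc)
 also have "3 ^ k * a k = 2 * beta k / 3" by (simp add: a_def)
 also have "3 ^ k * ((1 / 3 ^ Suc k) * t) = t / 3" by simp
 finally have "3 ^ k * suminf a = t / 3 + 2 * beta k / 3 + 2 * of_int n" using n by simp
 hence "sch (3 ^ k * suminf a) = sch (t / 3 + 2 * beta k / 3)" by (simp only: sch_periodic)
 also have "... = beta k"
 proof (cases "beta k = 0")
  case True
  thus ?thesis using t by (simp add: sch_eq_0)
 next
  case False
  hence "beta k = 1" using beta[of k] by simp
  moreover have "sch (t / 3 + 2 / 3) = 1" by (rule sch_eq_1) (use t in auto)
  ultimately show ?thesis by simp
 qed
 finally show ?thesis by (simp only: a_def[abs_def])
qed

definition digit :: "nat => real => real" where
 "digit n z = of_int \<lfloor>2 ^ Suc n * z\<rfloor> - 2 * of_int \<lfloor>2 ^ n * z\<rfloor>"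

lemma digit_01: "digit n z : {0, 1}"
proof -
 have "\<lfloor>2 * w\<rfloor> - 2 * \<lfloor>w\<rfloor> : {0, 1}" for w :: real
 proof -
  have "0 <= \<lfloor>2 * w\<rfloor> - 2 * \<lfloor>w\<rfloor>" "\<lfloor>2 * w\<rfloor> - 2 * \<lfloor>w\<rfloor> < 2" by linarith+
  thus ?thesis by auto
 qed
 from this[of "2 ^ n * z"] show ?thesis by (auto simp: digit_def mult.assoc)

qed

lemma digit_sums:
 assumes "0 <= z" "z < 1"
 shows "(%n. digit n z / 2 ^ Suc n) sums z"
proof -
 have z0: "\<lfloor>z\<rfloor> = 0" using assms by (simp add: floor_eq_iff)
 have "(SUM n<N. digit n z / 2 ^ Suc n) = of_int \<lfloor>2 ^ N * z\<rfloor> / 2 ^ N" for N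
 proof (induction N)
  case (Suc N)
  thus ?case by (simp add: digit_def field_simps)
 qed (simp add: z0)
 moreover have "(%N. of_int \<lfloor>2 ^ N * z\<rfloor> / 2 ^ N) ----> z"
 proof (rule LIM_zero_cancel, rule Lim_null_comparison)
  show "\<forall>\<^sub>F N in sequentially. norm (of_int \<lfloor>2 ^ N * z\<rfloor> / 2 ^ N - z) <= (1/2) ^ N"
  proof (intro always_eventually allI)
   fix N
   have "abs (of_int \<lfloor>2 ^ N * z\<rfloor> - 2 ^ N * z) <= 1" by linarith
   hence "abs (of_int \<lfloor>2 ^ N * z\<rfloor> - 2 ^ N * z) / 2 ^ N <= 1 / 2 ^ N" by (intro divide_right_mono) auto
   moreover have "of_int \<lfloor>2 ^ N * z\<rfloor> / 2 ^ N - z = (of_int \<lfloor>2 ^ N * z\<rfloor> - 2 ^ N * z) / 2 ^ N"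
    by (simp add: field_simps)
   ultimately show "norm (of_int \<lfloor>2 ^ N * z\<rfloor> / 2 ^ N - z) <= (1/2) ^ N" by (simp add: power_one_over)
  qed
  show "(%N. (1/2) ^ N) ----> (0::real)" by (rule LIMSEQ_power_zero) simp
 qed
 ultimately show ?thesis by (simp add: sums_def)
qed

text \<open>\<open>prod_encode\<close> interleaves the binary expansions of countably many numbers
  in one ternary expansion; coordinate \<open>j\<close> reads its own digits back.\<close>

definition sch_coord :: "nat => real => real" where
 "sch_coord j t = (\<Sum>n. sch (3 ^ prod_encode (j, n) * t) / 2 ^ Suc n)"

lemma continuous_sch_coord: "cts (sch_coord j)"
proof -
 let ?X = "%t. \<Sum>n. sch (3 ^ prod_encode (j, n) * t) / 2 ^ Suc n"
 have "uniform_limit UNIV (%N t. SUM n<N. sch (3 ^ prod_encode (j, n) * t) / 2 ^ Suc n)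
   ?X sequentially"
 proof (rule Weierstrass_m_test)
  show "norm (sch (3 ^ prod_encode (j, n) * t) / 2 ^ Suc n) <= (1/2) ^ n" for n t
   using sch_bounds[of "3 ^ prod_encode (j, n) * t"] by (simp add: field_simps)
  show "summable (%n. (1/2) ^ n :: real)" by simp
 qed
 hence "cts ?X" by (rule uniform_limit_theorem[rotated])
   (auto simp: sch_def continuous_intros)
 thus ?thesis by (simp add: sch_coord_def)
qed

text \<open>\<open>arccos (cos (pi * t)) / pi\<close> is the distance of \<open>t\<close> to the
  nearest even integer. At \<open>t = u + 2 * K\<close> with \<open>u\<close> in [0,1] the scalar
  factor is therefore \<open>K\<close>: the even part of \<open>t\<close> codes the size of a box
  and the remainder a point of the box, so that one continuous curve reaches the whole
  space.\<close>

definition fill :: "real => 'b::euclidean_space" where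
 "fill t = ((t - arccos (cos (pi * t)) / pi) / 2) *\<^sub>R (SUM b:Basis. (2 * sch_coord (to_nat_on Basis b) t - 1) *\<^sub>R b)"

lemma continuous_fill: "cts fill" unfolding fill_def by (intro continuous_intros continuous_on_subset[OF continuous_sch_coord]) auto

text \<open>Strictly larger than the norm, so that the relative coordinates lie in [0,1) with 1
  excluded, as the binary expansion requires.\<close>

definition box_size :: "'b::euclidean_space => real" where
 "box_size x = of_int \<lfloor>norm x\<rfloor> + 1"

definition rel_coord :: "'b::euclidean_space => nat => real" where
 "rel_coord x j = (x \<bullet> from_nat_into Basis j / box_size x + 1) / 2"

definition code_digit :: "'b::euclidean_space => nat => real" where
 "code_digit x k = digit (snd (prod_decode k)) (rel_coord x (fst (prod_decode k)))"

definition code_of :: "'b::euclidean_space => real" where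
 "code_of x = (\<Sum>j. 2 * code_digit x j / 3 ^ Suc j) + 2 * box_size x"

lemma code_digit_01: "code_digit x k : {0, 1}" unfolding code_digit_def by (rule digit_01)

lemma measurable_code_of [measurable]: "code_of : bm borel" unfolding code_of_def code_digit_def digit_def rel_coord_def box_size_def by simp

lemma fill_code_of: "fill (code_of x) = (x :: 'b::euclidean_space)"
proof -
 define K :: int where "K = \<lfloor>norm x\<rfloor> + 1"
 have K: "box_size x = of_int K" "K >= 1" "norm x < of_int K" by (auto simp: box_size_def K_def)
 define u where "u = (\<Sum>j. 2 * code_digit x j / 3 ^ Suc j)"
 have u: "0 <= u" "u <= 1" unfolding u_def by (rule ternary_bounds[OF code_digit_01])+
 have cx: "code_of x = u + 2 * of_int K" by (simp add: code_of_def u_def K)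
 have "arccos (cos (pi * code_of x)) = pi * u" unfolding cx cos_shift using u by (intro arccos_cos) (auto)
 hence scale: "(code_of x - arccos (cos (pi * code_of x)) / pi) / 2 = of_int K" by (simp add: cx)
 have co: "sch_coord (to_nat_on Basis b) (code_of x) = (x \<bullet> b / of_int K + 1) / 2" if b: "b : Basis" for b
 proof -
  have "sch (3 ^ prod_encode (to_nat_on Basis b, n) * code_of x) = digit n ((x \<bullet> b / of_int K + 1) / 2)" for n
  proof -
   have "3 ^ prod_encode (to_nat_on Basis b, n) * code_of x
    = 3 ^ prod_encode (to_nat_on Basis b, n) * u + 2 * of_int (3 ^ prod_encode (to_nat_on Basis b, n) * K)" by (simp add: cx algebra_simps)
   hence "sch (3 ^ prod_encode (to_nat_on Basis b, n) * code_of x) = sch (3 ^ prod_encode (to_nat_on Basis b, n) * u)" by (simp only: sch_periodic)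
   also have "... = code_digit x (prod_encode (to_nat_on Basis b, n))" unfolding u_def by (rule sch_ternary[OF code_digit_01])
   also have "... = digit n ((x \<bullet> b / of_int K + 1) / 2)" using b by (simp add: code_digit_def rel_coord_def K countable_finite)
   finally show ?thesis .
  qed
  moreover have "(%n. digit n ((x \<bullet> b / of_int K + 1) / 2) / 2 ^ Suc n) sums ((x \<bullet> b / of_int K + 1) / 2)"
  proof (rule digit_sums)
   have q: "abs (x \<bullet> b / of_int K) < 1" using K Basis_le_norm[OF b, of x] by simp
   have "0 <= (q + 1) / 2 & (q + 1) / 2 < 1" if "abs q < 1" for q :: real using that by auto
   from this[OF q] show "0 <= (x \<bullet> b / of_int K + 1) / 2" "(x \<bullet> b / of_int K + 1) / 2 < 1" by auto
  qed
  ultimately show ?thesis by (simp add: sch_coord_def sums_iff)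
 qed
 have e: "2 * ((q + 1) / 2) - 1 = q" for q :: real by (simp add: field_simps)
 have "fill (code_of x) = of_int K *\<^sub>R (SUM b:Basis. (x \<bullet> b / of_int K) *\<^sub>R b)" unfolding fill_def scale
  by (rule arg_cong, rule sum.cong[OF refl]) (simp only: co e)
 also have "... = (SUM b:Basis. (x \<bullet> b) *\<^sub>R b)" using K by (simp add: scaleR_sum_right)
 finally show ?thesis by (simp add: euclidean_representation)
qed

lemma code_of_bounds: "norm x <= R ==> 0 < code_of x & code_of x <= 2 * R + 3"
proof -
 assume R: "norm x <= R"
 have u: "0 <= (\<Sum>j. 2 * code_digit x j / 3 ^ Suc j)" "(\<Sum>j. 2 * code_digit x j / 3 ^ Suc j) <= 1" by (rule ternary_bounds[OF code_digit_01])+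
 have "of_int \<lfloor>norm x\<rfloor> <= R" using R of_int_floor_le order_trans by blast
 hence "1 <= box_size x" "box_size x <= R + 1" by (auto simp: box_size_def)
 thus ?thesis using u unfolding code_of_def by simp
qed

text \<open>\<open>code_of\<close> is a Borel right inverse of the continuous map
  \<open>fill\<close> and maps balls into bounded intervals. The image measures on the line are
  therefore tight, Helly selection gives a weak limit there, and \<open>fill\<close> carries it
  back. Since \<open>f\<close> is only integrated as \<open>f o fill\<close> on the line, the jumps
  of \<open>code_of\<close> do no harm.\<close>

theorem prokhorov:
 fixes mu :: "nat => 'b::euclidean_space measure"
 assumes P: "!!n. mu n : PM"
  and tight: "!!e. e > 0 ==> EX R. ALL n. measure (mu n) (cball 0 R) > 1 - e"
 obtains r N where "strict_mono r" "N : PM" "wconv (%n. mu (r n)) N sequentially"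
proof -
 have [measurable_cong]: "sets (mu n) = sets borel" for n using P by (simp add: prob_measures_def)
 have sp: "space (mu n) = UNIV" for n using finb_space PM_fb P by auto
 define nu where "nu n = distr (mu n) borel code_of" for n
 have rd: "real_distribution (nu n)" for n
 proof -
  interpret prob_space "mu n" using P by (simp add: prob_measures_def)
  show ?thesis unfolding nu_def by (simp add: nu_def)
 qed
 have "EX a b. a < b & (ALL n. measure (nu n) {a<..b} > 1 - e)" if e: "e > 0" for e
 proof -
  obtain R where R: "!!n. measure (mu n) (cball 0 R) > 1 - e" using tight[OF e] by auto
  let ?X = "{0<..2 * abs R + 3}"
  have "1 - e < measure (nu n) ?X" for n
  proof -
   interpret prob_space "mu n" using P by (simp add: prob_measures_def)
   have "measure (mu n) (cball 0 R) <= measure (mu n) (code_of -` ?X Int space (mu n))"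
   proof (rule finite_measure_mono)
    have "0 < code_of x & code_of x <= 2 * abs R + 3" if "x : cball 0 R" for x :: 'b using that by (intro code_of_bounds) auto
    thus "cball 0 R <= code_of -` ?X Int space (mu n)" by (auto simp: sp)
   qed measurable
   also have "... = measure (nu n) ?X" unfolding nu_def by (subst measure_distr) auto
   finally show ?thesis using R[of n] by simp
  qed
  thus ?thesis by (intro exI exI[of _ "2 * abs R + 3"]) auto
 qed
 hence "Helly_Selection.tight nu" using rd by (simp add: Helly_Selection.tight_def)
 then obtain r M where r: "strict_mono (r::nat=>nat)" "real_distribution M" "weak_conv_m (nu o id o r) M"
  using tight_imp_convergent_subsubsequence[of nu id] by (auto simp: strict_mono_def)
 interpret M: real_distribution M by fact
 have [measurable]: "(fill :: real => 'b) : bm borel" by (intro cts_bm continuous_fill)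
 define N where "N = distr M borel (fill :: real => 'b)"
 have "N : PM" unfolding prob_measures_def N_def by (auto intro!: M.prob_space_distr)
 moreover have "wconv (%n. mu (r n)) N sequentially" unfolding wconv_def
 proof (intro allI impI)
  fix f :: "'b => real" assume f: "cts f" "bounded (range f)"
  then obtain B where B: "!!x. abs (f x) <= B" by (auto simp: bdd_iff)
  have [measurable]: "f : bm borel" by (intro cts_bm f)
  have fc: "cts (%t. f (fill t))" using f(1) continuous_fill by (rule continuous_on_compose2) auto
  have "(%n. LINT t|(nu o id o r) n. f (fill t)) ----> (LINT t|M. f (fill t))"
  proof (rule weak_conv_imp_integral_bdd_continuous_conv[OF _ r(2,3)])
   show "real_distribution ((nu o id o r) n)" for n using rd by simp
   show "isCont (%t. f (fill t)) t" for t using fc by (simp add: continuous_on_eq_continuous_at)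
   show "norm (f (fill t)) <= B" for t using B by simp
  qed
  moreover have "(LINT t|(nu o id o r) n. f (fill t)) = (LINT x|mu (r n). f x)" for n by (simp add: nu_def integral_distr fill_code_of)
  moreover have "(LINT t|M. f (fill t)) = (LINT x|N. f x)" unfolding N_def by (subst integral_distr) auto
  ultimately show "(%n. LINT x|mu (r n). f x) ----> (LINT x|N. f x)" by simp
 qed
 ultimately show ?thesis using that r by simp
qed

section \<open>Jump measures\<close>

locale jump_setting =
 fixes J :: "'a::euclidean_space => 'a measure" and theta :: "real => real => real"
 assumes kernel: "jump_kernel J" and mean: "mean_function theta"
begin

abbreviation (input) GG :: "('a * 'a) set" where "GG \<equiv> G"
abbreviation (input) fcomp :: "'a measure => 'a measure set" where "fcomp \<equiv> finite_component theta J"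
abbreviation (input) WT :: "'a measure topology" where "WT \<equiv> extended_metric_topology PM (W theta J)"
abbreviation (input) Act :: "(real => 'a measure) => (real => ('a * 'a) signed_radon) => ennreal"
 where "Act mu nu \<equiv> \<integral>\<^sup>+t\<in>{0..1}. action theta J (mu t) (nu t) \<partial>lborel"

definition kk :: "'a => 'a => real" where "kk x y = min 1 ((norm (x - y))^2)"

lemma kk_bounds: "0 <= kk x y" "kk x y <= 1" and kk_pos: "x ~= y ==> kk x y > 0" and kk_diag: "kk x x = 0"
 and kk_sym: "kk x y = kk y x" by (auto simp: kk_def norm_minus_commute)

lemma kk_eq: "(min 1 (norm (x - y)))^2 = kk x y"
proof (cases "norm (x - y) <= 1")
 case True
 thus ?thesis using True by (simp add: power_le_one kk_def)

next
 case False
 thus ?thesis using False by (simp add: kk_def)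

qed

lemma measurable_kk [measurable]: "(%p. kk (fst p) (snd p)) : bm borel" "kk x : bm borel" unfolding kk_def by (intro cts_bm continuous_intros)+

lemma J_sets: "sets (J x) = sets (restrict_space borel (- {x}))" and J_space: "space (J x) = - {x}"
proof -
 show *: "sets (J x) = sets (restrict_space borel (- {x}))" using kernel by (auto simp: jump_kernel_def radon_on_def)
 show "space (J x) = - {x}" using sets_eq_imp_space_eq[OF *] by simp
qed

lemma measurable_J: "f : measurable borel M ==> f : measurable (J x) M"
 by (subst measurable_cong_sets[OF J_sets refl]) (rule measurable_restrict_space1)

lemma J_test:
 assumes "cts f" "bounded (range f)"
 shows "integrable (J x) (%y. f y * kk x y)" "bounded (range (%x. LINT y|J x. f y * kk x y))"
  "cts (%x. LINT y|J x. f y * kk x y)" using kernel assms unfolding jump_kernel_def kk_def by blast+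

text \<open>Chosen strictly positive, so that it can be divided by even for a vanishing
  kernel.\<close>

definition KC :: real where
 "KC = (SOME C. C > 0 & (ALL x. (LINT y|J x. kk x y) <= C))"

lemma KC: "KC > 0" "(LINT y|J x. kk x y) <= KC"
proof -
 obtain B where B: "!!x. abs (\<integral>y. kk x y \<partial>J x) <= B" using J_test[of "%_. 1"] by (auto simp: bdd_iff)
 have "EX C. C > 0 & (ALL x. (LINT y|J x. kk x y) <= C)"
 proof (intro exI[of _ "abs B + 1"] conjI allI)
  fix x show "(LINT y|J x. kk x y) <= abs B + 1" using B[of x] by simp
 qed simp
 hence "KC > 0 & (ALL x. (LINT y|J x. kk x y) <= KC)" unfolding KC_def by (rule)
 thus "KC > 0" "(LINT y|J x. kk x y) <= KC" by auto
qed

text \<open>Each \<open>J x\<close> lives on a different space, the complement of \<open>x\<close>.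
  Pushing the normalised measure to the whole space gives all \<open>K x\<close> one sigma-algebra;
  \<open>K_diag\<close> keeps the information that \<open>x\<close> is not charged.\<close>

definition K :: "'a => 'a measure" where
 "K x = distr (dens (J x) (%y. kk x y / KC)) borel (%y. y)"

lemma sets_K [simp, measurable_cong]: "sets (K x) = sets borel" and space_K [simp]: "space (K x) = UNIV" by (simp_all add: K_def)

lemma nn_integral_K:
 assumes [measurable]: "f : bm borel"
 shows "nn_integral (K x) (%y. f y) = nn_integral (J x) (%y. ennreal (kk x y / KC) * f y)"
proof -
 have [measurable]: "f : bm (J x)" "kk x : bm (J x)" "(%y. y) : measurable (J x) borel" by (auto intro!: measurable_J)
 show ?thesis unfolding K_def by (subst nn_integral_distr) (auto simp: nn_integral_density)
qed

lemma integral_K: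
 fixes f :: "'a => real"
 assumes [measurable]: "f : bm borel"
 shows "(LINT y|K x. f y) = (LINT y|J x. f y * kk x y) / KC"
proof -
 have [measurable]: "f : bm (J x)" "kk x : bm (J x)" "(%y. y) : measurable (J x) borel" by (auto intro!: measurable_J)
 have "(LINT y|K x. f y) = (LINT y|J x. kk x y / KC * f y)"
  unfolding K_def by (subst integral_distr) (use KC kk_bounds in \<open>auto simp: integral_density\<close>)
 also have "... = (LINT y|J x. (f y * kk x y) / KC)" by (simp add: mult.commute)
 finally show ?thesis by simp
qed

lemma subprob_K: "subprob_space (K x)"
proof (rule subprob_spaceI)
 have "emeasure (K x) (space (K x)) = nn_integral (K x) (%y. 1)" by simp
 also have "... = nint (J x) (%y. kk x y / KC)" by (subst nn_integral_K) auto
 also have "... = ennreal (LINT y|J x. kk x y / KC)" using J_test[of "%_. 1"] KC kk_bounds by (intro nn_integral_eq_integral) auto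
 also have "... <= 1" using KC by simp
 finally show "emeasure (K x) (space (K x)) <= 1" .
qed simp

lemma finb_K: "finb (K x)" using subprob_K by (auto simp: finb_def subprob_space_def)

lemma continuous_K:
 fixes f :: "'a => real"
 assumes "cts f" "bounded (range f)"
 shows "cts (%x. LINT y|K x. f y)" using J_test KC assms by (simp add: integral_K cts_bm) (intro continuous_intros, auto)

lemma measurable_K [measurable]: "K : measurable borel (subprob_algebra borel)"
 by (rule measurable_kernel_test) (auto simp: subprob_K cts_bm continuous_K)

lemma K_diag: "emeasure (K x) {x} = 0"
proof -
 have m: "(%y. y) : measurable (dens (J x) (%y. kk x y / KC)) borel" by (simp add: measurable_J)
 have e: "(%y. y) -` {x} Int space (dens (J x) (%y. kk x y / KC)) = {}" by (auto simp: J_space)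
 show ?thesis unfolding K_def by (subst emeasure_distr[OF m]) (simp, simp only: e emeasure_empty)
qed

text \<open>Inverse of the density that normalises \<open>J x\<close> to \<open>K x\<close>.
  Division by zero makes it 0 on the diagonal.\<close>

definition cc :: "'a * 'a => real" where "cc p = KC / kk (fst p) (snd p)"

lemma measurable_cc [measurable]: "cc : bm borel" unfolding cc_def by simp

lemma cc_nonneg: "cc p >= 0" using KC kk_bounds by (simp add: cc_def)

lemma cc_swap: "cc (prod.swap p) = cc p" by (simp add: cc_def kk_sym)

lemma nn_integral_J:
 assumes [measurable]: "f : bm borel"
 shows "nn_integral (J x) (%y. f y) = nn_integral (K x) (%y. ennreal (cc (x, y)) * f y)"
proof -
 have "ennreal (kk x y / KC) * (ennreal (cc (x, y)) * f y) = f y" if "y : space (J x)" for y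
 proof -
  have "kk x y > 0" using that by (intro kk_pos) (auto simp: J_space)
  hence "kk x y / KC * cc (x, y) = 1" using KC by (simp add: cc_def)
  moreover have "ennreal (kk x y / KC) * ennreal (cc (x, y)) = ennreal (kk x y / KC * cc (x, y))"
   using kk_bounds KC cc_nonneg by (intro ennreal_mult[symmetric]) auto
  ultimately show ?thesis by (auto simp: mult.assoc[ symmetric])
 qed
 thus ?thesis by (subst nn_integral_K) (auto intro: nn_integral_cong)
qed

section \<open>Rescaled jump measures on the product space and their weak continuity\<close>

definition M1 :: "'a measure => ('a * 'a) measure" where
 "M1 mu = mu \<bind> (%x. distr (K x) borel (Pair x))"

definition M2 :: "'a measure => ('a * 'a) measure" where
 "M2 mu = distr (M1 mu) borel prod.swap"

definition Lam :: "'a measure => ('a * 'a) measure" where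
 "Lam mu = summ (M1 mu) (M2 mu)"

lemma measurable_K_Pair [measurable]: "(%x. distr (K x) borel (Pair x)) : measurable borel (subprob_algebra borel)"
proof (rule measurable_distr2[OF _ measurable_K])
 show "(%(x, y). (x, y)) : borel \<Otimes>\<^sub>M borel \<rightarrow>\<^sub>M (borel :: ('a * 'a) measure)" by measurable
qed

lemma measurable_swap [measurable]: "prod.swap : measurable (borel :: ('a * 'a) measure) borel" by (intro cts_bm continuous_on_swap)

lemma PMD:
 assumes "mu : PM"
 shows "sets mu = sets borel" "space mu = UNIV" "prob_space mu" "subprob_space mu" "finite_measure mu" using assms sets_eq_imp_space_eq[of mu]
 by (auto simp: prob_measures_def prob_space_imp_subprob_space prob_space_def)

lemma measurable_from_prob: "mu : PM ==> f : measurable borel N ==> f : measurable mu N" by (simp add: measurable_cong_sets[OF PMD(1)])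

lemma sets_M1: "mu : PM ==> sets (M1 mu) = sets borel" unfolding M1_def using PMD[of mu] by simp

lemma sets_M2 [simp]: "sets (M2 mu) = sets borel" by (simp add: M2_def)

lemma sets_Lam: "mu : PM ==> sets (Lam mu) = sets borel" by (simp add: Lam_def sets_M1)

lemma subprob_M1: "mu : PM ==> subprob_space (M1 mu)" unfolding M1_def
 by (rule subprob_space_bind[OF PMD(4)]) (auto intro: measurable_from_prob measurable_K_Pair)

lemma subprob_M2: "mu : PM ==> subprob_space (M2 mu)" unfolding M2_def
 by (rule subprob_space.subprob_space_distr[OF subprob_M1]) (auto simp: measurable_cong_sets[OF sets_M1])

lemma finb_M1: "mu : PM ==> finb (M1 mu)" using subprob_M1 sets_M1 by (auto simp: finb_def subprob_space_def)

lemma finb_M2: "mu : PM ==> finb (M2 mu)" using subprob_M2 by (auto simp: finb_def subprob_space_def)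

lemma finb_Lam: "mu : PM ==> finb (Lam mu)" using finb_M1 finb_M2 unfolding finb_def Lam_def by (auto intro: finite_measure_summ)

lemma nn_integral_M1:
 assumes "mu : PM" and [measurable]: "f : bm borel"
 shows "nn_integral (M1 mu) (%p. f p) = (\<integral>\<^sup>+x. \<integral>\<^sup>+y. f (x, y) \<partial>K x \<partial>mu)"
proof -
 have "nn_integral (M1 mu) (%p. f p) = (\<integral>\<^sup>+x. \<integral>\<^sup>+p. f p \<partial>(distr (K x) borel (Pair x)) \<partial>mu)"
  unfolding M1_def using measurable_from_prob[OF assms(1) measurable_K_Pair] by (intro nn_integral_bind) auto
 also have "... = (\<integral>\<^sup>+x. \<integral>\<^sup>+y. f (x, y) \<partial>K x \<partial>mu)" by (subst nn_integral_distr) auto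
 finally show ?thesis .
qed

lemma integral_M1:
 fixes f :: "'a * 'a => real"
 assumes "mu : PM" and [measurable]: "f : bm borel" and B: "!!p. abs (f p) <= B"
 shows "(LINT p|M1 mu. f p) = (\<integral>x. \<integral>y. f (x, y) \<partial>K x \<partial>mu)"
proof -
 have "(LINT p|M1 mu. f p) = (\<integral>x. \<integral>p. f p \<partial>(distr (K x) borel (Pair x)) \<partial>mu)" unfolding M1_def
 proof (rule integral_bind[where K=borel and B'=1])
  show "(%x. distr (K x) borel (Pair x)) : mu \<rightarrow>\<^sub>M subprob_algebra borel"
   by (rule measurable_from_prob[OF assms(1) measurable_K_Pair])
  show "AE x in mu. emeasure (distr (K x) borel (Pair x)) (space (distr (K x) borel (Pair x))) <= ennreal 1"
   by (simp add: emeasure_distr subprob_space.emeasure_space_le_1[OF subprob_K, simplified])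
 qed (use B assms PMD in auto)
 also have "... = (\<integral>x. \<integral>y. f (x, y) \<partial>K x \<partial>mu)" by (subst integral_distr) auto
 finally show ?thesis .
qed

lemma nn_integral_M2:
 assumes "mu : PM" and [measurable]: "f : bm borel"
 shows "nn_integral (M2 mu) (%p. f p) = nn_integral (M1 mu) (%p. f (prod.swap p))"
 unfolding M2_def by (rule nn_integral_distr) (auto simp: measurable_cong_sets[OF sets_M1[OF assms(1)]])

lemma integral_M2:
 fixes f :: "'a * 'a => real"
 assumes "mu : PM" and [measurable]: "f : bm borel"
 shows "(LINT p|M2 mu. f p) = (LINT p|M1 mu. f (prod.swap p))"
 unfolding M2_def by (rule integral_distr) (auto simp: measurable_cong_sets[OF sets_M1[OF assms(1)]])

definition diag :: "('a * 'a) set" where "diag = {p. fst p = snd p}"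

lemma closed_diag: "closed diag" unfolding diag_def by (intro closed_Collect_eq continuous_intros)

lemma diag_sets [measurable]: "diag : sets borel" using closed_diag by simp

lemma G_eq: "G = - diag" by (auto simp: G_def diag_def)

lemma open_G: "open GG" unfolding G_eq by (rule open_Compl[OF closed_diag])

lemma G_sets [measurable]: "G : sets (borel :: ('a * 'a) measure)" using open_G by simp

lemma M1_diag: "mu : PM ==> emeasure (M1 mu) diag = 0"
proof -
 assume P: "mu : PM"
 have "emeasure (M1 mu) diag = nn_integral (M1 mu) (%p. indicator diag p)" using sets_M1[OF P] by simp
 also have "... = (\<integral>\<^sup>+x. \<integral>\<^sup>+y. indicator {x} y \<partial>K x \<partial>mu)"
  by (subst nn_integral_M1[OF P], measurable)
   (intro nn_integral_cong, simp add: diag_def indicator_def)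
 finally show ?thesis by (simp add: K_diag)
qed

lemma M2_diag: "mu : PM ==> emeasure (M2 mu) diag = 0"
proof -
 assume P: "mu : PM"
 have "emeasure (M2 mu) diag = nn_integral (M2 mu) (%p. indicator diag p)" by simp
 also have "... = nn_integral (M1 mu) (%p. indicator diag p)" by (subst nn_integral_M2[OF P], measurable)
   (intro nn_integral_cong, simp add: diag_def indicator_def)
 finally show ?thesis using M1_diag[OF P] sets_M1[OF P] by simp
qed

lemma jump_measure1_eq:
 assumes P: "mu : PM"
 shows "jump_measure1 J mu = restrict_space (dens (M1 mu) cc) G"
proof -
 let ?R = "restrict_space (dens (M1 mu) cc) G"
 have [measurable_cong]: "sets (M1 mu) = sets borel" by (rule sets_M1[OF P])
 have sp: "space ?R = G" by simp
 let ?X = "restrict_space borel G"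
 have st: "sets ?R = sets ?X" by (rule sets_restrict_space_cong) (simp add: sets_M1[OF P])
 have em: "emeasure ?R B = nn_integral mu (%x. emeasure (J x) {y. (x, y) : B})" if "B : sets ?X" for B
 proof -
  have B [measurable]: "B : sets borel" and BG: "B <= G" using that by (auto simp: sets_restrict_space_iff)
  have "emeasure ?R B = emeasure (dens (M1 mu) cc) B" using BG by (intro emeasure_restrict_space) (auto)
  also have "... = nn_integral (M1 mu) (%p. ennreal (cc p) * indicator B p)" by (rule emeasure_density) (auto)
  also have "... = (\<integral>\<^sup>+x. \<integral>\<^sup>+y. ennreal (cc (x, y)) * indicator B (x, y) \<partial>K x \<partial>mu)"
   by (subst nn_integral_M1[OF P]) auto
  also have "... = nn_integral mu (%x. emeasure (J x) {y. (x, y) : B})"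
  proof (rule nn_integral_cong)
   fix x
   have "{y. (x, y) : B} : sets (J x)" unfolding J_sets using BG by (subst sets_restrict_space_iff) (auto simp: G_def)
   hence "emeasure (J x) {y. (x, y) : B} = nn_integral (J x) (%y. indicator {y. (x, y) : B} y)" by simp
   also have "... = nn_integral (K x) (%y. ennreal (cc (x, y)) * indicator {y. (x, y) : B} y)" by (rule nn_integral_J) measurable
   finally show "nn_integral (K x) (%y. ennreal (cc (x, y)) * indicator B (x, y)) = emeasure (J x) {y. (x, y) : B}" by (simp add: indicator_def)
  qed
  finally show ?thesis .
 qed
 have "?R = measure_of (space ?R) (sets ?R) (emeasure ?R)" by (simp only: measure_of_of_measure)
 also have "... = jump_measure1 J mu" unfolding jump_measure1_def sp st
 proof (rule measure_of_eq)
  show "sets ?X <= Pow GG" by (auto simp: sets_restrict_space)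
  fix B assume "B : sigma_sets G (sets (restrict_space borel GG))"
  hence "B : sets ?X" using sets.sigma_sets_eq[of "restrict_space borel GG"] by simp
  thus "emeasure ?R B = nn_integral mu (%x. emeasure (J x) {y. (x, y) : B})" by (rule em)
 qed
 finally show ?thesis by simp
qed

lemma jump_measure2_eq:
 assumes P: "mu : PM"
 shows "jump_measure2 J mu = restrict_space (dens (M2 mu) cc) G"
proof (rule measure_eqI)
 let ?Y = "jump_measure1 J mu"
 let ?V = "restrict_space borel G"
 have sets1: "sets ?Y = sets ?V"
  unfolding jump_measure1_eq[OF P] by (rule sets_restrict_space_cong) (simp add: sets_M1[OF P])
 have sw: "prod.swap : measurable ?Y ?V" unfolding measurable_cong_sets[OF sets1 refl]
  by (intro measurable_restrict_space2 measurable_restrict_space1) (auto simp: space_restrict_space G_def)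
 let ?X = "restrict_space (dens (M2 mu) cc) G"
 let ?Z = "jump_measure2 J mu"
 show "sets ?Z = sets ?X"
  unfolding jump_measure2_def by (simp, rule sets_restrict_space_cong) simp
 fix B assume "B : sets ?Z"
 hence BR: "B : sets ?V" by (simp add: jump_measure2_def)
 hence B [measurable]: "B : sets borel" and BG: "B <= G" by (auto simp: sets_restrict_space_iff)
 have sB [measurable]: "prod.swap -` B : sets (borel :: ('a * 'a) measure)" using measurable_sets[OF measurable_swap] by simp
 have sBG: "prod.swap -` B <= G" using BG by (auto simp: G_def)
 have e: "prod.swap -` B Int space ?Y = prod.swap -` B" using sets_eq_imp_space_eq[OF sets1] sBG by auto
 have [measurable_cong]: "sets (M1 mu) = sets borel" by (rule sets_M1[OF P])
 have "emeasure ?Z B = emeasure ?Y (prod.swap -` B)"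
  unfolding jump_measure2_def by (subst emeasure_distr[OF sw BR]) (simp only: e)
 also have "... = emeasure (dens (M1 mu) cc) (prod.swap -` B)" unfolding jump_measure1_eq[OF P] using sBG by (intro emeasure_restrict_space) (auto)
 also have "... = nn_integral (M1 mu) (%p. ennreal (cc p) * indicator (prod.swap -` B) p)" by (rule emeasure_density) (auto)
 also have "... = nn_integral (M2 mu) (%p. ennreal (cc p) * indicator B p)" by (subst nn_integral_M2[OF P]) (auto simp: cc_swap indicator_def)
 also have "... = emeasure (dens (M2 mu) cc) B" by (rule emeasure_density[symmetric]) (auto simp: M2_def)
 also have "... = emeasure ?X B" using BG by (intro emeasure_restrict_space[symmetric]) (auto)
 finally show "emeasure ?Z B = emeasure ?X B" .
qed

lemma continuous_K_pair:
 fixes phi :: "'a * 'a => real"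
 assumes "Ccs phi"
 shows "cts (%x. LINT y|K x. phi (x, y))"
proof (rule continuous_at_imp_continuous_on, rule ballI)
 fix x0
 obtain C where C: "C >= 0" "!!p. abs (phi p) <= C" "!!p q. abs (phi q - phi p) <= C * min 1 (norm (p - q))" using Ccs_bounds[OF assms] by auto
 have c: "cts phi" by (rule Ccs_continuous[OF assms])
 have cy: "cts (%y. phi (x, y))" for x by (rule continuous_on_compose2[OF c]) (auto intro!: continuous_intros)
 have [measurable]: "(%y. phi (x, y)) : bm borel" for x by (rule cts_bm[OF cy])
 have int: "integrable (K x) (%y. phi (x', y))" for x x' by (rule finb_integrable[OF finb_K _ C(2)]) measurable
 have lip: "abs ((LINT y|K x. phi (x, y)) - (LINT y|K x. phi (x0, y))) <= C * norm (x - x0)" for x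
 proof -
  interpret subprob_space "K x" by (rule subprob_K)
  have "abs ((LINT y|K x. phi (x, y)) - (LINT y|K x. phi (x0, y))) = abs (\<integral>y. phi (x, y) - phi (x0, y) \<partial>K x)" using int by simp
  also have "... <= (LINT y|K x. abs (phi (x, y) - phi (x0, y)))" by simp
  also have "... <= (LINT y|K x. C * norm (x - x0))"
  proof (rule integral_mono)
   fix y
   have "abs (phi (x, y) - phi (x0, y)) <= C * min 1 (norm ((x0, y) - (x, y)))" by (rule C)
   also have "... <= C * norm (x - x0)" using C by (intro mult_left_mono) (auto simp: norm_minus_commute)
   finally show "abs (phi (x, y) - phi (x0, y)) <= C * norm (x - x0)" .
  qed (use int in auto)
  also have "... = (C * norm (x - x0)) * measure (K x) (space (K x))" by simp
  also have "... <= (C * norm (x - x0)) * 1" using C by (intro mult_left_mono subprob_measure_le_1) auto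
  finally show ?thesis by simp
 qed
 have "bounded (range (%y. phi (x0, y)))" unfolding bdd_iff using C by auto
 hence 1: "((%x. LINT y|K x. phi (x0, y)) ---> (LINT y|K x0. phi (x0, y))) (at x0)"
  using continuous_K[OF cy] by (simp add: continuous_on_eq_continuous_at isCont_def)
 have 2: "((%x. (LINT y|K x. phi (x, y)) - (LINT y|K x. phi (x0, y))) ---> 0) (at x0)"
 proof (rule Lim_null_comparison)
  show "\<forall>\<^sub>F x in at x0. norm ((LINT y|K x. phi (x, y)) - (LINT y|K x. phi (x0, y))) <= C * norm (x - x0)" using lip by simp
  have "((%x. C * norm (x - x0)) ---> C * norm (x0 - x0)) (at x0)" by (intro tendsto_intros)
  thus "((%x. C * norm (x - x0)) ---> 0) (at x0)" by simp
 qed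
 from tendsto_add[OF 1 2] show "isCont (%x. LINT y|K x. phi (x, y)) x0" by (simp add: isCont_def)
qed

text \<open>Integrating out the second variable turns a test of \<open>M1 (mu i)\<close> into a test
  of \<open>mu i\<close> with a bounded continuous function. The constant 1 gives convergence of the
  masses, so \<open>wconv_testI\<close> is applicable.\<close>

lemma wconv_M1:
 assumes mu: "eventually (%i. mu i : PM) F" and P: "mu' : PM" and wc: "wconv mu mu' F"
 shows "wconv (%i. M1 (mu i)) (M1 mu') F"
proof (rule wconv_testI)
 show "eventually (%i. finb (M1 (mu i))) F" using mu by eventually_elim (rule finb_M1)
 show "finb (M1 mu')" by (rule finb_M1[OF P])
 have conv: "((%i. \<integral>x. \<integral>y. f (x, y) \<partial>K x \<partial>mu i) ---> (\<integral>x. \<integral>y. f (x, y) \<partial>K x \<partial>mu')) F"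
  if "cts (%x. LINT y|K x. f (x, y))" "!!p. abs (f p) <= C" for f :: "'a * 'a => real" and C
 proof -
  have "C >= 0" using that(2)[of undefined] by simp
  have "abs (\<integral>y. f (x, y) \<partial>K x) <= C" for x
  proof -
   interpret subprob_space "K x" by (rule subprob_K)
   have "abs (\<integral>y. f (x, y) \<partial>K x) <= C * measure (K x) (space (K x))"
   proof -
    have "norm (LINT y|K x. f (x, y)) <= (LINT y|K x. C)"
    proof (cases "integrable (K x) (%y. f (x, y))")
     case True
     show ?thesis by (rule order_trans[OF integral_norm_bound integral_mono]) (use True that in auto)
    qed (simp add: not_integrable_integral_eq `C >= 0`)
    thus ?thesis by (simp add: mult.commute)
   qed
   also have "... <= C * 1" using `C >= 0` by (intro mult_left_mono subprob_measure_le_1)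
   finally show ?thesis by simp
  qed
  hence "bounded (range (%x. LINT y|K x. f (x, y)))" unfolding bdd_iff using `C >= 0` by auto
  thus ?thesis using wc that unfolding wconv_def by simp
 qed
 have tr: "((%i. LINT p|M1 (mu i). f p) ---> (LINT p|M1 mu'. f p)) F"
  if "cts (%x. LINT y|K x. f (x, y))" "!!p. abs (f p) <= C" "f : bm borel"
  for f :: "'a * 'a => real" and C
 proof -
  have "eventually (%i. (\<integral>x. \<integral>y. f (x, y) \<partial>K x \<partial>mu i) = (LINT p|M1 (mu i). f p)) F"
   using mu by eventually_elim (rule integral_M1[symmetric]; use that in blast)
  moreover have "(\<integral>x. \<integral>y. f (x, y) \<partial>K x \<partial>mu') = (LINT p|M1 mu'. f p)"
   by (rule integral_M1[symmetric]) (use P that in blast)+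
  ultimately show ?thesis using conv[OF that(1,2)] by (simp add: tendsto_cong)
 qed
 show "((%i. LINT p|M1 (mu i). phi p) ---> (LINT p|M1 mu'. phi p)) F" if phi: "Ccs phi" for phi
 proof -
  obtain C where "!!p. abs (phi p) <= C" using Ccs_bounds[OF phi] by metis
  thus ?thesis by (rule tr[OF continuous_K_pair[OF phi]]) (rule Ccs_measurable[OF phi])
 qed
 have "((%i. LINT p|M1 (mu i). 1) ---> (\<integral>p. 1 \<partial>M1 mu' :: real)) F" by (rule tr) (use continuous_K[of "%_. 1"] in auto)
 moreover have "eventually (%i. (LINT p|M1 (mu i). 1) = measure (M1 (mu i)) UNIV) F" using mu by eventually_elim (simp add: finb_space[OF finb_M1])
 ultimately show "((%i. measure (M1 (mu i)) UNIV) ---> measure (M1 mu') UNIV) F" using P by (simp add: tendsto_cong finb_space[OF finb_M1])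
qed

lemma wconv_M2:
 assumes mu: "eventually (%i. mu i : PM) F" and P: "mu' : PM" and wc: "wconv mu mu' F"
 shows "wconv (%i. M2 (mu i)) (M2 mu') F" unfolding wconv_def
proof (intro allI impI)
 fix f :: "'a * 'a => real" assume f: "cts f" "bounded (range f)"
 have "cts (%p. f (prod.swap p))" by (rule continuous_on_compose2[OF f(1)]) (auto intro: continuous_on_swap)
 moreover have "bounded (range (%p. f (prod.swap p)))" using f by (auto simp: bdd_iff)
 ultimately have "((%i. LINT p|M1 (mu i). f (prod.swap p)) ---> (LINT p|M1 mu'. f (prod.swap p))) F"
  using wconv_M1[OF assms] unfolding wconv_def by simp
 moreover have "eventually (%i. (LINT p|M1 (mu i). f (prod.swap p)) = (LINT p|M2 (mu i). f p)) F"
  using mu by eventually_elim (rule integral_M2[symmetric], auto intro: cts_bm f)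
 ultimately show "((%i. LINT p|M2 (mu i). f p) ---> (LINT p|M2 mu'. f p)) F" using P f by (simp add: tendsto_cong integral_M2 cts_bm)
qed

end

section \<open>Supporting lines of the mean function\<close>

lemma integral_summ:
 fixes f :: "'b => real"
 assumes "sets N = sets M" "integrable M f" "integrable N f" "!!x. f x >= 0"
 shows "integrable (summ M N) f" "(LINT x|summ M N. f x) = (LINT x|M. f x) + (LINT x|N. f x)"
proof -
 have [measurable]: "f : bm M" using assms by simp
 have "nint (summ M N) f = nint M f + nint N f"
   by (rule nn_integral_summ[OF assms(1)]) measurable
 also have "... = ennreal (LINT x|M. f x) + ennreal (LINT x|N. f x)" using assms by (simp add: nn_integral_eq_integral)
 also have "... = ennreal ((LINT x|M. f x) + (LINT x|N. f x))" using assms by simp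
 finally have "has_bochner_integral (summ M N) f ((LINT x|M. f x) + (LINT x|N. f x))" using assms by (intro has_bochner_integral_nn_integral) auto
 thus "integrable (summ M N) f" "(LINT x|summ M N. f x) = (LINT x|M. f x) + (LINT x|N. f x)" by (auto simp: has_bochner_integral_iff)
qed

context jump_setting begin

lemma th_nonneg: "s >= 0 ==> t >= 0 ==> theta s t >= 0"
proof -
 show "s >= 0 ==> t >= 0 ==> theta s t >= 0" using mean unfolding mean_function_def by simp

qed

lemma th_sym: "s >= 0 ==> t >= 0 ==> theta s t = theta t s"
proof -
 show "s >= 0 ==> t >= 0 ==> theta s t = theta t s" using mean unfolding mean_function_def by simp

qed

lemma th_0: "t >= 0 ==> theta 0 t = 0"
proof -
 show "t >= 0 ==> theta 0 t = 0" using mean unfolding mean_function_def by simp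

qed

lemma th_mono: "0 <= r ==> r <= s ==> 0 <= t ==> theta r t <= theta s t"
proof -
 show "0 <= r ==> r <= s ==> 0 <= t ==> theta r t <= theta s t" using mean unfolding mean_function_def by simp

qed

lemma th_hom_pos: "c > 0 ==> s >= 0 ==> t >= 0 ==> theta (c * s) (c * t) = c * theta s t"
proof -
 show "c > 0 ==> s >= 0 ==> t >= 0 ==> theta (c * s) (c * t) = c * theta s t" using mean unfolding mean_function_def by simp

qed

lemma th_cont: "continuous_on ({0..} \<times> {0..}) (%(s, t). theta s t)" using mean unfolding mean_function_def by simp

lemma th_conc: "concave_on ({0..} \<times> {0..}) (%(s, t). theta s t)" using mean unfolding mean_function_def by simp

lemma th_11: "theta 1 1 = 1" using mean unfolding mean_function_def by simp

lemma th_0': "t >= 0 ==> theta t 0 = 0" using th_0[of t] th_sym by simp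

lemma th_hom: "c >= 0 ==> s >= 0 ==> t >= 0 ==> theta (c * s) (c * t) = c * theta s t" using th_hom_pos[of c] th_0 by force

lemma th_concD:
 assumes "s >= 0" "t >= 0" "s' >= 0" "t' >= 0" "0 <= u" "u <= 1"
 shows "(1 - u) * theta s t + u * theta s' t' <= theta ((1 - u) * s + u * s') ((1 - u) * t + u * t')"
proof -
 have "convex_on ({0..} \<times> {0..}) (%x. - (case x of (s, t) => theta s t))" using th_conc by (simp add: concave_on_def)
 from convex_onD[OF this assms(5,6), of "(s, t)" "(s', t')"] assms(1-4) show ?thesis by simp
qed

lemma th_le_avg: "s >= 0 ==> t >= 0 ==> theta s t <= (s + t) / 2"
proof -
 assume "s >= 0" "t >= 0"
 hence "theta s t <= theta ((s + t) / 2) ((s + t) / 2)" using th_concD[of s t t s "1/2"] th_sym by (simp add: add_divide_distrib add.commute)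
 also have "... = (s + t) / 2" using th_hom[of "(s+t)/2" 1 1] th_11 `s >= 0` `t >= 0` by simp
 finally show ?thesis .
qed

lemma measurable_th:
 assumes [measurable]: "f : bm M" "g : bm M" and "!!p. f p >= 0" "!!p. g p >= 0"
 shows "(%p. theta (f p) (g p)) : bm M"
proof -
 let ?X = "restrict_space borel ({0..} \<times> {0..})"
 have "(%(s, t). theta s t) : bm ?X" by (rule borel_measurable_continuous_on_restrict[OF th_cont])
 moreover have "(%p. (f p, g p)) : measurable M ?X" using assms by (intro measurable_restrict_space2) auto
 ultimately have "(%p. case (f p, g p) of (s, t) => theta s t) : bm M" by measurable
 thus ?thesis by simp
qed

text \<open>The linear majorants of the mean function with nonnegative coefficients. A concave
  one-homogeneous function is the infimum of its linear majorants, and a linear majorant replaces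
  the nonlinear weighted measure by integrals against \<open>M1\<close> and \<open>M2\<close>, which
  behave well under weak limits.\<close>

definition adm :: "real => real => bool" where
 "adm a b \<longleftrightarrow> a >= 0 & b >= 0 & (ALL s>=0. ALL t>=0. theta s t <= a * s + b * t)"

lemma admD: "adm a b ==> a >= 0" "adm a b ==> b >= 0" "adm a b ==> s >= 0 ==> t >= 0 ==> theta s t <= a * s + b * t" by (auto simp: adm_def)

lemma adm_half: "adm (1/2) (1/2)" unfolding adm_def using th_le_avg by (auto simp: add_divide_distrib)

lemma adm_swap: "adm a b ==> adm b a" unfolding adm_def by (metis add.commute th_sym)

lemma adm_convex:
 assumes "adm a b" "adm a' b'" "0 <= u" "u <= 1"
 shows "adm (u * a + (1 - u) * a') (u * b + (1 - u) * b')" unfolding adm_def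
proof (intro conjI allI impI)
 fix s t :: real assume st: "0 <= s" "0 <= t"
 have "theta s t = u * theta s t + (1 - u) * theta s t" by (simp add: algebra_simps)
 also have "... <= u * (a * s + b * t) + (1 - u) * (a' * s + b' * t)" using assms st by (intro add_mono mult_left_mono admD(3)) auto
 finally show "theta s t <= (u * a + (1 - u) * a') * s + (u * b + (1 - u) * b') * t" by (simp add: algebra_simps)
qed (use assms in \<open>auto simp: adm_def\<close>)

lemma adm_from_slice:
 assumes "a >= 0" "b >= 0" "!!s. s >= 0 ==> theta s 1 <= a * s + b"
 shows "adm a b" unfolding adm_def
proof (intro conjI allI impI assms(1,2))
 fix s t :: real assume st: "0 <= s" "0 <= t"
 show "theta s t <= a * s + b * t"
 proof (cases "t = 0")
  case True
  thus ?thesis using th_0' st assms by simp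
 next
  case False
  hence "theta s t = t * theta (s / t) 1" using th_hom[of t "s / t" 1] st by simp
  also have "... <= t * (a * (s / t) + b)" using st by (intro mult_left_mono assms) auto
  also have "... = a * s + b * t" using False by (simp add: field_simps)
  finally show ?thesis .
 qed
qed

lemma th_slice_cont: "continuous_on {0..} (%s. theta s 1)"
proof -
 have "continuous_on {0..} (%s. case (s, 1) of (s, t) => theta s t)" by (rule continuous_on_compose2[OF th_cont]) (auto intro!: continuous_intros)
 thus ?thesis by simp
qed

text \<open>One coefficient can be made arbitrarily small at the expense of the other, because theta
  vanishes on the axes. Continuity keeps \<open>theta s 1\<close> below \<open>kappa\<close> for
  small \<open>s\<close>; for the other \<open>s\<close> a large slope absorbs the bound by the
  average.\<close>

lemma adm_small:
 assumes "kappa > 0"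
 obtains a where "adm a kappa"
proof -
 have "continuous (at 0 within {0..}) (%s. theta s 1)" using th_slice_cont by (simp add: continuous_on_eq_continuous_within)
 hence "EX d>0. ALL s:{0..}. dist s 0 < d --> dist (theta s 1) (theta 0 1) < kappa" using assms unfolding continuous_within_eps_delta by simp
 then obtain d where d0: "d > 0" "ALL s:{0..}. dist s 0 < d --> dist (theta s 1) (theta 0 1) < kappa" by auto
 have d: "d > 0" "theta s 1 < kappa" if "s >= 0" "s < d" for s
 proof -
  show "theta s 1 < kappa" using d0 that using th_0 by auto
 qed (rule d0)
 \<comment> \<open>For \<open>s >= d\<close> one has \<open>1 <= s / d\<close>, so
   \<open>(s + 1) / 2\<close> is at most \<open>s / 2 + s / (2 * d)\<close>.\<close>
 have "adm (1/2 + 1/(2*d)) kappa"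
 proof (rule adm_from_slice)
  fix s :: real assume s: "0 <= s"
  show "theta s 1 <= (1/2 + 1/(2*d)) * s + kappa"
  proof (cases "s < d")
   case True
   hence "theta s 1 < kappa" by (intro d s)
   moreover have "0 <= (1/2 + 1/(2*d)) * s" using s d0 by simp
   ultimately show ?thesis by simp
  next
   case False
   hence "(s + 1) / 2 <= (1/2 + 1/(2*d)) * s" using d0 by (simp add: algebra_simps)
   thus ?thesis using th_le_avg[of s 1] s assms by simp
  qed
 qed (use d0 assms in auto)
 thus ?thesis by (rule)
qed

text \<open>Supporting lines of the concave function \<open>s \<mapsto> theta s 1\<close>.\<close>

lemma adm_touch:
 assumes "s0 > 0"
 obtains a b where "adm a b" "a * s0 + b = theta s0 1"
proof -
 have conv: "convex_on {0..} (%s. - theta s 1)"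
 proof (rule convex_onI)
  fix t x y :: real assume "0 < t" "t < 1" "x : {0..}" "y : {0..}"
  thus "- theta ((1 - t) *\<^sub>R x + t *\<^sub>R y) 1 <= (1 - t) * - theta x 1 + t * - theta y 1" using th_concD[of x 1 y 1 t] by simp
 qed (rule convex_real_interval)
 have int: "s0 : interior {0..}" using assms by simp
 define A where "A = - Inf ((%t. (- theta s0 1 - - theta t 1) / (s0 - t)) ` ({s0<..} Int {0..}))"
 have sup: "theta s 1 <= theta s0 1 + A * (s - s0)" if "s >= 0" for s
  using convex_le_Inf_differential[OF conv int] that by (simp add: A_def algebra_simps)
 have A0: "A >= 0" using sup[of "s0 + 1"] th_mono[of s0 "s0 + 1" 1] assms by simp
 have "adm A (theta s0 1 - A * s0)" using sup[of 0] th_0 by (intro adm_from_slice A0) (use sup in \<open>auto simp: algebra_simps\<close>)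
 thus ?thesis by (rule) simp
qed

text \<open>Homogeneity reduces the claim to the segment \<open>s + t = 1\<close>, which is compact.
  At interior points a supporting line touches exactly; at the two ends, where the slope may be
  infinite, \<open>adm_small\<close> provides a line that is nearly optimal.\<close>

lemma adm_finite_approx:
 assumes "eps > 0"
 obtains F where "finite F" "!!a b. (a, b) : F ==> adm a b"
  "!!s t. s >= 0 ==> t >= 0 ==> EX (a, b):F. a * s + b * t <= theta s t + eps * (s + t)"
proof -
 define T where "T u = theta (max 0 u) (max 0 (1 - u))" for u
 have Tc: "cts T"
 proof -
  have "cts (%u. case (max 0 u, max 0 (1 - u)) of (s, t) => theta s t)" by (rule continuous_on_compose2[OF th_cont]) (auto intro!: continuous_intros)
  thus ?thesis by (simp add: T_def)
 qed
 define U where "U q = {u. fst q * u + snd q * (1 - u) - T u < eps}" for q :: "real * real"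
 have Uo: "open (U q)" for q unfolding U_def by (intro open_Collect_less continuous_intros Tc)
 let ?X = "{q. adm (fst q) (snd q)}"
 have cov: "{0..1} <= (UN q:?X. U q)"
 proof
  fix u :: real assume "u : {0..1}"
  then consider "u = 0" | "u = 1" | "0 < u" "u < 1" by force
  hence "EX a b. adm a b & a * u + b * (1 - u) - T u < eps"
  proof cases
   case 1
   obtain a where "adm a (eps/2)" using adm_small[of "eps/2"] assms by auto
   thus ?thesis using 1 assms th_0 by (intro exI exI[of _ "eps/2"]) (simp add: T_def)
  next
   case 2
   obtain a where "adm a (eps/2)" using adm_small[of "eps/2"] assms by auto
   hence "adm (eps/2) a" by (rule adm_swap)
   thus ?thesis using 2 assms th_0' by (auto simp: T_def)
  next
   case 3
   obtain a b where ab: "adm a b" "a * (u / (1 - u)) + b = theta (u / (1 - u)) 1" using adm_touch[of "u / (1 - u)"] 3 by auto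
   have "T u = (1 - u) * theta (u / (1 - u)) 1" using th_hom[of "1 - u" "u / (1 - u)" 1] 3 by (simp add: T_def)
   also have "... = a * u + b * (1 - u)" using 3 by (simp add: ab(2)[symmetric] field_simps)
   finally show ?thesis using ab assms by force
  qed
  thus "u : (UN q:?X. U q)" by (auto simp: U_def)
 qed
 obtain F where F: "F <= ?X" "finite F" "{0..1} <= (UN q:F. U q)" by (rule compactE_image[OF compact_Icc Uo cov])
 show ?thesis
 proof (rule that[OF F(2)])
  show "(a, b) : F ==> adm a b" for a b using F by auto
  fix s t :: real assume st: "s >= 0" "t >= 0"
  define u where "u = (if s + t = 0 then 0 else s / (s + t))"
  have "u : {0..1}" using st by (auto simp: u_def)
  then obtain q where q: "q : F" "u : U q" using F by auto
  have "fst q * s + snd q * t <= theta s t + eps * (s + t)"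
  proof (cases "s + t = 0")
   case True
   hence "s = 0" "t = 0" using st by auto
   thus ?thesis using th_0 by simp
  next
   case False
   hence p: "s + t > 0" using st by simp
   have e: "s = (s + t) * u" "t = (s + t) * (1 - u)" using False by (auto simp: u_def field_simps)
   have "theta s t = (s + t) * T u" using `u : {0..1}` using th_hom[of "s + t" u "1 - u"] e p `u : {0..1}` by (simp add: T_def)
   moreover have "fst q * s + snd q * t = (s + t) * (fst q * u + snd q * (1 - u))" by (subst e, subst e) (simp add: algebra_simps)
   moreover have "(s + t) * (fst q * u + snd q * (1 - u)) <= (s + t) * (T u + eps)" using q p by (auto simp: U_def)
   ultimately show ?thesis by (simp add: algebra_simps)
  qed
  thus "EX (a, b):F. a * s + b * t <= theta s t + eps * (s + t)" using q by auto
 qed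
qed

section \<open>Densities of the jump measures and upper bounds for the weighted measure\<close>

definition is_dens :: "('a * 'a) measure => ('a * 'a) measure => ('a * 'a => real) => bool" where
 "is_dens L N s \<longleftrightarrow> s : bm borel & (ALL p. s p >= 0) & dens L s = N"

definition r1 where "r1 mu = (SOME s. is_dens (Lam mu) (M1 mu) s)"
definition r2 where "r2 mu = (SOME s. is_dens (Lam mu) (M2 mu) s)"

lemma r12:
 assumes P: "mu : PM"
 shows "is_dens (Lam mu) (M1 mu) (r1 mu)" "is_dens (Lam mu) (M2 mu) (r2 mu)"
proof -
 have fin: "finite_measure (Lam mu)" "finite_measure (M1 mu)" "finite_measure (M2 mu)"
  using finb_Lam[OF P] finb_M1[OF P] finb_M2[OF P] by (auto simp: finb_def)
 have s: "sets (M2 mu) = sets (M1 mu)" by (simp add: sets_M1[OF P])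
 have sf: "sigma_finite_measure (Lam mu)" "sigma_finite_measure (M1 mu)" "sigma_finite_measure (M2 mu)" using fin by (auto simp: finite_measure_def)
 have cong: "f : bm (Lam mu) \<longleftrightarrow> f : bm borel" for f :: "_ => real"
  by (rule measurable_cong_sets[OF sets_Lam[OF P] refl, THEN arg_cong])
 have "EX s. is_dens (Lam mu) (M1 mu) s" by (rule real_dens[OF sf(1) sf(2)])
   (use ac_summ[OF s] sets_Lam[OF P] sets_M1[OF P] in \<open>auto simp: is_dens_def cong Lam_def[symmetric]\<close>)
 thus "is_dens (Lam mu) (M1 mu) (r1 mu)" unfolding r1_def by (rule)
 have "EX s. is_dens (Lam mu) (M2 mu) s" by (rule real_dens[OF sf(1) sf(3)])
   (use ac_summ[OF s] sets_Lam[OF P] in \<open>auto simp: is_dens_def cong Lam_def[symmetric]\<close>)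
 thus "is_dens (Lam mu) (M2 mu) (r2 mu)" unfolding r2_def by (rule)
qed

lemma r12':
 assumes P: "mu : PM"
 shows "r1 mu : bm borel" "r2 mu : bm borel" "r1 mu p >= 0" "r2 mu p >= 0"
  "dens (Lam mu) (r1 mu) = M1 mu" "dens (Lam mu) (r2 mu) = M2 mu"
  "(%p. theta (r1 mu p) (r2 mu p)) : bm borel"
proof -
 show *: "r1 mu : bm borel" "r2 mu : bm borel"
  "dens (Lam mu) (r1 mu) = M1 mu" "dens (Lam mu) (r2 mu) = M2 mu" using r12[OF P] unfolding is_dens_def by blast+
 have nn: "r1 mu q >= 0" "r2 mu q >= 0" for q using r12[OF P] unfolding is_dens_def by blast+
 show "r1 mu p >= 0" "r2 mu p >= 0" by (rule nn)+
 show "(%p. theta (r1 mu p) (r2 mu p)) : bm borel" by (rule measurable_th[OF *(1,2) nn])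
qed

text \<open>This is theta(d mu^1, d mu^2) in the calculus of one-homogeneous functions of measures,
  computed with the finite reference measure \<open>Lam mu\<close>; \<open>cc\<close> undoes the
  normalisation of the kernel and removes the diagonal.\<close>

definition Th :: "'a measure => ('a * 'a) measure" where
 "Th mu = dens (Lam mu) (%p. theta (r1 mu p) (r2 mu p) * cc p)"

lemma sets_Th: "mu : PM ==> sets (Th mu) = sets borel" by (simp add: Th_def sets_Lam)

lemma Lam_bm: "mu : PM ==> f : bm borel ==> f : bm (Lam mu)"
 and Th_bm: "mu : PM ==> f : bm borel ==> f : bm (Th mu)" by (simp_all add: measurable_cong_sets[OF sets_Lam] measurable_cong_sets[OF sets_Th])

lemma nn_integral_Th:
 assumes P: "mu : PM" and [measurable]: "f : bm borel"
 shows "nn_integral (Th mu) (%p. f p) = nn_integral (Lam mu) (%p. ennreal (theta (r1 mu p) (r2 mu p) * cc p) * f p)"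
proof -
 note [measurable] = r12'(7)[OF P]
 show ?thesis unfolding Th_def by (rule nn_integral_density) (auto intro!: Lam_bm[OF P])
qed

lemma nn_integral_M_dens:
 assumes P: "mu : PM" and [measurable]: "f : bm borel"
 shows "nn_integral (M1 mu) (%p. f p) = nn_integral (Lam mu) (%p. ennreal (r1 mu p) * f p)"
  "nn_integral (M2 mu) (%p. f p) = nn_integral (Lam mu) (%p. ennreal (r2 mu p) * f p)"
proof -
 note [measurable] = r12'(1,2)[OF P]
 show "nn_integral (M1 mu) (%p. f p) = nn_integral (Lam mu) (%p. ennreal (r1 mu p) * f p)"
  by (subst r12'(5)[OF P, symmetric], rule nn_integral_density) (auto intro!: Lam_bm[OF P])
 show "nn_integral (M2 mu) (%p. f p) = nn_integral (Lam mu) (%p. ennreal (r2 mu p) * f p)"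
  by (subst r12'(6)[OF P, symmetric], rule nn_integral_density) (auto intro!: Lam_bm[OF P])
qed

text \<open>A pointwise use of linear majorants, after which the densities \<open>r1\<close> and
  \<open>r2\<close> turn \<open>Lam mu\<close> into \<open>M1 mu\<close> and \<open>M2 mu\<close>.
  The coefficients may vary from point to point; both the semicontinuity and the tail estimate
  exploit this.\<close>

lemma nn_Th_le:
 assumes P: "mu : PM" and [measurable]: "f : bm borel"
  "a : bm borel" "b : bm borel" and adm: "!!p. adm (a p) (b p)"
 shows "nn_integral (Th mu) (%p. f p) <= nn_integral (M1 mu) (%p. f p * ennreal (cc p * a p)) + nn_integral (M2 mu) (%p. f p * ennreal (cc p * b p))"
proof -
 note [measurable] = r12'(1,2,7)[OF P]
 have "nn_integral (Th mu) (%p. f p) = nn_integral (Lam mu) (%p. ennreal (theta (r1 mu p) (r2 mu p) * cc p) * f p)"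
  by (rule nn_integral_Th[OF P]) measurable
 also have "... <= nn_integral (Lam mu) (%p. ennreal (r1 mu p) * (f p * ennreal (cc p * a p)) + ennreal (r2 mu p) * (f p * ennreal (cc p * b p)))"
 proof (rule nn_integral_mono)
  fix p
  have ab: "a p >= 0" "b p >= 0" using adm by (auto simp: adm_def)
  have "theta (r1 mu p) (r2 mu p) * cc p <= (a p * r1 mu p + b p * r2 mu p) * cc p" using r12'[OF P] cc_nonneg by (intro mult_right_mono admD[OF adm])
  also have "... = r1 mu p * (cc p * a p) + r2 mu p * (cc p * b p)" by (simp add: algebra_simps)
  finally have "ennreal (theta (r1 mu p) (r2 mu p) * cc p) <= ennreal (r1 mu p * (cc p * a p) + r2 mu p * (cc p * b p))" by (rule ennreal_leI)
  also have "... = ennreal (r1 mu p) * ennreal (cc p * a p) + ennreal (r2 mu p) * ennreal (cc p * b p)"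
   using r12'[OF P] cc_nonneg ab by (auto simp: ennreal_mult)
  finally have "ennreal (theta (r1 mu p) (r2 mu p) * cc p) * f p <=
   (ennreal (r1 mu p) * ennreal (cc p * a p) + ennreal (r2 mu p) * ennreal (cc p * b p)) * f p" by (rule mult_right_mono) simp
  thus "ennreal (theta (r1 mu p) (r2 mu p) * cc p) * f p <=
   ennreal (r1 mu p) * (f p * ennreal (cc p * a p)) + ennreal (r2 mu p) * (f p * ennreal (cc p * b p))" by (simp add: distrib_left mult_ac)
 qed
 also have "... = nn_integral (Lam mu) (%p. ennreal (r1 mu p) * (f p * ennreal (cc p * a p)))
   + nn_integral (Lam mu) (%p. ennreal (r2 mu p) * (f p * ennreal (cc p * b p)))" by (rule nn_integral_add) (auto intro!: Lam_bm[OF P])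
 also have "... = nn_integral (M1 mu) (%p. f p * ennreal (cc p * a p)) + nn_integral (M2 mu) (%p. f p * ennreal (cc p * b p))"
  by (rule arg_cong2[where f="(+)"], rule nn_integral_M_dens[OF P, symmetric], measurable)
   (rule nn_integral_M_dens[OF P, symmetric], measurable)
 finally show ?thesis .
qed

text \<open>Integrands for which \<open>f * cc\<close> stays bounded although \<open>cc\<close>
  blows up at the diagonal. Products of two differences of test functions are of this kind.\<close>

definition kdom :: "('a * 'a => real) => real => bool" where
 "kdom f B \<longleftrightarrow> f : bm borel & B >= 0 & (ALL p. abs (f p) <= B * kk (fst p) (snd p))"

lemma kdomD: "kdom f B ==> f : bm borel" "kdom f B ==> B >= 0"
 "kdom f B ==> abs (f p) <= B * kk (fst p) (snd p)" unfolding kdom_def by blast+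

lemma kdom_cc: "kdom f B ==> abs (f p * cc p) <= B * KC"
proof -
 assume f: "kdom f B"
 show ?thesis
 proof (cases "fst p = snd p")
  case True
  thus ?thesis using f KC by (simp add: cc_def kk_diag kdom_def)
 next
  case False
  have "abs (f p * cc p) <= (B * kk (fst p) (snd p)) * cc p" using kdomD[OF f] cc_nonneg by (simp add: abs_mult mult_right_mono)
  also have "... = B * KC" using kk_pos[OF False] by (simp add: cc_def)
  finally show ?thesis .
 qed
qed

lemma nn_Th_bound:
 assumes P: "mu : PM" and f: "kdom f B"
 shows "nn_integral (Th mu) (%p. ennreal (abs (f p))) <= ennreal (B * KC)"
proof -
 have [measurable]: "f : bm borel" using f by (simp add: kdom_def)
 have BK: "B * KC >= 0" using f KC by (simp add: kdom_def)
 have m: "emeasure (M1 mu) (space (M1 mu)) <= 1" "emeasure (M2 mu) (space (M2 mu)) <= 1"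
  using subprob_space.emeasure_space_le_1[OF subprob_M1[OF P]] subprob_space.emeasure_space_le_1[OF subprob_M2[OF P]] by auto
 have b: "ennreal (abs (f p)) * ennreal (cc p * (1/2)) <= ennreal (B * KC / 2)" for p using kdom_cc[OF f, of p] cc_nonneg
  by (subst ennreal_mult[symmetric]) (auto)
 let ?X = "%p. ennreal (abs (f p)) * ennreal (cc p * (1/2))"
 have "nn_integral (Th mu) (%p. ennreal (abs (f p)))
   <= nn_integral (M1 mu) ?X + nn_integral (M2 mu) ?X"
  by (rule nn_Th_le[OF P]) (auto intro: adm_half)
 also have "... <= nint (M1 mu) (%p. B * KC / 2) + nint (M2 mu) (%p. B * KC / 2)" by (intro add_mono nn_integral_mono b)
 also have "... <= ennreal (B * KC / 2) + ennreal (B * KC / 2)" using mult_left_mono[OF m(1)] mult_left_mono[OF m(2)] by (intro add_mono) auto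
 also have "... = ennreal (B * KC)" using BK by (subst ennreal_plus[symmetric]) auto
 finally show ?thesis .
qed

lemma Th_int:
 assumes P: "mu : PM" and f: "kdom f B"
 shows "integrable (Th mu) f" "abs (\<integral>p. f p \<partial>Th mu) <= B * KC"
proof -
 have m: "f : bm (Th mu)" using f by (intro Th_bm[OF P]) (simp add: kdom_def)
 show i: "integrable (Th mu) f" unfolding integrable_iff_bounded using nn_Th_bound[OF P f] m by (auto simp: le_less_trans)
 have "ennreal (abs (\<integral>p. f p \<partial>Th mu)) <= ennreal (LINT p|Th mu. abs (f p))" by simp
 also have "... = nn_integral (Th mu) (%p. ennreal (abs (f p)))" using i by (intro nn_integral_eq_integral[symmetric]) auto
 also have "... <= ennreal (B * KC)" by (rule nn_Th_bound[OF P f])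
 finally show "abs (\<integral>p. f p \<partial>Th mu) <= B * KC" using f KC by (auto simp: kdom_def)
qed

lemma Th_le:
 assumes P: "mu : PM" and f: "kdom f B" "!!p. f p >= 0"
  and [measurable]: "a : bm borel" "b : bm borel" and adm: "!!p. adm (a p) (b p)"
  and bd: "!!p. a p <= m" "!!p. b p <= m"
 shows "(LINT p|Th mu. f p) <= (LINT p|M1 mu. f p * cc p * a p) + (LINT p|M2 mu. f p * cc p * b p)"
proof -
 have [measurable]: "f : bm borel" using f by (simp add: kdom_def)
 have ab: "a p >= 0" "b p >= 0" for p using adm by (auto simp: adm_def)
 have BK: "B * KC >= 0" using f KC by (simp add: kdom_def)
 have i: "integrable (M1 mu) (%p. f p * cc p * a p)" "integrable (M2 mu) (%p. f p * cc p * b p)"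
 proof -
  have "abs (f p * cc p * a p) <= B * KC * m" "abs (f p * cc p * b p) <= B * KC * m" for p unfolding abs_mult[of "f p * cc p"] using bd ab
   by (intro mult_mono kdom_cc[OF f(1)] BK, auto)+
  thus "integrable (M1 mu) (%p. f p * cc p * a p)" "integrable (M2 mu) (%p. f p * cc p * b p)"
   by (auto intro!: finb_integrable[OF finb_M1[OF P]] finb_integrable[OF finb_M2[OF P]])
 qed
 have nn: "f p * cc p * a p >= 0" "f p * cc p * b p >= 0" for p using f cc_nonneg ab by auto
 have "ennreal (LINT p|Th mu. f p) = nint (Th mu) f" using Th_int[OF P] f by (intro nn_integral_eq_integral[symmetric]) auto
 also have "... <= nn_integral (M1 mu) (%p. ennreal (f p) * ennreal (cc p * a p)) + nn_integral (M2 mu) (%p. ennreal (f p) * ennreal (cc p * b p))"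
  by (rule nn_Th_le[OF P _ _ _ adm]) auto
 also have "... = nint (M1 mu) (%p. f p * cc p * a p) + nint (M2 mu) (%p. f p * cc p * b p)"
  using f cc_nonneg ab by (simp add: ennreal_mult mult.assoc)
 also have "... = ennreal ((LINT p|M1 mu. f p * cc p * a p) + (LINT p|M2 mu. f p * cc p * b p))" using i nn by (auto simp: nn_integral_eq_integral)
 finally show ?thesis using nn by (subst (asm) ennreal_le_iff) (auto)
qed

section \<open>The weighted measure\<close>

lemma finb_bounded_integrable:
 assumes "finb M" "f : bm borel" "!!x. 0 <= f x" "!!x. f x <= (B::real)"
 shows "integrable M f" using assms by (intro finb_integrable) auto

definition cfield :: "('a * 'a => real) => ('a * 'a => real) => real => bool" where
 "cfield a b m \<longleftrightarrow> (ALL p. adm (a p) (b p)) & (ALL p. a p <= m) & (ALL p. b p <= m)"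

lemma cfieldD:
 assumes "cfield a b m"
 shows "adm (a p) (b p)" "a p <= m" "b p <= m" "0 <= a p" "0 <= b p"
proof -
 show *: "adm (a p) (b p)" "a p <= m" "b p <= m" using assms unfolding cfield_def by blast+
 show "0 <= a p" "0 <= b p" by (rule admD[OF *(1)], rule admD[OF *(1)])
qed

lemma cfield_dist:
 assumes "cfield a b m" "cfield a' b' m'"
 shows "abs (a p - a' p) + abs (b p - b' p) <= 2 * (m + m')"
proof -
 note c = cfieldD[OF assms(1), of p] cfieldD[OF assms(2), of p]
 have "abs (a p - a' p) <= m + m'" "abs (b p - b' p) <= m + m'" by (rule abs_leI; use c in linarith)+
 from add_mono[OF this] show ?thesis by simp
qed

text \<open>The pointwise best choice among finitely many majorants is only a Borel field, while
  weak convergence acts on continuous coefficients; this class connects the two. The approximating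
  fields have to be admissible themselves, not merely close.\<close>

definition approxable :: "('a * 'a) measure => ('a * 'a => real) => ('a * 'a => real) => bool" where
 "approxable L a b \<longleftrightarrow> a : bm borel & b : bm borel & (EX m. cfield a b m) &
  (ALL e>0. EX a' b' m. cts a' & cts b' & cfield a' b' m &
   (LINT p|L. abs (a p - a' p) + abs (b p - b' p)) < e)"

lemma approxable_const: assumes "adm x y" shows "approxable L (%_. x) (%_. y)"
proof -
 have cf: "cfield (%_. x) (%_. y) (max x y)" using assms by (simp add: cfield_def)
 show ?thesis unfolding approxable_def
 proof (intro conjI allI impI)
  fix e :: real assume "e > 0"
  thus "EX a' b' m. cts a' & cts b' & cfield a' b' m &
   (LINT p|L. abs (x - a' p) + abs (y - b' p)) < e" using cf by (intro exI[of _ "%_. x"] exI[of _ "%_. y"] exI) simp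
 qed (use cf in \<open>simp, simp, blast\<close>)
qed

text \<open>Admissible pairs form a convex set: a continuous \<open>f\<close> close to the indicator
  of \<open>B\<close> interpolates between the constant pair and the approximation of the old field
  without leaving that set.\<close>

lemma approxable_glue:
 assumes L: "finb L" and ap: "approxable L a b" and xy: "adm x y" and B [measurable]: "B : sets borel"
 shows "approxable L (%p. if p : B then x else a p) (%p. if p : B then y else b p)"
proof -
 have [measurable]: "a : bm borel" "b : bm borel" using ap by (auto simp: approxable_def)
 obtain m where m: "cfield a b m" using ap by (auto simp: approxable_def)
 have xy0: "x >= 0" "y >= 0" using xy by (auto simp: adm_def)
 have cf0: "cfield (%p. if p : B then x else a p) (%p. if p : B then y else b p) (max m (max x y))" unfolding cfield_def
 proof (intro conjI allI)
  fix p
  show "adm (if p : B then x else a p) (if p : B then y else b p)" using cfieldD[OF m] xy by simp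
  show "(if p : B then x else a p) <= max m (max x y)" "(if p : B then y else b p) <= max m (max x y)"
   using cfieldD[OF m] by (simp_all add: le_max_iff_disj)
 qed
 have appr: "EX a' b' m. cts a' & cts b' & cfield a' b' m &
   (LINT p|L. abs ((if p : B then x else a p) - a' p) + abs ((if p : B then y else b p) - b' p)) < e" if e: "e > 0" for e
 proof -
  obtain a' b' m' where ab: "cts a'" "cts b'" "cfield a' b' m'"
   "(LINT p|L. abs (a p - a' p) + abs (b p - b' p)) < e / 2"
  proof -
   have "e / 2 > 0" using e by simp
   thus ?thesis using ap that unfolding approxable_def by blast
  qed
  have [measurable]: "a' : bm borel" "b' : bm borel" using ab by (auto intro: cts_bm)
  define Q where "Q = abs m' + x + y + 1"
  have Q: "Q > 0" using xy0 by (simp add: Q_def)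
  have L': "finite_measure L" "sets L = sets borel" "e / (4 * Q) > 0" using L e Q by (simp_all add: finb_def)
  obtain f where f: "cts f" "!!p. 0 <= f p" "!!p. f p <= 1"
    "(LINT p|L. abs (f p - indicator B p)) < e / (4 * Q)" by (rule continuous_approx_indicator[OF L'(1,2) B L'(3)]) blast
  have [measurable]: "f : bm borel" using f by (auto intro: cts_bm)
  define c where "c p = f p * x + (1 - f p) * a' p" for p
  define d where "d p = f p * y + (1 - f p) * b' p" for p
  define X where "X = max x (max y m')"
  have X: "x <= X" "y <= X" "m' <= X" by (simp_all add: X_def)
  have bd: "f p * z + (1 - f p) * z' <= X" if "z <= X" "z' <= X" for p z z'
  proof -
   have "f p * z + (1 - f p) * z' <= f p * X + (1 - f p) * X" using f that by (intro add_mono mult_left_mono) simp_all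
   thus ?thesis by (simp add: algebra_simps)
  qed
  have cf: "cfield c d X" unfolding cfield_def c_def d_def
   using adm_convex[OF xy cfieldD(1)[OF ab(3)] f(2,3)] bd X order_trans[OF cfieldD(2)[OF ab(3)]]
    order_trans[OF cfieldD(3)[OF ab(3)]] by simp
  have cont: "cts c" "cts d" unfolding c_def d_def by (intro continuous_intros ab f)+
  have pt: "abs ((if p : B then z else u) - (f p * z + (1 - f p) * u')) <= abs (u - u') + Q * abs (f p - indicator B p)"
   if "0 <= u'" "u' <= m'" "0 <= z" "z <= x + y" for p z u u'
  proof -
   have zu: "abs (z - u') <= Q" using that unfolding Q_def by simp
   show ?thesis
   proof (cases "p : B")
    case True
    have "abs (z - (f p * z + (1 - f p) * u')) = abs ((1 - f p) * (z - u'))" by (simp add: algebra_simps)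
    also have "... = abs (z - u') * abs (f p - 1)" using f by (simp add: abs_mult)
    also have "... <= Q * abs (f p - 1)" using zu by (intro mult_right_mono) auto
    finally show ?thesis using True by simp
   next
    case False
    have "abs (u - (f p * z + (1 - f p) * u')) = abs ((u - u') + f p * (u' - z))" by (simp add: algebra_simps)
    also have "... <= abs (u - u') + abs (z - u') * abs (f p)" by (rule order_trans[OF abs_triangle_ineq]) (simp add: abs_mult abs_minus_commute)
    also have "... <= abs (u - u') + Q * abs (f p)" using zu by (intro add_left_mono mult_right_mono) auto
    finally show ?thesis using False by simp
   qed
  qed
  have i1: "integrable L (%p. abs (a p - a' p) + abs (b p - b' p))"
  proof (rule finb_bounded_integrable[OF L])
   show "abs (a p - a' p) + abs (b p - b' p) <= 2 * (m + m')" for p by (rule cfield_dist[OF m ab(3)])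
  qed auto
  have i2: "integrable L (%p. abs (f p - indicator B p))"
  proof (rule finb_bounded_integrable[OF L])
   show "abs (f p - indicator B p) <= 1" for p using f by (cases "p : B") auto
  qed auto
  have "(LINT p|L. abs ((if p : B then x else a p) - c p) + abs ((if p : B then y else b p) - d p))
    <= (LINT p|L. (abs (a p - a' p) + abs (b p - b' p)) + 2 * Q * abs (f p - indicator B p))"
  proof (rule integral_mono')
   show "integrable L (%p. (abs (a p - a' p) + abs (b p - b' p)) + 2 * Q * abs (f p - indicator B p))" by (intro Bint_add i1 integrable_mult_right i2)
   fix p
   have "abs ((if p : B then x else a p) - c p) <= abs (a p - a' p) + Q * abs (f p - indicator B p)"
    unfolding c_def by (rule pt) (use cfieldD[OF ab(3)] xy0 in auto)
   moreover have "abs ((if p : B then y else b p) - d p) <= abs (b p - b' p) + Q * abs (f p - indicator B p)"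
    unfolding d_def by (rule pt) (use cfieldD[OF ab(3)] xy0 in auto)
   ultimately show "abs ((if p : B then x else a p) - c p) + abs ((if p : B then y else b p) - d p)
    <= (abs (a p - a' p) + abs (b p - b' p)) + 2 * Q * abs (f p - indicator B p)" by linarith
   show "0 <= (abs (a p - a' p) + abs (b p - b' p)) + 2 * Q * abs (f p - indicator B p)" using Q by simp
  qed
  also have "... = (LINT p|L. abs (a p - a' p) + abs (b p - b' p)) + 2 * Q * (LINT p|L. abs (f p - indicator B p))" using i1 i2 by simp
  also have "... < e / 2 + 2 * Q * (e / (4 * Q))" using ab f(4) Q by (intro add_strict_mono mult_strict_left_mono) auto
  also have "... = e" using Q by simp
  finally show ?thesis using cf cont by auto
 qed
 show ?thesis unfolding approxable_def using cf0 appr by auto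
qed

text \<open>Induction over the majorants: a new one is glued in on the Borel set where it lies below
  the minimum found so far.\<close>

lemma approxable_list:
 assumes L: "finb L" and [measurable]: "s1 : bm borel" "s2 : bm borel"
 shows "(!!q. q : set qs ==> adm (fst q) (snd q)) ==>
  EX a b. approxable L a b & (ALL p. ALL q:set qs. a p * s1 p + b p * s2 p <= fst q * s1 p + snd q * s2 p)"
proof (induction qs)
 case Nil
 show ?case using approxable_const[OF adm_half] by auto
next
 case (Cons q qs)
 obtain a b where ab: "approxable L a b" "!!p q. q : set qs ==> a p * s1 p + b p * s2 p <= fst q * s1 p + snd q * s2 p"
  using Cons.IH Cons.prems by (metis list.set_intros)
 have [measurable]: "a : bm borel" "b : bm borel" using ab by (auto simp: approxable_def)
 define B where "B = {p : space borel. fst q * s1 p + snd q * s2 p <= a p * s1 p + b p * s2 p}"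
 have B: "B : sets borel" unfolding B_def by simp
 have "adm (fst q) (snd q)" using Cons.prems by simp
 from approxable_glue[OF L ab(1) this B] show ?case
 proof (intro exI conjI)
  show "ALL p. ALL q':set (q # qs). (if p : B then fst q else a p) * s1 p + (if p : B then snd q else b p) * s2 p
   <= fst q' * s1 p + snd q' * s2 p"
  proof (intro allI ballI)
   fix p q' assume "q' : set (q # qs)"
   thus "(if p : B then fst q else a p) * s1 p + (if p : B then snd q else b p) * s2 p
   <= fst q' * s1 p + snd q' * s2 p" using ab(2)[of q' p] by (auto simp: B_def)
  qed
 qed
qed

lemma cfield_weighted_bound:
 assumes "kdom f B" "cfield a b m"
 shows "abs (f p * cc p * a p) <= B * KC * m" "abs (f p * cc p * b p) <= B * KC * m"
proof -
 have BK: "B * KC >= 0" using kdomD[OF assms(1)] KC by simp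
 show "abs (f p * cc p * a p) <= B * KC * m" "abs (f p * cc p * b p) <= B * KC * m" unfolding abs_mult[of "f p * cc p"] using cfieldD[OF assms(2)]
  by (intro mult_mono kdom_cc[OF assms(1)] BK, auto)+
qed

text \<open>Converse of \<open>Th_le\<close> up to \<open>eps\<close>, with continuous coefficients.
  The minimum over a finite family of majorants is nearly theta, and replacing this Borel field by a
  continuous admissible one costs an error controlled in L^1.\<close>

lemma Th_cont_fields:
 assumes P: "mu : PM" and f: "kdom f B" "!!p. f p >= 0" and "eps > 0"
 obtains a b m where "cts a" "cts b" "cfield a b m"
  "(LINT p|M1 mu. f p * cc p * a p) + (LINT p|M2 mu. f p * cc p * b p) <= (LINT p|Th mu. f p) + eps"
proof -
 note [measurable] = r12'(1,2,7)[OF P] kdomD(1)[OF f(1)]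
 define V where "V = B * KC"
 have V: "V >= 0" using kdomD[OF f(1)] KC by (simp add: V_def)
 have w: "0 <= f p * cc p" "f p * cc p <= V" for p using f cc_nonneg kdom_cc[OF f(1)] by (auto simp: V_def)
 \<comment> \<open>The weight \<open>f * cc\<close> is at most \<open>V\<close>, and the densities
   \<open>r1\<close> and \<open>r2\<close> integrate to at most 1 each, so the error
   \<open>e1 * (r1 + r2)\<close> costs at most \<open>2 * e1 * V\<close>.\<close>
 define e1 where "e1 = eps / (4 * (V + 1))"
 have e1: "e1 > 0" "2 * e1 * V <= eps / 2" using V `eps > 0` by (auto simp: e1_def field_simps)
 obtain F where F: "finite F" "!!a b. (a, b) : F ==> adm a b"
  "!!s t. s >= 0 ==> t >= 0 ==> EX (a, b):F. a * s + b * t <= theta s t + e1 * (s + t)" by (rule adm_finite_approx[OF e1(1)]) blast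
 obtain qs where qs: "set qs = F" using finite_list[OF F(1)] by auto
 obtain a b where ab: "approxable (Lam mu) a b"
  "!!p q. q : F ==> a p * r1 mu p + b p * r2 mu p <= fst q * r1 mu p + snd q * r2 mu p"
 proof -
  have "!!q. q : set qs ==> adm (fst q) (snd q)" using F qs by simp
  from approxable_list[OF finb_Lam[OF P] r12'(1,2)[OF P] this] show ?thesis using that qs by blast
 qed
 have le: "a p * r1 mu p + b p * r2 mu p <= theta (r1 mu p) (r2 mu p) + e1 * (r1 mu p + r2 mu p)" for p
 proof -
  obtain q where "q : F" "fst q * r1 mu p + snd q * r2 mu p <= theta (r1 mu p) (r2 mu p) + e1 * (r1 mu p + r2 mu p)"
   using F(3)[OF r12'(3)[OF P, of p] r12'(4)[OF P, of p]] by auto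
  thus ?thesis using ab(2)[of q p] by simp
 qed
 obtain m where m: "cfield a b m" and [measurable]: "a : bm borel" "b : bm borel" using ab unfolding approxable_def by auto
 note abn = cfieldD(4,5)[OF m]
 have mass: "emeasure (M1 mu) (space (M1 mu)) <= 1" "emeasure (M2 mu) (space (M2 mu)) <= 1"
  using subprob_space.emeasure_space_le_1[OF subprob_M1[OF P]] subprob_space.emeasure_space_le_1[OF subprob_M2[OF P]] by auto
 have i1: "integrable (M1 mu) (%p. f p * cc p * a p)" "integrable (M2 mu) (%p. f p * cc p * b p)" using cfield_weighted_bound[OF f(1) m]
  by (auto intro!: finb_integrable[OF finb_M1[OF P]] finb_integrable[OF finb_M2[OF P]])
 have n1: "f p * cc p * a p >= 0" "f p * cc p * b p >= 0" for p using w abn by auto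
 have "ennreal ((LINT p|M1 mu. f p * cc p * a p) + (LINT p|M2 mu. f p * cc p * b p))
   = nint (M1 mu) (%p. f p * cc p * a p) + nint (M2 mu) (%p. f p * cc p * b p)" using i1 n1 by (auto simp: nn_integral_eq_integral)
 also have "... = nn_integral (Lam mu) (%p. ennreal (r1 mu p) * ennreal (f p * cc p * a p))
   + nn_integral (Lam mu) (%p. ennreal (r2 mu p) * ennreal (f p * cc p * b p))"
  by (rule arg_cong2[where f="(+)"], rule nn_integral_M_dens(1)[OF P], measurable)
   (rule nn_integral_M_dens(2)[OF P], measurable)
 also have "... = nn_integral (Lam mu) (%p. ennreal (r1 mu p) * ennreal (f p * cc p * a p) + ennreal (r2 mu p) * ennreal (f p * cc p * b p))"
  by (rule nn_integral_add[symmetric]) (auto intro!: Lam_bm[OF P])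
 also have "... <= nn_integral (Lam mu) (%p. ennreal (theta (r1 mu p) (r2 mu p) * cc p) * ennreal (f p)
   + (ennreal (r1 mu p) * ennreal (e1 * V) + ennreal (r2 mu p) * ennreal (e1 * V)))"
 proof (rule nn_integral_mono)
  fix p
  note rn = r12'(3)[OF P, of p] r12'(4)[OF P, of p]
  have tn: "theta (r1 mu p) (r2 mu p) >= 0" using rn by (intro th_nonneg)
  have "r1 mu p * (f p * cc p * a p) + r2 mu p * (f p * cc p * b p) = (f p * cc p) * (a p * r1 mu p + b p * r2 mu p)" by (simp add: algebra_simps)
  also have "... <= (f p * cc p) * (theta (r1 mu p) (r2 mu p) + e1 * (r1 mu p + r2 mu p))" using w by (intro mult_left_mono le)
  also have "... = (theta (r1 mu p) (r2 mu p) * cc p) * f p + (f p * cc p) * (e1 * (r1 mu p + r2 mu p))" by (simp add: algebra_simps)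
  also have "... <= (theta (r1 mu p) (r2 mu p) * cc p) * f p + V * (e1 * (r1 mu p + r2 mu p))"
   using w e1 rn by (intro add_left_mono mult_right_mono) auto
  also have "... = (theta (r1 mu p) (r2 mu p) * cc p) * f p + (r1 mu p * (e1 * V) + r2 mu p * (e1 * V))" by (simp add: algebra_simps)
  finally have "ennreal (r1 mu p * (f p * cc p * a p) + r2 mu p * (f p * cc p * b p)) <=
   ennreal ((theta (r1 mu p) (r2 mu p) * cc p) * f p + (r1 mu p * (e1 * V) + r2 mu p * (e1 * V)))" by (rule ennreal_leI)
  moreover have "ennreal (r1 mu p * (f p * cc p * a p) + r2 mu p * (f p * cc p * b p))
   = ennreal (r1 mu p) * ennreal (f p * cc p * a p) + ennreal (r2 mu p) * ennreal (f p * cc p * b p)"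
   using rn n1 by (subst ennreal_plus) (auto simp only: ennreal_mult mult_nonneg_nonneg)
  moreover have "ennreal ((theta (r1 mu p) (r2 mu p) * cc p) * f p + (r1 mu p * (e1 * V) + r2 mu p * (e1 * V)))
   = ennreal (theta (r1 mu p) (r2 mu p) * cc p) * ennreal (f p) + (ennreal (r1 mu p) * ennreal (e1 * V) + ennreal (r2 mu p) * ennreal (e1 * V))"
  proof -
   show ?thesis using tn cc_nonneg f e1 V using rn by (simp only: ennreal_plus ennreal_mult mult_nonneg_nonneg add_nonneg_nonneg)
  qed
  ultimately show "ennreal (r1 mu p) * ennreal (f p * cc p * a p) + ennreal (r2 mu p) * ennreal (f p * cc p * b p)
   <= ennreal (theta (r1 mu p) (r2 mu p) * cc p) * ennreal (f p) + (ennreal (r1 mu p) * ennreal (e1 * V) + ennreal (r2 mu p) * ennreal (e1 * V))"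
   by simp
 qed
 also have "... = nn_integral (Lam mu) (%p. ennreal (theta (r1 mu p) (r2 mu p) * cc p) * ennreal (f p))
   + (nn_integral (Lam mu) (%p. ennreal (r1 mu p) * ennreal (e1 * V)) + nn_integral (Lam mu) (%p. ennreal (r2 mu p) * ennreal (e1 * V)))"
  by (subst nn_integral_add, (intro Lam_bm[OF P]; measurable), (intro Lam_bm[OF P]; measurable),
    subst nn_integral_add, (intro Lam_bm[OF P]; measurable), (intro Lam_bm[OF P]; measurable), rule)
 also have "... = nint (Th mu) f + (nint (M1 mu) (%p. e1 * V) + nint (M2 mu) (%p. e1 * V))"
  by (rule arg_cong2[where f="(+)"], rule nn_integral_Th[OF P, symmetric], measurable)
   (rule arg_cong2[where f="(+)"], rule nn_integral_M_dens[OF P, symmetric], measurable,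
   rule nn_integral_M_dens[OF P, symmetric], measurable)
 also have "... <= ennreal (LINT p|Th mu. f p) + (ennreal (e1 * V) + ennreal (e1 * V))" using mult_left_mono[OF mass(1)] mult_left_mono[OF mass(2)]
   nn_integral_eq_integral[OF Th_int(1)[OF P]] f by (intro add_mono) auto
 also have "... = ennreal ((LINT p|Th mu. f p) + 2 * e1 * V)" using e1 V f by (simp add: ennreal_plus[symmetric] del: ennreal_plus)
 finally have A: "(LINT p|M1 mu. f p * cc p * a p) + (LINT p|M2 mu. f p * cc p * b p) <= (LINT p|Th mu. f p) + 2 * e1 * V"
  using e1 V f by (subst (asm) ennreal_le_iff) (auto)
 obtain a' b' m' where ab': "cts a'" "cts b'" "cfield a' b' m'"
  "(LINT p|Lam mu. abs (a p - a' p) + abs (b p - b' p)) < eps / (2 * (V + 1))"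
 proof -
  have "eps / (2 * (V + 1)) > 0" using `eps > 0` V by simp
  thus ?thesis using ab that unfolding approxable_def by blast
 qed
 have [measurable]: "a' : bm borel" "b' : bm borel" using ab' by (auto intro: cts_bm)
 let ?h = "%p. abs (a p - a' p) + abs (b p - b' p)"
 have hb: "?h p <= 2 * (m + m')" for p by (rule cfield_dist[OF m ab'(3)])
 have ih: "integrable (M1 mu) ?h" "integrable (M2 mu) ?h" by (rule finb_bounded_integrable[OF _ _ _ hb]; use finb_M1[OF P] finb_M2[OF P] in auto)+
 have Leq: "(LINT p|Lam mu. ?h p) = (LINT p|M1 mu. ?h p) + (LINT p|M2 mu. ?h p)"
  unfolding Lam_def by (rule integral_summ) (use ih sets_M1[OF P] in auto)
 have i2: "integrable (M1 mu) (%p. f p * cc p * a' p)" "integrable (M2 mu) (%p. f p * cc p * b' p)" using cfield_weighted_bound[OF f(1) ab'(3)]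
  by (auto intro!: finb_integrable[OF finb_M1[OF P]] finb_integrable[OF finb_M2[OF P]])
 have step: "f p * cc p * z' <= f p * cc p * z + V * ?h p" if "abs (z - z') <= ?h p" for z z' p
 proof -
  have "f p * cc p * z' - f p * cc p * z = f p * cc p * (z' - z)" by (simp add: algebra_simps)
  also have "... <= (f p * cc p) * abs (z - z')" using w by (intro mult_left_mono) auto
  also have "... <= V * ?h p" using w V that by (intro mult_mono) auto
  finally show ?thesis by simp
 qed
 have "(LINT p|M1 mu. f p * cc p * a' p) <= (LINT p|M1 mu. f p * cc p * a p + V * ?h p)"
  by (intro integral_mono i2 Bint_add integrable_mult_right ih i1 step) auto
 also have "... = (LINT p|M1 mu. f p * cc p * a p) + V * (LINT p|M1 mu. ?h p)"
  by (subst Bochner_Integration.integral_add[OF i1(1) integrable_mult_right[OF ih(1)]]) simp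
 finally have s1: "(LINT p|M1 mu. f p * cc p * a' p) <= (LINT p|M1 mu. f p * cc p * a p) + V * (LINT p|M1 mu. ?h p)" .
 have "(LINT p|M2 mu. f p * cc p * b' p) <= (LINT p|M2 mu. f p * cc p * b p + V * ?h p)"
  by (intro integral_mono i2 Bint_add integrable_mult_right ih i1 step) auto
 also have "... = (LINT p|M2 mu. f p * cc p * b p) + V * (LINT p|M2 mu. ?h p)"
  by (subst Bochner_Integration.integral_add[OF i1(2) integrable_mult_right[OF ih(2)]]) simp
 finally have s2: "(LINT p|M2 mu. f p * cc p * b' p) <= (LINT p|M2 mu. f p * cc p * b p) + V * (LINT p|M2 mu. ?h p)" .
 have "V * (LINT p|Lam mu. ?h p) <= (V + 1) * (eps / (2 * (V + 1)))" using V ab' by (intro mult_mono) (auto)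
 also have "... = eps / 2" using V by (simp add: field_simps)
 finally have s3: "V * (LINT p|Lam mu. ?h p) <= eps / 2" .
 have s4: "V * (LINT p|Lam mu. ?h p) = V * (LINT p|M1 mu. ?h p) + V * (LINT p|M2 mu. ?h p)" by (simp only: Leq distrib_left)
 have "(LINT p|M1 mu. f p * cc p * a' p) + (LINT p|M2 mu. f p * cc p * b' p) <= (LINT p|Th mu. f p) + eps" using s1 s2 s3 s4 A e1 by linarith
 thus ?thesis by (rule that[OF ab'(1-3)])
qed

lemma cc_isCont: "p ~: diag ==> isCont cc p"
proof -
 assume p: "p ~: diag"
 have "kk (fst p) (snd p) > 0" using p by (intro kk_pos) (simp add: diag_def)
 moreover have "isCont (%p. kk (fst p) (snd p)) p" unfolding kk_def by (intro continuous_intros)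
 ultimately show ?thesis by (simp add: cc_def[abs_def])

qed

text \<open>Continuous coefficients that are nearly optimal for the limit are admissible for every
  \<open>mu i\<close>, and the bounds they give converge. The weight \<open>cc\<close> is
  discontinuous on the diagonal only, which the limit measures do not charge.\<close>

lemma Th_usc:
 assumes mu: "eventually (%i. mu i : PM) F" and P: "mu' : PM" and wc: "wconv mu mu' F"
  and f: "kdom f B" "!!p. f p >= 0" "cts f" and "eps > 0"
 shows "eventually (%i. (LINT p|Th (mu i). f p) < (LINT p|Th mu'. f p) + eps) F"
proof -
 obtain a b m where ab: "cts a" "cts b" "cfield a b m"
  "(LINT p|M1 mu'. f p * cc p * a p) + (LINT p|M2 mu'. f p * cc p * b p) <= (LINT p|Th mu'. f p) + eps/2"
  using Th_cont_fields[OF P f(1,2), of "eps/2"] `eps > 0` by auto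
 have [measurable]: "a : bm borel" "b : bm borel" "f : bm borel" using ab f by (auto intro: cts_bm)
 have ic: "isCont (%p. f p * cc p * a p) p" "isCont (%p. f p * cc p * b p) p" if "p ~: diag" for p
 proof -
  have "isCont a p" "isCont b p" "isCont f p" using ab f by (metis UNIV_I continuous_on_eq_continuous_at open_UNIV)+
  note c = this cc_isCont[OF that]
  show "isCont (%p. f p * cc p * a p) p" "isCont (%p. f p * cc p * b p) p" by (intro continuous_mult c)+
 qed
 have ne: "diag ~= {}" unfolding diag_def by auto
 have d0: "measure (M1 mu') diag = 0" "measure (M2 mu') diag = 0" using M1_diag[OF P] M2_diag[OF P] by (simp_all add: measure_def)
 have "((%i. LINT p|M1 (mu i). f p * cc p * a p) ---> (LINT p|M1 mu'. f p * cc p * a p)) F"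
 proof (rule wconv_null_discont[OF wconv_M1[OF mu P wc] _ finb_M1[OF P] closed_diag ne d0(1)])
  show "eventually (%i. finb (M1 (mu i))) F" using mu by eventually_elim (rule finb_M1)
  show "abs (f p * cc p * a p) <= B * KC * m" for p by (rule cfield_weighted_bound[OF f(1) ab(3)])
 qed (measurable, rule ic(1))
 moreover have "((%i. LINT p|M2 (mu i). f p * cc p * b p) ---> (LINT p|M2 mu'. f p * cc p * b p)) F"
 proof (rule wconv_null_discont[OF wconv_M2[OF mu P wc] _ finb_M2[OF P] closed_diag ne d0(2)])
  show "eventually (%i. finb (M2 (mu i))) F" using mu by eventually_elim (rule finb_M2)
  show "abs (f p * cc p * b p) <= B * KC * m" for p by (rule cfield_weighted_bound[OF f(1) ab(3)])
 qed (measurable, rule ic(2))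
 ultimately have "((%i. (LINT p|M1 (mu i). f p * cc p * a p) + (LINT p|M2 (mu i). f p * cc p * b p)) --->
  (LINT p|M1 mu'. f p * cc p * a p) + (LINT p|M2 mu'. f p * cc p * b p)) F" by (rule tendsto_add)
 hence "eventually (%i. (LINT p|M1 (mu i). f p * cc p * a p) + (LINT p|M2 (mu i). f p * cc p * b p) < (LINT p|Th mu'. f p) + eps) F"
  using ab `eps > 0` by (intro order_tendstoD) auto
 with mu show ?thesis
 proof eventually_elim
  case (elim i)
  have "(LINT p|Th (mu i). f p) <= (LINT p|M1 (mu i). f p * cc p * a p) + (LINT p|M2 (mu i). f p * cc p * b p)"
   by (rule Th_le[OF elim(1) f(1,2)]) (use cfieldD[OF ab(3)] in auto)
  thus ?case using elim by simp
 qed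
qed

section \<open>Tightness\<close>

definition dif :: "('a => real) => 'a * 'a => real" where "dif phi p = phi (snd p) - phi (fst p)"

lemma dif_continuous: "cts phi ==> cts (dif phi)"
 unfolding dif_def by (intro continuous_intros; rule continuous_on_compose2[of UNIV phi]) (auto intro: continuous_intros)

lemma dif_bm: "Ccs phi ==> dif phi : bm borel" by (intro cts_bm dif_continuous Ccs_continuous)

lemma dif_bound:
 assumes "Ccs phi"
 obtains C where "C >= 0" "!!p. abs (dif phi p) <= C * min 1 (norm (fst p - snd p))" using Ccs_bounds[OF assms] unfolding dif_def by metis

lemma kdom_prod:
 assumes "f : bm borel" "g : bm borel" "C >= 0" "D >= 0"
  "!!p. abs (f p) <= C * min 1 (norm (fst p - snd p))" "!!p. abs (g p) <= D * min 1 (norm (fst p - snd p))"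
 shows "kdom (%p. f p * g p) (C * D)" unfolding kdom_def
proof (intro conjI allI)
 fix p
 have "abs (f p * g p) <= (C * min 1 (norm (fst p - snd p))) * (D * min 1 (norm (fst p - snd p)))"
  unfolding abs_mult using assms(3-) by (intro mult_mono) auto
 also have "... = C * D * (min 1 (norm (fst p - snd p)))^2" by (simp add: power2_eq_square)
 finally show "abs (f p * g p) <= C * D * kk (fst p) (snd p)" by (simp only: kk_eq)
qed (use assms in auto)

lemma kdom_dif2:
 assumes "Ccs phi" "Ccs psi"
 obtains B where "kdom (%p. dif phi p * dif psi p) B"
proof -
 obtain C where C: "C >= 0" "!!p. abs (dif phi p) <= C * min 1 (norm (fst p - snd p))" by (rule dif_bound[OF assms(1)]) blast
 obtain D where D: "D >= 0" "!!p. abs (dif psi p) <= D * min 1 (norm (fst p - snd p))" by (rule dif_bound[OF assms(2)]) blast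
 show ?thesis by (rule that[OF kdom_prod[OF dif_bm[OF assms(1)] dif_bm[OF assms(2)] C(1) D(1) C(2) D(2)]])
qed

text \<open>The squared gradient norm at \<open>mu\<close>, that is, the metric tensor on the
  cotangent side. The squared difference is dominated by \<open>kk\<close>, hence the value is
  finite for every probability measure.\<close>

definition Gam :: "'a measure => ('a => real) => real" where
 "Gam mu phi = (LINT p|Th mu. (dif phi p)^2)"

lemma Gam_nonneg: "Gam mu phi >= 0" unfolding Gam_def by simp

lemma Gam_zero: "Gam mu (%x. 0) = 0" by (simp add: Gam_def dif_def)

lemma Gam_cmult: "Gam mu (%x. c * phi x) = c^2 * Gam mu phi"
proof -
 have "(dif (%x. c * phi x) p)^2 = c^2 * (dif phi p)^2" for p by (simp add: dif_def power_mult_distrib[symmetric] right_diff_distrib)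
 thus ?thesis by (simp add: Gam_def)
qed

lemma Gam_bounded:
 assumes "Ccs phi"
 obtains B where "B >= 0" "!!mu. mu : PM ==> Gam mu phi <= B"
proof -
 obtain B where B: "kdom (%p. dif phi p * dif phi p) B" by (rule kdom_dif2[OF assms assms])
 show ?thesis
 proof (rule that[of "B * KC"])
  show "B * KC >= 0" using kdomD[OF B] KC by simp
  show "Gam mu phi <= B * KC" if "mu : PM" for mu using Th_int[OF that B] by (simp add: Gam_def power2_eq_square)
 qed
qed

lemma Gam_usc:
 assumes "eventually (%i. mu i : PM) F" "mu' : PM" "wconv mu mu' F"
  and phi: "Ccs phi" and "eps > 0"
 shows "eventually (%i. Gam (mu i) phi < Gam mu' phi + eps) F"
proof -
 obtain B where B: "kdom (%p. dif phi p * dif phi p) B" by (rule kdom_dif2[OF phi phi])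
 have c: "cts (%p. dif phi p * dif phi p)" by (intro continuous_on_mult dif_continuous Ccs_continuous phi)
 show ?thesis using Th_usc[OF assms(1-3) B _ c `eps > 0`] by (simp add: Gam_def power2_eq_square)
qed

text \<open>Uniform tightness of the kernel on a ball: the sets \<open>U n\<close> of points whose
  tail beyond a given cutoff is small are open by weak continuity of \<open>K\<close>, and finitely
  many of them cover the compact ball.\<close>

lemma K_tail:
 assumes "e > 0"
 obtains R' where "!!x. norm x <= R ==> measure (K x) {y. norm y >= R'} <= e"
proof -
 define U where "U n = {x. measure (K x) UNIV - (LINT y|K x. cutoff (real (Suc n)) y) < e}" for n
 have ca: "cts (cutoff (real (Suc n)) :: 'a => real)" for n by (intro Ccs_continuous Ccs_cutoff) simp
 have br: "bounded (range (cutoff (real (Suc n)) :: 'a => real))" for n unfolding bdd_iff by (rule exI[of _ 1]) (simp add: cutoff_bounds)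
 have "cts (%x. \<integral>y. 1 \<partial>K x :: real)" by (rule continuous_K) auto
 hence cm: "cts (%x. measure (K x) UNIV)" by simp
 have Uo: "open (U n)" for n unfolding U_def by (intro open_Collect_less continuous_intros cm continuous_K ca br)
 have cov: "cball 0 R <= (UN n:UNIV. U n)"
 proof
  fix x :: 'a
  have "eventually (%n. (LINT y|K x. cutoff (real (Suc n)) y) > measure (K x) UNIV - e) sequentially"
   using cutoff_integral_tendsto[OF finb_K] `e > 0` by (intro order_tendstoD) auto
  from eventually_happens[OF this] obtain n where "(LINT y|K x. cutoff (real (Suc n)) y) > measure (K x) UNIV - e" by auto
  hence "x : U n" by (simp add: U_def)
  thus "x : (UN n:UNIV. U n)" by auto
 qed
 obtain N where N: "finite N" "cball 0 R <= (UN n:N. U n)" by (rule compactE_image[OF compact_cball Uo cov])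
 define m where "m = Max N"
 have m: "n <= m" if "n : N" for n unfolding m_def using N that by simp
 show ?thesis
 proof (rule that[of "2 * real (Suc m)"])
  fix x :: 'a assume "norm x <= R"
  then obtain n where n: "n : N" "x : U n" using N by auto
  interpret subprob_space "K x" by (rule subprob_K)
  have Sm: "{y::'a. norm y >= 2 * real (Suc m)} : sets borel" by simp
  have ic: "integrable (K x) (cutoff (real (Suc n)))" by (rule finb_integrable[OF finb_K cts_bm[OF ca], of _ 1])
    (simp add: cutoff_bounds)
  let ?X = "{y. norm y >= 2 * real (Suc m)}"
  have "measure (K x) ?X = (LINT y|K x. indicator ?X y)" by simp
  also have "... <= (LINT y|K x. 1 - cutoff (real (Suc n)) y)"
  proof (rule integral_mono)
   show "integrable (K x) (indicator ?X :: 'a => real)"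
    by (rule finb_integrable[OF finb_K borel_measurable_indicator[OF Sm], where B=1]) (simp)
   show "integrable (K x) (%y. 1 - cutoff (real (Suc n)) y)" using ic by simp
   fix y :: 'a
   have "cutoff (real (Suc n)) y = 0" if "norm y >= 2 * real (Suc m)" using that m[OF n(1)] by (intro cutoff_eq_0) auto
   thus "indicator ?X y <= 1 - cutoff (real (Suc n)) y" using cutoff_bounds by force
  qed
  also have "... = measure (K x) UNIV - (LINT y|K x. cutoff (real (Suc n)) y)" using ic by simp
  also have "... <= e" using n by (simp add: U_def)
  finally show "measure (K x) ?X <= e" .
 qed
qed

lemma integral_affine_indicator:
 fixes c d :: real
 assumes "finb M" "S : sets borel"
 shows "(LINT p|M. c * indicator S p + d) = c * measure M S + d * measure M UNIV"
proof -
 interpret finite_measure M using assms by (simp add: finb_def)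
 show ?thesis using assms by (simp add: finb_def finb_space less_top[ symmetric])

qed

definition long_jump :: "real => real => ('a * 'a) set" where
 "long_jump R R' = {p. norm (fst p) <= R & norm (snd p) >= R'}"

lemma long_jump_sets [measurable]: "long_jump R R' : sets borel"
proof -
 have "closed (long_jump R R')" unfolding long_jump_def by (intro closed_Collect_conj closed_Collect_le continuous_intros)
 thus ?thesis by simp
qed

lemma long_jump_kk:
 assumes "p : long_jump R R' | prod.swap p : long_jump R R'" "R' >= R + 1"
 shows "kk (fst p) (snd p) = 1"
proof -
 have "1 <= (norm (fst p - snd p))^2"
  using assms norm_triangle_ineq2[of "fst p" "snd p"] norm_triangle_ineq2[of "snd p" "fst p"] by (auto simp: long_jump_def norm_minus_commute)
 thus ?thesis by (simp add: kk_def)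
qed

text \<open>Weights \<open>(A, kappa)\<close> with small \<open>kappa\<close> exploit that \<open>theta\<close> is small as soon as one of the two
 densities is; this bounds jumps that connect a ball with the complement of a much larger one.\<close>

lemma Th_long_jump:
 assumes P: "mu : PM" and A: "adm A kappa" and R: "R' >= R + 1"
  and e: "!!x. norm x <= R ==> measure (K x) {y. norm y >= R'} <= e" "e >= 0"
 defines "S \<equiv> long_jump R R' Un prod.swap -` long_jump R R'"
 shows "kdom (indicator S) 1" "(LINT p|Th mu. indicator S p) <= KC * (2 * A * e + 2 * kappa)"
proof -
 let ?L = "long_jump R R'"
 have [measurable]: "prod.swap -` ?L : sets (borel :: ('a * 'a) measure)" using measurable_sets[OF measurable_swap] by simp
 have Sm [measurable]: "S : sets borel" unfolding S_def by simp
 have kS: "kk (fst p) (snd p) = 1" if "p : S" for p using that R unfolding S_def by (intro long_jump_kk) auto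
 have "abs (indicator S p) <= 1 * kk (fst p) (snd p)" for p using kS[of p] kk_bounds by force
 thus kd: "kdom (indicator S) 1" unfolding kdom_def by simp
 have cS: "cc p = KC" if "p : S" for p using kS[OF that] by (simp add: cc_def)
 \<comment> \<open>On \<open>S\<close> the large coefficient \<open>A\<close> meets
   \<open>M1\<close> only on \<open>long_jump R R'\<close> and \<open>M2\<close> only on its mirror
   image, each of mass at most \<open>e\<close>. Elsewhere the coefficient is \<open>kappa\<close>
   and the mass at most 1.\<close>
 define a where "a p = (if norm (fst p) <= R then A else kappa)" for p :: "'a * 'a"
 define b where "b p = (if norm (fst p) <= R then kappa else A)" for p :: "'a * 'a"
 have A0: "A >= 0" "kappa >= 0" using A by (auto simp: adm_def)
 have [measurable]: "(%p::'a * 'a. norm (fst p)) : bm borel" by (intro cts_bm continuous_intros)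
 have [measurable]: "a : bm borel" "b : bm borel" unfolding a_def b_def by auto
 have adm: "adm (a p) (b p)" for p unfolding a_def b_def using A adm_swap by auto
 let ?X = "LINT p|M1 mu. indicator S p * cc p * a p"
 let ?Y = "LINT p|M2 mu. indicator S p * cc p * b p"
 have le: "(LINT p|Th mu. indicator S p) <= ?X + ?Y"
  by (rule Th_le[OF P kd, of a b "max A kappa"]) (auto simp: adm, auto simp: a_def b_def)
 have mL: "measure (M1 mu) ?L <= e"
 proof -
  have "measure (M1 mu) ?L = (LINT p|M1 mu. indicator ?L p)" using finb_space[OF finb_M1[OF P]] by simp
  also have "... = (\<integral>x. \<integral>y. indicator ?L (x, y) \<partial>K x \<partial>mu)" by (rule integral_M1[OF P]) (auto)
  also have "... <= (LINT x|mu. e)"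
  proof (rule integral_mono')
   fix x
   have "(LINT y|K x. indicator ?L (x, y)) = (LINT y|K x. (if norm x <= R then indicator {y. norm y >= R'} y else 0))"
    by (intro Bint_cong) (auto simp: long_jump_def indicator_def)
   also have "... <= e"
   proof (cases "norm x <= R")
    case True
    thus ?thesis using e by simp
   qed (use e(2) in simp)
   finally show "(LINT y|K x. indicator ?L (x, y)) <= e" .
  qed (use e PMD[OF P] in \<open>auto intro!: finite_measure.integrable_const\<close>)
  also have "... = e" using prob_space.prob_space[OF PMD(3)[OF P]] by simp
  finally show ?thesis .
 qed
 have mass: "measure (M1 mu) UNIV <= 1" "measure (M2 mu) UNIV <= 1"
  using subprob_space.subprob_measure_le_1[OF subprob_M1[OF P]] subprob_space.subprob_measure_le_1[OF subprob_M2[OF P]] by auto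
 let ?Z = "prod.swap -` ?L"
 have i1: "integrable (M1 mu) (%p. KC * A * indicator ?L p + KC * kappa)"
  "integrable (M2 mu) (%p. KC * A * indicator ?Z p + KC * kappa)"
  using A0 KC by (auto intro!: finb_bounded_integrable[OF finb_M1[OF P]]
   finb_bounded_integrable[OF finb_M2[OF P]] simp: indicator_def)
 have KA: "0 <= KC * A" "0 <= KC * kappa" using A0 KC by auto
 have "?X <= (LINT p|M1 mu. KC * A * indicator ?L p + KC * kappa)"
 proof (rule integral_mono'[OF i1(1)])
  fix p
  show "indicator S p * cc p * a p <= KC * A * indicator ?L p + KC * kappa"
  proof (cases "p : S")
   case True
   show ?thesis
   proof (cases "p : ?L")
    case True
    thus ?thesis using `p : S` cS KA by (auto simp: a_def)
   next
    case False
    thus ?thesis using `p : S` using `p : S` cS R False by (auto simp: S_def long_jump_def a_def)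
   qed
  qed (use KA in \<open>auto simp: indicator_def\<close>)
 qed (use KA in \<open>auto simp: indicator_def\<close>)
 also have "... = KC * A * measure (M1 mu) ?L + KC * kappa * measure (M1 mu) UNIV" by (rule integral_affine_indicator[OF finb_M1[OF P]]) measurable
 also have "... <= KC * A * e + KC * kappa * 1" using KA mL mass by (intro add_mono mult_left_mono)
 finally have b1: "?X <= KC * A * e + KC * kappa" by simp
 have "?Y <= (LINT p|M2 mu. KC * A * indicator ?Z p + KC * kappa)"
 proof (rule integral_mono'[OF i1(2)])
  fix p
  show "indicator S p * cc p * b p <= KC * A * indicator ?Z p + KC * kappa"
  proof (cases "p : S")
   case True
   show ?thesis
   proof (cases "p : ?L")
    case True
    thus ?thesis using cS KA by (auto simp: b_def long_jump_def indicator_def)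
   next
    case False
    hence "p : prod.swap -` ?L" using `p : S` by (auto simp: S_def)
    moreover from this have "norm (fst p) >= R'" by (auto simp: long_jump_def)
    ultimately show ?thesis using cS KA by (auto simp: b_def indicator_def)
   qed
  qed (use KA in \<open>auto simp: indicator_def\<close>)
 qed (use KA in \<open>auto simp: indicator_def\<close>)
 also have "... = KC * A * measure (M2 mu) ?Z + KC * kappa * measure (M2 mu) UNIV"
  by (rule integral_affine_indicator[OF finb_M2[OF P]]) measurable
 also have "measure (M2 mu) ?Z = measure (M1 mu) ?L"
 proof -
  have "prod.swap -` ?Z = ?L" by auto
  thus ?thesis unfolding M2_def by (subst measure_distr) (auto simp: finb_space[OF finb_M1[OF P]] measurable_cong_sets[OF sets_M1[OF P]])
 qed
 also have "KC * A * measure (M1 mu) ?L + KC * kappa * measure (M2 mu) UNIV <= KC * A * e + KC * kappa * 1"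
  using KA mL mass by (intro add_mono mult_left_mono)
 finally have b2: "?Y <= KC * A * e + KC * kappa" by simp
 show "(LINT p|Th mu. indicator S p) <= KC * (2 * A * e + 2 * kappa)" using le b1 b2 by (simp add: algebra_simps)

qed

text \<open>The energy of one cutoff is bounded but need not be small. Averaging \<open>N\<close>
  cutoffs with rapidly growing radii makes it small: only very long jumps are seen by two of the
  cutoffs, so their gradients are almost orthogonal for every \<open>mu\<close>, and the square of
  the average is of order \<open>1 / N\<close> up to the small mixed terms.\<close>

lemma tight_test:
 assumes "eps > 0"
 obtains phi where "Ccs phi" "!!x. 0 <= phi x" "!!x. phi x <= 1" "!!x. norm x <= R ==> phi x = 1"
  "!!mu. mu : PM ==> Gam mu phi <= eps"
proof -
 define kappa where "kappa = eps / (8 * KC)"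
 have kappa: "kappa > 0" "KC * (2 * kappa) = eps / 4" using `eps > 0` KC by (auto simp: kappa_def)
 obtain A where A: "adm A kappa" by (rule adm_small[OF kappa(1)])
 have A0: "A >= 0" using A by (simp add: adm_def)
 define e where "e = eps / (8 * KC * (A + 1))"
 have e: "e > 0" using `eps > 0` KC A0 by (simp add: e_def)
 have "KC * (2 * A * e) <= KC * (2 * (A + 1) * e)" using e KC by simp
 also have "... = eps / 4"
 proof -
  have "e * (8 * KC * (A + 1)) = eps" using KC A0 unfolding e_def by auto
  thus ?thesis by auto
 qed
 finally have bound: "KC * (2 * A * e + 2 * kappa) <= eps / 2" using kappa by (simp add: distrib_left)
 have "EX R'. ALL x. norm x <= r --> measure (K x) {y. norm y >= R'} <= e" for r
 proof -
  obtain R' where "!!x. norm x <= r ==> measure (K x) {y. norm y >= R'} <= e" by (rule K_tail[OF e]) blast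
  thus ?thesis by auto
 qed
 from choice[OF allI[OF this]] obtain tail
  where tail': "ALL r x. norm x <= r --> measure (K x) {y. norm y >= tail r} <= e" ..
 have tail: "measure (K x) {y. norm y >= tail r} <= e" if "norm x <= r" for r x using tail' that by simp
 \<comment> \<open>Cutoff \<open>n\<close> is supported in the ball of radius
   \<open>2 * rad n\<close>; the next radius lies beyond the tail radius of that ball and at
   distance at least 1 from it.\<close>
 define rad where "rad = rec_nat (max R 1) (%n r. max (tail (2 * r)) (2 * r + 1))"
 have rad_0: "rad 0 = max R 1" and rad_Suc: "rad (Suc n) = max (tail (2 * rad n)) (2 * rad n + 1)" for n by (simp_all add: rad_def)
 have rad1: "rad n >= max R 1" for n
 proof (induction n)
  case (Suc n)
  thus ?case unfolding rad_Suc by auto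
 qed (simp only: rad_0 order_refl)
 have rmono: "rad n <= rad (Suc n)" for n
 proof -
  have "1 <= rad n" using rad1 by simp
  thus ?thesis unfolding rad_Suc by simp
 qed
 have incr: "rad (Suc i) <= rad j" if "i < j" for i j by (rule lift_Suc_mono_le[of rad, OF rmono]) (use that in simp)
 obtain L where L: "L >= 0" "!!r x y. r >= 1 ==> abs (cutoff r x - cutoff r (y::'a)) <= L * norm (x - y)" by (rule cutoff_lipschitz) blast
 define b :: "nat => 'a => real" where "b i = cutoff (rad i)" for i
 have bs: "Ccs (b i)" for i unfolding b_def using rad1[of i] by (intro Ccs_cutoff) auto
 have b01: "0 <= b i x" "b i x <= 1" for i x by (auto simp: b_def cutoff_bounds)
 define C where "C = L + 1"
 have C: "C >= 0" using L by (simp add: C_def)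
 have dC: "abs (dif (b i) p) <= C * min 1 (norm (fst p - snd p))" for i p
 proof -
  have "abs (dif (b i) p) <= L * norm (fst p - snd p)" unfolding dif_def b_def using L(2)[of "rad i" "snd p"] rad1 by (simp add: norm_minus_commute)
  moreover have d1: "abs (dif (b i) p) <= 1" unfolding dif_def using b01[of i "fst p"] b01[of i "snd p"] by simp
  show ?thesis
  proof (cases "norm (fst p - snd p) <= 1")
   case True
   have "L * norm (fst p - snd p) <= C * norm (fst p - snd p)" by (intro mult_right_mono) (simp_all add: C_def)
   thus ?thesis using True \<open>\<bar>dif (b i) p\<bar> <= L * norm (fst p - snd p)\<close> by simp
  next
   case False
   hence "min 1 (norm (fst p - snd p)) = 1" by simp
   moreover have "1 <= C" using L by (simp add: C_def)
   ultimately show ?thesis using order_trans[OF d1] by simp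
  qed
 qed
 have d1: "abs (dif (b i) p) <= 1" for i p unfolding dif_def using b01[of i "fst p"] b01[of i "snd p"] by simp
 have kd: "kdom (%p. dif (b i) p * dif (b j) p) (C * C)" for i j by (rule kdom_prod) (auto intro: dif_bm bs C dC)
 have diag_bd: "(LINT p|Th mu. dif (b i) p * dif (b i) p) <= C * C * KC" if "mu : PM" for i mu using Th_int[OF that kd[of i i]] by simp
 have off: "(LINT p|Th mu. dif (b i) p * dif (b j) p) <= eps / 2" if P: "mu : PM" and ij: "i < j" for i j mu
 proof -
  let ?r = "2 * rad i" and ?r' = "rad (Suc i)"
  have r': "?r' >= ?r + 1" by (simp add: rad_Suc)
  have tl: "measure (K x) {y. norm y >= ?r'} <= e" if "norm x <= ?r" for x
  proof -
   interpret subprob_space "K x" by (rule subprob_K)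
   have "measure (K x) {y. norm y >= ?r'} <= measure (K x) {y. norm y >= tail ?r}"
   proof (rule finite_measure_mono)
    show "{y. norm y >= tail ?r} : sets (K x)" by simp
   qed (auto simp: rad_Suc)
   thus ?thesis using tail[OF that] by simp
  qed
  define S where "S = long_jump ?r ?r' Un prod.swap -` long_jump ?r ?r'"
  note LJ = Th_long_jump[OF P A r' tl less_imp_le[OF e], folded S_def]
  have pt: "dif (b i) p * dif (b j) p <= indicator S p" for p
  proof (cases "p : S")
   case True
   have "abs (dif (b i) p * dif (b j) p) <= 1 * 1" unfolding abs_mult using d1 by (intro mult_mono) auto
   thus ?thesis using True by simp
  next
   case False
   \<comment> \<open>To change cutoff \<open>i\<close> a jump must touch the ball of radius
     \<open>2 * rad i\<close>, and to change cutoff \<open>j\<close> it must leave that of radius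
     \<open>rad j\<close>. A jump that does both belongs to \<open>S\<close>.\<close>
   have "dif (b i) p = 0 | dif (b j) p = 0"
   proof (rule ccontr)
    assume nz: "~ ?thesis"
    have "~ (norm (fst p) > ?r & norm (snd p) > ?r)"
    proof
     assume "norm (fst p) > ?r & norm (snd p) > ?r"
     hence "b i (fst p) = 0" "b i (snd p) = 0" unfolding b_def using rad1[of i] by (intro cutoff_eq_0; simp)+
     thus False using nz by (simp add: dif_def)
    qed
    moreover have "~ (norm (fst p) <= rad j & norm (snd p) <= rad j)" using nz by (auto simp: dif_def b_def cutoff_eq_1)
    ultimately show False
     using incr[OF ij] using False by (auto simp: S_def long_jump_def)
   qed
   thus ?thesis by auto
  qed
  have "(LINT p|Th mu. dif (b i) p * dif (b j) p) <= (LINT p|Th mu. indicator S p)" by (intro integral_mono Th_int[OF P kd] Th_int[OF P LJ(1)] pt)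
  also have "... <= KC * (2 * A * e + 2 * kappa)" using LJ by auto
  finally show ?thesis using bound by simp
 qed
 \<comment> \<open>The \<open>N\<close> diagonal terms, each at most \<open>C * C * KC\<close> and
   divided by \<open>N^2\<close>, should add up to at most \<open>eps / 2\<close>.\<close>
 obtain N0 :: nat where N0: "C * C * KC / (eps / 2) <= real N0" using real_arch_simple by auto
 define N where "N = Suc N0"
 have N: "real N > 0" "C * C * KC <= real N * (eps / 2)"
 proof -
  have "C * C * KC / (eps / 2) <= real N" using N0 by (simp add: N_def)
  thus "C * C * KC <= real N * (eps / 2)" using `eps > 0` by (subst (asm) pos_divide_le_eq) auto
 qed (simp add: N_def)
 define phi where "phi x = (1 / real N) * (SUM i<N. b i x)" for x
 show ?thesis
 proof (rule that[of phi])
  show "Ccs phi" unfolding phi_def by (intro Ccs_cmult Ccs_sum bs)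
  show "0 <= phi x" for x unfolding phi_def using b01 by (intro mult_nonneg_nonneg sum_nonneg) auto
  have "(SUM i<N. b i x) <= (SUM i<N. 1)" for x using b01 by (intro sum_mono)
  thus "phi x <= 1" for x unfolding phi_def using N by simp
  show "phi x = 1" if "norm x <= R" for x
  proof -
   have "b i x = 1" for i unfolding b_def using that rad1[of i] by (intro cutoff_eq_1) auto
   thus ?thesis using N by (simp add: phi_def)
  qed
  fix mu :: "'a measure" assume P: "mu : PM"
  have dphi: "dif phi p = (1 / real N) * (SUM i<N. dif (b i) p)" for p by (simp add: phi_def dif_def sum_subtractf right_diff_distrib)
  have sq: "(dif phi p)^2 = (1 / (real N)^2) * (SUM i<N. SUM j<N. dif (b i) p * dif (b j) p)" for p
   by (simp only: dphi power_mult_distrib power2_eq_square[of "sum _ _"] sum_product power_divide) simp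
  let ?X = "SUM i<N. SUM j<N. eps / 2 + (if i = j then C * C * KC else 0)"
  have "Gam mu phi = (1 / (real N)^2) * (SUM i<N. SUM j<N. LINT p|Th mu. dif (b i) p * dif (b j) p)"
   unfolding Gam_def sq using Th_int[OF P kd] by simp
  also have "... <= (1 / (real N)^2) * ?X"
  proof (intro mult_left_mono sum_mono)
   fix i j :: nat
   consider "i < j" | "j < i" | "i = j" by force
   thus "(LINT p|Th mu. dif (b i) p * dif (b j) p) <= eps / 2 + (if i = j then C * C * KC else 0)"
   proof cases
    case 2
    thus ?thesis using off[OF P 2] by (simp add: mult.commute)
   next
    case 3
    thus ?thesis using diag_bd[OF P, of i] `eps > 0` by simp
   qed (use off[OF P] in auto)
  qed simp
  also have "?X = (real N)^2 * (eps / 2) + real N * (C * C * KC)"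
   by (simp add: sum.distrib power2_eq_square algebra_simps)
  also have "(1 / (real N)^2) * ... <= (1 / (real N)^2) * ((real N)^2 * (eps / 2) + real N * (real N * (eps / 2)))"
   using N by (intro mult_left_mono) auto
  also have "... = eps" using N by (simp add: power2_eq_square)
  finally show "Gam mu phi <= eps" .
 qed
qed

end

section \<open>Energy of curves\<close>

lemma ennreal_add_le: "ennreal (x + y) <= ennreal x + ennreal y"
proof (cases "x >= 0 & y >= 0")
 case True
 thus ?thesis by simp
next
 case False
 then consider "x < 0" | "y < 0" by auto
 thus ?thesis
 proof cases
  case 1
  hence "ennreal (x + y) <= ennreal y" by (intro ennreal_leI) simp
  thus ?thesis by (simp add: add_increasing)
 next
  case 2
  hence "ennreal (x + y) <= ennreal x" by (intro ennreal_leI) simp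
  thus ?thesis by (simp add: add_increasing2)
 qed
qed

text \<open>Optimisation over \<open>c\<close>, with the maximum at \<open>c = 2 * D / q\<close>. It
  converts upper bounds for the quadratic functional \<open>ev\<close> into bounds for its linear
  part.\<close>

lemma quadratic_bound:
 fixes D e q :: real
 assumes "!!c. 2 * c * D <= e + c^2 * q / 2" "q >= 0"
 shows "D^2 <= e * q / 2"
proof (cases "q = 0")
 case True
 have "D = 0"
 proof (rule ccontr)
  assume "D ~= 0"
  thus False using assms(1)[of "(abs e + 1) / D"] True by simp
 qed
 thus ?thesis using True by simp
next
 case False
 hence q: "q > 0" using assms by simp
 have "2 * (2 * D / q) * D <= e + (2 * D / q)^2 * q / 2" by (rule assms)
 also have "(2 * D / q)^2 * q / 2 = 2 * D^2 / q" by (simp add: power2_eq_square)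
 finally have "2 * D^2 / q <= e" by (simp add: power2_eq_square)
 thus ?thesis using q by (simp add: pos_divide_le_eq)

qed

context jump_setting begin

text \<open>Testing with smooth functions of compact support is enough, since all masses are 1;
  \<open>wcurve_wconv\<close> recovers weak continuity.\<close>

definition wcurve :: "real => real => (real => 'a measure) => bool" where
 "wcurve a b mu \<longleftrightarrow> (ALL t:{a..b}. mu t : PM) &
  (ALL phi. Ccs phi --> continuous_on {a..b} (%t. LINT x|mu t. phi x))"

lemma wcurveD: "wcurve a b mu ==> t : {a..b} ==> mu t : PM"
 "wcurve a b mu ==> Ccs phi ==> continuous_on {a..b} (%t. LINT x|mu t. phi x)" unfolding wcurve_def by auto

lemma wcurve_wconv:
 assumes "wcurve a b mu" "t : {a..b}"
 shows "eventually (%s. mu s : PM) (at t within {a..b})" "wconv mu (mu t) (at t within {a..b})"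
proof -
 let ?X = "at t within {a..b}"
 show ev: "eventually (%s. mu s : PM) ?X" using wcurveD[OF assms(1)] by (auto simp: eventually_at_filter)
 show "wconv mu (mu t) ?X"
 proof (rule wconv_testI)
  show "eventually (%s. finb (mu s)) ?X" using ev by eventually_elim (rule PM_fb)
  show "finb (mu t)" using wcurveD(1)[OF assms] by (rule PM_fb)
  have "eventually (%s. 1 = measure (mu s) UNIV) ?X" using ev by eventually_elim (simp add: PM_mass)
  hence "((%s. measure (mu s) UNIV) ---> 1) ?X" by (rule Lim_transform_eventually[OF tendsto_const])
  thus "((%s. measure (mu s) UNIV) ---> measure (mu t) UNIV) ?X" using wcurveD(1)[OF assms] by (simp add: PM_mass)
  show "((%s. LINT x|mu s. phi x) ---> (LINT x|mu t. phi x)) ?X" if "Ccs phi" for phi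
   using wcurveD(2)[OF assms(1) that] assms by (simp add: continuous_on_def)
 qed
qed

lemma wcurve_subset: "wcurve a b mu ==> a <= a' ==> b' <= b ==> wcurve a' b' mu" unfolding wcurve_def by (auto intro: continuous_on_subset)

fun active :: "(real * real * ('a => real)) list => real => 'a => real" where
 "active [] r x = 0"
| "active ((s, t, phi) # l) r x = (if s < r & r < t then phi x else 0) + active l r x"

fun Lf :: "(real * real * ('a => real)) list => (real => 'a measure) => real" where
 "Lf [] mu = 0"
| "Lf ((s, t, phi) # l) mu = ((LINT x|mu t. phi x) - (LINT x|mu s. phi x)) + Lf l mu"

definition tests :: "real => real => (real * real * ('a => real)) list set" where
 "tests a b = {l. list_all (%(s, t, phi). a <= s & s <= t & t <= b & Ccs phi) l}"

lemma tests_Nil [simp]: "[] : tests a b"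
 and tests_Cons [simp]: "(s, t, phi) # l : tests a b \<longleftrightarrow> a <= s & s <= t & t <= b & Ccs phi & l : tests a b"
 and tests_append [simp]: "l @ l' : tests a b \<longleftrightarrow> l : tests a b & l' : tests a b" by (auto simp: tests_def)

definition smul :: "real => (real * real * ('a => real)) list => (real * real * ('a => real)) list" where
 "smul c l = map (%(s, t, phi). (s, t, %x. c * phi x)) l"

lemma active_append: "active (l @ l') r x = active l r x + active l' r x" by (induction l r x rule: active.induct) auto

lemma Lf_append: "Lf (l @ l') mu = Lf l mu + Lf l' mu" by (induction l mu rule: Lf.induct) auto

lemma active_smul: "active (smul c l) r x = c * active l r x" by (induction r x rule: active.induct) (auto simp: smul_def algebra_simps)

lemma Lf_smul: "Lf (smul c l) mu = c * Lf l mu" by (induction rule: Lf.induct) (auto simp: smul_def algebra_simps)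

lemma tests_smul: "l : tests a b ==> smul c l : tests a b" by (induction l) (auto simp: smul_def Ccs_cmult)

lemma tests_mono: "l : tests a b ==> a' <= a ==> b <= b' ==> l : tests a' b'" by (induction l) auto

lemma Ccs_active: "l : tests a b ==> Ccs (active l r)"
proof (induction l)
 case Nil
 thus ?case by (simp add: Ccs_zero)
next
 case (Cons q l)
 obtain s t phi where q: "q = (s, t, phi)" by (cases q)
 have e: "active (q # l) r = (%x. (if s < r & r < t then phi x else 0) + active l r x)" by (auto simp: q)
 have "Ccs (%x. if s < r & r < t then phi x else 0)" using Cons.prems by (cases "s < r & r < t") (auto simp: q Ccs_zero)
 thus ?case unfolding e using Cons by (intro Ccs_add) (auto simp: q)
qed

text \<open>Upper semicontinuity in time makes the sets where the integral is below a constant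
  relatively open in the time interval.\<close>

lemma Th_field_measurable:
 assumes w: "wcurve a b mu" and f: "kdom f B" "!!p. f p >= 0" "cts f"
 shows "(%r. indicator {a..b} r * (LINT p|Th (mu r). f p)) : bm borel"
proof -
 let ?Y = "restrict_space borel {a..b}"
 let ?Z = "%r. if r : {a..b} then (LINT p|Th (mu r). f p) else 0"
 have "(%r. (LINT p|Th (mu r). f p)) : bm ?Y"
 proof (subst borel_measurable_iff_less, rule allI)
  fix c
  have "EX T. open T & r : T & (ALL y:T Int {a..b}. (LINT p|Th (mu y). f p) < c)" if r: "r : {a..b}" "(LINT p|Th (mu r). f p) < c" for r
  proof -
   have "eventually (%s. (LINT p|Th (mu s). f p) < (LINT p|Th (mu r). f p) + (c - (LINT p|Th (mu r). f p))) (at r within {a..b})"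
    by (rule Th_usc[OF wcurve_wconv(1)[OF w r(1)] wcurveD(1)[OF w r(1)] wcurve_wconv(2)[OF w r(1)] f]) (use r in simp)
   then obtain T where "open T" "r : T" "ALL y:T. y ~= r --> y : {a..b} --> (LINT p|Th (mu y). f p) < c" unfolding eventually_at_topological by auto
   thus ?thesis using r by (intro exI) auto
  qed
  note T = this
  define U where "U = \<Union>{T. open T & (ALL y:T Int {a..b}. (LINT p|Th (mu y). f p) < c)}"
  let ?X = "{r : {a..b}. (LINT p|Th (mu r). f p) < c}"
  have "?X = {a..b} Int U"
  proof (intro equalityI subsetI)
   fix r assume "r : ?X"
   hence r: "r : {a..b}" "(LINT p|Th (mu r). f p) < c" by auto
   from T[OF r] show "r : {a..b} Int U" using r unfolding U_def by auto
  next
   fix r assume "r : {a..b} Int U"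
   thus "r : ?X" unfolding U_def by auto
  qed
  moreover have "open U" unfolding U_def by auto
  ultimately show "{w : space ?Y. (LINT p|Th (mu w). f p) < c} : sets ?Y"
   by (auto simp: sets_restrict_space)
 qed
 hence "?Z : bm borel" by (subst (asm) measurable_restrict_space_iff) auto
 moreover have "?Z = (%r. indicator {a..b} r * (LINT p|Th (mu r). f p))" by auto
 ultimately show ?thesis by simp
qed

lemma Gam_measurable:
 assumes w: "wcurve a b mu" and psi: "Ccs psi"
 shows "(%r. indicator {a..b} r * Gam (mu r) psi) : bm borel"
proof -
 obtain B where B: "kdom (%p. dif psi p * dif psi p) B" by (rule kdom_dif2[OF psi psi])
 have "cts (%p. dif psi p * dif psi p)" by (intro continuous_on_mult dif_continuous Ccs_continuous psi)
 from Th_field_measurable[OF w B _ this] show ?thesis by (simp add: Gam_def power2_eq_square)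
qed

text \<open>\<open>Gam\<close> is not additive in the test function, so the induction carries a
  summand \<open>psi\<close>: on its interval the head of the list is moved into \<open>psi\<close>,
  and outside it disappears.\<close>

lemma Gam_active_aux:
 assumes w: "wcurve a b mu"
 shows "l : tests a' b' ==> Ccs psi ==>
  (%r. indicator {a..b} r * Gam (mu r) (%x. psi x + active l r x)) : bm borel"
proof (induction l arbitrary: psi)
 case Nil
 thus ?case using Gam_measurable[OF w] by simp
next
 case (Cons q l)
 obtain s t phi where q: "q = (s, t, phi)" by (cases q)
 have psi': "Ccs (%x. psi x + phi x)" using Cons.prems by (intro Ccs_add) (auto simp: q)
 have [measurable]: "(%r. indicator {a..b} r * Gam (mu r) (%x. (psi x + phi x) + active l r x)) : bm borel"
  "(%r. indicator {a..b} r * Gam (mu r) (%x. psi x + active l r x)) : bm borel" using Cons.IH[OF _ psi'] Cons.IH Cons.prems by (auto simp: q)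
 have "(%r. indicator {a..b} r * Gam (mu r) (%x. psi x + active (q # l) r x)) =
  (%r. if s < r & r < t then indicator {a..b} r * Gam (mu r) (%x. (psi x + phi x) + active l r x)
   else indicator {a..b} r * Gam (mu r) (%x. psi x + active l r x))" by (auto simp: fun_eq_iff q add.assoc)
 thus ?case by simp
qed

lemma Gam_active_measurable:
 assumes "wcurve a b mu" "l : tests a' b'"
 shows "(%r. indicator {a..b} r * Gam (mu r) (active l r)) : bm borel" using Gam_active_aux[OF assms Ccs_zero] by simp

lemma Gam_active_bound_aux:
 "l : tests a b ==> Ccs psi ==>
  EX B>=0. ALL mu:PM. ALL r. Gam mu (%x. psi x + active l r x) <= B"
proof (induction l arbitrary: psi)
 case Nil
 obtain B where "B >= 0" "!!mu. mu : PM ==> Gam mu psi <= B" by (rule Gam_bounded[OF Nil(2)]) blast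
 thus ?case by auto
next
 case (Cons q l)
 obtain s t phi where q: "q = (s, t, phi)" by (cases q)
 have psi': "Ccs (%x. psi x + phi x)" using Cons.prems by (intro Ccs_add) (auto simp: q)
 have l: "l : tests a b" using Cons.prems by (simp add: q)
 obtain B1 where B1: "B1 >= 0" "ALL mu:PM. ALL r. Gam mu (%x. (psi x + phi x) + active l r x) <= B1" using Cons.IH[OF l psi'] by auto
 obtain B2 where B2: "B2 >= 0" "ALL mu:PM. ALL r. Gam mu (%x. psi x + active l r x) <= B2" using Cons.IH[OF l Cons.prems(2)] by auto
 have "Gam mu (%x. psi x + active (q # l) r x) <= max B1 B2" if P: "mu : PM" for mu r
 proof (cases "s < r & r < t")
  case True
  hence "(%x. psi x + active (q # l) r x) = (%x. (psi x + phi x) + active l r x)" by (auto simp: q)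
  thus ?thesis using B1 P by (metis max.coboundedI1)
 next
  case False
  hence "(%x. psi x + active (q # l) r x) = (%x. psi x + active l r x)" by (auto simp: q)
  thus ?thesis using B2 P by (metis max.coboundedI2)
 qed
 thus ?case using B1 by (intro exI[of _ "max B1 B2"]) auto
qed

lemma Gam_active_bound:
 assumes "l : tests a b"
 obtains B where "B >= 0" "!!mu r. mu : PM ==> Gam mu (active l r) <= B" using Gam_active_bound_aux[OF assms Ccs_zero] by auto

definition Qf :: "real => real => (real => 'a measure) => (real * real * ('a => real)) list => real" where
 "Qf a b mu l = (LINT r|lborel. indicator {a..b} r * Gam (mu r) (active l r))"

lemma Qf_int:
 assumes "wcurve a b mu" "l : tests a' b'"
 shows "integrable lborel (%r. indicator {a..b} r * Gam (mu r) (active l r))"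
proof -
 obtain B where B: "B >= 0" "!!mu r. mu : PM ==> Gam mu (active l r) <= B" by (rule Gam_active_bound[OF assms(2)]) blast
 show ?thesis
 proof (rule Bint_bound)
  show "integrable lborel (%r. indicator {a..b} r * B)" by (simp_all add: emeasure_lborel_Icc_eq)
  show "(%r. indicator {a..b} r * Gam (mu r) (active l r)) : bm lborel" using Gam_active_measurable[OF assms] by simp
  show "AE r in lborel. norm (indicator {a..b} r * Gam (mu r) (active l r)) <= norm (indicator {a..b} r * B)"
  proof (rule AE_I2)
   fix r
   show "norm (indicator {a..b} r * Gam (mu r) (active l r)) <= norm (indicator {a..b} r * B)" using B(2)[OF wcurveD(1)[OF assms(1)]] Gam_nonneg B
    by (cases "r : {a..b}") simp_all
  qed
 qed
qed

lemma Qf_nonneg: "Qf a b mu l >= 0" unfolding Qf_def by (intro Bochner_Integration.integral_nonneg mult_nonneg_nonneg Gam_nonneg) simp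

lemma Qf_smul: "Qf a b mu (smul c l) = c^2 * Qf a b mu l"
proof -
 have "active (smul c l) r = (%x. c * active l r x)" for r by (rule) (rule active_smul)
 hence "indicator {a..b} r * Gam (mu r) (active (smul c l) r) = c^2 * (indicator {a..b} r * Gam (mu r) (active l r))" for r by (simp add: Gam_cmult)
 thus ?thesis by (simp only: Qf_def integral_mult_right_zero)
qed

definition ev :: "real => real => (real => 'a measure) => (real * real * ('a => real)) list => real" where
 "ev a b mu l = 2 * Lf l mu - Qf a b mu l / 2"

text \<open>Truncation of negative values by \<open>ennreal\<close> is harmless, since the empty
  list already yields 0.\<close>

definition energy :: "real => real => (real => 'a measure) => ennreal" where
 "energy a b mu = (SUP l\<in>tests a b. ennreal (ev a b mu l))"

lemma energy_upper: "l : tests a b ==> ennreal (ev a b mu l) <= energy a b mu" unfolding energy_def by (rule SUP_upper)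

lemma energy_least: "(!!l. l : tests a b ==> ennreal (ev a b mu l) <= E) ==> energy a b mu <= E" unfolding energy_def by (rule SUP_least)

text \<open>Multiples of the one-element list \<open>[(s, t, phi)]\<close> are tested and the factor
  is optimised. The bound is linear in \<open>t - s\<close> for the squared increment, thus Holder
  continuity of exponent 1/2, and it is small whenever \<open>Gam\<close> of \<open>phi\<close> is
  small.\<close>

lemma energy_holder:
 assumes w: "wcurve a b mu" and E: "energy a b mu <= ennreal e" "e >= 0" and phi: "Ccs phi"
  and st: "a <= s" "s <= t" "t <= b" and B: "!!r. r : {a..b} ==> Gam (mu r) phi <= B" "B >= 0"
 shows "((LINT x|mu t. phi x) - (LINT x|mu s. phi x))^2 <= e * (B * (t - s)) / 2"
proof (rule quadratic_bound)
 let ?D = "(LINT x|mu t. phi x) - (LINT x|mu s. phi x)"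
 show "B * (t - s) >= 0" using B st by simp
 fix c
 have l: "[(s, t, phi)] : tests a b" using st phi by simp
 have ac: "active [(s, t, phi)] r = (if s < r & r < t then phi else (%x. 0))" for r by auto
 have "Qf a b mu [(s, t, phi)] <= (LINT r|lborel. indicator {s..t} r * B)" unfolding Qf_def
 proof (rule integral_mono[OF Qf_int[OF w l]])
  show "integrable lborel (%r. indicator {s..t} r * B)" by (simp_all add: emeasure_lborel_Icc_eq)
  show "indicator {a..b} r * Gam (mu r) (active [(s, t, phi)] r) <= indicator {s..t} r * B" for r unfolding ac using B st by (auto simp: Gam_zero)
 qed
 also have "... = B * (t - s)" using st by simp
 finally have Q: "Qf a b mu [(s, t, phi)] <= B * (t - s)" .
 have "ennreal (ev a b mu (smul c [(s, t, phi)])) <= ennreal e" using energy_upper[OF tests_smul[OF l]] E(1) by (rule order_trans)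
 hence "2 * c * ?D - c^2 * Qf a b mu [(s, t, phi)] / 2 <= e" using E by (simp only: ev_def Qf_smul Lf_smul) simp
 moreover have "c^2 * Qf a b mu [(s, t, phi)] <= c^2 * (B * (t - s))" using Q by (intro mult_left_mono) auto
 ultimately show "2 * c * ?D <= e + c^2 * (B * (t - s)) / 2" by simp
qed

lemma ae_neq: "AE r in lborel. r ~= (b::real)" by (rule AE_lborel_singleton)

text \<open>Clamping all times at \<open>b\<close> from above and from below cuts a list in two. An
  interval on the wrong side of \<open>b\<close> degenerates to a point and contributes
  nothing.\<close>

lemma energy_split_le:
 assumes w: "wcurve a c mu" and ab: "a <= b" "b <= c"
 shows "energy a c mu <= energy a b mu + energy b c mu"
proof (rule energy_least)
 fix l assume l: "l : tests a c"
 define l1 where "l1 = map (%(s, t, phi). (min s b, min t b, phi)) l"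
 define l2 where "l2 = map (%(s, t, phi). (max s b, max t b, phi)) l"
 have t1: "l1 : tests a b" unfolding l1_def using l ab by (induction l) (auto)
 have t2: "l2 : tests b c" unfolding l2_def using l ab by (induction l) (auto)
 have L: "Lf l mu = Lf l1 mu + Lf l2 mu" unfolding l1_def l2_def by (induction l mu rule: Lf.induct) (auto simp: max_def)
 have a1: "active l1 r = active l r" if "r < b" for r unfolding l1_def using that by (intro ext, induction l) auto
 have a2: "active l2 r = active l r" if "b < r" for r unfolding l2_def using that by (intro ext, induction l) auto
 have w1: "wcurve a b mu" "wcurve b c mu" using w ab by (auto intro: wcurve_subset)
 have "Qf a c mu l = (LINT r|lborel. indicator {a..b} r * Gam (mu r) (active l1 r) + indicator {b..c} r * Gam (mu r) (active l2 r))" unfolding Qf_def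
 proof (rule integral_cong_AE)
  show "AE r in lborel. indicator {a..c} r * Gam (mu r) (active l r) =
   indicator {a..b} r * Gam (mu r) (active l1 r) + indicator {b..c} r * Gam (mu r) (active l2 r)" using ae_neq[of b]
  proof eventually_elim
   case (elim r)
   then consider "r < b" | "r > b" by force
   thus ?case by cases (use ab in \<open>auto simp: a1 a2 indicator_def\<close>)
  qed
 qed (use Qf_int[OF w l] Qf_int[OF w1(1) t1] Qf_int[OF w1(2) t2] in auto)
 also have "... = Qf a b mu l1 + Qf b c mu l2" unfolding Qf_def by (rule Bochner_Integration.integral_add[OF Qf_int[OF w1(1) t1] Qf_int[OF w1(2) t2]])
 finally have "ev a c mu l = ev a b mu l1 + ev b c mu l2" by (simp add: ev_def L add_divide_distrib)
 hence "ennreal (ev a c mu l) <= ennreal (ev a b mu l1) + ennreal (ev b c mu l2)" using ennreal_add_le by simp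
 also have "... <= energy a b mu + energy b c mu" by (intro add_mono energy_upper t1 t2)
 finally show "ennreal (ev a c mu l) <= energy a b mu + energy b c mu" .
qed

lemma active_outside: "l : tests a b ==> r <= a | b <= r ==> active l r = (%x. 0)" by (intro ext, induction l) auto

lemma energy_split_ge:
 assumes w: "wcurve a c mu" and ab: "a <= b" "b <= c"
 shows "energy a b mu + energy b c mu <= energy a c mu"
proof -
 have w1: "wcurve a b mu" "wcurve b c mu" using w ab by (auto intro: wcurve_subset)
 have key: "ennreal (ev a b mu l1) + ennreal (ev b c mu l2) <= energy a c mu"
  if l1: "l1 : tests a b" and l2: "l2 : tests b c" for l1 l2
 proof -
  have val: "ev a c mu (l1 @ l2) = ev a b mu l1 + ev b c mu l2" and mem: "l1 @ l2 : tests a c"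
   if l1: "l1 : tests a b" and l2: "l2 : tests b c" for l1 l2
  proof -
   show l: "l1 @ l2 : tests a c" using l1 l2 ab by (auto intro: tests_mono)
   have "Qf a c mu (l1 @ l2) = (LINT r|lborel. indicator {a..b} r * Gam (mu r) (active l1 r) + indicator {b..c} r * Gam (mu r) (active l2 r))"
    unfolding Qf_def
   proof (rule integral_cong_AE)
    show "AE r in lborel. indicator {a..c} r * Gam (mu r) (active (l1 @ l2) r) =
     indicator {a..b} r * Gam (mu r) (active l1 r) + indicator {b..c} r * Gam (mu r) (active l2 r)" using ae_neq[of b]
    proof eventually_elim
     case (elim r)
     have e: "active (l1 @ l2) r = (%x. active l1 r x + active l2 r x)" by (rule) (rule active_append)
     consider "r < b" | "r > b" using elim by force
     thus ?case
     proof cases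
      case 1
      thus ?thesis using active_outside[OF l2] using 1 ab by (simp add: e indicator_def)
     next
      case 2
      thus ?thesis using active_outside[OF l1] using 2 ab by (simp add: e indicator_def)
     qed
    qed
   qed (use Qf_int[OF w l] Qf_int[OF w1(1) l1] Qf_int[OF w1(2) l2] in auto)
   also have "... = Qf a b mu l1 + Qf b c mu l2"
    unfolding Qf_def by (rule Bochner_Integration.integral_add[OF Qf_int[OF w1(1) l1] Qf_int[OF w1(2) l2]])
   finally show "ev a c mu (l1 @ l2) = ev a b mu l1 + ev b c mu l2" by (simp add: ev_def Lf_append add_divide_distrib)
  qed
  have e0: "ev a b mu [] = 0" "ev b c mu [] = 0" by (simp_all add: ev_def Qf_def) (simp_all add: Gam_def dif_def)
  \<comment> \<open>\<open>ennreal\<close> is additive on nonnegative numbers only; a list with a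
    negative value is replaced by the empty one, which has the same truncated value 0.\<close>
  define k1 where "k1 = (if ev a b mu l1 >= 0 then l1 else [])"
  define k2 where "k2 = (if ev b c mu l2 >= 0 then l2 else [])"
  have k: "k1 : tests a b" "k2 : tests b c" using l1 l2 by (auto simp: k1_def k2_def)
  have kv: "ennreal (ev a b mu l1) = ennreal (ev a b mu k1)" "ev a b mu k1 >= 0"
   "ennreal (ev b c mu l2) = ennreal (ev b c mu k2)" "ev b c mu k2 >= 0" by (auto simp: k1_def k2_def e0 ennreal_neg)
  have "ennreal (ev a b mu l1) + ennreal (ev b c mu l2) = ennreal (ev a c mu (k1 @ k2))" using kv by (simp add: val[OF k])
  also have "... <= energy a c mu" by (rule energy_upper[OF mem[OF k]])
  finally show ?thesis .
 qed
 have ne: "tests a b ~= {}" "tests b c ~= {}" using tests_Nil by blast+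
 have "energy a b mu + energy b c mu = (SUP l1\<in>tests a b. ennreal (ev a b mu l1) + energy b c mu)"
  unfolding energy_def by (rule ennreal_SUP_add_left[symmetric]) (simp_all add: ne)
 also have "... <= energy a c mu"
 proof (rule SUP_least)
  fix l1 assume l1: "l1 : tests a b"
  have "ennreal (ev a b mu l1) + energy b c mu = (SUP l2\<in>tests b c. ennreal (ev a b mu l1) + ennreal (ev b c mu l2))"
   unfolding energy_def by (rule ennreal_SUP_add_right) (simp_all add: ne)
  also have "... <= energy a c mu" by (rule SUP_least) (rule key[OF l1])
  finally show "ennreal (ev a b mu l1) + energy b c mu <= energy a c mu" .
 qed
 finally show ?thesis .
qed

lemma wcurve_affine:
 assumes "wcurve a b mu" "c > 0"
 shows "wcurve ((a - d) / c) ((b - d) / c) (%r. mu (c * r + d))"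
proof -
 have im: "c * r + d : {a..b}" if "r : {(a - d) / c..(b - d) / c}" for r using that assms by (auto simp: field_simps)
 show ?thesis unfolding wcurve_def
 proof (intro conjI ballI allI impI)
  fix phi :: "'a => real" assume "Ccs phi"
  from wcurveD(2)[OF assms(1) this]
  show "continuous_on {(a - d) / c..(b - d) / c} (%t. LINT x|mu (c * t + d). phi x)"
   by (rule continuous_on_compose2) (use im in \<open>auto intro!: continuous_intros\<close>)
 qed (use im wcurveD(1)[OF assms(1)] in auto)
qed

text \<open>The time change keeps the increments and divides the quadratic part by \<open>c\<close>.
  Multiplying the test functions by \<open>1 / c\<close> brings both parts to the same scale and
  leaves the factor \<open>c\<close>.\<close>

lemma energy_affine_le:
 assumes w: "wcurve a b mu" and c: "c > 0"
 shows "energy ((a - d) / c) ((b - d) / c) (%r. mu (c * r + d)) <= ennreal c * energy a b mu"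
proof (rule energy_least)
 let ?a = "(a - d) / c" and ?b = "(b - d) / c" and ?mu = "%r. mu (c * r + d)"
 fix l assume l: "l : tests ?a ?b"
 define l' where "l' = map (%(s, t, phi). (c * s + d, c * t + d, phi)) l"
 have mem: "l' : tests a b" unfolding l'_def using l c by (induction l) (auto simp: field_simps)
 have L: "Lf l' mu = Lf l ?mu" unfolding l'_def by (induction l) auto
 have ac: "active l' (c * r + d) = active l r" for r unfolding l'_def using c by (intro ext, induction l) auto
 let ?X = "LINT r|lborel. indicator {a..b} (d + c * r) * Gam (mu (d + c * r)) (active l' (d + c * r))"
 have "Qf a b mu l' = c * ?X"
  unfolding Qf_def using c by (subst lborel_integral_real_affine[where c=c and t=d]) auto
 also have "?X = Qf ?a ?b ?mu l" unfolding Qf_def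
 proof (rule Bint_cong[OF refl])
  fix r
  have "indicator {a..b} (d + c * r) = (indicator {?a..?b} r :: real)" using c by (auto simp: indicator_def field_simps)
  thus "indicator {a..b} (d + c * r) * Gam (mu (d + c * r)) (active l' (d + c * r)) = indicator {?a..?b} r * Gam (?mu r) (active l r)"
   using ac by (simp add: add.commute)
 qed
 finally have Q: "Qf a b mu l' = c * Qf ?a ?b ?mu l" .
 have "ev ?a ?b ?mu l = c * ev a b mu (smul (1 / c) l')" using c by (simp add: ev_def Lf_smul Qf_smul Q L power2_eq_square field_simps)
 hence "ennreal (ev ?a ?b ?mu l) = ennreal c * ennreal (ev a b mu (smul (1 / c) l'))" using c by (simp add: ennreal_mult')
 also have "... <= ennreal c * energy a b mu" by (intro mult_left_mono energy_upper tests_smul mem) simp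
 finally show "ennreal (ev ?a ?b ?mu l) <= ennreal c * energy a b mu" .
qed

lemma wcurve_reverse:
 assumes "wcurve 0 1 mu"
 shows "wcurve 0 1 (%r. mu (1 - r))" unfolding wcurve_def
proof (intro conjI ballI allI impI)
 fix phi :: "'a => real" assume "Ccs phi"
 from wcurveD(2)[OF assms(1) this]
 show "continuous_on {0..1} (%t. LINT x|mu (1 - t). phi x)" by (rule continuous_on_compose2) (auto intro!: continuous_intros)
qed (use wcurveD(1)[OF assms] in auto)

lemma energy_reverse_le:
 assumes w: "wcurve 0 1 mu"
 shows "energy 0 1 (%r. mu (1 - r)) <= energy 0 1 mu"
proof (rule energy_least)
 let ?mu = "%r. mu (1 - r)"
 fix l assume l: "l : tests 0 1"
 define l' where "l' = map (%(s, t, phi). (1 - t, 1 - s, %x. (-1) * phi x)) l"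
 have mem: "l' : tests 0 1" unfolding l'_def using l by (induction l) (auto intro: Ccs_cmult[of _ "-1", simplified])
 have L: "Lf l' mu = Lf l ?mu" unfolding l'_def by (induction l) auto
 have ac: "active l' (1 - r) x = (-1) * active l r x" for r x unfolding l'_def by (induction l) auto
 have ac': "Gam m (active l' (1 - r)) = Gam m (active l r)" for m r using Gam_cmult[of m "-1"] by (simp add: ac[abs_def])
 have "Qf 0 1 mu l' = (LINT r|lborel. I01 (1 + (-1) * r) * Gam (mu (1 + (-1) * r)) (active l' (1 + (-1) * r)))"
  unfolding Qf_def by (subst lborel_integral_real_affine[where c="-1" and t=1]) auto
 also have "... = Qf 0 1 ?mu l" unfolding Qf_def
 proof (rule Bint_cong[OF refl])
  fix r :: real
  have "I01 (1 + (-1) * r) = (I01 r :: real)" by (auto simp: indicator_def)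
  moreover have "1 + (-1) * r = 1 - r" by simp
  ultimately show "I01 (1 + (-1) * r) * Gam (mu (1 + (-1) * r)) (active l' (1 + (-1) * r))
   = I01 r * Gam (?mu r) (active l r)" by (simp only: ac')
 qed
 finally have "ev 0 1 ?mu l = ev 0 1 mu l'" by (simp add: ev_def L)
 thus "ennreal (ev 0 1 ?mu l) <= energy 0 1 mu" using energy_upper[OF mem] by simp
qed

lemma energy_cong:
 assumes "!!r. r : {a..b} ==> mu r = nu r"
 shows "energy a b mu = energy a b nu"
proof -
 have "ev a b mu l = ev a b nu l" if l: "l : tests a b" for l
 proof -
  have "Lf l mu = Lf l nu" using l by (induction l) (auto simp: assms)
  moreover have "Qf a b mu l = Qf a b nu l" unfolding Qf_def by (rule Bint_cong[OF refl]) (simp add: indicator_def assms)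
  ultimately show ?thesis by (simp add: ev_def)
 qed
 thus ?thesis unfolding energy_def by simp
qed

lemma wcurve_cong:
 assumes "!!r. r : {a..b} ==> mu r = nu r" "wcurve a b mu"
 shows "wcurve a b nu"
proof -
 have "continuous_on {a..b} (%t. LINT x|mu t. phi x) \<longleftrightarrow> continuous_on {a..b} (%t. LINT x|nu t. phi x)" for phi :: "'a => real"
  by (rule continuous_on_cong) (simp_all add: assms)
 thus ?thesis using assms by (simp add: wcurve_def)
qed

end

section \<open>Compactness of curves and lower semicontinuity of the energy\<close>

lemma closed_indicator_limit:
 fixes A :: "'b::euclidean_space set"
 assumes M: "finb M" and A: "closed A" "A ~= {}"
 shows "(%k. LINT x|M. 1 - min 1 (real k * infdist x A)) ----> measure M A"
proof -
 interpret finite_measure M using M by (simp add: finb_def)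
 have sp: "space M = UNIV" "sets M = sets borel" using M by (simp_all add: finb_space, simp add: finb_def)
 have Am: "A : sets M" unfolding sp using A by simp
 have "(%k. LINT x|M. 1 - min 1 (real k * infdist x A)) ----> (LINT x|M. indicator A x)"
 proof (rule integral_dominated_convergence[where w="%_. 1"])
  show "AE x in M. (%k. 1 - min 1 (real k * infdist x A)) ----> indicator A x"
  proof (rule AE_I2)
   fix x
   show "(%k. 1 - min 1 (real k * infdist x A)) ----> indicator A x"
   proof (cases "x : A")
    case False
    hence "infdist x A > 0" using A infdist_pos_not_in_closed by auto
    then obtain n0 :: nat where n0: "1 < real n0 * infdist x A" using reals_Archimedean3 by auto
    have "eventually (%k. 1 - min 1 (real k * infdist x A) = 0) sequentially"
    proof (rule eventually_sequentiallyI[of n0])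
     fix k assume "n0 <= k"
     hence "real n0 * infdist x A <= real k * infdist x A" by (intro mult_right_mono) (simp_all add: infdist_nonneg)
     thus "1 - min 1 (real k * infdist x A) = 0" using n0 by simp
    qed
    thus ?thesis using False by (simp add: tendsto_eventually)
   qed simp
  qed
  show "(%x. 1 - min 1 (real k * infdist x A)) : bm M" for k unfolding measurable_cong_sets[OF sp(2) refl] by (intro cts_bm continuous_intros)
  show "AE x in M. norm (1 - min 1 (real k * infdist x A)) <= 1" for k by (simp add: infdist_nonneg)
  show "(indicator A :: 'b => real) : bm M" using Am by simp
 qed simp
 thus ?thesis by (simp add: sp)
qed

lemma finb_eqI:
 fixes M N :: "'b::euclidean_space measure"
 assumes M: "finb M" and N: "finb N"
  and eq: "!!f. cts f ==> bounded (range f) ==> (LINT x|M. f x) = ((LINT x|N. f x) :: real)"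
 shows "M = N"
proof -
 interpret M: finite_measure M using M by (simp add: finb_def)
 interpret N: finite_measure N using N by (simp add: finb_def)
 have b: "sets borel = sigma_sets UNIV (Collect closed :: 'b set set)" by (subst borel_eq_closed) simp
 have clo: "measure M A = measure N A" if A: "closed A" for A
 proof (cases "A = {}")
  case False
  have "(LINT x|M. 1 - min 1 (real k * infdist x A)) = (LINT x|N. 1 - min 1 (real k * infdist x A))" for k
  proof (rule eq)
   show "bounded (range (%x. 1 - min 1 (real k * infdist x A)))" unfolding bdd_iff by (rule exI[of _ 1]) (simp add: infdist_nonneg)
  qed (intro continuous_intros)
  thus ?thesis
   using closed_indicator_limit[OF N A False] using closed_indicator_limit[OF M A False] LIMSEQ_unique by auto
 qed simp
 show ?thesis
 proof (rule measure_eqI_generator_eq[where E="Collect closed" and \<Omega>=UNIV and A="%_. UNIV"])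
  show "Int_stable (Collect closed :: 'b set set)" by (auto simp: Int_stable_def)
  show "X : Collect closed ==> emeasure M X = emeasure N X" for X using clo by (simp add: M.emeasure_eq_measure N.emeasure_eq_measure)
  show "sets M = sigma_sets UNIV (Collect closed)" "sets N = sigma_sets UNIV (Collect closed)" using M N b by (simp_all add: finb_def)
 qed auto
qed

lemma wconv_unique:
 assumes "finb N" "finb N'" "wconv M N F" "wconv M N' F" "F ~= bot"
 shows "N = N'" using assms by (intro finb_eqI) (auto simp: wconv_def tendsto_unique)

context jump_setting begin

text \<open>A function from \<open>tight_test\<close> with tiny \<open>Gam\<close> is 1 on a ball
  that carries most of \<open>x\<close>. By the Holder estimate its integral hardly moves along the
  curve, so most of the mass stays in its support, uniformly over all curves with the same start and
  energy bound.\<close>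

lemma curve_tight:
 assumes P: "x : PM" and C: "C >= 0" and e: "e > 0"
 obtains R where "!!mu t. wcurve 0 1 mu ==> mu 0 = x ==> energy 0 1 mu <= ennreal C ==> t : {0..1} ==>
  measure (mu t) (cball 0 R) > 1 - e"
proof -
 have "eventually (%n. (LINT y|x. cutoff (real (Suc n)) y) > 1 - e/2) sequentially" using cutoff_integral_tendsto[OF PM_fb[OF P]] e
  by (intro order_tendstoD) (auto simp: PM_mass[OF P])
 hence "EX n. (LINT y|x. cutoff (real (Suc n)) y) > 1 - e/2" by (rule eventually_happens'[OF sequentially_bot])
 then obtain n where n: "(LINT y|x. cutoff (real (Suc n)) y) > 1 - e/2" ..
 define R0 where "R0 = 2 * real (Suc n)"
 \<comment> \<open>The Holder bound \<open>C * eps / 2\<close> for the squared increment has to stay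
   below \<open>(e/2)^2\<close>.\<close>
 define eps where "eps = e^2 / (4 * (C + 1))"
 have eps: "eps > 0" "C * eps / 2 < (e/2)^2"
 proof -
  show "eps > 0" using e C by (simp add: eps_def)
  have "C * eps <= (C + 1) * eps" using `eps > 0` by simp
  also have "... = e^2 / 4"
  proof -
   have "z * (y / (4 * z)) = y / 4" if "z ~= 0" for y z :: real using that by simp
   thus ?thesis unfolding eps_def using C by (metis add_nonneg_eq_0_iff zero_le_one zero_neq_one)
  qed
  finally have "C * eps / 2 <= e^2 / 8" by simp
  also have "... < (e/2)^2" using e by (simp add: power2_eq_square)
  finally show "C * eps / 2 < (e/2)^2" .
 qed
 obtain phi where phi: "Ccs phi" "!!x. 0 <= phi x" "!!x. phi x <= 1" "!!x. norm x <= R0 ==> phi x = 1"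
  "!!mu. mu : PM ==> Gam mu phi <= eps" by (rule tight_test[OF eps(1)]) blast
 obtain R where R: "!!x. norm x > R ==> phi x = 0" using phi unfolding Ccs_alt by auto
 have [measurable]: "phi : bm borel" using phi by simp
 have i: "integrable mu phi" if "mu : PM" for mu by (rule finb_integrable[OF PM_fb[OF that], of _ 1]) (simp_all add: phi)
 show ?thesis
 proof (rule that[of R])
  fix mu and t :: real assume w: "wcurve 0 1 mu" and x: "mu 0 = x" and E: "energy 0 1 mu <= ennreal C" and t: "t : {0..1}"
  have Pt: "mu t : PM" using wcurveD(1)[OF w t] .
  have "((LINT y|mu t. phi y) - (LINT y|mu 0. phi y))^2 <= C * (eps * (t - 0)) / 2"
   by (rule energy_holder[OF w E C phi(1)]) (use t phi(5) wcurveD[OF w] eps in auto)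
  also have "... <= C * eps / 2" using t C eps by (simp add: mult_left_mono)
  also have "... < (e/2)^2" by (rule eps)
  finally have "abs ((LINT y|mu t. phi y) - (LINT y|mu 0. phi y))^2 < (e/2)^2" by simp
  hence "abs ((LINT y|mu t. phi y) - (LINT y|mu 0. phi y)) < e/2" by (rule power2_less_imp_less) (use e in simp)
  hence d: "(LINT y|mu t. phi y) > (LINT y|x. phi y) - e/2" unfolding x by linarith
  have "(LINT y|x. cutoff (real (Suc n)) y) <= (LINT y|x. phi y)"
  proof (rule integral_mono[OF _ i[OF P]])
   show "integrable x (cutoff (real (Suc n)))" by (rule finb_integrable[OF PM_fb[OF P] Ccs_measurable[OF Ccs_cutoff], of _ 1])
     (simp_all add: cutoff_bounds)
   show "cutoff (real (Suc n)) y <= phi y" for y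
   proof (cases "norm y <= R0")
    case True
    thus ?thesis using phi cutoff_bounds by simp
   next
    case False
    hence "cutoff (real (Suc n)) y = 0" unfolding R0_def by (intro cutoff_eq_0) auto
    thus ?thesis using phi by simp
   qed
  qed
  moreover have "(LINT y|mu t. phi y) <= (LINT y|mu t. indicator (cball 0 R) y)"
  proof (rule integral_mono[OF i[OF Pt]])
   show "integrable (mu t) (indicator (cball 0 R) :: 'a => real)" by (rule finb_integrable[OF PM_fb[OF Pt]]) (auto simp: borel_measurable_indicator)
   show "phi y <= indicator (cball 0 R) y" for y using phi R[of y] by force
  qed
  ultimately show "measure (mu t) (cball 0 R) > 1 - e" using d n using finb_space[OF PM_fb[OF Pt]] by simp
 qed
qed

lemma curve_holder:
 assumes phi: "Ccs phi" and C: "C >= 0"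
 obtains Q where "Q >= 0" "!!mu s t. wcurve 0 1 mu ==> energy 0 1 mu <= ennreal C ==> s : {0..1} ==> t : {0..1} ==>
  ((LINT x|mu t. phi x) - (LINT x|mu s. phi x))^2 <= Q * abs (t - s)"
proof -
 obtain B where B: "B >= 0" "!!mu. mu : PM ==> Gam mu phi <= B" by (rule Gam_bounded[OF phi]) blast
 show ?thesis
 proof (rule that[of "C * B / 2"])
  show "C * B / 2 >= 0" using C B by simp
  fix mu and s t :: real assume w: "wcurve 0 1 mu" and E: "energy 0 1 mu <= ennreal C" and st: "s : {0..1}" "t : {0..1}"
  have le: "((LINT x|mu t. phi x) - (LINT x|mu s. phi x))^2 <= C * (B * (t - s)) / 2" if "s <= t" "s : {0..1}" "t : {0..1}" for s t
   by (rule energy_holder[OF w E C phi]) (use that B wcurveD[OF w] in auto)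
  show "((LINT x|mu t. phi x) - (LINT x|mu s. phi x))^2 <= C * B / 2 * abs (t - s)"
  proof (cases "s <= t")
   case True
   thus ?thesis using le[OF True st] by simp
  next
   case False
   thus ?thesis using le[of t s] st by (simp add: power2_commute)
  qed
 qed
qed

lemma wconv_prob_testI:
 assumes "!!n. M n : PM" "N : PM"
  "!!phi. Ccs phi ==> ((%n. LINT x|M n. phi x) ---> (LINT x|N. phi x)) F"
 shows "wconv M N F" by (rule wconv_testI) (use assms in \<open>auto simp: PM_fb PM_mass\<close>)

lemma wconv_Cc: "wconv M N F ==> Ccs phi ==> ((%n. LINT x|M n. phi x) ---> (LINT x|N. phi x)) F"
proof -
 assume w: "wconv M N F" and phi: "Ccs phi"
 obtain C where C: "C >= 0" "!!x. abs (phi x) <= C" by (rule Ccs_bounds[OF phi]) blast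
 hence "bounded (range phi)" unfolding bdd_iff by auto
 thus ?thesis using w Ccs_continuous[OF phi] unfolding wconv_def by simp
qed

lemma abs_le_of_sq: "(D::real)^2 <= q ==> abs D <= sqrt q" using real_le_rsqrt by simp

text \<open>Prokhorov's theorem at rational times and a diagonal subsequence make the test integrals
  converge there; the uniform Holder estimate extends the convergence to every time. At each time
  Prokhorov's theorem is used again to produce the limit measure; since the test integrals already
  converge, the whole diagonal sequence tends to it.\<close>

lemma curve_pointwise_limit:
 assumes P: "x : PM" and C: "C >= 0"
  and w: "!!n. wcurve 0 1 (mu n)" and x: "!!n. mu n 0 = x" and E: "!!n. energy 0 1 (mu n) <= ennreal C"
 obtains r nu where "strict_mono (r :: nat => nat)" "wcurve 0 1 nu"
  "!!t. t : {0..1} ==> wconv (%n. mu (r n) t) (nu t) sequentially"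
proof -
 have Pn: "mu n t : PM" if "t : {0..1}" for n t using wcurveD(1)[OF w that] .
 have tight: "EX R. ALL n. measure (mu (s n) t) (cball 0 R) > 1 - e" if "e > 0" "t : {0..1}" for e t and s :: "nat => nat"
 proof -
  obtain R where R: "!!mu t. wcurve 0 1 mu ==> mu 0 = x ==> energy 0 1 mu <= ennreal C ==> t : {0..1} ==>
   measure (mu t) (cball 0 R) > 1 - e" by (rule curve_tight[OF P C `e > 0`]) blast
  show ?thesis by (intro exI allI) (rule R[OF w x E `t : {0..1}`])
 qed
 define q where "q = from_nat_into (\<rat> Int {0..1::real})"
 have ne: "\<rat> Int {0..1::real} ~= {}" by force
 have q01: "q k : {0..1}" for k using from_nat_into[OF ne] unfolding q_def by simp
 have q_dense: "EX k. abs (q k - t) < d" if "d > 0" "t : {0..1}" for d t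
 proof -
  have "max 0 (t - d) < min 1 (t + d)" using that by auto
  then obtain z where z: "z : \<rat>" "max 0 (t - d) < z" "z < min 1 (t + d)" using Rats_dense_in_real by blast
  moreover
  hence "abs (z - t) < d" by auto
  ultimately have "z : \<rat> Int {0..1}" by simp
  moreover have "countable (\<rat> Int {0..1::real})" using countable_rat by auto
  ultimately have "EX k. q k = z" unfolding q_def by (intro from_nat_into_surj)
  thus ?thesis using \<open>\<bar>z - t\<bar> < d\<close> by auto
 qed
 define Pr where "Pr k s \<longleftrightarrow> (ALL phi. Ccs phi --> convergent (%n. LINT x|mu (s n) (q k). phi x))" for k and s :: "nat => nat"
 interpret subseqs Pr
 proof
  fix k and s :: "nat => nat" assume "strict_mono s"
  obtain r N where r: "strict_mono r" "wconv (%n. mu (s (r n)) (q k)) N sequentially"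
  proof (rule prokhorov[of "%n. mu (s n) (q k)"])
   show "mu (s n) (q k) : PM" for n by (rule Pn[OF q01])
   show "EX R. ALL n. measure (mu (s n) (q k)) (cball 0 R) > 1 - e" if "e > 0" for e by (rule tight[OF that q01])
  qed blast
  show "EX r'. strict_mono r' & Pr k (s o r')" unfolding Pr_def using wconv_Cc[OF r(2)] using r by (auto simp: convergent_def)
 qed
 define r where "r = diagseq"
 have r: "strict_mono r" unfolding r_def by (rule subseq_diagseq)
 have rq: "convergent (%n. LINT x|mu (r n) (q k). phi x)" if phi: "Ccs phi" for phi k
 proof -
  have "Pr k (diagseq o ((+) (Suc k)))"
  proof (rule diagseq_holds)
   fix r s n assume "strict_mono (r :: nat => nat)" "Pr n s"
   thus "Pr n (s o r)" unfolding Pr_def using convergent_subseq_convergent[unfolded o_def] by auto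
  qed
  hence "convergent (%n. LINT x|mu (r (n + Suc k)) (q k). phi x)" unfolding Pr_def r_def using phi by (simp add: add.commute)
  thus ?thesis by (subst (asm) convergent_ignore_initial_segment)
 qed
 have conv: "convergent (%n. LINT x|mu (r n) t. phi x)" if phi: "Ccs phi" and t: "t : {0..1}" for phi t
 proof -
  obtain Q where Q: "Q >= 0" "!!mu s t. wcurve 0 1 mu ==> energy 0 1 mu <= ennreal C ==> s : {0..1} ==> t : {0..1} ==>
   ((LINT x|mu t. phi x) - (LINT x|mu s. phi x))^2 <= Q * abs (t - s)" by (rule curve_holder[OF phi C]) blast
  have "Cauchy (%n. LINT x|mu (r n) t. phi x)"
  proof (rule metric_CauchyI)
   fix e :: real assume e: "e > 0"
   define d where "d = (e/4)^2 / (Q + 1)"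
   have d: "d > 0" using e Q by (simp add: d_def)
   obtain k where k: "abs (q k - t) < d" using q_dense[OF d t] by auto
   have "Q * abs (t - q k) <= (Q + 1) * d" using k Q by (intro mult_mono) auto
   also have "... = (e/4)^2" using Q by (simp add: d_def)
   finally have Qd: "Q * abs (t - q k) <= (e/4)^2" .
   have near: "abs ((LINT x|mu n t. phi x) - (LINT x|mu n (q k). phi x)) <= e/4" for n
    using abs_le_of_sq[OF order_trans[OF Q(2)[OF w E q01 t] Qd]] e by simp
   obtain N where N: "!!m n. m >= N ==> n >= N ==> dist (LINT x|mu (r m) (q k). phi x) (LINT x|mu (r n) (q k). phi x) < e/4"
    using metric_CauchyD[OF convergent_Cauchy[OF rq[OF phi, of k]], of "e/4"] e by auto
   show "EX M. ALL m>=M. ALL n>=M. dist (LINT x|mu (r m) t. phi x) (LINT x|mu (r n) t. phi x) < e"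
   proof (intro exI[of _ N] allI impI)
    fix m n assume mn: "m >= N" "n >= N"
    show "dist (LINT x|mu (r m) t. phi x) (LINT x|mu (r n) t. phi x) < e"
     using near[of "r m"] near[of "r n"] N[OF mn] unfolding dist_real_def by linarith
   qed
  qed
  thus ?thesis by (simp add: Cauchy_convergent_iff)
 qed
 have ex: "EX N. N : PM & wconv (%n. mu (r n) t) N sequentially" if t: "t : {0..1}" for t
 proof -
  obtain r' N where r': "strict_mono r'" "N : PM" "wconv (%n. mu (r (r' n)) t) N sequentially"
  proof (rule prokhorov[of "%n. mu (r n) t"])
   show "mu (r n) t : PM" for n by (rule Pn[OF t])
   show "EX R. ALL n. measure (mu (r n) t) (cball 0 R) > 1 - e" if "e > 0" for e by (rule tight[OF that t])
  qed blast
  have "wconv (%n. mu (r n) t) N sequentially"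
  proof (rule wconv_prob_testI[OF Pn[OF t] r'(2)])
   fix phi :: "'a => real" assume phi: "Ccs phi"
   obtain L where L: "(%n. LINT x|mu (r n) t. phi x) ----> L" using conv[OF phi t] unfolding convergent_def by auto
   from LIMSEQ_subseq_LIMSEQ[OF L r'(1)] have "(%n. LINT x|mu (r (r' n)) t. phi x) ----> L" by (simp add: o_def)
   with wconv_Cc[OF r'(3) phi] show "(%n. LINT x|mu (r n) t. phi x) ----> (LINT x|N. phi x)" using LIMSEQ_unique using L by auto
  qed
  thus ?thesis using r' by auto
 qed
 define nu where "nu t = (SOME N. N : PM & wconv (%n. mu (r n) t) N sequentially)" for t
 have nu: "nu t : PM" "wconv (%n. mu (r n) t) (nu t) sequentially" if "t : {0..1}" for t using someI_ex[OF ex[OF that]] unfolding nu_def by auto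
 have "wcurve 0 1 nu" unfolding wcurve_def
 proof (intro conjI ballI allI impI)
  fix phi :: "'a => real" assume phi: "Ccs phi"
  obtain Q where Q: "Q >= 0" "!!mu s t. wcurve 0 1 mu ==> energy 0 1 mu <= ennreal C ==> s : {0..1} ==> t : {0..1} ==>
   ((LINT x|mu t. phi x) - (LINT x|mu s. phi x))^2 <= Q * abs (t - s)" by (rule curve_holder[OF phi C]) blast
  have le: "((LINT x|nu t. phi x) - (LINT x|nu s. phi x))^2 <= Q * abs (t - s)" if "s : {0..1}" "t : {0..1}" for s t
  proof (rule tendsto_upperbound)
   show "(%n. ((LINT x|mu (r n) t. phi x) - (LINT x|mu (r n) s. phi x))^2) ----> ((LINT x|nu t. phi x) - (LINT x|nu s. phi x))^2"
    by (intro tendsto_intros wconv_Cc[OF nu(2) phi] that)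
   show "\<forall>\<^sub>F n in sequentially. ((LINT x|mu (r n) t. phi x) - (LINT x|mu (r n) s. phi x))^2 <= Q * abs (t - s)"
    by (intro always_eventually allI Q(2)[OF w E that])
  qed simp
  show "continuous_on {0..1} (%t. LINT x|nu t. phi x)"
  proof (rule continuous_on_eq_continuous_within[THEN iffD2], rule ballI)
   fix s :: real assume s: "s : {0..1}"
   have "((%t. (LINT x|nu t. phi x) - (LINT x|nu s. phi x)) ---> 0) (at s within {0..1})"
   proof (rule Lim_null_comparison)
    show "\<forall>\<^sub>F t in at s within {0..1}. norm ((LINT x|nu t. phi x) - (LINT x|nu s. phi x)) <= sqrt (Q * abs (t - s))"
     using abs_le_of_sq[OF le[OF s]] by (auto simp: eventually_at_filter)
    have "((%t. sqrt (Q * abs (t - s))) ---> sqrt (Q * abs (s - s))) (at s within {0..1})" by (intro tendsto_intros)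
    thus "((%t. sqrt (Q * abs (t - s))) ---> 0) (at s within {0..1})" by simp
   qed
   thus "continuous (at s within {0..1}) (%t. LINT x|nu t. phi x)" unfolding continuous_within by (rule LIM_zero_cancel)
  qed
 qed (rule nu(1))
 thus ?thesis using that[OF r _ nu(2)] by simp
qed

text \<open>For a fixed list the linear part converges, while the quadratic part is only upper
  semicontinuous; it enters with a minus sign, so this is the right direction.\<close>

lemma energy_lsc:
 assumes w: "!!n. wcurve 0 1 (mu n)" and w': "wcurve 0 1 nu"
  and conv: "!!t. t : {0..1} ==> wconv (%n. mu n t) (nu t) sequentially"
  and E: "!!n. energy 0 1 (mu n) <= ennreal (c n)" and c: "c ----> c'" "!!n. c n >= 0"
 shows "energy 0 1 nu <= ennreal c'"
proof (rule energy_least, rule ennreal_leI)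
 fix l assume l: "l : tests 0 1"
 have L: "(%n. Lf l (mu n)) ----> Lf l nu" using l
 proof (induction l)
  case (Cons q l)
  obtain s t phi where q: "q = (s, t, phi)" by (cases q)
  show ?case using Cons unfolding q by (auto intro!: tendsto_intros wconv_Cc[OF conv])
 qed simp
 obtain B where B: "B >= 0" "!!mu r. mu : PM ==> Gam mu (active l r) <= B" by (rule Gam_active_bound[OF l]) blast
 let ?G = "%mu r. I01 r * Gam (mu r) (active l r)"
 have [measurable]: "?G (mu n) : bm lborel" "?G nu : bm lborel" for n using Gam_active_measurable[OF w l] Gam_active_measurable[OF w' l] by auto
 \<comment> \<open>Upper semicontinuity says that the positive part of the excess tends to 0 at
   every time. It is bounded by a constant on [0,1], so dominated convergence applies to it, though
   the integrands themselves need not converge.\<close>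
 define h where "h n r = max 0 (?G (mu n) r - ?G nu r)" for n r
 have "(%n. LINT r|lborel. h n r) ----> (\<integral>r. 0 \<partial>(lborel :: real measure))"
 proof (rule integral_dominated_convergence[where w="%r. I01 r * B"])
  show "integrable lborel (%r::real. I01 r * B)" by simp
  show "h n : bm lborel" for n unfolding h_def by simp
  show "AE r in lborel. (%n. h n r) ----> 0"
  proof (rule AE_I2)
   fix r :: real
   show "(%n. h n r) ----> 0"
   proof (cases "r : {0..1}")
    case True
    show ?thesis
    proof (rule tendstoI)
     fix e :: real assume e: "e > 0"
     have "eventually (%n. Gam (mu n r) (active l r) < Gam (nu r) (active l r) + e) sequentially"
      by (rule Gam_usc[OF _ wcurveD(1)[OF w' True] conv[OF True] Ccs_active[OF l] e])
       (simp add: wcurveD(1)[OF w True])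
     thus "eventually (%n. dist (h n r) 0 < e) sequentially" by eventually_elim (use True e in \<open>simp add: h_def\<close>)
    qed
   qed (simp add: h_def)
  qed
  show "AE r in lborel. norm (h n r) <= I01 r * B" for n
  proof (rule AE_I2)
   fix r :: real
   show "norm (h n r) <= I01 r * B"
   proof (cases "r : {0..1}")
    case True
    thus ?thesis using B(2)[OF wcurveD(1)[OF w True], of n r] Gam_nonneg[of "nu r" "active l r"] B by (simp add: h_def)
   qed (simp add: h_def)
  qed
 qed simp_all
 hence h0: "(%n. LINT r|lborel. h n r) ----> 0" by simp
 have hi: "integrable lborel (h n)" for n
 proof -
  have "integrable lborel (%r. ?G (mu n) r - ?G nu r)" by (intro Bochner_Integration.integrable_diff Qf_int[OF w l] Qf_int[OF w' l])
  thus ?thesis unfolding h_def by (intro integrable_max) simp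
 qed
 have Qn: "Qf 0 1 (mu n) l <= Qf 0 1 nu l + (LINT r|lborel. h n r)" for n
 proof -
  have "Qf 0 1 (mu n) l <= (LINT r|lborel. ?G nu r + h n r)" unfolding Qf_def
  proof (rule integral_mono[OF Qf_int[OF w l]])
   show "integrable lborel (%r. ?G nu r + h n r)" by (intro Bint_add Qf_int[OF w' l] hi)
  qed (simp add: h_def)
  also have "... = Qf 0 1 nu l + (LINT r|lborel. h n r)" unfolding Qf_def by (rule Bochner_Integration.integral_add[OF Qf_int[OF w' l] hi])
  finally show ?thesis .
 qed
 have evn: "ev 0 1 (mu n) l <= c n" for n using order_trans[OF energy_upper[OF l] E] c by simp
 have le: "2 * Lf l (mu n) - (Qf 0 1 nu l + (LINT r|lborel. h n r)) / 2 <= c n" for n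
 proof -
  have gen: "2 * L - Q / 2 <= C ==> Q <= q + h ==> 2 * L - (q + h) / 2 <= C" for L Q C q h :: real by (simp add: field_simps)
  show ?thesis by (rule gen[OF evn[unfolded ev_def] Qn])
 qed
 have "2 * Lf l nu - (Qf 0 1 nu l + 0) / 2 <= c'"
 proof (rule LIMSEQ_le)
  show "(%n. 2 * Lf l (mu n) - (Qf 0 1 nu l + (LINT r|lborel. h n r)) / 2) ----> 2 * Lf l nu - (Qf 0 1 nu l + 0) / 2"
   by (intro tendsto_intros L h0) simp
  show "c ----> c'" by (rule c)
  show "EX N. ALL n>=N. 2 * Lf l (mu n) - (Qf 0 1 nu l + (LINT r|lborel. h n r)) / 2 <= c n" using le by simp
 qed
 thus "ev 0 1 nu l <= c'" by (simp add: ev_def)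
qed

end

section \<open>The energy distance\<close>

text \<open>Equality in the Cauchy-Schwarz inequality forces proportionality, by Lagrange's
  identity. It is used with square roots of durations and of energies of three consecutive pieces of
  a minimiser.\<close>

lemma lagrange_equality:
 fixes p1 p2 p3 q1 q2 q3 :: real
 assumes "p1^2 + p2^2 + p3^2 = 1" "q1^2 + q2^2 + q3^2 <= (p1 * q1 + p2 * q2 + p3 * q3)^2"
 shows "q2^2 = p2^2 * (q1^2 + q2^2 + q3^2)"
proof -
 have id: "(p1^2 + p2^2 + p3^2) * (q1^2 + q2^2 + q3^2) =
  (p1 * q1 + p2 * q2 + p3 * q3)^2 + ((p1 * q2 - p2 * q1)^2 + (p1 * q3 - p3 * q1)^2 + (p2 * q3 - p3 * q2)^2)"
  by (simp add: power2_eq_square algebra_simps)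
 hence "(p1 * q2 - p2 * q1)^2 + (p1 * q3 - p3 * q1)^2 + (p2 * q3 - p3 * q2)^2 <= 0" using assms by simp
 hence "(p1 * q2 - p2 * q1)^2 <= 0" "(p2 * q3 - p3 * q2)^2 <= 0"
  using zero_le_power2[of "p1 * q2 - p2 * q1"] zero_le_power2[of "p1 * q3 - p3 * q1"] zero_le_power2[of "p2 * q3 - p3 * q2"] by linarith+
 hence e: "p1 * q2 = p2 * q1" "p2 * q3 = p3 * q2" by auto
 have "p2^2 * (q1^2 + q2^2 + q3^2) = (p2 * q1)^2 + p2^2 * q2^2 + (p2 * q3)^2" by (simp add: algebra_simps)
 also have "... = (p1 * q2)^2 + p2^2 * q2^2 + (p3 * q2)^2" by (simp only: e)
 also have "... = (p1^2 + p2^2 + p3^2) * q2^2" by (simp add: algebra_simps)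
 finally show ?thesis using assms by simp
qed

lemma ennreal_sqrt_le_iff: "a >= 0 ==> ennreal_sqrt x <= ennreal a \<longleftrightarrow> x <= ennreal (a^2)"
proof (cases x rule: ennreal_cases)
 case (real r)
 assume "a >= 0"
 thus ?thesis using real by (auto simp: ennreal_sqrt_def real_le_lsqrt sqrt_le_D)
qed (simp add: ennreal_sqrt_def top_unique)

lemma ennreal_sqrt_real: "r >= 0 ==> ennreal_sqrt (ennreal r) = ennreal (sqrt r)" by (simp add: ennreal_sqrt_def)

lemma ennreal_sqrt_eq_top: "ennreal_sqrt x = infty \<longleftrightarrow> x = infty" by (simp add: ennreal_sqrt_def)

lemma ennreal_sqrt_eq_0: "ennreal_sqrt x = 0 \<longleftrightarrow> x = 0" by (cases rule: ennreal_cases) (auto simp: ennreal_sqrt_def)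

context jump_setting begin

definition curves :: "'a measure => 'a measure => (real => 'a measure) set" where
 "curves x y = {mu. wcurve 0 1 mu & mu 0 = x & mu 1 = y}"

definition E2 :: "'a measure => 'a measure => ennreal" where
 "E2 x y = (INF mu\<in>curves x y. energy 0 1 mu)"

lemma E2_le: "wcurve 0 1 mu ==> mu 0 = x ==> mu 1 = y ==> E2 x y <= energy 0 1 mu" unfolding E2_def curves_def by (rule INF_lower) simp

lemma wconv_const: "wconv (%_. x) x F" by (simp add: wconv_def)

text \<open>The end points are allowed to vary, so the same compactness statement yields the
  existence of minimisers, the lower semicontinuity of \<open>E2\<close> and the limit point in the
  proof of completeness.\<close>

lemma E2_limit_curve:
 assumes P: "x : PM" and E: "!!n. E2 x (y n) < ennreal (c n)" and c: "c ----> c'" "!!n. 0 <= c n" "!!n. c n <= C"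
 obtains r mu where "strict_mono (r :: nat => nat)" "wcurve 0 1 mu" "mu 0 = x" "wconv (%n. y (r n)) (mu 1) sequentially"
  "energy 0 1 mu <= ennreal c'"
proof -
 have "EX mu. wcurve 0 1 mu & mu 0 = x & mu 1 = y n & energy 0 1 mu <= ennreal (c n)" for n
  using E[of n] unfolding E2_def INF_less_iff curves_def by auto
 from choice[OF allI[OF this]] obtain m where
  m: "ALL n. wcurve 0 1 (m n) & m n 0 = x & m n 1 = y n & energy 0 1 (m n) <= ennreal (c n)" ..
 have mw: "wcurve 0 1 (m n)" and m0: "m n 0 = x" and m1: "m n 1 = y n" and mE: "energy 0 1 (m n) <= ennreal (c n)" for n using m by auto
 have C: "C >= 0" using c(2,3)[of 0] by simp
 have mC: "energy 0 1 (m n) <= ennreal C" for n by (rule order_trans[OF mE ennreal_leI[OF c(3)]])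
 obtain r mu where r: "strict_mono (r :: nat => nat)" "wcurve 0 1 mu"
  "!!t. t : {0..1} ==> wconv (%n. m (r n) t) (mu t) sequentially" by (rule curve_pointwise_limit[where mu = m, OF P C mw m0 mC]) blast
 have "mu 0 = x"
 proof (rule wconv_unique)
  show "finb (mu 0)" using wcurveD[OF r(2)] by (simp add: PM_fb)
  show "finb x" using P by (rule PM_fb)
  show "wconv (%n. m (r n) 0) (mu 0) sequentially" by (rule r) simp
  show "wconv (%n. m (r n) 0) x sequentially" by (simp add: m0 wconv_const)
 qed simp
 moreover have "wconv (%n. y (r n)) (mu 1) sequentially" using r(3)[of 1] by (simp add: m1)
 moreover have "energy 0 1 mu <= ennreal c'" by (rule energy_lsc[where mu = "%n. m (r n)" and c = "%n. c (r n)", OF mw r(2) r(3) mE])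
   (use LIMSEQ_subseq_LIMSEQ[OF c(1) r(1)] c in \<open>auto simp: o_def\<close>)
 ultimately show ?thesis by (intro that[OF r(1,2)])
qed

lemma E2_attained:
 assumes P: "x : PM" "y : PM" and fin: "E2 x y < infty"
 obtains mu where "wcurve 0 1 mu" "mu 0 = x" "mu 1 = y" "energy 0 1 mu = E2 x y"
proof -
 define e where "e = enn2real (E2 x y)"
 have e: "E2 x y = ennreal e" "e >= 0" using fin by (simp_all add: e_def)
 define c where "c n = e + inverse (real (Suc n))" for n
 have c: "c ----> e" unfolding c_def using tendsto_add[OF tendsto_const LIMSEQ_inverse_real_of_nat] by simp
 have c0: "0 <= c n" "c n <= e + 1" "e < c n" for n using e by (simp_all add: c_def inverse_le_1_iff)
 have El: "E2 x y < ennreal (c n)" for n using c0 e by (simp add: ennreal_less_iff)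
 obtain r mu where r: "strict_mono (r :: nat => nat)" "wcurve 0 1 mu" "mu 0 = x" "wconv (%n. y) (mu 1) sequentially"
  "energy 0 1 mu <= ennreal e" by (rule E2_limit_curve[OF P(1) El c c0(1,2)])
 have "mu 1 = y"
 proof (rule wconv_unique)
  show "finb (mu 1)" using wcurveD[OF r(2)] by (simp add: PM_fb)
  show "finb y" using P(2) by (rule PM_fb)
  show "wconv (%n. y) (mu 1) sequentially" by (rule r)
  show "wconv (%n. y) y sequentially" by (rule wconv_const)
 qed simp
 moreover have "energy 0 1 mu = E2 x y" using r E2_le[OF r(2,3) `mu 1 = y`] by (simp add: e)
 ultimately show ?thesis by (intro that[OF r(2,3)])
qed

lemma E2_lsc:
 assumes P: "x : PM" and E: "!!n. E2 x (y n) <= ennreal c" "c >= 0" and y: "z : PM" "wconv y z sequentially"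
 shows "E2 x z <= ennreal c"
proof -
 define d where "d n = c + inverse (real (Suc n))" for n
 have d: "d ----> c" unfolding d_def using tendsto_add[OF tendsto_const LIMSEQ_inverse_real_of_nat] by simp
 have d0: "0 <= d n" "d n <= c + 1" "c < d n" for n using E by (simp_all add: d_def inverse_le_1_iff)
 have El: "E2 x (y n) < ennreal (d n)" for n by (rule le_less_trans[OF E(1)]) (use d0 E in \<open>simp add: ennreal_less_iff\<close>)
 obtain r mu where r: "strict_mono (r :: nat => nat)" "wcurve 0 1 mu" "mu 0 = x" "wconv (%n. y (r n)) (mu 1) sequentially"
  "energy 0 1 mu <= ennreal c" by (rule E2_limit_curve[OF P El d d0(1,2)])
 have "mu 1 = z"
 proof (rule wconv_unique)
  show "finb (mu 1)" using wcurveD[OF r(2)] by (simp add: PM_fb)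
  show "finb z" using y(1) by (rule PM_fb)
  show "wconv (%n. y (r n)) (mu 1) sequentially" by (rule r)
  show "wconv (%n. y (r n)) z sequentially" by (rule wconv_subseq[OF y(2) r(1)])
 qed simp
 hence "E2 x z <= energy 0 1 mu" using r by (intro E2_le)
 thus ?thesis using r by simp
qed

lemma E2_sym: "E2 x y = E2 y x"
proof -
 have "E2 y x <= E2 x y" for x y unfolding E2_def[of x y]
 proof (rule INF_greatest)
  fix mu assume "mu : curves x y"
  hence mu: "wcurve 0 1 mu" "mu 0 = x" "mu 1 = y" by (auto simp: curves_def)
  have "E2 y x <= energy 0 1 (%r. mu (1 - r))" using mu by (intro E2_le wcurve_reverse) auto
  also have "... <= energy 0 1 mu" by (rule energy_reverse_le[OF mu(1)])
  finally show "E2 y x <= energy 0 1 mu" .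
 qed
 thus ?thesis by (intro antisym)
qed

lemma E2_refl: assumes "x : PM" shows "E2 x x = 0"
proof -
 have w: "wcurve 0 1 (%_. x)" using assms by (simp add: wcurve_def)
 have L: "Lf l (%_. x) = 0" for l by (induction "%_::real. x" rule: Lf.induct) auto
 have "energy 0 1 (%_. x) <= 0" by (rule energy_least) (simp add: ev_def L Qf_nonneg ennreal_neg)
 moreover have "E2 x x <= energy 0 1 (%_. x)" by (rule E2_le[OF w]) simp_all
 ultimately show ?thesis by simp
qed

text \<open>The Holder estimate along a minimiser from time 0 to time 1. As the distance controls
  all smooth test integrals, both definiteness and the comparison with the weak topology
  follow.\<close>

lemma E2_test:
 assumes "Ccs phi"
 obtains Q where "Q >= 0" "!!x y e. x : PM ==> y : PM ==> e >= 0 ==> E2 x y <= ennreal e ==>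
  ((LINT z|y. phi z) - (LINT z|x. phi z))^2 <= Q * e"
proof -
 obtain B where B: "B >= 0" "!!mu. mu : PM ==> Gam mu phi <= B" by (rule Gam_bounded[OF assms]) blast
 show ?thesis
 proof (rule that[of "B / 2"])
  show "B / 2 >= 0" using B by simp
  fix x y :: "'a measure" and e :: real
  assume P: "x : PM" "y : PM" and e: "e >= 0" "E2 x y <= ennreal e"
  have "E2 x y < infty" by (rule le_less_trans[OF e(2)]) simp
  obtain mu where mu: "wcurve 0 1 mu" "mu 0 = x" "mu 1 = y" "energy 0 1 mu = E2 x y" by (rule E2_attained[OF P \<open>E2 x y < infty\<close>])
  have "((LINT z|mu 1. phi z) - (LINT z|mu 0. phi z))^2 <= e * (B * (1 - 0)) / 2"
   by (rule energy_holder[OF mu(1) _ e(1) assms]) (use mu e B wcurveD(1) in auto)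
  thus "((LINT z|y. phi z) - (LINT z|x. phi z))^2 <= B / 2 * e" by (simp add: mu mult.commute)
 qed
qed

lemma E2_eq_0:
 assumes P: "x : PM" "y : PM" and "E2 x y = 0"
 shows "x = y"
proof (rule wconv_unique)
 show "finb x" "finb y" using P by (auto intro: PM_fb)
 show "wconv (%_::nat. x) x sequentially" by (rule wconv_const)
 show "wconv (%_::nat. x) y sequentially"
 proof (rule wconv_prob_testI)
  fix phi :: "'a => real" assume phi: "Ccs phi"
  obtain Q where Q: "Q >= 0" "!!x y e. x : PM ==> y : PM ==> e >= 0 ==> E2 x y <= ennreal e ==>
   ((LINT z|y. phi z) - (LINT z|x. phi z))^2 <= Q * e" by (rule E2_test[OF phi]) blast
  have "((LINT z|y. phi z) - (LINT z|x. phi z))^2 <= Q * 0" by (rule Q) (simp_all add: assms)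
  thus "((%n. LINT z|x. phi z) ---> (LINT z|y. phi z)) sequentially" by simp
 qed (use P in auto)
qed simp

lemma E2_restrict:
 assumes w: "wcurve 0 1 mu" and st: "0 <= s" "s <= t" "t <= 1"
 shows "E2 (mu s) (mu t) <= ennreal (t - s) * energy s t mu"
proof (cases "s = t")
 case True
 moreover have "mu t : PM" by (rule wcurveD[OF w]) (use st in simp)
 ultimately show ?thesis by (simp add: E2_refl)
next
 case False
 hence c: "t - s > 0" using st by simp
 have w': "wcurve s t mu" by (rule wcurve_subset[OF w]) (use st in auto)
 have e: "(s - s) / (t - s) = 0" "(t - s) / (t - s) = 1" using c by auto
 have "E2 (mu s) (mu t) <= energy 0 1 (%r. mu ((t - s) * r + s))"
 proof (rule E2_le)
  show "wcurve 0 1 (%r. mu ((t - s) * r + s))" by (rule wcurve_affine[OF w' c, of s, unfolded e])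
 qed simp_all
 also have "... <= ennreal (t - s) * energy s t mu" by (rule energy_affine_le[OF w' c, of s, unfolded e])
 finally show ?thesis .
qed

lemma E2_concat:
 assumes w1: "wcurve 0 1 mu1" "mu1 0 = x" "mu1 1 = y" and w2: "wcurve 0 1 mu2" "mu2 0 = y" "mu2 1 = z"
  and l: "0 < l" "l < 1"
 shows "E2 x z <= ennreal (1 / l) * energy 0 1 mu1 + ennreal (1 / (1 - l)) * energy 0 1 mu2"
proof -
 let ?c = "1 / (1 - l)" and ?d = "- l / (1 - l)"
 define m1 where "m1 r = mu1 (1 / l * r + 0)" for r
 define m2 where "m2 r = mu2 (?c * r + ?d)" for r
 define mu where "mu r = (if r <= l then m1 r else m2 r)" for r
 have c: "1 / l > 0" "?c > 0" using l by auto
 have e2: "(0 - ?d) / ?c = l" "(1 - ?d) / ?c = 1" using l by (auto simp: field_simps)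
 have W1: "wcurve 0 l m1" and En1: "energy 0 l m1 <= ennreal (1 / l) * energy 0 1 mu1"
  unfolding m1_def using wcurve_affine[OF w1(1) c(1), of 0] energy_affine_le[OF w1(1) c(1), of 0] by auto
 have W2: "wcurve l 1 m2" and En2: "energy l 1 m2 <= ennreal ?c * energy 0 1 mu2"
  unfolding m2_def using wcurve_affine[OF w2(1) c(2), of ?d] energy_affine_le[OF w2(1) c(2), of ?d] by (simp_all only: e2)
 have ml: "m1 l = y" "m2 l = y" "m1 0 = x" "m2 1 = z"
 proof -
  show "m1 l = y" "m2 l = y" "m1 0 = x" "m2 1 = z" using l unfolding m1_def m2_def using w1 w2 by (auto simp: field_simps)
 qed
 have c1: "m1 r = mu r" if "r : {0..l}" for r using that by (simp add: mu_def)
 have c2: "m2 r = mu r" if "r : {l..1}" for r using that ml by (cases "r = l") (simp_all add: mu_def)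
 have W1': "wcurve 0 l mu" by (rule wcurve_cong[OF c1 W1])
 have W2': "wcurve l 1 mu" by (rule wcurve_cong[OF c2 W2])
 have un: "{0..1} = {0..l} Un {l..1}" using l by auto
 have W: "wcurve 0 1 mu" unfolding wcurve_def
 proof (intro conjI ballI allI impI)
  fix t assume "t : {0..1::real}"
  then consider "t : {0..l}" | "t : {l..1}" by force
  thus "mu t : PM" using wcurveD(1)[OF W1'] wcurveD[OF W2'] by blast
 next
  fix phi :: "'a => real" assume phi: "Ccs phi"
  show "continuous_on {0..1} (%t. LINT x|mu t. phi x)"
   unfolding un by (rule continuous_on_closed_Un) (simp_all add: wcurveD(2)[OF W1' phi] wcurveD(2)[OF W2' phi])
 qed
 have "E2 x z <= energy 0 1 mu"
 proof (rule E2_le[OF W])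
  show "mu 0 = x" using c1 l ml by simp
  show "mu 1 = z" using c2 l ml by simp
 qed
 also have "... <= energy 0 l mu + energy l 1 mu" using l by (intro energy_split_le[OF W]) auto
 also have "energy 0 l mu = energy 0 l m1" by (rule energy_cong) (simp add: c1)
 also have "energy l 1 mu = energy l 1 m2" by (rule energy_cong) (simp add: c2)
 also have "energy 0 l m1 + energy l 1 m2 <= ennreal (1 / l) * energy 0 1 mu1 + ennreal ?c * energy 0 1 mu2" by (rule add_mono[OF En1 En2])
 finally show ?thesis .
qed

section \<open>Triangle inequality, comparison of topologies, geodesics and completeness\<close>

definition dW :: "'a measure => 'a measure => ennreal" where "dW x y = ennreal_sqrt (E2 x y)"

lemma dW_sym: "dW x y = dW y x" by (simp add: dW_def E2_sym)

lemma dW_refl: "x : PM ==> dW x x = 0" by (simp add: dW_def E2_refl ennreal_sqrt_eq_0)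

lemma dW_eq_0: "x : PM ==> y : PM ==> dW x y = 0 ==> x = y" by (simp add: dW_def ennreal_sqrt_eq_0 E2_eq_0)

lemma dW_real:
 assumes "dW x y < infty"
 obtains a where "a >= 0" "dW x y = ennreal a" "E2 x y = ennreal (a^2)"
proof -
 have "E2 x y ~= infty"
 proof
  assume "E2 x y = infty"
  hence "dW x y = infty" by (simp only: dW_def ennreal_sqrt_eq_top)
  with assms show False by simp
 qed
 define e where "e = enn2real (E2 x y)"
 hence e: "E2 x y = ennreal e" "e >= 0" using \<open>E2 x y ~= infty\<close> by (simp_all add: less_top)
 show ?thesis by (rule that[of "sqrt e"]) (use e in \<open>simp_all add: dW_def ennreal_sqrt_real\<close>)
qed

lemma dW_le_iff: "a >= 0 ==> dW x y <= ennreal a \<longleftrightarrow> E2 x y <= ennreal (a^2)" unfolding dW_def by (rule ennreal_sqrt_le_iff)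

lemma dW_triangle:
 assumes P: "x : PM" "y : PM" "z : PM"
 shows "dW x z <= dW x y + dW y z"
proof (cases "dW x y < infty & dW y z < infty")
 case False
 hence "dW x y + dW y z = infty" by (simp add: less_top[symmetric])
 thus ?thesis by auto
next
 case True
 obtain a where a: "a >= 0" "dW x y = ennreal a" "E2 x y = ennreal (a^2)" by (rule dW_real[OF conjunct1[OF True]])
 obtain b where b: "b >= 0" "dW y z = ennreal b" "E2 y z = ennreal (b^2)" by (rule dW_real[OF conjunct2[OF True]])
 have fin: "E2 x y < infty" "E2 y z < infty" using a b by auto
 obtain mu1 where mu1: "wcurve 0 1 mu1" "mu1 0 = x" "mu1 1 = y" "energy 0 1 mu1 = E2 x y" by (rule E2_attained[OF P(1,2) fin(1)])
 obtain mu2 where mu2: "wcurve 0 1 mu2" "mu2 0 = y" "mu2 1 = z" "energy 0 1 mu2 = E2 y z" by (rule E2_attained[OF P(2,3) fin(2)])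
 have le: "dW x z <= ennreal (a + b + e)" if e: "e > 0" for e
 proof -
  \<comment> \<open>Spending a fraction \<open>l\<close> of the time on the first curve costs
    \<open>a^2 / l + b^2 / (1 - l)\<close>, which is least, with value \<open>(a + b)^2\<close>,
    when time is proportional to length. The summand \<open>e/2\<close> keeps both lengths positive,
    so that \<open>l\<close> is strictly between 0 and 1.\<close>
  define a' where "a' = a + e/2"
  define b' where "b' = b + e/2"
  have ab: "a' > 0" "b' > 0" "a' + b' = a + b + e" "a <= a'" "b <= b'" using a b e by (simp_all add: a'_def b'_def)
  define l where "l = a' / (a' + b')"
  have l: "0 < l" "l < 1" "1 / l = (a' + b') / a'" "1 / (1 - l) = (a' + b') / b'" using ab by (simp_all add: l_def field_simps)
  have "E2 x z <= ennreal (1 / l) * E2 x y + ennreal (1 / (1 - l)) * E2 y z" using E2_concat[OF mu1(1-3) mu2(1-3) l(1,2)] by (simp only: mu1 mu2)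
  also have "... = ennreal (1 / l * a^2 + 1 / (1 - l) * b^2)"
   using l(1,2) by (simp add: a b ennreal_mult[symmetric] ennreal_plus[symmetric] del: ennreal_plus)
  also have "... <= ennreal ((a + b + e)^2)"
  proof (rule ennreal_leI)
   have "1 / l * a^2 + 1 / (1 - l) * b^2 <= 1 / l * a'^2 + 1 / (1 - l) * b'^2" using l a b(1) ab(4,5) by (intro add_mono mult_left_mono) auto
   also have "... = (a' + b') * a' + (a' + b') * b'" unfolding l by (simp add: power2_eq_square)
   also have "... = (a' + b')^2" by (simp add: power2_eq_square algebra_simps)
   also have "... = (a + b + e)^2" by (simp only: ab)
   finally show "1 / l * a^2 + 1 / (1 - l) * b^2 <= (a + b + e)^2" .
  qed
  finally have "E2 x z <= ennreal ((a + b + e)^2)" .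
  moreover have "0 <= a + b + e" using a b e by simp
  ultimately show ?thesis using dW_le_iff by simp
 qed
 have "dW x z <= ennreal (a + b)"
 proof (rule ennreal_le_epsilon)
  fix e :: real assume e: "e > 0"
  show "dW x z <= ennreal (a + b) + ennreal e" using a b e using le[OF e] by simp
 qed
 thus ?thesis using a b by simp
qed

text \<open>If every radius \<open>inverse (real (Suc n))\<close> failed, the counterexamples would
  form a sequence whose smooth test integrals converge by \<open>E2_test\<close>; it would converge
  weakly to \<open>x\<close>, against the choice of \<open>V\<close>.\<close>

lemma dW_weak_nhd:
 assumes x: "x : PM" and f: "cts f" "bounded (range f)" and V: "open V" "(LINT z|x. f z) : (V :: real set)"
 obtains e where "e > 0" "!!y. y : PM ==> dW x y < e ==> (LINT z|y. f z) : V"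
proof (rule ccontr)
 assume no: "~ thesis"
 have "EX y. y : PM & dW x y < ennreal (inverse (real (Suc n))) & (LINT z|y. f z) ~: V" for n
 proof (rule ccontr)
  assume c: "~ ?thesis"
  have "thesis"
  proof (rule that)
   show "ennreal (inverse (real (Suc n))) > 0" by simp
   fix y :: "'a measure" assume "y : PM" "dW x y < ennreal (inverse (real (Suc n)))"
   thus "(LINT z|y. f z) : V" using c by simp
  qed
  with no show False ..
 qed
 from choice[OF allI[OF this]] obtain y where
  y: "ALL n. y n : PM & dW x (y n) < ennreal (inverse (real (Suc n))) & (LINT z|y n. f z) ~: V" ..
 have "wconv y x sequentially"
 proof (rule wconv_prob_testI[OF _ x])
  show "y n : PM" for n using y by simp
  fix phi :: "'a => real" assume phi: "Ccs phi"
  obtain Q where Q: "Q >= 0" "!!x y e. x : PM ==> y : PM ==> e >= 0 ==> E2 x y <= ennreal e ==>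
   ((LINT z|y. phi z) - (LINT z|x. phi z))^2 <= Q * e" by (rule E2_test[OF phi]) blast
  have "abs ((LINT z|y n. phi z) - (LINT z|x. phi z)) <= sqrt (Q * (inverse (real (Suc n)))^2)" for n
  proof (rule abs_le_of_sq, rule Q(2)[OF x])
   show "y n : PM" using y by simp
   have "dW x (y n) <= ennreal (inverse (real (Suc n)))" using spec[OF y, of n] by auto
   thus "E2 x (y n) <= ennreal ((inverse (real (Suc n)))^2)" by (rule dW_le_iff[THEN iffD1, rotated]) simp
  qed simp
  hence "ALL n. norm ((LINT z|y n. phi z) - (LINT z|x. phi z)) <= sqrt (Q * (inverse (real (Suc n)))^2)" by simp
  moreover have "(%n. sqrt (Q * (inverse (real (Suc n)))^2)) ----> sqrt (Q * 0^2)"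
   by (intro tendsto_real_sqrt tendsto_mult tendsto_const tendsto_power LIMSEQ_inverse_real_of_nat)
  ultimately have "(%n. (LINT z|y n. phi z) - (LINT z|x. phi z)) ----> 0"
   by (rule Lim_null_comparison[OF always_eventually, OF _ tendsto_eq_rhs]) simp
  thus "(%n. LINT z|y n. phi z) ----> (LINT z|x. phi z)" by (rule LIM_zero_cancel)
 qed
 hence "(%n. LINT z|y n. f z) ----> (LINT z|x. f z)" by (rule wconv_def[THEN iffD1, rule_format, OF _ f])
 from topological_tendstoD[OF this V] show False using y by simp

qed

text \<open>A minimiser has constant speed. Energy is additive and each squared distance is at most
  duration times energy, so the triangle inequality for the three pieces cut at \<open>s\<close> and
  \<open>t\<close> turns Cauchy-Schwarz into an equality. The energy on [s,t] is then
  \<open>(t - s) * a^2\<close>, which bounds the distance from above; the triangle inequality gives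
  the matching lower bound.\<close>

lemma dW_geodesic:
 assumes P: "x : PM" "y : PM" and a: "a >= 0" "dW x y = ennreal a"
 obtains mu where "wcurve 0 1 mu" "mu 0 = x" "mu 1 = y"
  "!!s t. s : {0..1} ==> t : {0..1} ==> dW (mu s) (mu t) = ennreal (abs (t - s) * a)"
proof -
 have E: "E2 x y = ennreal (a^2)"
 proof (rule dW_real[of x y])
  fix b assume "b >= 0" "dW x y = ennreal b" "E2 x y = ennreal (b^2)"
  thus ?thesis using a by simp
 qed (simp add: a)
 obtain mu where mu: "wcurve 0 1 mu" "mu 0 = x" "mu 1 = y" "energy 0 1 mu = E2 x y" by (rule E2_attained[OF P]) (simp_all add: E)
 have Pt: "mu t : PM" if "t : {0..1}" for t using wcurveD(1)[OF mu(1) that] .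
 have up: "dW (mu s) (mu t) <= ennreal ((t - s) * a)" if st: "0 <= s" "s <= t" "t <= 1" for s t
 proof -
  have w01: "wcurve 0 t mu" by (rule wcurve_subset[OF mu(1)]) (use st in auto)
  have sp: "energy 0 s mu + energy s t mu + energy t 1 mu = ennreal (a^2)"
  proof -
   have "energy 0 1 mu = energy 0 t mu + energy t 1 mu" using st by (intro antisym energy_split_le[OF mu(1)] energy_split_ge[OF mu(1)]) auto
   moreover have "energy 0 t mu = energy 0 s mu + energy s t mu" using st by (intro antisym energy_split_le[OF w01] energy_split_ge[OF w01])
   ultimately show ?thesis using mu E by simp
  qed
  have "energy 0 s mu ~= infty" "energy s t mu ~= infty" "energy t 1 mu ~= infty" using arg_cong[OF sp, of "%z. z = infty"] by auto
  define e1 e2 e3 where "e1 = enn2real (energy 0 s mu)" and "e2 = enn2real (energy s t mu)" and "e3 = enn2real (energy t 1 mu)"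
  hence e: "energy 0 s mu = ennreal e1" "e1 >= 0" "energy s t mu = ennreal e2" "e2 >= 0" "energy t 1 mu = ennreal e3" "e3 >= 0"
   using \<open>energy 0 s mu ~= infty\<close> \<open>energy s t mu ~= infty\<close> \<open>energy t 1 mu ~= infty\<close> by (simp_all add: less_top)
  have es: "e1 + e2 + e3 = a^2" using sp e by (simp add: ennreal_plus[symmetric] del: ennreal_plus)
  have leg: "dW (mu u) (mu v) <= ennreal (sqrt (v - u) * sqrt q)"
   if "0 <= u" "u <= v" "v <= 1" "energy u v mu = ennreal q" "q >= 0" for u v q
  proof -
   have "E2 (mu u) (mu v) <= ennreal (v - u) * ennreal q" using E2_restrict[OF mu(1) that(1-3)] that by simp
   also have "... = ennreal ((sqrt (v - u) * sqrt q)^2)" using that by (simp add: ennreal_mult power_mult_distrib)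
   finally show ?thesis using that by (subst dW_le_iff) auto
  qed
  have "dW x y <= dW x (mu s) + (dW (mu s) (mu t) + dW (mu t) y)"
   using st by (intro order_trans[OF dW_triangle[OF P(1) Pt P(2)] add_left_mono[OF dW_triangle[OF Pt Pt P(2)]]]) auto
  also have "... <= ennreal (sqrt (s - 0) * sqrt e1) + (ennreal (sqrt (t - s) * sqrt e2) + ennreal (sqrt (1 - t) * sqrt e3))"
   using leg[of 0 s] leg[of s t] leg[of t] e st mu by (intro add_mono) auto
  also have "... = ennreal (sqrt (s - 0) * sqrt e1 + (sqrt (t - s) * sqrt e2 + sqrt (1 - t) * sqrt e3))" using e st by simp
  finally have "a^2 <= (sqrt s * sqrt e1 + sqrt (t - s) * sqrt e2 + sqrt (1 - t) * sqrt e3)^2"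
   using e st unfolding a using a by (subst (asm) ennreal_le_iff) auto
  hence "(sqrt e2)^2 = (sqrt (t - s))^2 * ((sqrt e1)^2 + (sqrt e2)^2 + (sqrt e3)^2)" using e st es by (intro lagrange_equality) simp_all
  hence "sqrt (t - s) * sqrt e2 = (t - s) * a" using e st es using st a by (simp add: real_sqrt_mult)
  thus ?thesis using leg[of s t] e st by simp
 qed
 have eq: "dW (mu s) (mu t) = ennreal ((t - s) * a)" if st: "0 <= s" "s <= t" "t <= 1" for s t
 proof -
  have "dW (mu s) (mu t) < infty" using up[OF st] by (rule le_less_trans) simp
  then obtain d where d: "d >= 0" "dW (mu s) (mu t) = ennreal d" by (rule dW_real)
  have "ennreal a <= dW x (mu s) + (dW (mu s) (mu t) + dW (mu t) y)" unfolding a(2)[symmetric]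
   using st by (intro order_trans[OF dW_triangle[OF P(1) Pt P(2)] add_left_mono[OF dW_triangle[OF Pt Pt P(2)]]]) auto
  also have "... <= ennreal ((s - 0) * a) + (ennreal d + ennreal ((1 - t) * a))" using up[of 0 s] up st mu d by (intro add_mono) auto
  also have "... = ennreal ((s - 0) * a + (d + (1 - t) * a))" using st a d by simp
  finally have "a <= (s - 0) * a + (d + (1 - t) * a)" using st a d by (subst (asm) ennreal_le_iff) auto
  hence "(t - s) * a <= d" by (simp add: algebra_simps)
  moreover have "d <= (t - s) * a" using up[OF st] d st a by simp
  ultimately show ?thesis using d by simp
 qed
 show ?thesis
 proof (rule that[OF mu(1-3)])
  fix s t :: real assume st: "s : {0..1}" "t : {0..1}"
  show "dW (mu s) (mu t) = ennreal (abs (t - s) * a)"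
  proof (cases "s <= t")
   case True
   thus ?thesis using eq st by simp
  next
   case False
   thus ?thesis using eq st dW_sym[of "mu s"] by simp
  qed
 qed
qed

text \<open>From some index on the members have bounded \<open>E2\<close> from one fixed member,
  hence a subsequence converges weakly. Lower semicontinuity of \<open>E2\<close> passes the Cauchy
  estimate to this weak limit.\<close>

lemma dW_complete:
 assumes P: "!!n. sg n : PM"
  and cau: "!!e. e > 0 ==> EX N::nat. ALL n>=N. ALL m>=N. dW (sg n) (sg m) < ennreal e"
 obtains z where "z : PM" "!!e. e > 0 ==> EX N. ALL n>=N. dW (sg n) z <= ennreal e"
proof -
 obtain N where "ALL n>=N. ALL m>=N. dW (sg n) (sg m) < ennreal 1" using cau[OF zero_less_one] ..
 hence N: "!!n m. n >= N ==> m >= N ==> dW (sg n) (sg m) < ennreal 1" by simp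
 have "dW (sg N) (sg (n + N)) <= ennreal 1" for n using N[of N "n + N"] by simp
 hence b: "E2 (sg N) (sg (n + N)) <= ennreal (1^2)" for n using dW_le_iff[of 1] by simp
 \<comment> \<open>The compactness statement asks for a strict bound; any number above 1 would
   do.\<close>
 have b': "E2 (sg N) (sg (n + N)) < ennreal 2" for n using b by (rule le_less_trans) simp
 obtain r mu where r: "strict_mono (r :: nat => nat)" "wcurve 0 1 mu" "mu 0 = sg N" "wconv (%n. sg (r n + N)) (mu 1) sequentially"
  by (rule E2_limit_curve[where c = "%_. 2" and c' = 2 and C = 2, OF P b']) auto
 have z: "mu 1 : PM" using wcurveD[OF r(2)] by simp
 show ?thesis
 proof (rule that[OF z])
  fix e :: real assume e: "e > 0"
  obtain M where "ALL n>=M. ALL m>=M. dW (sg n) (sg m) < ennreal e" using cau[OF e] ..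
  hence M: "!!n m. n >= M ==> m >= M ==> dW (sg n) (sg m) < ennreal e" by simp
  have "dW (sg n) (mu 1) <= ennreal e" if n: "n >= M" for n
  proof -
   have le: "E2 (sg n) (sg (r (k + M) + N)) <= ennreal (e^2)" for k
   proof -
    have "M <= r (k + M) + N" using seq_suble[OF r(1), of "k + M"] by simp
    hence "dW (sg n) (sg (r (k + M) + N)) <= ennreal e" using M[OF n] by force
    thus ?thesis using dW_le_iff e by simp
   qed
   have "strict_mono (%k::nat. k + M)" by (simp add: strict_mono_def)
   from wconv_subseq[OF r(4) this] have "wconv (%k. sg (r (k + M) + N)) (mu 1) sequentially" .
   from E2_lsc[OF P le _ z this] show ?thesis using dW_le_iff e by simp
  qed
  thus "EX N. ALL n>=N. dW (sg n) (mu 1) <= ennreal e" by auto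
 qed
qed

section \<open>Signed Radon measures\<close>

lemma cc_diag: "p ~: G ==> cc p = 0" by (cases p) (simp add: cc_def G_def kk_diag)

lemma radonD:
 assumes "radon_on GG M"
 shows "sets M = sets (restrict_space borel G)" "space M = G" "compact C ==> C <= G ==> emeasure M C < infty"
proof -
 show s: "sets M = sets (restrict_space borel G)" using assms by (simp add: radon_on_def)
 show "space M = G" using sets_eq_imp_space_eq[OF s] by simp
 show "compact C ==> C <= G ==> emeasure M C < infty" using assms unfolding radon_on_def by simp
qed

lemma sets_GI: "A : sets borel ==> A <= G ==> A : sets (restrict_space borel GG)" by (subst sets_restrict_space_iff) auto

lemma sets_GD: "A : sets (restrict_space borel GG) ==> A : sets borel & A <= G" by (subst (asm) sets_restrict_space_iff) auto

lemma radon_bm: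
 assumes "sets M = sets (restrict_space borel GG)" "f : measurable borel N"
 shows "f : measurable M N" using measurable_restrict_space1[OF assms(2)] measurable_cong_sets[OF assms(1) , of N] by simp

lemma radon_sf: "radon_on GG M ==> sigma_finite_measure M"
proof -
 assume M: "radon_on GG M"
 obtain C :: "nat => ('a * 'a) set" where C: "!!n. compact (C n)" "!!n. C n <= G" "\<Union>(range C) = G"
  by (rule open_Union_compact_subsets[OF open_G]) blast
 show ?thesis
 proof
  show "EX A. countable A & A <= sets M & \<Union>A = space M & (ALL a:A. emeasure M a ~= infty)"
  proof (intro exI conjI ballI)
   show "countable (range C)" by simp
   show "range C <= sets M" unfolding radonD[OF M] using sets_GI[OF borel_closed[OF compact_imp_closed[OF C(1)]] C(2)] by auto
   show "\<Union>(range C) = space M" using C radonD[OF M] by simp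
   fix a assume "a : range C"
   thus "emeasure M a ~= infty" using radonD(3)[OF M C(1,2)] by (auto simp: less_top)
  qed
 qed
qed

lemma radon_sum:
 assumes "radon_on GG M" "radon_on G N"
 shows "radon_on G (summ M N)" unfolding radon_on_def
proof (intro conjI allI impI)
 show "sets (summ M N) = sets (restrict_space borel G)" using radonD[OF assms(1)] by simp
 fix C :: "('a * 'a) set" assume K: "compact C & C <= G"
 have "C : sets M" unfolding radonD[OF assms(1)] using K by (intro sets_GI) (auto simp: compact_imp_closed)
 thus "emeasure (summ M N) C < infty" using radonD[OF assms(1)] radonD[OF assms(2)] K by (simp add: emeasure_summ)
qed

lemma radon_Cc_integrable:
 assumes M: "radon_on GG M" and f: "cts f" "compact_support_in G f"
 shows "integrable M (f :: 'a * 'a => real)"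
proof -
 let ?K = "closure {p. f p ~= 0}"
 have K: "compact ?K" "?K <= G" using f by (auto simp: compact_support_in_def)
 have "compact (f ` ?K)" by (rule compact_continuous_image[OF continuous_on_subset[OF f(1)] K(1)]) simp
 hence "bounded (f ` ?K)" by (rule compact_imp_bounded)
 then obtain B where "ALL y:f ` ?K. norm y <= B" unfolding bounded_iff ..
 hence B: "abs (f p) <= B" if "p : ?K" for p using bspec[OF _ that] by simp
 have "?K : sets M" unfolding radonD[OF M] using K by (intro sets_GI) (auto)
 hence i: "integrable M (%p. B * indicator ?K p)" using radonD(3)[OF M K] by simp
 show ?thesis
 proof (rule Bint_bound[OF i])
  show "f : bm M" by (rule radon_bm[OF radonD(1)[OF M] cts_bm[OF f(1)]])
  have "abs (f p) <= abs (B * indicator ?K p)" for p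
  proof (cases "p : ?K")
   case True thus ?thesis using B[OF True] by simp
  next
   case False
   thus ?thesis using closure_subset[of "{p. f p ~= 0}"] by auto
  qed
  thus "AE p in M. norm (f p) <= norm (B * indicator ?K p)" by simp
 qed
qed

text \<open>A continuous exhaustion of \<open>G\<close>: the first factor vanishes near the
  diagonal, the second outside a ball, and the product tends to 1 at each point of
  \<open>G\<close>.\<close>

definition chi :: "nat => 'a * 'a => real" where
 "chi n p = min 1 (max 0 (real n * norm (fst p - snd p) - 1)) * cutoff (real (Suc n)) p"

lemma chi_bounds: "0 <= chi n p" "chi n p <= 1" using cutoff_bounds[of "real (Suc n)" p] by (auto simp: chi_def mult_le_one)

lemma chi_continuous: "cts (chi n)" unfolding chi_def by (intro continuous_intros Ccs_continuous[OF Ccs_cutoff]) simp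

lemma chi_support: "compact_support_in G (%p. chi n p * f p)"
proof -
 let ?S = "{p :: 'a * 'a. 1 <= real n * norm (fst p - snd p)} Int cball 0 (2 * real (Suc n))"
 have cl: "closed ?S" by (intro closed_cball closed_Collect_le continuous_intros)
 let ?X = "{p. chi n p * f p ~= 0}"
 have "?X <= ?S"
 proof
  fix p assume "p : ?X"
  hence "1 <= real n * norm (fst p - snd p)" "~ 2 * real (Suc n) <= norm p"
   using cutoff_eq_0[of "real (Suc n)"] by (auto simp: chi_def)
  thus "p : ?S" by simp
 qed
 hence sub: "closure ?X <= ?S" by (rule closure_minimal[OF _ cl])
 have "compact ?S" using cl by (simp add: compact_eq_bounded_closed bounded_Int)
 hence "compact (closure ?X)" using sub by (meson bounded_subset closed_closure compact_eq_bounded_closed)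
 moreover have "?S <= G" by (auto simp: G_def)
 ultimately show ?thesis unfolding compact_support_in_def using sub by auto
qed

lemma chi_tendsto: "p : G ==> (%n. chi n p) ----> 1"
proof -
 assume "p : G"
 hence d: "norm (fst p - snd p) > 0" by (auto simp: G_def)
 have "chi n p = 1" if n: "n >= nat \<lceil>max (2 / norm (fst p - snd p)) (norm p)\<rceil>" for n
 proof -
  have "2 / norm (fst p - snd p) <= real n" "norm p <= real (Suc n)" using n by auto
  thus ?thesis using d by (simp add: field_simps chi_def cutoff_eq_1)
 qed
 hence "eventually (%n. chi n p = 1) sequentially" unfolding eventually_sequentially by blast
 thus ?thesis by (rule tendsto_eventually)
qed

lemma SRMD:
 assumes "nu : SRM GG"
 shows "radon_on G (fst nu)" "radon_on G (snd nu)"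
  "EX A. A : sets borel & A <= G & emeasure (fst nu) (G - A) = 0 & emeasure (snd nu) A = 0"
proof -
 obtain p n where nu: "nu = (p, n)" by force
 from assms obtain A where A: "radon_on G p" "radon_on G n" "A : sets (restrict_space borel G)"
  "emeasure p (G - A) = 0" "emeasure n A = 0" unfolding signed_radon_measures_def nu by auto
 show "radon_on G (fst nu)" "radon_on G (snd nu)" using A by (simp_all add: nu)
 show "EX A. A : sets borel & A <= G & emeasure (fst nu) (G - A) = 0 & emeasure (snd nu) A = 0" using A sets_GD by (intro exI[of _ A]) (simp add: nu)
qed

lemma signed_radon_swap:
 assumes "nu : SRM GG"
 shows "prod.swap nu : SRM G"
proof -
 obtain p n where nu: "nu = (p, n)" by force
 obtain A where A: "A : sets borel" "A <= G" "emeasure p (G - A) = 0" "emeasure n A = 0" using SRMD[OF assms] by (auto simp: nu)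
 have "G - (G - A) = A" using A by auto
 moreover have "G - A : sets (restrict_space borel G)" using A by (intro sets_GI) auto
 ultimately have "EX A:sets (restrict_space borel G). emeasure n (G - A) = 0 & emeasure p A = 0" using A by (intro bexI) simp_all
 thus ?thesis using SRMD[OF assms] unfolding signed_radon_measures_def by (simp add: nu)
qed

text \<open>Lower semicontinuity of the positive part in the weak* topology: testing with continuous approximations of the
 indicator of a Hahn set recovers the mass of the positive part.\<close>

lemma positive_part_sup:
 assumes nu: "nu : SRM GG"
  and f: "cts f" "!!p. f p >= 0" and q: "ennreal q < nint (fst nu) f" "q >= 0"
 obtains u where "cts u" "compact_support_in G u" "!!p. 0 <= u p" "!!p. u p <= f p" "signed_integral nu u > q"
proof -
 note p = SRMD(1)[OF nu] and n = SRMD(2)[OF nu]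
 have meas: "h : bm (fst nu)" "h : bm (snd nu)" if "h : bm borel" for h :: "'a * 'a => real"
  using radon_bm[OF radonD(1)[OF p] that] radon_bm[OF radonD(1)[OF n] that] by auto
 have fm: "f : bm borel" "chi k : bm borel" for k using f chi_continuous by (auto intro: cts_bm)
 have ex: "EX k. ennreal q < nint (fst nu) (%p. chi k p * f p)"
 proof (rule ccontr)
  assume "~ ?thesis"
  hence le: "nint (fst nu) (%p. chi k p * f p) <= ennreal q" for k by (auto simp: not_less)
  have "nint (fst nu) f = nn_integral (fst nu) (%p. liminf (%k. ennreal (chi k p * f p)))"
  proof (rule nn_integral_cong)
   fix p assume "p : space (fst nu)"
   hence "p : G" using radonD[OF p] by simp
   hence "(%k. ennreal (chi k p * f p)) ----> ennreal (1 * f p)" by (intro tendsto_ennrealI tendsto_mult tendsto_const chi_tendsto)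
   from lim_imp_Liminf[OF sequentially_bot this] show "ennreal (f p) = liminf (%k. ennreal (chi k p * f p))" by simp
  qed
  also have "... <= liminf (%k. nint (fst nu) (%p. chi k p * f p))"
   by (intro nn_integral_liminf measurable_compose[OF meas(1) measurable_ennreal] borel_measurable_times fm)
  also have "... <= liminf (%k. ennreal q)" by (intro Liminf_mono always_eventually allI le)
  finally show False using q by (simp add: Liminf_const)
 qed
 then obtain k where k: "ennreal q < nint (fst nu) (%p. chi k p * f p)" ..
 define g where "g p = chi k p * f p" for p
 have g0: "g p >= 0" "g p <= f p" for p using chi_bounds f by (auto simp: g_def mult_left_le_one_le)
 have gc: "cts g" unfolding g_def by (intro continuous_on_mult chi_continuous f)
 have gs: "compact_support_in G g" unfolding g_def by (rule chi_support)
 have gm: "g : bm borel" by (rule cts_bm[OF gc])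
 let ?M = "summ (fst nu) (snd nu)"
 have se: "sets (snd nu) = sets (fst nu)" using radonD[OF p] radonD[OF n] by simp
 have gi: "integrable (fst nu) g" "integrable (snd nu) g" "integrable ?M g"
  using radon_Cc_integrable[OF p gc gs] radon_Cc_integrable[OF n gc gs] radon_Cc_integrable[OF radon_sum[OF p n] gc gs] by auto
 let ?X = "LINT p|fst nu. g p"
 define e where "e = ?X - q"
 have "ennreal ?X = nint (fst nu) g" by (rule nn_integral_eq_integral[symmetric, OF gi(1)]) (simp add: g0)
 hence "ennreal q < ennreal ?X" using k by (simp only: g_def)
 hence "e > 0" unfolding ennreal_less_iff[OF q(2)] by (simp add: e_def)
 obtain A where A: "A : sets borel" "A <= G" "emeasure (fst nu) (G - A) = 0" "emeasure (snd nu) A = 0" using SRMD[OF nu] by auto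
 \<comment> \<open>\<open>g\<close> has compact support in \<open>G\<close>, so \<open>g\<close>
   times the total variation is a finite measure, even though the total variation may be infinite.
   Approximation of the Hahn set in this measure controls the error in both parts at once.\<close>
 define N where "N = distr (dens ?M g) borel (%p. p)"
 have idm: "(%p. p) : measurable (dens ?M g) borel" by (rule radon_bm[OF _ measurable_ident_sets[OF refl]]) (simp add: radonD[OF p])
 have gM: "g : bm ?M" using gi by simp
 have "emeasure N UNIV = nint ?M g" unfolding N_def using gM by (subst emeasure_distr[OF idm]) (auto simp: emeasure_density intro!: nn_integral_cong)
 also have "... < infty" using gi g0 by (simp add: integrable_iff_bounded)
 finally have fN: "finite_measure N" by (intro finite_measureI) (simp add: N_def)
 obtain c :: "'a * 'a => real" where c: "cts c" "!!p. 0 <= c p" "!!p. c p <= 1" "(LINT p|N. abs (c p - indicator A p)) < e"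
  by (rule continuous_approx_indicator[OF fN _ A(1) `e > 0`]) (simp_all add: N_def)
 have cm: "c : bm borel" by (rule cts_bm[OF c(1)])
 define d where "d p = abs (c p - indicator A p) * g p" for p
 have dm: "d : bm borel" unfolding d_def using cm gm A(1) by simp
 have d0: "0 <= d p" "d p <= g p" for p using c g0 by (auto simp: d_def indicator_def mult_left_le_one_le)
 have di: "integrable (fst nu) d" "integrable (snd nu) d" by (rule Bint_bound[OF gi(1)], rule meas[OF dm], use d0 g0 in simp,
    rule Bint_bound[OF gi(2)], rule meas[OF dm], use d0 g0 in simp)
 let ?Y = "LINT p|fst nu. d p"
 have "(LINT p|N. abs (c p - indicator A p)) = (LINT p|dens ?M g. abs (c p - indicator A p))"
  unfolding N_def using cm A by (subst integral_distr[OF idm]) auto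
 also have "... = (LINT p|?M. g p *\<^sub>R (abs (c p - indicator A p)))"
 proof (rule integral_density)
  have "(%p. abs (c p - indicator A p)) : bm borel" using cm A by simp
  from meas(1)[OF this] show "(%p. abs (c p - indicator A p)) : bm ?M" by simp
 qed (simp_all add: g0 gM)
 also have "... = (LINT p|?M. d p)" by (intro Bint_cong) (auto simp: d_def)
 also have "... = ?Y + (LINT p|snd nu. d p)" by (rule integral_summ[OF se di]) (rule d0)
 finally have small: "?Y + (LINT p|snd nu. d p) < e" using c by simp
 define u where "u p = c p * g p" for p
 have u0: "0 <= u p" "u p <= g p" for p using c g0 by (auto simp: u_def mult_left_le_one_le)
 have um: "u : bm borel" unfolding u_def using cm gm by simp
 have inA: "AE p in fst nu. p : A" by (rule AE_I) (use A radonD[OF p] in \<open>auto intro: sets_GI\<close>)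
 have ninA: "AE p in snd nu. p ~: A" by (rule AE_I) (use A radonD[OF n] in \<open>auto intro: sets_GI\<close>)
 have "(LINT p|fst nu. u p) = (LINT p|fst nu. g p - d p)"
 proof (rule integral_cong_AE)
  show "AE p in fst nu. u p = g p - d p" using inA by eventually_elim (use c in \<open>simp add: u_def d_def algebra_simps\<close>)
 qed (intro meas borel_measurable_diff um gm dm)+
 also have "... = ?X - ?Y" by (rule Bint_diff[OF gi(1) di(1)])
 finally have up: "(LINT p|fst nu. u p) = ?X - ?Y" .
 have un: "(LINT p|snd nu. u p) = (LINT p|snd nu. d p)"
 proof (rule integral_cong_AE)
  show "AE p in snd nu. u p = d p" using ninA by eventually_elim (use c in \<open>simp add: u_def d_def\<close>)
 qed (intro meas um dm)+
 show ?thesis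
 proof (rule that[of u])
  show "cts u" unfolding u_def by (intro continuous_on_mult c gc)
  have "u = (%p. chi k p * (c p * f p))" by (auto simp: u_def g_def)
  thus "compact_support_in G u" by (simp add: chi_support)
  show "0 <= u p" "u p <= f p" for p using u0[of p] g0[of p] by auto
  show "q < signed_integral nu u" using up un small by (simp add: signed_integral_def e_def)
 qed
qed

section \<open>Measurability for the weak* topology\<close>

lemma topspace_weak_star: "topspace (weak_star_topology G) = SRM GG"
proof -
 have "{nu : SRM GG. signed_integral nu (%_. 0) : UNIV} :
  {{nu : SRM G. signed_integral nu f : U} | f U.
    cts f & compact_support_in G f & open (U :: real set)}" by (rule , rule exI[of _ "%_. 0"], rule exI[of _ UNIV]) (simp add: compact_support_in_def)
 thus ?thesis unfolding weak_star_topology_def by auto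
qed

lemma openin_weak_star_test:
 assumes "cts f" "compact_support_in GG f" "open (U :: real set)"
 shows "openin (weak_star_topology G) {nu : SRM G. signed_integral nu f : U}"
 unfolding weak_star_topology_def by (rule topology_generated_by_Basis) (use assms in blast)

lemma signed_integral_le:
 assumes nu: "nu : SRM GG"
  and u: "cts u" "compact_support_in G u" "!!p. 0 <= u p" "!!p. u p <= f p"
 shows "ennreal (signed_integral nu u) <= nint (fst nu) f"
proof -
 note i = radon_Cc_integrable[OF SRMD(1)[OF nu] u(1,2)]
 have "ennreal (signed_integral nu u) <= ennreal (LINT p|fst nu. u p)"
  unfolding signed_integral_def using u by simp
 also have "... = nint (fst nu) u" by (rule nn_integral_eq_integral[symmetric, OF i]) (simp add: u)
 also have "... <= nint (fst nu) f" by (intro nn_integral_mono ennreal_leI u)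
 finally show ?thesis .
qed

lemma signed_integral_swap: "signed_integral (prod.swap nu) u = - signed_integral nu u" by (simp add: signed_integral_def)

text \<open>The integral against the positive part is the supremum of the weak* continuous
  functionals \<open>signed_integral nu u\<close> with \<open>0 <= u <= f\<close>, so it exceeds
  \<open>q\<close> on a union of subbasic open sets. Swapping the pair exchanges the two parts and
  changes the sign of the functional.\<close>

lemma openin_parts:
 fixes f :: "'a * 'a => real"
 assumes f: "cts f" "!!p. f p >= 0" and q: "q >= 0"
 shows "openin (weak_star_topology G) {nu : SRM G. ennreal q < nint (fst nu) f}"
  "openin (weak_star_topology G) {nu : SRM G. ennreal q < nint (snd nu) f}"
proof -
 let ?T = "{u :: 'a * 'a => real. cts u & compact_support_in G u & (ALL p. 0 <= u p) & (ALL p. u p <= f p)}"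
 have le: "ennreal q < nint (fst nu) f \<longleftrightarrow> (EX u:?T. signed_integral nu u > q)"
  if nu: "nu : SRM GG" for nu
 proof
  assume a: "ennreal q < nint (fst nu) f"
  show "EX u:?T. signed_integral nu u > q" by (rule positive_part_sup[OF nu f a q]) blast
 next
  assume "EX u:?T. signed_integral nu u > q"
  then obtain u where u: "cts u" "compact_support_in G u" "!!p. 0 <= u p" "!!p. u p <= f p" "signed_integral nu u > q" by auto
  have "ennreal q < ennreal (signed_integral nu u)" using u q by (simp add: ennreal_less_iff)
  also have "... <= nint (fst nu) f" by (rule signed_integral_le[OF nu u(1-4)])
  finally show "ennreal q < nint (fst nu) f" .
 qed
 have e1: "{nu : SRM G. ennreal q < nint (fst nu) f} =
  (UN u:?T. {nu : SRM G. signed_integral nu u : {q<..}})" using le by auto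
 show "openin (weak_star_topology G) {nu : SRM G. ennreal q < nint (fst nu) f}"
  unfolding e1 by (rule , elim imageE, simp only:, rule openin_weak_star_test) auto
 have sw: "ennreal q < nint (snd nu) f \<longleftrightarrow> (EX u:?T. signed_integral nu u < - q)"
  if nu: "nu : SRM GG" for nu
 proof -
  show ?thesis using le[OF signed_radon_swap[OF nu]] unfolding signed_integral_swap by auto
 qed
 have e2: "{nu : SRM G. ennreal q < nint (snd nu) f} =
  (UN u:?T. {nu : SRM G. signed_integral nu u : {..<-q}})" using sw by auto
 show "openin (weak_star_topology G) {nu : SRM G. ennreal q < nint (snd nu) f}"
  unfolding e2 by (rule , elim imageE, simp only:, rule openin_weak_star_test) auto
qed

lemma measurable_parts:
 fixes f :: "'a * 'a => real"
 assumes nu: "nu : measurable M (borel_of_topology (weak_star_topology G))" and f: "cts f" "!!p. f p >= 0"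
 shows "(%t. nint (fst (nu t)) f) : bm M"
  "(%t. nint (snd (nu t)) f) : bm M"
proof -
 have sp: "space (borel_of_topology (weak_star_topology G)) = SRM GG" by (simp add: borel_of_topology_def topspace_weak_star space_measure_of_conv)
 have mem: "nu t : SRM G" if "t : space M" for t using measurable_space[OF nu that] sp by simp
 have *: "(%t. h (nu t)) : bm M"
  if h: "!!q. q >= 0 ==> openin (weak_star_topology G) {nu : SRM G. ennreal q < h nu}" for h
 proof (rule borel_measurableI_greater)
  fix y :: ennreal
  show "{x : space M. y < h (nu x)} : sets M"
  proof (cases y rule: ennreal_cases)
   case (real r)
   have "{nu : SRM G. ennreal r < h nu} : sets (borel_of_topology (weak_star_topology G))"
    unfolding borel_of_topology_def using h[OF real(1)] openin_subset by auto
   from measurable_sets[OF nu this] have "nu -` {nu : SRM G. ennreal r < h nu} Int space M : sets M" .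
   also have "nu -` {nu : SRM G. ennreal r < h nu} Int space M = {x : space M. y < h (nu x)}" using mem real by auto
   finally show ?thesis .
  qed simp
 qed
 show "(%t. nint (fst (nu t)) f) : bm M" by (rule *) (rule openin_parts[OF f])
 show "(%t. nint (snd (nu t)) f) : bm M" by (rule *) (rule openin_parts[OF f])
qed

section \<open>The action\<close>

text \<open>The way back from the finite measures on the product space to measures on
  \<open>G\<close> at the original scale of \<open>J\<close>.\<close>

definition cG :: "('a * 'a) measure => ('a * 'a) measure" where
 "cG N = restrict_space (dens N cc) G"

lemma sets_cG: "sets N = sets borel ==> sets (cG N) = sets (restrict_space borel G)" unfolding cG_def by (rule sets_restrict_space_cong) simp

lemma nn_integral_cG:
 assumes N: "sets N = sets borel" and f: "f : bm borel"
 shows "nn_integral (cG N) (%p. f p) = nn_integral N (%p. ennreal (cc p) * f p)"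
proof -
 have m: "(%p. ennreal (cc p)) : bm N" "f : bm N"
  "(%p. f p * indicator G p) : bm N" using f by (simp_all add: measurable_cong_sets[OF N])
 have "nn_integral (cG N) (%p. f p) = nn_integral (dens N cc) (%p. f p * indicator G p)"
  unfolding cG_def by (rule nn_integral_restrict_space) (simp add: N)
 also have "... = nn_integral N (%p. ennreal (cc p) * (f p * indicator G p))" by (rule nn_integral_density[OF m(1,3)])
 also have "... = nn_integral N (%p. ennreal (cc p) * f p)" by (intro nn_integral_cong) (auto simp: indicator_def cc_diag)
 finally show ?thesis .
qed

lemma density_cG:
 assumes N: "sets N = sets borel" and s: "s : bm borel"
 shows "density (cG N) s = cG (density N s)"
proof (rule measure_eqI)
 let ?X = "density N s"
 have Nd: "sets ?X = sets borel" using N by simp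
 have sm: "s : bm (cG N)" by (rule radon_bm[OF sets_cG[OF N] s])
 let ?Y = "density (cG N) s"
 show se: "sets ?Y = sets (cG ?X)" by (simp add: sets_cG[OF N] sets_cG[OF Nd])
 fix A assume "A : sets ?Y"
 hence A: "A : sets (cG N)" by simp
 hence Ab: "A : sets borel" using sets_GD unfolding sets_cG[OF N] by simp
 have m: "indicator A : bm borel" using Ab by simp
 have m2: "(%p. ennreal (cc p) * indicator A p) : bm N" "s : bm N" using Ab s by (simp_all add: measurable_cong_sets[OF N])
 have "emeasure ?Y A = nn_integral (cG N) (%p. s p * indicator A p)" by (rule emeasure_density[OF sm A])
 also have "... = nn_integral N (%p. ennreal (cc p) * (s p * indicator A p))"
  by (intro nn_integral_cG[OF N] borel_measurable_times_ennreal s borel_measurable_indicator Ab)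
 also have "... = nn_integral N (%p. s p * (ennreal (cc p) * indicator A p))" by (simp add: mult_ac)
 also have "... = nn_integral ?X (%p. ennreal (cc p) * indicator A p)" by (rule nn_integral_density[symmetric, OF m2(2,1)])
 also have "... = nn_integral (cG ?X) (%p. indicator A p)" by (rule nn_integral_cG[symmetric, OF Nd m])
 also have "... = emeasure (cG ?X) A" using A by (simp add: sets_cG[OF N] sets_cG[OF Nd])
 finally show "emeasure ?Y A = emeasure (cG ?X) A" .
qed

text \<open>The weight \<open>cc\<close> is continuous off the diagonal, hence bounded on each
  compact subset of \<open>G\<close>.\<close>

lemma radon_cG:
 assumes N: "finb N"
 shows "radon_on G (cG N)" unfolding radon_on_def
proof (intro conjI allI impI)
 have sN: "sets N = sets borel" using N by (simp add: finb_def)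
 show "sets (cG N) = sets (restrict_space borel G)" by (rule sets_cG[OF sN])
 fix C :: "('a * 'a) set" assume C: "compact C & C <= G"
 have Cb: "C : sets borel" using C by (simp add: compact_imp_closed)
 show "emeasure (cG N) C < infty"
 proof (cases "C = {}")
  case False
  have "continuous_on C cc" using cc_isCont C by (intro continuous_at_imp_continuous_on) (auto simp: G_eq)
  hence "EX p:C. ALL q:C. cc q <= cc p" using C False by (intro continuous_attains_sup) auto
  then obtain p where p: "!!q. q : C ==> cc q <= cc p" by auto
  have "emeasure (cG N) C = nn_integral (cG N) (%q. indicator C q)" using C Cb by (simp add: sets_cG[OF sN] sets_GI)
  also have "... = nn_integral N (%q. ennreal (cc q) * indicator C q)" using Cb by (intro nn_integral_cG[OF sN]) simp
  also have "... <= nn_integral N (%q. ennreal (cc p) * indicator C q)" by (intro nn_integral_mono) (auto simp: indicator_def ennreal_leI p)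
  also have "... = ennreal (cc p) * emeasure N C" using Cb sN by (simp add: nn_integral_cmult_indicator)
  also have "... < infty" using N finite_measure.emeasure_finite[of N] by (simp add: ennreal_mult_eq_top_iff finb_def less_top[symmetric])
  finally show ?thesis .
 qed simp
qed

lemma jump_measures_cG:
 assumes "mu : PM"
 shows "jump_measure1 J mu = cG (M1 mu)" "jump_measure2 J mu = cG (M2 mu)"
 using jump_measure1_eq[OF assms] jump_measure2_eq[OF assms] by (simp_all add: cG_def)

lemma density_Lam:
 assumes P: "mu : PM"
 shows "dens (cG (Lam mu)) (r1 mu) = jump_measure1 J mu"
  "dens (cG (Lam mu)) (r2 mu) = jump_measure2 J mu"
proof -
 have m: "(%p. ennreal (r1 mu p)) : bm borel" "(%p. ennreal (r2 mu p)) : bm borel" using r12'(1,2)[OF P] by auto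
 show "dens (cG (Lam mu)) (r1 mu) = jump_measure1 J mu"
  "dens (cG (Lam mu)) (r2 mu) = jump_measure2 J mu"
  unfolding density_cG[OF sets_Lam[OF P] m(1)] density_cG[OF sets_Lam[OF P] m(2)] r12'[OF P] jump_measures_cG[OF P] by auto
qed

text \<open>Expresses the weighted measure through an arbitrary reference measure, such as the
  unspecified one in \<open>action_value\<close>. It is the case of
  \<open>homogeneous_integral_unique\<close> in which \<open>H\<close> does not depend on its first
  real argument.\<close>

lemma theta_integral_unique:
 assumes P: "mu : PM" and sg: "radon_on G sg"
  and m: "rho1 : bm sg" "rho2 : bm sg" and pos: "!!p. rho1 p >= 0" "!!p. rho2 p >= 0"
  and d: "jump_measure1 J mu = dens sg rho1" "jump_measure2 J mu = dens sg rho2"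
  and g: "g : bm borel" "!!p. g p >= 0"
 shows "nint sg (%p. g p * theta (rho1 p) (rho2 p)) = nint (Th mu) g"
proof -
 let ?L = "cG (Lam mu)"
 have sL: "sets ?L = sets (restrict_space borel G)" by (rule sets_cG[OF sets_Lam[OF P]])
 have rL: "radon_on G ?L" by (rule radon_cG[OF finb_Lam[OF P]])
 have msg: "h : bm sg" if "h : bm borel" for h :: "'a * 'a => real" by (rule radon_bm[OF radonD(1)[OF sg] that])
 have "nint sg (%p. g p * theta (rho1 p) (rho2 p)) = nint ?L (%p. g p * theta (r1 mu p) (r2 mu p))"
 proof (rule homogeneous_integral_unique[where H = "%p u s t. ennreal (g p * theta s t)" and w = "%_. 0" and w' = "%_. 0"])
  show "sigma_finite_measure sg" "sigma_finite_measure ?L" "sigma_finite_measure (summ sg ?L)" by (intro radon_sf radon_sum sg rL)+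
  show "sets ?L = sets sg" using sL radonD[OF sg] by simp
  show "r1 mu : bm sg" "r2 mu : bm sg" by (intro msg r12'[OF P])+
  show "r1 mu p >= 0" "r2 mu p >= 0" for p by (rule r12'[OF P])+
  show "dens sg rho1 = dens ?L (r1 mu)"
   "dens sg rho2 = dens ?L (r2 mu)" by (simp_all add: density_Lam[OF P] d)
  have "dens sg (%p. 0) = dens ?L (%p. 0)"
  proof (rule measure_eqI)
   fix A assume "A : sets (dens sg (%p. 0))"
   thus "emeasure (dens sg (%p. 0)) A = emeasure (dens ?L (%p. 0)) A" using sL radonD[OF sg] by (simp add: emeasure_density)
  qed (simp add: sL radonD(1)[OF sg])
  thus "dens sg (%p. 0) = dens ?L (%p. 0)"
   "dens sg (%p. - 0) = dens ?L (%p. - 0)" by auto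
  show "ennreal (g p * theta (c * s) (c * t)) = ennreal c * ennreal (g p * theta s t)" if "c >= 0" "s >= 0" "t >= 0" for p c s t
   using that g th_nonneg by (simp add: th_hom ennreal_mult mult_ac)
  show "(%p. ennreal (g p * theta (s p) (t p))) : bm sg"
   if "s : bm sg" "t : bm sg" "!!p. s p >= 0" "!!p. t p >= 0" for s t using measurable_th[OF that] msg[OF g(1)] by simp
 qed (use m pos in auto)
 also have "... = nn_integral (Lam mu) (%p. ennreal (cc p) * ennreal (g p * theta (r1 mu p) (r2 mu p)))"
  using g r12'[OF P] by (intro nn_integral_cG[OF sets_Lam[OF P]]) measurable
 also have "... = nn_integral (Lam mu) (%p. ennreal (theta (r1 mu p) (r2 mu p) * cc p) * ennreal (g p))"
  by (simp add: ennreal_mult cc_nonneg g th_nonneg r12'[OF P] mult_ac)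
 also have "... = nint (Th mu) g" using g by (intro nn_integral_Th[symmetric, OF P]) measurable
 finally show ?thesis .
qed

text \<open>Completing the square; if theta vanishes, either \<open>w\<close> is 0 or the right-hand
  side is infinite.\<close>

lemma action_young:
 assumes "s >= 0" "t >= 0"
 shows "ennreal (abs (g * w)) <= action_density theta w s t + ennreal (g^2 * theta s t / 2)"
proof (cases "theta s t = 0")
 case True
 thus ?thesis by (simp_all add: action_density_def)
next
 case False
 hence th: "theta s t > 0" using th_nonneg[OF assms] by simp
 have "0 <= (abs w - abs g * theta s t)^2" by simp
 hence "abs (g * w) <= w^2 / (2 * theta s t) + g^2 * theta s t / 2"
  using th by (simp add: abs_mult field_simps power2_eq_square)
 hence "ennreal (abs (g * w)) <= ennreal (w^2 / (2 * theta s t) + g^2 * theta s t / 2)" by simp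
 also have "... = action_density theta w s t + ennreal (g^2 * theta s t / 2)" using th by (simp add: action_density_def)
 finally show ?thesis .
qed

lemma measurable_action_density:
 assumes "w : bm M" "f : bm M" "g : bm M" and "!!p. f p >= 0" "!!p. g p >= 0"
 shows "(%p. action_density theta (w p) (f p) (g p)) : bm M"
proof -
 show ?thesis
  using measurable_th[OF assms(2-)] assms(1) unfolding action_density_def by simp

qed

lemma signed_integral_density:
 assumes m: "w : bm sg" "g : bm sg" and gw: "integrable sg (%p. g p * w p)"
 shows "signed_integral (dens sg w, dens sg (%p. - w p)) g = (LINT p|sg. g p * w p)"
proof -
 let ?X = "%p. max 0 (- w p) * g p"
 let ?Y = "%p. max 0 (w p) * g p"
 have wi: "integrable sg ?Y" "integrable sg ?X"
 proof -
  have "?Y : bm sg" "?X : bm sg" using m by auto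
  moreover have "norm (max 0 (w p) * g p) <= norm (g p * w p)" "norm (max 0 (- w p) * g p) <= norm (g p * w p)" for p
   unfolding real_norm_def abs_mult mult.commute[of "abs (g p)"] by (intro mult_right_mono; simp)+
  ultimately show "integrable sg ?Y" "integrable sg ?X" by (intro Bint_bound[OF gw] ; simp)+
 qed
  have e: "dens sg w = dens sg (%p. max 0 (w p))"
   "dens sg (%p. - w p) = dens sg (%p. max 0 (- w p))" by auto
  have "(LINT p|dens sg w. g p) = (LINT p|sg. max 0 (w p) * g p)"
   "(LINT p|dens sg (%p. - w p). g p) = (LINT p|sg. max 0 (- w p) * g p)" unfolding e using m by (subst integral_density; simp)+
  hence "signed_integral (dens sg w, dens sg (%p. - w p)) g = (LINT p|sg. max 0 (w p) * g p - max 0 (- w p) * g p)"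
   unfolding signed_integral_def using Bint_diff[OF wi] by simp
  also have "... = (LINT p|sg. g p * w p)" by (intro Bint_cong) (auto simp: max_def)
  finally show ?thesis .
 qed

text \<open>Young's inequality integrated, with the gradient of \<open>psi\<close> for
  \<open>g\<close>. It also shows that the gradient times \<open>w\<close> is integrable when the
  action is finite, so that the signed integral is a true one and not a default value.\<close>

lemma action_value_test:
 assumes P: "mu : PM" and av: "action_value theta J mu nu a" and psi: "Ccs psi"
 shows "ennreal (signed_integral nu (dif psi) - Gam mu psi / 2) <= a"
proof (cases "a = infty")
 case False
 from av obtain sg rho1 rho2 w where sg: "radon_on G sg"
  and m: "rho1 : bm sg" "rho2 : bm sg" "w : bm sg"
  and pos: "ALL p. rho1 p >= 0 & rho2 p >= 0"
  and d: "jump_measure1 J mu = dens sg rho1" "jump_measure2 J mu = dens sg rho2"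
  and n: "fst nu = dens sg w" "snd nu = dens sg (%p. - w p)"
  and a: "a = nn_integral sg (%p. action_density theta (w p) (rho1 p) (rho2 p))" unfolding action_value_def by blast
 have pos': "rho1 p >= 0" "rho2 p >= 0" for p using pos by blast+
 let ?g = "dif psi"
 have gb: "?g : bm borel" by (rule dif_bm[OF psi])
 have gm: "?g : bm sg" by (rule radon_bm[OF radonD(1)[OF sg] gb])
 obtain B where "kdom (%p. dif psi p * dif psi p) B" by (rule kdom_dif2[OF psi psi])
 hence i: "integrable (Th mu) (%p. (?g p)^2)" using Th_int[OF P] by (simp add: power2_eq_square)
 let ?Y = "%p. (?g p)^2 / 2 * theta (rho1 p) (rho2 p)"
 let ?Z = "Gam mu psi / 2"
 have G: "nint sg ?Y = ennreal ?Z"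
 proof -
  have "nint sg ?Y = nint (Th mu) (%p. (?g p)^2 / 2)"
   by (rule theta_integral_unique[OF P sg m(1,2) pos' d]) (use gb in auto)
  also have "... = ennreal (LINT p|Th mu. (?g p)^2 / 2)" using i by (intro nn_integral_eq_integral) auto
  finally show ?thesis by (simp add: Gam_def)
 qed
 let ?X = "%p. ennreal (abs (?g p * w p))"
 have le: "nn_integral sg ?X <= a + ennreal ?Z"
 proof -
  have "nn_integral sg ?X <=
   (nn_integral sg (%p. action_density theta (w p) (rho1 p) (rho2 p) + ennreal ((?g p)^2 / 2 * theta (rho1 p) (rho2 p))))"
   using action_young[OF pos'] by (intro nn_integral_mono) simp
  also have "... = a + ennreal ?Z"
  proof (subst nn_integral_add)
   have "(%p. theta (rho1 p) (rho2 p)) : bm sg" by (rule measurable_th[OF m(1,2) pos'])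
   thus "(%p. ennreal ((?g p)^2 / 2 * theta (rho1 p) (rho2 p))) : bm sg" using gm by simp
  qed (use measurable_action_density[OF m(3,1,2) pos'] in \<open>simp_all only: G a\<close>)
  finally show ?thesis .
 qed
 also have "... < infty" using False by (simp add: less_top)
 finally have gw: "integrable sg (%p. ?g p * w p)" using gm m(3) by (intro integrableI_bounded) auto
 have sig: "signed_integral nu ?g = (LINT p|sg. ?g p * w p)" using signed_integral_density[OF m(3) gm gw] n by (simp add: signed_integral_def)
 let ?V = "signed_integral nu ?g"
 have "ennreal ?V <= ennreal (LINT p|sg. abs (?g p * w p))" unfolding sig using gw by (intro ennreal_leI integral_mono) auto
 also have "... = nn_integral sg ?X" using gw by (intro nn_integral_eq_integral[symmetric]) auto
 also note le
 finally have fin: "ennreal ?V <= a + ennreal ?Z" .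
 define r where "r = enn2real a"
 have r: "a = ennreal r" "r >= 0" using False by (simp_all add: r_def less_top)
 have "ennreal ?V <= ennreal (r + Gam mu psi / 2)" using fin r Gam_nonneg by simp
 thus ?thesis
  using r Gam_nonneg unfolding r by (subst (asm) ennreal_le_iff) auto

qed simp

text \<open>On a Hahn set the signed density is that of the positive part, off it minus that of the
  negative part; mutual singularity makes the discarded values vanish almost everywhere.\<close>

lemma radon_density_split:
 assumes "nu : SRM GG" "radon_on G sg"
  "absolutely_continuous sg (fst nu)" "absolutely_continuous sg (snd nu)"
 obtains w :: "'a * 'a => real" where "w : bm sg"
  "fst nu = dens sg w" "snd nu = dens sg (%p. - w p)"
proof -
 note p = SRMD(1)[OF assms(1)] and n = SRMD(2)[OF assms(1)] and sg = assms(2)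
 have sp: "sets (fst nu) = sets sg" "sets (snd nu) = sets sg" using radonD[OF p] radonD[OF n] radonD[OF sg] by auto
 obtain s1 where s1: "s1 : bm sg" "!!p. s1 p >= 0" "dens sg s1 = fst nu" by (rule real_dens[OF radon_sf[OF sg] radon_sf[OF p] sp(1) assms(3)]) blast
 obtain s2 where s2: "s2 : bm sg" "!!p. s2 p >= 0" "dens sg s2 = snd nu" by (rule real_dens[OF radon_sf[OF sg] radon_sf[OF n] sp(2) assms(4)]) blast
 obtain A where A: "A : sets borel" "A <= G" "emeasure (fst nu) (G - A) = 0" "emeasure (snd nu) A = 0" using SRMD[OF assms(1)] by auto
 have As: "A : sets sg" "G - A : sets sg" using A radonD[OF sg] by (auto intro: sets_GI)
 define w where "w p = (if p : A then s1 p else - s2 p)" for p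
 have null1: "AE p in sg. p ~: A --> s1 p = 0"
 proof -
  have "nn_integral sg (%p. ennreal (s1 p) * indicator (G - A) p) = 0"
   using emeasure_density[of "%p. ennreal (s1 p)" sg, OF _ As(2)] s1(1) A(3) unfolding s1 by simp
  hence "AE p in sg. ennreal (s1 p) * indicator (G - A) p = 0" using s1 As by (subst (asm) nn_integral_0_iff_AE) auto
  moreover have "AE p in sg. p : G" using radonD[OF sg] by auto
  ultimately show ?thesis
  proof eventually_elim
   case (elim p)
   thus ?case using s1 by auto
  qed
 qed
 have null2: "AE p in sg. p : A --> s2 p = 0"
 proof -
  have "nn_integral sg (%p. ennreal (s2 p) * indicator A p) = 0" using emeasure_density[of "%p. ennreal (s2 p)" , OF _ As(1)] s2 A by simp
  hence "AE p in sg. ennreal (s2 p) * indicator A p = 0" using s2 As by (subst (asm) nn_integral_0_iff_AE) auto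
  thus ?thesis
  proof eventually_elim
   case (elim p)
   thus ?case using s2 by auto
  qed
 qed
 have wm: "w : bm sg" unfolding w_def using s1 s2(1) As by simp
 show ?thesis
 proof (rule that[OF wm])
  show "fst nu = dens sg w" unfolding s1(3)[symmetric]
  proof (rule density_cong)
   show "AE p in sg. ennreal (s1 p) = ennreal (w p)" using null1 by eventually_elim (use s2 in \<open>auto simp: w_def ennreal_neg\<close>)
  qed (use s1(1) wm in auto)
  show "snd nu = dens sg (%p. - w p)" unfolding s2(3)[symmetric]
  proof (rule density_cong)
   show "AE p in sg. ennreal (s2 p) = ennreal (- w p)" using null2 by eventually_elim (use s1 in \<open>auto simp: w_def ennreal_neg\<close>)
  qed (use s2(1) wm in auto)
 qed
qed

text \<open>The sum of \<open>cG (Lam mu)\<close> and the total variation dominates everything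
  involved. Existence gives the choice in \<open>action\<close> its meaning; uniqueness follows from
  homogeneity.\<close>

lemma action_value_exists:
 assumes P: "mu : PM" and nu: "nu : SRM G"
 shows "action_value theta J mu nu (action theta J mu nu)"
proof -
 let ?L = "cG (Lam mu)" and ?V = "summ (fst nu) (snd nu)"
 note p = SRMD(1)[OF nu] and n = SRMD(2)[OF nu]
 have rL: "radon_on G ?L" by (rule radon_cG[OF finb_Lam[OF P]])
 have rV: "radon_on G ?V" by (rule radon_sum[OF p n])
 define sg where "sg = summ ?L ?V"
 have sg: "radon_on G sg" unfolding sg_def by (rule radon_sum[OF rL rV])
 have sV: "sets ?V = sets ?L" "sets (snd nu) = sets (fst nu)" using radonD[OF rL] radonD[OF p] radonD[OF n] by auto
 have acL: "absolutely_continuous sg ?L" and acV: "absolutely_continuous sg ?V" unfolding sg_def by (rule ac_summ[OF sV(1)])+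
 have ac: "absolutely_continuous sg (fst nu)" "absolutely_continuous sg (snd nu)"
  using acV ac_summ[OF sV(2)] unfolding absolutely_continuous_def by auto
 obtain w where w: "w : bm sg" "fst nu = dens sg w" "snd nu = dens sg (%p. - w p)" by (rule radon_density_split[OF nu sg ac])
 obtain s where s: "s : bm sg" "!!p. s p >= 0" "dens sg s = ?L" by (rule real_dens[OF radon_sf[OF sg] radon_sf[OF rL] _ acL])
   (use radonD(1)[OF sg] radonD[OF rL] in auto)
 have rm: "r1 mu : bm sg" "r2 mu : bm sg" by (rule radon_bm[OF radonD(1)[OF sg] r12'(1)[OF P]], rule radon_bm[OF radonD(1)[OF sg] r12'(2)[OF P]])
 have e: "dens ?L r = dens sg (%p. s p * r p)"
  if "r : bm sg" "!!p. r p >= 0" for r unfolding s(3)[symmetric] using that s by (subst density_density_eq) (auto simp: ennreal_mult)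
 have "action_value theta J mu nu (nn_integral sg (%p. action_density theta (w p) (s p * r1 mu p) (s p * r2 mu p)))" unfolding action_value_def
  by (rule exI[of _ sg], rule exI[of _ "%p. s p * r1 mu p"], rule exI[of _ "%p. s p * r2 mu p"])
   (use sg w s rm r12'[OF P] density_Lam[OF P] e in auto)
 thus ?thesis unfolding action_def by (rule someI)
qed

lemma action_density_cmult:
 assumes "c >= 0" "s >= 0" "t >= 0"
 shows "action_density theta (c * u) (c * s) (c * t) = ennreal c * action_density theta u s t"
proof (cases "c = 0")
 case True
 thus ?thesis by (simp add: action_density_def)
next
 case False
 hence c: "c > 0" using assms by simp
 have th: "theta (c * s) (c * t) = c * theta s t" by (rule th_hom[OF assms])
 show ?thesis
 proof (cases "theta s t = 0")
  case True
  thus ?thesis using c by (simp add: action_density_def th)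
 next
  case F: False
  hence pos: "theta s t > 0" using th_nonneg[OF assms(2,3)] by simp
  let ?X = "u^2 / (2 * theta s t)"
  have "(c * u)^2 / (2 * (c * theta s t)) = c * ?X" by (simp add: power2_eq_square)
  moreover from this have "ennreal (c * ?X) = ennreal c * ennreal ?X"
   using c pos by (intro ennreal_mult) simp_all
  ultimately show ?thesis using F unfolding action_density_def th by simp
 qed
qed

lemma action_value_unique:
 assumes "action_value theta J mu nu a" "action_value theta J mu nu b"
 shows "a = b"
proof -
 from assms(1) obtain sg rho1 rho2 w where sg: "radon_on G sg"
  and m: "rho1 : bm sg" "rho2 : bm sg" "w : bm sg"
  and pos: "ALL p. rho1 p >= 0 & rho2 p >= 0"
  and d: "jump_measure1 J mu = dens sg rho1" "jump_measure2 J mu = dens sg rho2"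
  and n: "fst nu = dens sg w" "snd nu = dens sg (%p. - w p)"
  and a: "a = nn_integral sg (%p. action_density theta (w p) (rho1 p) (rho2 p))" unfolding action_value_def by blast
 from assms(2) obtain sg' rho1' rho2' w' where sg': "radon_on G sg'"
  and m': "rho1' : bm sg'" "rho2' : bm sg'" "w' : bm sg'"
  and pos': "ALL p. rho1' p >= 0 & rho2' p >= 0"
  and d': "jump_measure1 J mu = dens sg' rho1'" "jump_measure2 J mu = dens sg' rho2'"
  and n': "fst nu = dens sg' w'" "snd nu = dens sg' (%p. - w' p)"
  and b: "b = nn_integral sg' (%p. action_density theta (w' p) (rho1' p) (rho2' p))" unfolding action_value_def by blast
 have se: "sets sg' = sets sg" using radonD[OF sg] radonD[OF sg'] by simp
 have me: "h : bm sg" if "h : bm sg'" for h :: "'a * 'a => real" using that measurable_cong_sets[OF se , of "borel :: real measure"] by simp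
 show ?thesis unfolding a b by (rule homogeneous_integral_unique[where H = "%p. action_density theta", OF
     radon_sf[OF sg] radon_sf[OF sg'] radon_sf[OF radon_sum[OF sg sg']] se
     m(3,1,2) me[OF m'(3)] me[OF m'(1)] me[OF m'(2)] _ _ _ _ _ _ _ _ action_density_cmult measurable_action_density])
   (use pos pos' d d' n n' in auto)
qed

lemma action_eqI:
 assumes P: "mu : PM" and nu: "nu : SRM G" and av: "action_value theta J mu nu a"
 shows "action theta J mu nu = a" by (rule action_value_unique[OF action_value_exists[OF P nu] av])

end

section \<open>Energy is bounded by the action\<close>

lemma smooth_real_deriv:
 fixes f :: "real => real"
 assumes "smooth f"
 shows "(f has_real_derivative deriv f x) (at x)" "cts (deriv f)"
proof -
 have C: "Ck_on (Suc 0) UNIV f" using assms by (simp add: smooth_def)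
 have d: "(f has_real_derivative deriv f x) (at x)" for x
  using Ck_SucD[OF C] using DERIV_deriv_iff_real_differentiable by (auto simp: differentiable_def)
 thus "(f has_real_derivative deriv f x) (at x)" .
 have "frechet_derivative f (at x) 1 = deriv f x" for x
  using fun_cong[OF frechet_derivative_at[OF d[of x, unfolded has_field_derivative_def]], of 1] by simp
 thus "cts (deriv f)" using Ck_SucD[OF C, of 1] by simp
qed

lemma stepd_deriv:
 shows "(stepd has_real_derivative deriv stepd x) (at x)" "continuous_on A (deriv stepd)"
  "x ~: {0..1} ==> deriv stepd x = 0"
proof -
 show "(stepd has_real_derivative deriv stepd x) (at x)" by (rule smooth_real_deriv[OF smooth_stepd])
 show "continuous_on A (deriv stepd)" by (rule continuous_on_subset[OF smooth_real_deriv(2)[OF smooth_stepd]]) simp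
 assume x: "x ~: {0..1}"
 have "(stepd has_real_derivative 0) (at x)"
 proof (cases "x < 0")
  case True
  show ?thesis by (rule has_field_derivative_transform_within_open[of "%_. 1" _ _ "{..<0}"]) (use True in \<open>auto simp: stepd_eq_1\<close>)
 next
  case False
  hence "x > 1" using x by auto
  show ?thesis by (rule has_field_derivative_transform_within_open[of "%_. 0" _ _ "{1<..}"]) (use `x > 1` in \<open>auto simp: stepd_eq_0\<close>)
 qed
 thus "deriv stepd x = 0" by (rule DERIV_imp_deriv)
qed

lemma stepd_deriv_integral: "(LINT z|lborel. I01 z * deriv stepd z) = -1"
proof -
 have "(LINT z|lborel. deriv stepd z * I01 z) = stepd 1 - stepd 0" by (rule integral_FTC_Icc_real)
   (use stepd_deriv continuous_on_interior[OF stepd_deriv(2)[of UNIV]] in \<open>auto simp: continuous_at_imp_continuous_on\<close>)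
 thus ?thesis by (simp add: stepd_eq_1 stepd_eq_0 mult.commute)
qed

text \<open>\<open>- deriv stepd\<close> vanishes outside [0,1] and integrates to 1, so its rescaled
  copies are an approximate identity. Their supports \<open>[c n, c n + e n]\<close> stay inside
  [0,1], where \<open>F\<close> is continuous, and their positions may move with
  \<open>n\<close>.\<close>

lemma stepd_mollifier:
 fixes F :: "real => real"
 assumes F: "continuous_on {0..1} F" and c: "c ----> c0" and e: "e ----> 0"
  and ce: "!!n. e n > 0" "!!n. 0 <= c n" "!!n. c n + e n <= 1"
 shows "(%n. LINT r|lborel. I01 r * (deriv stepd ((r - c n) / e n) / e n * F r)) ----> - F c0"
proof -
 let ?d = "deriv stepd"
 have mem: "c n + e n * z : {0..1}" if "z : {0..1}" for n z
 proof -
  have "0 <= e n * z" "e n * z <= e n * 1" using that ce[of n] by auto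
  thus ?thesis using ce(2,3)[of n] by auto
 qed
 have "compact (F ` {0..1})" by (rule compact_continuous_image[OF F]) simp
 hence "bounded (F ` {0..1})" by (rule compact_imp_bounded)
 then obtain B where B': "ALL y:F ` {0..1}. norm y <= B" unfolding bounded_iff ..
 have "compact (?d ` {0..1})" by (rule compact_continuous_image[OF stepd_deriv(2)]) simp
 hence "bounded (?d ` {0..1})" by (rule compact_imp_bounded)
 then obtain D where D': "ALL y:?d ` {0..1}. norm y <= D" unfolding bounded_iff ..
 have c01: "c0 : {0..1}"
 proof -
  have "c n : {0..1}" for n using ce[of n] by auto
  thus ?thesis using closed_sequentially[OF closed_atLeastAtMost _ c] by auto
 qed
 have eq: "(LINT r|lborel. I01 r * (?d ((r - c n) / e n) / e n * F r)) =
  (LINT z|lborel. I01 z * (?d z * F (c n + e n * z)))" for n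
 proof -
  have ne: "e n ~= 0" using ce[of n] by simp
  have "(LINT r|lborel. I01 r * (?d ((r - c n) / e n) / e n * F r)) =
   abs (e n) *\<^sub>R (LINT z|lborel. I01 (c n + e n * z) * (?d ((c n + e n * z - c n) / e n) / e n * F (c n + e n * z)))"
   by (rule lborel_integral_real_affine[OF ne])
  also have "... = (LINT z|lborel. abs (e n) * (I01 (c n + e n * z) * (?d z / e n * F (c n + e n * z))))" using ne by simp
  also have "... = (LINT z|lborel. I01 z * (?d z * F (c n + e n * z)))"
  proof (rule Bint_cong)
   fix z :: real
   show "abs (e n) * (I01 (c n + e n * z) * (?d z / e n * F (c n + e n * z))) =
    I01 z * (?d z * F (c n + e n * z))"
   proof (cases "z : {0..1}")
    case True
    thus ?thesis using mem ce[of n] by simp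
   next
    case False
    thus ?thesis by (simp add: stepd_deriv)
   qed
  qed simp
  finally show ?thesis .
 qed
 have cont: "continuous_on {0..1} (%z. ?d z * F (c n + e n * z))" for n
  by (intro stepd_deriv continuous_on_compose2[OF F] continuous_intros) (use mem in blast)
 let ?X = "LINT z|lborel. I01 z * (?d z * F c0)"
 have "(%n. LINT z|lborel. I01 z * (?d z * F (c n + e n * z))) ---->
  ?X"
 proof (rule integral_dominated_convergence[where w = "%z. I01 z * (D * B)"])
  show "(%z. I01 z * (?d z * F c0)) : bm lborel" using cts_bm[OF stepd_deriv(2)] by simp
  show "(%z. I01 z * (?d z * F (c n + e n * z))) : bm lborel" for n using borel_measurable_continuous_on_indicator[OF _ cont] by simp
  show "integrable lborel (%z::real. I01 z * (D * B))" by simp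
  show "AE z in lborel. (%n. I01 z * (?d z * F (c n + e n * z))) ----> I01 z * (?d z * F c0)"
  proof (rule AE_I2)
   fix z :: real
   show "(%n. I01 z * (?d z * F (c n + e n * z))) ----> I01 z * (?d z * F c0)"
   proof (cases "z : {0..1}")
    case True
    have "(%n. c n + e n * z) ----> c0 + 0 * z" by (intro tendsto_intros c e)
    hence "(%n. F (c n + e n * z)) ----> F c0" by (intro continuous_on_tendsto_compose[OF F _ c01] always_eventually allI mem[OF True]) simp
    thus ?thesis by (intro tendsto_mult tendsto_const)
   qed simp
  qed
  show "AE z in lborel. norm (I01 z * (?d z * F (c n + e n * z))) <= I01 z * (D * B)" for n
  proof (rule AE_I2)
   fix z :: real
   show "norm (I01 z * (?d z * F (c n + e n * z))) <= I01 z * (D * B)"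
   proof (cases "z : {0..1}")
    case True
    have "abs (?d z) <= D" using bspec[OF D' imageI[OF True]] by simp
    moreover have "abs (F (c n + e n * z)) <= B" using bspec[OF B' imageI[OF mem[OF True]]] by simp
    ultimately show ?thesis using True by (auto simp: abs_mult mult_mono)
   qed simp
  qed
 qed
 moreover have "?X = - F c0"
 proof -
  have "?X = (LINT z|lborel. I01 z * ?d z) * F c0"
   by (subst integral_mult_left_zero[symmetric]) (simp add: mult.assoc)
  thus ?thesis by (simp add: stepd_deriv_integral)
 qed
 ultimately show ?thesis by (simp only: eq)
qed

text \<open>Fundamental lemma of the calculus of variations, tested with smoothed indicators of \<open>[s, t]\<close>.\<close>

lemma weak_derivative:
 fixes F k :: "real => real"
 assumes F: "continuous_on {0..1} F" and k: "integrable lborel (%r. I01 r * k r)"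
  and weak: "!!eta a b. smooth eta ==> 0 < a ==> b < 1 ==> (!!r. r ~: {a..b} ==> eta r = 0) ==>
   (LINT r|lborel. I01 r * (deriv eta r * F r)) + (LINT r|lborel. I01 r * (eta r * k r)) = 0"
  and st: "0 <= s" "s < t" "t <= 1"
 shows "F t - F s = (LINT r|lborel. indicator {s<..<t} r * k r)"
proof -
 \<comment> \<open>The shift by 3 gives \<open>4 * e n <= t - s\<close>. Then the ramps of
   \<open>eta n\<close>, on [s + e, s + 2e] and [t - 2e, t - e], do not overlap, and its support
   stays off the end points of [0,1].\<close>
 define e where "e n = (t - s) * inverse (real (Suc (n + 3)))" for n
 have e0: "e n > 0" "4 * e n <= t - s" for n
 proof -
  show "e n > 0" using st by (simp add: e_def)
  have "4 * inverse (real (Suc (n + 3))) <= 1" by (simp add: field_simps)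
  from mult_left_mono[OF this, of "t - s"] show "4 * e n <= t - s" using st by (simp add: e_def)
 qed
 have "(%n. inverse (real (Suc (n + 3)))) ----> 0" by (rule LIMSEQ_ignore_initial_segment[OF LIMSEQ_inverse_real_of_nat])
 from tendsto_mult_right_zero[OF this, of "t - s"] have e: "e ----> 0" unfolding e_def by simp
 define ct where "ct n = t - 2 * e n" for n
 define cs where "cs n = s + e n" for n
 have ctl: "ct ----> t" unfolding ct_def using tendsto_diff[OF tendsto_const tendsto_mult_right_zero[OF e]] by simp
 have csl: "cs ----> s" unfolding cs_def using tendsto_add[OF tendsto_const e] by simp
 define eta where "eta n r = stepd ((r - ct n) / e n) - stepd ((r - cs n) / e n)" for n r
 let ?d = "deriv stepd"
 have sm: "smooth (%r. stepd ((r - c) / e n))" for c n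
 proof -
  have "smooth (%r. inverse (e n) * r + - (c / e n))" by (intro smooth_add smooth_const smooth_bounded_linear bounded_linear_mult_right)
  hence "smooth (%r. (r - c) / e n)" by (simp add: divide_inverse algebra_simps)
  thus ?thesis by (rule smooth_compose_real[OF smooth_stepd])
 qed
 have "smooth (%r. stepd ((r - ct n) / e n) + (%_. -1) r * stepd ((r - cs n) / e n))" for n by (intro smooth_add smooth_mult sm smooth_const)
 hence smn: "smooth (eta n)" for n unfolding eta_def by simp
 have dn: "deriv (eta n) r = ?d ((r - ct n) / e n) / e n - ?d ((r - cs n) / e n) / e n" for n r
 proof (rule DERIV_imp_deriv)
  have d: "((%r. stepd ((r - c) / e n)) has_real_derivative ?d ((r - c) / e n) * (1 / e n)) (at r)" for c
   by (rule DERIV_chain2[OF stepd_deriv(1)]) (use e0[of n] in \<open>auto intro!: derivative_eq_intros\<close>)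
  show "(eta n has_real_derivative ?d ((r - ct n) / e n) / e n - ?d ((r - cs n) / e n) / e n) (at r)"
   unfolding eta_def using DERIV_diff[OF d d] by simp
 qed
 have out: "eta n r = 0" if "r ~: {s + e n..t - e n}" for n r
 proof (cases "r < s + e n")
  case True
  hence "(r - ct n) / e n <= 0" "(r - cs n) / e n <= 0" using e0[of n] using e0[of n] by (auto simp: ct_def cs_def divide_le_0_iff)
  thus ?thesis by (simp add: eta_def stepd_eq_1)
 next
  case False
  hence "r - ct n >= e n" "r - cs n >= e n" using that e0[of n] by (auto simp: ct_def cs_def)
  thus ?thesis using e0 by (simp add: eta_def stepd_eq_0)
 qed
 have one: "eta n r = 1" if "r >= s + 2 * e n" "r <= t - 2 * e n" for n r
 proof -
  show ?thesis
   using that e0[of n] by (simp add: ct_def cs_def divide_le_0_iff eta_def stepd_eq_0 stepd_eq_1)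
 qed
 have etab: "abs (eta n r) <= 1" for n r unfolding eta_def using stepd_bounds[of "(r - ct n) / e n"] stepd_bounds[of "(r - cs n) / e n"] by simp
 have w: "(LINT r|lborel. I01 r * (deriv (eta n) r * F r)) + (LINT r|lborel. I01 r * (eta n r * k r)) = 0" for n
  by (rule weak[OF smn _ _ out]) (use e0[of n] st in auto)
 have int: "integrable lborel (%r. I01 r * (?d ((r - c) / e n) / e n * F r))" for c n
 proof -
  have "continuous_on {0..1} (%r. ?d ((r - c) / e n) / e n * F r)"
   by (intro F continuous_on_divide continuous_on_compose2[OF stepd_deriv(2)] continuous_intros)
    (use e0[of n] in auto)
  from borel_integrable_atLeastAtMost'[OF this] show ?thesis by (simp add: set_integrable_def)
 qed
 have "(LINT r|lborel. I01 r * (deriv (eta n) r * F r)) =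
  (LINT r|lborel. I01 r * (?d ((r - ct n) / e n) / e n * F r)) -
  (LINT r|lborel. I01 r * (?d ((r - cs n) / e n) / e n * F r))" for n unfolding Bint_diff[OF int int, symmetric] dn by (simp_all add: algebra_simps)
 moreover have "(%n. (LINT r|lborel. I01 r * (?d ((r - ct n) / e n) / e n * F r)) -
  (LINT r|lborel. I01 r * (?d ((r - cs n) / e n) / e n * F r))) ----> - F t - - F s"
 proof (intro tendsto_diff stepd_mollifier F ctl csl e e0(1))
  show "0 <= ct n" "ct n + e n <= 1" "0 <= cs n" "cs n + e n <= 1" for n using e0[of n] st by (auto simp: ct_def cs_def)
 qed
 ultimately have l1: "(%n. LINT r|lborel. I01 r * (deriv (eta n) r * F r)) ----> - F t + F s" by simp
 have l2: "(%n. LINT r|lborel. I01 r * (eta n r * k r)) ----> (LINT r|lborel. indicator {s<..<t} r * k r)"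
 proof (rule integral_dominated_convergence[where w = "%r. abs (I01 r * k r)"])
  have km: "(%r. I01 r * k r) : bm lborel" using k by simp
  have "(%r. indicator {s<..<t} r * k r) = (%r. indicator {s<..<t} r * (I01 r * k r))" using st by (auto simp: indicator_def)
  thus "(%r. indicator {s<..<t} r * k r) : bm lborel" using km by simp
  have "eta n : bm borel" for n by (rule cts_bm[OF smooth_continuous[OF smn]])
  hence "(%r. eta n r * (I01 r * k r)) : bm lborel" for n using km by simp
  thus "(%r. I01 r * (eta n r * k r)) : bm lborel" for n by (simp add: mult_ac)
  show "integrable lborel (%r. abs (I01 r * k r))" using k by simp
  show "AE r in lborel. (%n. I01 r * (eta n r * k r)) ----> indicator {s<..<t} r * k r"
  proof (rule AE_I2)
   fix r :: real
   have "(%n. eta n r) ----> indicator {s<..<t} r"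
   proof (cases "r : {s<..<t}")
    case True
    hence "min (r - s) (t - r) > 0" by simp
    from order_tendstoD(2)[OF tendsto_mult_right_zero[OF e, of 2] this]
    have "eventually (%n. eta n r = 1) sequentially" by eventually_elim (rule one, auto)
    thus ?thesis using True by (simp add: tendsto_eventually)
   next
    case False
    hence "eta n r = 0" for n using e0[of n] by (intro out) auto
    thus ?thesis using False by simp
   qed
   hence "(%n. I01 r * (eta n r * k r)) ----> I01 r * (indicator {s<..<t} r * k r)" by (intro tendsto_mult tendsto_const)
   thus "(%n. I01 r * (eta n r * k r)) ----> indicator {s<..<t} r * k r" using st by (auto simp: indicator_def)
  qed
  show "AE r in lborel. norm (I01 r * (eta n r * k r)) <= abs (I01 r * k r)" for n
   using etab by (auto simp: abs_mult indicator_def mult_left_le_one_le)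
 qed
 have "- F t + F s + (LINT r|lborel. indicator {s<..<t} r * k r) = 0" using LIMSEQ_unique[OF tendsto_add[OF l1 l2]] w by simp
 thus ?thesis by simp
qed

section \<open>Solutions of the continuity equation tested with lists\<close>

context jump_setting begin

lemma signed_integral_cmult: "signed_integral nu (%p. c * g p) = c * signed_integral nu g" by (simp add: signed_integral_def algebra_simps)

lemma total_variation_eq: "total_variation nu = summ (fst nu) (snd nu)" by (simp add: total_variation_def summ_def)

abbreviation hh :: "'a * 'a => real" where "hh p \<equiv> min 1 (norm (fst p - snd p))"

definition varh :: "('a * 'a) signed_radon => ennreal" where
 "varh nu = nint (fst nu) hh + nint (snd nu) hh"

lemma hh_cont: "cts hh" by (intro continuous_intros)

lemma nn_integral_total_variation:
 assumes "nu : SRM G"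
 shows "nn_integral (total_variation nu) (%(x, y). ennreal (min 1 (norm (x - y)))) = varh nu"
proof -
 note p = radonD(1)[OF SRMD(1)[OF assms]] and n = radonD(1)[OF SRMD(2)[OF assms]]
 have hm: "(%p. ennreal (hh p)) : bm (fst nu)" by (rule radon_bm[OF p]) (use cts_bm[OF hh_cont] in simp)
 have "nn_integral (total_variation nu) (%(x, y). ennreal (min 1 (norm (x - y)))) = nint (summ (fst nu) (snd nu)) hh"
  unfolding total_variation_eq by (intro nn_integral_cong) (simp add: case_prod_beta)
 also have "... = varh nu" unfolding varh_def by (rule nn_integral_summ) (use p n hm in auto)
 finally show ?thesis .
qed

lemma hdom_integrable:
 assumes nu: "nu : SRM G" and g: "g : bm borel" "C >= 0" "!!p. abs (g p) <= C * hh p" and v: "varh nu < infty"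
 shows "integrable (fst nu) g" "integrable (snd nu) g"
proof -
 have *: "integrable M g" if M: "radon_on G M" and f: "nint M hh < infty" for M
 proof -
  have hm: "hh : bm M" by (rule radon_bm[OF radonD(1)[OF M] cts_bm[OF hh_cont]])
  have "integrable M hh" by (rule integrableI_bounded[OF hm]) (use f in simp)
  hence i: "integrable M (%p. C * hh p)" by simp
  show ?thesis by (rule Bint_bound[OF i radon_bm[OF radonD(1)[OF M]]]) (use g in \<open>auto intro: order_trans[OF _ abs_ge_self]\<close>)
 qed
 show "integrable (fst nu) g" "integrable (snd nu) g"
  by (rule *[OF SRMD(1)[OF nu]], use v in \<open>simp add: varh_def\<close>, rule *[OF SRMD(2)[OF nu]], use v in \<open>simp add: varh_def\<close>)
qed

lemma signed_integral_bound:
 assumes nu: "nu : SRM G" and g: "g : bm borel" "C >= 0" "!!p. abs (g p) <= C * hh p"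
 shows "ennreal (abs (signed_integral nu g)) <= ennreal C * varh nu"
proof -
 have *: "ennreal (abs (\<integral>p. g p \<partial>M)) <= ennreal C * nint M hh" if M: "radon_on G M" for M
 proof -
  have hm: "(%p. ennreal (hh p)) : bm M" by (rule radon_bm[OF radonD(1)[OF M]]) (use cts_bm[OF hh_cont] in simp)
  have "ennreal (abs (\<integral>p. g p \<partial>M)) <= nn_integral M (%p. ennreal (abs (g p)))"
  proof (cases "integrable M g")
   case True
   from integral_norm_bound_ennreal[OF this] show ?thesis by simp
  qed (simp add: not_integrable_integral_eq)
  also have "... <= nn_integral M (%p. ennreal C * ennreal (hh p))" using g by (intro nn_integral_mono) (simp add: ennreal_mult[symmetric])
  also have "... = ennreal C * nint M hh" by (rule nn_integral_cmult[OF hm])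
  finally show ?thesis .
 qed
 let ?X = "\<integral>p. g p \<partial>fst nu"
 let ?Y = "\<integral>p. g p \<partial>snd nu"
 have "abs (signed_integral nu g) <= abs ?X + abs ?Y" unfolding signed_integral_def by simp
 hence "ennreal (abs (signed_integral nu g)) <= ennreal (abs ?X + abs ?Y)" by (rule ennreal_leI)
 also have "... = ennreal (abs ?X) + ennreal (abs ?Y)" by simp
 also have "... <= ennreal C * varh nu" unfolding varh_def distrib_left by (intro add_mono * SRMD[OF nu])
 finally show ?thesis .
qed

lemma measurable_signed_integral:
 fixes g :: "'a * 'a => real"
 assumes nu: "nu : measurable M (borel_of_topology (weak_star_topology G))" and g: "cts g"
 shows "(%t. signed_integral (nu t) g) : bm M"
proof -
 have sp: "nu t : SRM G" if "t : space M" for t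
  using measurable_space[OF nu that] by (simp add: borel_of_topology_def topspace_weak_star space_measure_of_conv)
 have gm: "g : bm borel" by (rule cts_bm[OF g])
 let ?Y = "%p. max 0 (- g p)"
 let ?Z = "%p. max 0 (g p)"
 have c: "cts ?Z" "cts ?Y" "cts (%p. abs (g p))" by (intro continuous_intros g)+
 let ?X = "%p. ennreal (abs (g p))"
 \<comment> \<open>The case distinction reproduces the default value 0 of the Bochner integral, so
   measurability holds without any integrability of \<open>g\<close>.\<close>
 have ii: "(LINT p|N. g p) = (if (nn_integral N ?X) < infty
  then enn2real (nint N ?Z) - enn2real (nint N ?Y) else 0)"
  if "g : bm N" for N
 proof -
  show ?thesis using that using real_lebesgue_integral_def[of N] by (simp add: integrable_iff_bounded not_integrable_integral_eq)
 qed
 note m = measurable_parts[OF nu c(1)] measurable_parts[OF nu c(2)] measurable_parts[OF nu c(3)]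
 have [measurable]: "(%t. nint (fst (nu t)) ?Z) : bm M" "(%t. nint (snd (nu t)) ?Z) : bm M"
  "(%t. nint (fst (nu t)) ?Y) : bm M" "(%t. nint (snd (nu t)) ?Y) : bm M"
  "(%t. nn_integral (fst (nu t)) ?X) : bm M" "(%t. nn_integral (snd (nu t)) ?X) : bm M"
  by (rule m; simp)+
 have mf: "(%t. LINT p|fst (nu t). g p) : bm M"
 proof (subst measurable_cong)
  show "(LINT p|fst (nu t). g p) = (if (nn_integral (fst (nu t)) ?X) < infty
   then enn2real (nint (fst (nu t)) ?Z) - enn2real (nint (fst (nu t)) ?Y) else 0)"
   if "t : space M" for t by (rule ii[OF radon_bm[OF radonD(1)[OF SRMD(1)[OF sp[OF that]]] gm]])
 qed measurable
 have ms: "(%t. LINT p|snd (nu t). g p) : bm M"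
 proof (subst measurable_cong)
  show "(LINT p|snd (nu t). g p) = (if (nn_integral (snd (nu t)) ?X) < infty
   then enn2real (nint (snd (nu t)) ?Z) - enn2real (nint (snd (nu t)) ?Y) else 0)"
   if "t : space M" for t by (rule ii[OF radon_bm[OF radonD(1)[OF SRMD(2)[OF sp[OF that]]] gm]])
 qed measurable
 show ?thesis unfolding signed_integral_def using mf ms by simp
qed

lemma test_functionI:
 assumes eta: "smooth eta" "0 < a" "b < 1" "!!r. r ~: {a..b} ==> eta r = 0" and phi: "Ccs phi"
 shows "test_function 1 (%p. eta (fst p) * phi (snd p :: 'a))" unfolding test_function_def
proof
 let ?Y = "%p. eta (fst p) * phi (snd p)"
 have "smooth ?Y"
  by (intro smooth_mult smooth_compose_affine[OF bounded_linear_fst eta(1), of 0, simplified] smooth_compose_affine[OF bounded_linear_snd, of _ 0, simplified])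
   (use phi in \<open>simp add: Ccs_def\<close>)
 thus "ALL k. Ck_on k UNIV ?Y" by (simp add: smooth_def)
 let ?K = "{a..b} \<times> closure {x. phi x ~= 0}"
 have K: "compact ?K" using phi by (intro compact_Times) (auto simp: Ccs_def)
 let ?X = "{p. eta (fst p) * phi (snd p) ~= 0}"
 have "?X <= ?K" using eta closure_subset by force
 hence sub: "closure ?X <= ?K" by (rule closure_minimal[OF _ compact_imp_closed[OF K]])
 have "bounded (closure ?X)" by (rule bounded_subset[OF compact_imp_bounded[OF K] sub])
 moreover have "?K <= {0<..<1} \<times> UNIV" using eta by auto
 ultimately show "compact_support_in ({0<..<1} \<times> UNIV) ?Y"
  unfolding compact_support_in_def using sub by (auto simp: compact_eq_bounded_closed)
qed

lemma CE_D:
 assumes "(mu, nu) : CE 1 x y"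
 shows "!!t. t : {0..1} ==> mu t : PM" "continuous_map (top_of_set {0..1}) weak_topology mu" "mu 0 = x" "mu 1 = y"
  "nu : measurable (restrict_space borel {0..1}) (borel_of_topology (weak_star_topology G))"
  "(\<integral>\<^sup>+t\<in>{0..1}. nn_integral ((total_variation (nu t))) (%(x, y). ennreal (min 1 (norm (x - y)))) \<partial>lborel) < infty"
  "!!phi. test_function 1 phi ==>
    (LINT t:{0..1}|lborel. (LINT x|(mu t). deriv (%s. phi (s, x)) t)) +
    1 / 2 * (LINT t:{0..1}|lborel. signed_integral (nu t) (%(x, y). phi (t, y) - phi (t, x))) = 0" using assms unfolding CE_def by blast+

lemma weak_topology_wcurve:
 assumes "!!t. t : {0..1} ==> mu t : PM" "continuous_map (top_of_set {0..1}) weak_topology mu"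
 shows "wcurve 0 1 mu" unfolding wcurve_def
proof (intro conjI ballI allI impI)
 show "mu t : PM" if "t : {0..1}" for t by (rule assms(1)[OF that])
 fix phi :: "'a => real" assume phi: "Ccs phi"
 obtain C where C: "!!x. abs (phi x) <= C" by (rule Ccs_bounds[OF phi]) blast
 have b: "bounded (range phi)" using C unfolding bounded_iff by auto
 let ?Y = "%t. LINT x|mu t. phi x"
 show "continuous_on {0..1} ?Y" unfolding continuous_openin_preimage_eq
 proof (intro allI impI)
  fix T :: "real set" assume T: "open T"
  let ?X = "{mu : PM. (LINT x|mu. phi x) : T}"
  have "openin weak_topology ?X"
   unfolding weak_topology_def by (rule topology_generated_by_Basis) (use Ccs_continuous[OF phi] b T in blast)
  from openin_continuous_map_preimage[OF assms(2) this]
  have "openin (top_of_set {0..1}) {t : {0..1}. mu t : ?X}" by simp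
  also have "{t : {0..1}. mu t : ?X} = {0..1} Int ?Y -` T" using assms by auto
  finally show "openin (top_of_set {0..1}) ({0..1} Int ?Y -` T)" .
 qed
qed

lemma CE_signed_radon: "(mu, nu) : CE 1 x y ==> t : {0..1} ==> nu t : SRM GG" using measurable_space[OF CE_D(5), of mu]
 by (simp add: borel_of_topology_def topspace_weak_star space_measure_of_conv)

lemma CE_varh_finite:
 assumes ce: "(mu, nu) : CE 1 x y"
 shows "nn_integral lborel (%t. I01 t * varh (nu t)) < infty" "AE t in lborel. t : {0..1} --> varh (nu t) < infty"
proof -
 let ?X = "%t. I01 t * varh (nu t)"
 have "(%t. varh (nu t)) : bm (restrict_space borel {0..1})" unfolding varh_def using measurable_parts[OF CE_D(5)[OF ce] hh_cont] by simp
 hence m: "?X : bm lborel" by (subst (asm) borel_measurable_restrict_space_iff_ennreal) (simp_all add: mult.commute)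
 have "nn_integral lborel ?X =
  (\<integral>\<^sup>+t\<in>{0..1}. nn_integral ((total_variation (nu t))) (%(x, y). ennreal (min 1 (norm (x - y)))) \<partial>lborel)"
  by (intro nn_integral_cong) (simp add: indicator_def nn_integral_total_variation[OF CE_signed_radon[OF ce]])
 with CE_D(6)[OF ce] show f: "nn_integral lborel ?X < infty" by simp
 have "AE t in lborel. I01 t * varh (nu t) ~= infty" by (rule nn_integral_PInf_AE[OF m]) (use f in simp)
 thus "AE t in lborel. t : {0..1} --> varh (nu t) < infty" by (auto simp: less_top)
qed

text \<open>Test functions of the form eta(t) phi(x) say that the integral of \<open>phi\<close>
  along the curve has half the flux as its weak derivative in time; \<open>weak_derivative\<close>
  turns this into an identity for every pair of times.\<close>

lemma CE_flux:
 assumes ce: "(mu, nu) : CE 1 x y" and phi: "Ccs phi"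
 shows "integrable lborel (%r. I01 r * signed_integral (nu r) (dif phi))"
  "0 <= s ==> s <= t ==> t <= 1 ==>
   2 * ((LINT z|mu t. phi z) - (LINT z|mu s. phi z)) = (LINT r|lborel. indicator {s<..<t} r * signed_integral (nu r) (dif phi))"
proof -
 obtain C where C: "C >= 0" "!!p. abs (dif phi p) <= C * hh p" by (rule dif_bound[OF phi]) blast
 have dm: "dif phi : bm borel" by (rule dif_bm[OF phi])
 let ?k = "%r. signed_integral (nu r) (dif phi)"
 have "?k : bm (restrict_space borel {0..1})" by (rule measurable_signed_integral[OF CE_D(5)[OF ce] dif_continuous[OF Ccs_continuous[OF phi]]])
 hence m: "(%r. I01 r * ?k r) : bm lborel" by (subst (asm) borel_measurable_restrict_space_iff) simp_all
 have "nint lborel (%r. norm (I01 r * ?k r)) <= nn_integral lborel (%r. ennreal C * (I01 r * varh (nu r)))"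
  by (intro nn_integral_mono) (simp add: indicator_def signed_integral_bound[OF CE_signed_radon[OF ce] dm C])
 also have "... <= ennreal C * nn_integral lborel (%r. I01 r * varh (nu r))"
 proof -
  have "(%t. varh (nu t)) : bm (restrict_space borel {0..1})" unfolding varh_def using measurable_parts[OF CE_D(5)[OF ce] hh_cont] by simp
  hence "(%t. I01 t * varh (nu t)) : bm lborel" by (subst (asm) borel_measurable_restrict_space_iff_ennreal) (simp_all add: mult.commute)
  from nn_integral_cmult[OF this] show ?thesis by simp
 qed
 also have "... < infty" using CE_varh_finite[OF ce] by (simp add: ennreal_mult_less_top)
 finally show i: "integrable lborel (%r. I01 r * ?k r)" using m by (intro integrableI_bounded)
 have F: "continuous_on {0..1} (%t. LINT z|mu t. phi z)" by (rule wcurveD(2)[OF weak_topology_wcurve[OF CE_D(1,2)[OF ce]] phi])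
 assume st: "0 <= s" "s <= t" "t <= 1"
 show "2 * ((LINT z|mu t. phi z) - (LINT z|mu s. phi z)) = (LINT r|lborel. indicator {s<..<t} r * ?k r)"
 proof (cases "s = t")
  case False
  hence "s < t" using st by simp
  have "(LINT z|mu t. phi z) - (LINT z|mu s. phi z) = (LINT r|lborel. indicator {s<..<t} r * (?k r / 2))"
  proof (rule weak_derivative[OF F _ _ st(1) `s < t` st(3)])
   show "integrable lborel (%r. I01 r * (?k r / 2))" using i by simp
   fix eta :: "real => real" and a b :: real
   assume eta: "smooth eta" "0 < a" "b < 1" "!!r. r ~: {a..b} ==> eta r = 0"
   have "deriv (%s. eta s * phi x) t = deriv eta t * phi x" for t x
    by (rule DERIV_imp_deriv) (rule DERIV_cmult_right[OF smooth_real_deriv(1)[OF eta(1)]])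
   moreover have "(%(x, y). eta t * phi y - eta t * phi x) = (%p. eta t * dif phi p)" for t by (auto simp: dif_def algebra_simps)
   ultimately have "(LINT t:{0..1}|lborel. deriv eta t * (LINT x|(mu t). phi x)) + 1 / 2 * (LINT t:{0..1}|lborel. eta t * ?k t) = 0"
    using CE_D(7)[OF ce test_functionI[OF eta phi]] by (simp add: signed_integral_cmult)
   moreover
   ultimately show "(LINT r|lborel. I01 r * (deriv eta r * (LINT z|mu r. phi z))) +
    (LINT r|lborel. I01 r * (eta r * (?k r / 2))) = 0" by (simp add: set_lebesgue_integral_def)
  qed
  also have "... = (LINT r|lborel. indicator {s<..<t} r * ?k r / 2)" by simp
  also
  finally show ?thesis by simp
 qed simp
qed

text \<open>Stated with an auxiliary \<open>k\<close>, because \<open>signed_integral\<close> is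
  additive only if the single differences are integrable. This holds where \<open>varh\<close> is
  finite, that is, at almost every time.\<close>

lemma CE_test_list:
 assumes ce: "(mu, nu) : CE 1 x y"
 shows "l : tests 0 1 ==> EX k. integrable lborel (%r. I01 r * k r) &
  2 * Lf l mu = (LINT r|lborel. I01 r * k r) &
  (ALL r:{0..1}. varh (nu r) < infty --> k r = signed_integral (nu r) (dif (active l r)))"
proof (induction l)
 case Nil
 show ?case by (auto simp: dif_def signed_integral_def)

next
 case (Cons q l)
 obtain s t phi where q: "q = (s, t, phi)" by (cases q)
 have st: "0 <= s" "s <= t" "t <= 1" and phi: "Ccs phi" and l: "l : tests 0 1" using Cons.prems by (auto simp: q)
 obtain k where k: "integrable lborel (%r. I01 r * k r)" "2 * Lf l mu = (LINT r|lborel. I01 r * k r)"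
  "ALL r:{0..1}. varh (nu r) < infty --> k r = signed_integral (nu r) (dif (active l r))" using Cons.IH[OF l] by auto
 let ?m = "%r. signed_integral (nu r) (dif phi)"
 define k' where "k' r = indicator {s<..<t} r * ?m r + k r" for r
 have i: "integrable lborel (%r. indicator {s<..<t} r * (I01 r * ?m r))"
  by (rule integrable_mult_indicator[where 'b = real, simplified]) (use CE_flux[OF ce phi] in auto)
 have e: "indicator {s<..<t} r * (I01 r * ?m r) = indicator {s<..<t} r * ?m r" for r using st by (auto simp: indicator_def)
 have ek: "(%r. I01 r * k' r) = (%r. indicator {s<..<t} r * ?m r + I01 r * k r)" unfolding e[symmetric] by (simp add: k'_def algebra_simps)
 have "integrable lborel (%r. I01 r * k' r)" unfolding ek by (rule Bint_add[OF i[unfolded e] k(1)])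
 moreover have "2 * Lf (q # l) mu = (LINT r|lborel. I01 r * k' r)"
  unfolding ek Bochner_Integration.integral_add[OF i[unfolded e] k(1)] k(2)[symmetric] CE_flux(2)[OF ce phi st, symmetric] by (simp add: q)
 moreover have "k' r = signed_integral (nu r) (dif (active (q # l) r))" if r: "r : {0..1}" "varh (nu r) < infty" for r
 proof -
  note nu = CE_signed_radon[OF ce r(1)]
  have int: "integrable (fst (nu r)) (dif psi)" "integrable (snd (nu r)) (dif psi)" if psi: "Ccs psi" for psi
  proof -
   obtain C where C: "C >= 0" "!!p. abs (dif psi p) <= C * hh p" by (rule dif_bound[OF psi]) blast
   show "integrable (fst (nu r)) (dif psi)" "integrable (snd (nu r)) (dif psi)" by (rule hdom_integrable[OF nu dif_bm[OF psi] C r(2)])+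
  qed
  let ?c = "indicator {s<..<t} r :: real"
  have "dif (active (q # l) r) = (%p. ?c * dif phi p + dif (active l r) p)" by (auto simp: q dif_def)
  moreover have "signed_integral (nu r) (%p. ?c * dif phi p + dif (active l r) p) = ?c * ?m r + signed_integral (nu r) (dif (active l r))"
   unfolding signed_integral_def using int[OF phi] int[OF Ccs_active[OF l]] by (simp add: algebra_simps)
  ultimately show ?thesis using k(3) r by (simp add: k'_def)
 qed
 ultimately show ?case by blast
qed

lemma integral_le_nn_integral:
 fixes f :: "'z => real"
 assumes "integrable M f"
 shows "ennreal (LINT x|M. f x) <= nint M f"
proof -
 have i: "integrable M (%x. max 0 (f x))" using assms by simp
 have "ennreal (LINT x|M. f x) <= ennreal (LINT x|M. max 0 (f x))" by (intro ennreal_leI integral_mono assms i) simp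
 also have "... = nint M (%x. max 0 (f x))" by (rule nn_integral_eq_integral[symmetric, OF i]) simp
 finally show ?thesis by simp
qed

lemma CE_energy_le:
 assumes ce: "(mu, nu) : CE 1 x y"
 shows "wcurve 0 1 mu" "energy 0 1 mu <= (Act mu nu)"
proof -
 show w: "wcurve 0 1 mu" by (rule weak_topology_wcurve[OF CE_D(1,2)[OF ce]])
 show "energy 0 1 mu <= (Act mu nu)"
 proof (rule energy_least)
  fix l assume l: "l : tests 0 1"
  obtain k where k: "integrable lborel (%r. I01 r * k r)" "2 * Lf l mu = (LINT r|lborel. I01 r * k r)"
   "ALL r:{0..1}. varh (nu r) < infty --> k r = signed_integral (nu r) (dif (active l r))" using CE_test_list[OF ce l] by blast
  let ?g = "%r. I01 r * Gam (mu r) (active l r)"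
  have gi: "integrable lborel (%r. ?g r / 2)" using Qf_int[OF w l] by simp
  let ?f = "%r. I01 r * k r - ?g r / 2"
  have fi: "integrable lborel ?f" by (rule Bochner_Integration.integrable_diff[OF k(1) gi])
  have "ev 0 1 mu l = (LINT r|lborel. ?f r)" unfolding ev_def k Qf_def Bint_diff[OF k(1) gi] by simp
  hence "ennreal (ev 0 1 mu l) <= nint lborel ?f" using integral_le_nn_integral[OF fi] by simp
  also have "... <= (\<integral>\<^sup>+r\<in>{0..1}. action theta J (mu r) (nu r) \<partial>lborel)"
  proof (rule nn_integral_mono_AE)
   show "AE r in lborel. ennreal (?f r) <= action theta J (mu r) (nu r) * I01 r" using CE_varh_finite(2)[OF ce]
   proof eventually_elim
    case (elim r)
    show ?case
    proof (cases "r : {0..1}")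
     case True
     show ?thesis using k(3) elim True
      using action_value_test[OF CE_D(1)[OF ce] action_value_exists[OF CE_D(1)[OF ce] CE_signed_radon[OF ce]] Ccs_active[OF l]] True by simp
    qed simp
   qed
  qed
  finally show "ennreal (ev 0 1 mu l) <= (Act mu nu)" .
 qed
qed

end

section \<open>The velocity field of a curve of finite energy\<close>

text \<open>Each step of the induction applies \<open>(x + y)^2 <= 2 * x^2 + 2 * y^2\<close>; the
  geometric weights absorb the factor 2.\<close>

lemma square_telescope_bound:
 fixes g :: "nat => real"
 shows "(g (n + j) - g n)^2 <= 2 / 2 ^ n * (SUM k=n..<n+j. 2 ^ k * (g (Suc k) - g k)^2)"
proof (induction j arbitrary: n)
 case (Suc j)
 let ?R = "SUM k=Suc n..<Suc n+j. 2 ^ k * (g (Suc k) - g k)^2"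
 have IH: "(g (Suc n + j) - g (Suc n))^2 <= 2 / 2 ^ Suc n * ?R" by (rule Suc.IH)
 have "(x + y)^2 <= 2 * x^2 + 2 * y^2" for x y :: real using zero_le_power2[of "x - y"] by (simp add: power2_eq_square algebra_simps)
 from this[of "g (Suc n + j) - g (Suc n)" "g (Suc n) - g n"]
 have "(g (n + Suc j) - g n)^2 <= 2 * (g (Suc n + j) - g (Suc n))^2 + 2 * (g (Suc n) - g n)^2" by simp
 also have "... <= 2 * (2 / 2 ^ Suc n * ?R) + 2 * (g (Suc n) - g n)^2" using IH by simp
 also have "... = 2 / 2 ^ n * (2 ^ n * (g (Suc n) - g n)^2 + ?R)" by (simp add: field_simps)
 also have "2 ^ n * (g (Suc n) - g n)^2 + ?R = (SUM k=n..<n + Suc j. 2 ^ k * (g (Suc k) - g k)^2)" by (subst sum.atLeast_Suc_lessThan) simp_all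
 finally show ?case .
qed simp

lemma fast_cauchy_limit:
 fixes g :: "nat => real"
 assumes fin: "(\<Sum>k. ennreal (2 ^ k * (g (Suc k) - g k)^2)) < infty"
 shows "g ----> lim g"
  "ennreal ((lim g - g n)^2) <= ennreal (2 / 2 ^ n) * (\<Sum>k. ennreal (2 ^ k * (g (Suc k) - g k)^2))"
proof -
 define a where "a k = 2 ^ k * (g (Suc k) - g k)^2" for k
 let ?X = "\<Sum>k. ennreal (a k)"
 define S where "S = enn2real ?X"
 have S: "?X = ennreal S" "S >= 0" using fin by (simp_all add: S_def a_def)
 have a0: "a k >= 0" for k by (simp add: a_def)
 have part: "sum a A <= S" if "finite A" for A
 proof -
  have "ennreal (sum a A) = (SUM k:A. ennreal (a k))" using a0 by simp
  also have "... <= ?X" using that by (intro sum_le_suminf) auto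
  finally show ?thesis using S by simp
 qed
 have b: "(g m - g n)^2 <= 2 / 2 ^ n * S" if nm: "n <= m" for n m
 proof -
  obtain j where m: "m = n + j" using le_Suc_ex[OF nm] ..
  have "(g m - g n)^2 <= 2 / 2 ^ n * (SUM k=n..<n+j. a k)" unfolding m a_def by (rule square_telescope_bound)
  also have "... <= 2 / 2 ^ n * S" by (intro mult_left_mono part) simp_all
  finally show ?thesis .
 qed
 have "(%n. 2 / 2 ^ n * S) ----> 0" by (use LIMSEQ_divide_realpow_zero in simp)
 have "Cauchy g"
 proof (rule CauchyI')
  fix r :: real assume "r > 0"
  hence "r^2 > 0" by simp
  from order_tendstoD(2)[OF \<open>(%n. 2 / 2 ^ n * S) ----> 0\<close> this]
  obtain N where N: "!!n. n >= N ==> 2 / 2 ^ n * S < r^2" unfolding eventually_sequentially by auto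
  show "EX M. ALL m>=M. ALL n>m. dist (g m) (g n) < r"
  proof (intro exI[of _ N] allI impI)
   fix m n assume "m >= N" "n > m"
   hence "abs (g n - g m) < r" using b[of m n] N[of m] using `r > 0` by (intro power2_less_imp_less[of "abs (g n - g m)"]) simp_all
   thus "dist (g m) (g n) < r" by (simp add: dist_real_def)
  qed
 qed
 thus lim: "g ----> lim g" unfolding Cauchy_convergent_iff convergent_LIMSEQ_iff .
 have "(%m. (g m - g n)^2) ----> (lim g - g n)^2" by (intro tendsto_power tendsto_diff lim tendsto_const)
 hence "(lim g - g n)^2 <= 2 / 2 ^ n * S" by (rule LIMSEQ_le_const2) (rule , intro allI impI b)
 hence "ennreal ((lim g - g n)^2) <= ennreal (2 / 2 ^ n * S)" by (rule ennreal_leI)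
 also have "... = ennreal (2 / 2 ^ n) * ?X" unfolding S using S by (intro ennreal_mult) simp_all
 finally show "ennreal ((lim g - g n)^2) <= ennreal (2 / 2 ^ n) * (\<Sum>k. ennreal (2 ^ k * (g (Suc k) - g k)^2))" by (simp add: a_def)
qed

text \<open>The geometric weights make the sequence converge pointwise almost everywhere, with a
  rate. The pointwise \<open>lim\<close> thus serves as L^2 limit: it is a concrete measurable
  function, chosen in the same way at all times, and no subsequence depending on time
  occurs.\<close>

lemma L2_fast_limit:
 fixes g :: "nat => 'p => real"
 assumes [measurable]: "!!n. g n : bm M"
  and fin: "(\<Sum>k. nint M (%p. 2 ^ k * (g (Suc k) p - g k p)^2)) < infty"
 shows "nint M (%p. (lim (%n. g n p) - g n p)^2) <=
  ennreal (2 / 2 ^ n) * (\<Sum>k. nint M (%p. 2 ^ k * (g (Suc k) p - g k p)^2))"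
proof -
 let ?D = "%p. \<Sum>k. ennreal (2 ^ k * (g (Suc k) p - g k p)^2)"
 have D: "nn_integral M (%p. ?D p) = (\<Sum>k. nint M (%p. 2 ^ k * (g (Suc k) p - g k p)^2))" by (rule nn_integral_suminf) auto
 have "AE p in M. ?D p ~= infty" by (rule nn_integral_PInf_AE) (use fin D in auto)
 hence "AE p in M. ennreal ((lim (%n. g n p) - g n p)^2) <= ennreal (2 / 2 ^ n) * ?D p" by eventually_elim (rule fast_cauchy_limit, simp)
 hence "nint M (%p. (lim (%n. g n p) - g n p)^2) <= nn_integral M (%p. ennreal (2 / 2 ^ n) * ?D p)" by (rule nn_integral_mono_AE)
 also have "... = ennreal (2 / 2 ^ n) * nn_integral M (%p. ?D p)" by (rule nn_integral_cmult) auto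
 finally show ?thesis unfolding D .
qed

context jump_setting begin

lemma dif_prod_integrable:
 assumes "mu : PM" "Ccs phi" "Ccs psi"
 shows "integrable (Th mu) (%p. dif phi p * dif psi p)" by (rule kdom_dif2[OF assms(2,3)]) (rule Th_int[OF assms(1)])

lemma Gam_add_cmult:
 assumes P: "mu : PM" and phi: "Ccs phi" and psi: "Ccs psi"
 shows "Gam mu (%x. phi x + c * psi x) = Gam mu phi + 2 * c * (LINT p|Th mu. dif phi p * dif psi p) + c^2 * Gam mu psi"
proof -
 note i = dif_prod_integrable[OF P phi phi] dif_prod_integrable[OF P phi psi] dif_prod_integrable[OF P psi psi]
 have "(%p. (dif (%x. phi x + c * psi x) p)^2) =
  (%p. dif phi p * dif phi p + 2 * c * (dif phi p * dif psi p) + c^2 * (dif psi p * dif psi p))"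
  by (auto simp: dif_def power2_eq_square algebra_simps)
 thus ?thesis using i by (simp add: Gam_def power2_eq_square)
qed

text \<open>The polar form of \<open>Qf\<close>. In the lemmas that follow,
  \<open>l @ smul c l'\<close> plays the role of the vector l + c l'.\<close>

definition Bf :: "(real => 'a measure) => (real * real * ('a => real)) list => (real * real * ('a => real)) list => real" where
 "Bf mu l l' = (LINT r|lborel. I01 r * (LINT p|Th (mu r). dif (active l r) p * dif (active l' r) p))"

lemma active_add_smul: "active (l @ smul c l') r = (%x. active l r x + c * active l' r x)" by (simp add: fun_eq_iff active_append active_smul)

lemma Bf_integrable:
 assumes w: "wcurve 0 1 mu" and l: "l : tests 0 1" "l' : tests 0 1"
 shows "integrable lborel (%r. I01 r * (LINT p|Th (mu r). dif (active l r) p * dif (active l' r) p))"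
proof -
 let ?G = "%l r. I01 r * Gam (mu r) (active l r)"
 have m: "l @ smul 1 l' : tests 0 1" using l by (simp add: tests_smul)
 have "integrable lborel (%r. (?G (l @ smul 1 l') r - ?G l r - ?G l' r) / 2)"
  by (intro integrable_divide Bochner_Integration.integrable_diff Qf_int[OF w m] Qf_int[OF w l(1)] Qf_int[OF w l(2)])
 moreover have "(?G (l @ smul 1 l') r - ?G l r - ?G l' r) / 2 =
  I01 r * (LINT p|Th (mu r). dif (active l r) p * dif (active l' r) p)" for r
 proof (cases "r : {0..1}")
  case True
  show ?thesis
   unfolding active_add_smul using Gam_add_cmult[OF wcurveD(1)[OF w True] Ccs_active[OF l(1), of r] Ccs_active[OF l(2)], of 1] using True by simp
 qed simp
 ultimately show ?thesis by simp
qed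

lemma Qf_add_smul:
 assumes w: "wcurve 0 1 mu" and l: "l : tests 0 1" "l' : tests 0 1"
 shows "Qf 0 1 mu (l @ smul c l') = Qf 0 1 mu l + 2 * c * Bf mu l l' + c^2 * Qf 0 1 mu l'"
proof -
 let ?G = "%l r. I01 r * Gam (mu r) (active l r)"
 let ?B = "%r. I01 r * (LINT p|Th (mu r). dif (active l r) p * dif (active l' r) p)"
 have e: "?G (l @ smul c l') r = ?G l r + 2 * c * ?B r + c^2 * ?G l' r" for r
 proof (cases "r : {0..1}")
  case True
  thus ?thesis unfolding active_add_smul using Gam_add_cmult[OF wcurveD(1)[OF w] Ccs_active[OF l(1)] Ccs_active[OF l(2)]] by simp
 qed simp
 show ?thesis unfolding Qf_def Bf_def e using Qf_int[OF w l(1)] Qf_int[OF w l(2)] Bf_integrable[OF w l] by simp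
qed

lemma ev_add_smul:
 assumes w: "wcurve 0 1 mu" and l: "l : tests 0 1" "l' : tests 0 1"
 shows "ev 0 1 mu (l @ smul c l') = ev 0 1 mu l + c * (2 * Lf l' mu - Bf mu l l') - c^2 * Qf 0 1 mu l' / 2"
 unfolding ev_def Qf_add_smul[OF assms] by (simp add: Lf_append Lf_smul algebra_simps)

lemma Th_cG:
 assumes P: "mu : PM" and f: "f : bm borel"
 shows "integrable (cG (Lam mu)) (%p. f p * theta (r1 mu p) (r2 mu p)) \<longleftrightarrow> integrable (Th mu) f"
  "(LINT p|cG (Lam mu). f p * theta (r1 mu p) (r2 mu p)) = (LINT p|Th mu. f p)"
proof -
 let ?L = "cG (Lam mu)" and ?theta = "%p. theta (r1 mu p) (r2 mu p)"
 have rL: "radon_on G ?L" by (rule radon_cG[OF finb_Lam[OF P]])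
 have mL: "h : bm ?L" if "h : bm borel" for h :: "'a * 'a => real" by (rule radon_bm[OF radonD(1)[OF rL] that])
 have fm: "(%p. f p * ?theta p) : bm ?L" using f r12'[OF P] by (intro mL) measurable
 have ft: "f : bm (Th mu)" by (rule Th_bm[OF P f])
 have th: "?theta p >= 0" for p using th_nonneg r12'(3,4)[OF P] by simp
 have nn: "nint ?L (%p. g p * ?theta p) = nint (Th mu) g"
  if "g : bm borel" "!!p. g p >= 0" for g by (rule theta_integral_unique[OF P rL mL[OF r12'(1)[OF P]] mL[OF r12'(2)[OF P]] r12'(3,4)[OF P]
    density_Lam(1)[OF P, symmetric] density_Lam(2)[OF P, symmetric] that])
 show iff: "integrable ?L (%p. f p * ?theta p) \<longleftrightarrow> integrable (Th mu) f"
  using nn[] f th using fm ft by (simp add: abs_mult integrable_iff_bounded)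
 show "(LINT p|?L. f p * ?theta p) = (LINT p|Th mu. f p)"
 proof (cases "integrable (Th mu) f")
  case True
  have mx: "max 0 (f p) * ?theta p = max 0 (f p * ?theta p)" "max 0 (- f p) * ?theta p = max 0 (- (f p * ?theta p))" for p
   using th[of p] by (auto simp: max_def mult_le_0_iff zero_le_mult_iff)
  have "nint ?L (%p. f p * ?theta p) = nint (Th mu) f" using nn[of "%p. max 0 (f p)"] f by (simp add: mx)
  moreover have "nint ?L (%p. - (f p * ?theta p)) = nint (Th mu) (%p. - f p)" using nn[of "%p. max 0 (- f p)"] f by (simp add: mx)
  ultimately show ?thesis using True iff by (simp add: real_lebesgue_integral_def)
 next
  case False
  thus ?thesis using iff by (simp add: not_integrable_integral_eq)
 qed
qed

end

text \<open>\<open>l\<close> is a maximizing sequence for the energy of \<open>mu\<close>; the gradients of its active test functions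
 converge to the velocity field of \<open>mu\<close>.\<close>

locale finite_energy_curve = jump_setting +
 fixes mu :: "real => 'a measure" and e :: real and l :: "nat => (real * real * ('a => real)) list"
 assumes curve: "wcurve 0 1 mu" and e_nonneg: "e >= 0"
  and ev_le: "!!l'. l' : tests 0 1 ==> ev 0 1 mu l' <= e"
  and tests_l: "!!n. l n : tests 0 1" and ev_l: "!!n. ev 0 1 mu (l n) >= e - 1 / 4 ^ n"
begin

lemma prob: "t : {0..1} ==> mu t : PM" by (rule wcurveD[OF curve])

definition dl :: "nat => (real * real * ('a => real)) list" where
 "dl n = l (Suc n) @ smul (-1) (l n)"

lemma tests_dl: "dl n : tests 0 1" by (simp add: dl_def tests_l tests_smul)

lemma active_dl: "active (dl n) r x = active (l (Suc n)) r x - active (l n) r x" by (simp add: dl_def active_append active_smul)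

text \<open>Along the segment from \<open>l n\<close> to \<open>l (Suc n)\<close> the value
  \<open>ev\<close> is a concave quadratic polynomial. At the midpoint it exceeds the mean of the
  end values by \<open>Qf 0 1 mu (dl n) / 8\<close>; it is still at most \<open>e\<close>, while
  both end values are at least \<open>e - 1 / 4 ^ n\<close>.\<close>

lemma Qf_dl: "Qf 0 1 mu (dl n) <= 8 / 4 ^ n"
proof -
 let ?Q = "Qf 0 1 mu (dl n)" and ?X = "2 * Lf (dl n) mu - Bf mu (l n) (dl n)"
 let ?z0 = "l n @ smul 1 (dl n)"
 have "active ?z0 = active (l (Suc n))" by (auto simp: fun_eq_iff active_append active_smul active_dl)
 hence "Qf 0 1 mu ?z0 = Qf 0 1 mu (l (Suc n))" by (simp add: Qf_def)
 moreover have "Lf ?z0 mu = Lf (l (Suc n)) mu" by (simp add: Lf_append Lf_smul dl_def)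
 ultimately have "ev 0 1 mu ?z0 = ev 0 1 mu (l (Suc n))" by (simp add: ev_def)
 hence 1: "ev 0 1 mu (l (Suc n)) = ev 0 1 mu (l n) + ?X - ?Q / 2" using ev_add_smul[OF curve tests_l tests_dl] by simp
 have "ev 0 1 mu (l n @ smul (1/2) (dl n)) <= e" by (rule ev_le) (simp add: tests_l tests_dl tests_smul)
 hence 2: "ev 0 1 mu (l n) + ?X / 2 - ?Q / 8 <= e" using ev_add_smul[OF curve tests_l tests_dl] by (simp add: power2_eq_square)
 have "ev 0 1 mu (l (Suc n)) >= e - 1 / 4 ^ n" using ev_l[of "Suc n"] by (simp add: field_simps)
 moreover have "Q <= 8 * d" if "e - d <= a'" "a' = a + X - Q / 2" "a + X / 2 - Q / 8 <= e" "e - d <= a" for Q X a a' d :: real using that by simp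
 ultimately have "?Q <= 8 * (1 / 4 ^ n)" using 1 2 ev_l by blast
 thus ?thesis by simp
qed

text \<open>At an exact maximiser the first variation would vanish. At one that is optimal up to
  \<open>1 / 4 ^ n\<close> it is small, by optimising the multiple of \<open>l'\<close> that is
  added.\<close>

lemma euler_lagrange_bound:
 assumes l': "l' : tests 0 1"
 shows "(2 * Lf l' mu - Bf mu (l n) l')^2 <= 2 / 4 ^ n * Qf 0 1 mu l'"
proof -
 let ?X = "2 * Lf l' mu - Bf mu (l n) l'"
 have "2 * c * (?X / 2) <= 1 / 4 ^ n + c^2 * Qf 0 1 mu l' / 2" for c
 proof -
  have "ev 0 1 mu (l n @ smul c l') <= e" by (rule ev_le) (simp add: tests_l l' tests_smul)
  thus ?thesis using ev_l[of n] unfolding ev_add_smul[OF curve tests_l l'] by simp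
 qed
 from quadratic_bound[OF this Qf_nonneg] show ?thesis by (simp add: power_divide)

qed

text \<open>At an exact maximiser half the quadratic part equals \<open>e\<close>. In general
  \<open>Lf\<close> is at most the geometric mean of \<open>e\<close> and \<open>Qf / 2\<close>, by
  scaling the list; together with near-maximality this bounds the difference of the square roots of
  the two by \<open>sqrt (1 / 4 ^ n)\<close>.\<close>

lemma Qf_l: "Qf 0 1 mu (l n) / 2 <= (sqrt e + sqrt (1 / 4 ^ n))^2"
proof -
 let ?Q = "Qf 0 1 mu (l n)" and ?L = "Lf (l n) mu"
 have "2 * c * ?L <= e + c^2 * ?Q / 2" for c using ev_le[OF tests_smul[OF tests_l], of c n] by (simp add: ev_def Lf_smul Qf_smul)
 from quadratic_bound[OF this Qf_nonneg] have "?L^2 <= e * (?Q / 2)" by simp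
 hence "abs (?L) <= sqrt (e * (?Q / 2))" by (rule abs_le_of_sq)
 moreover have "sqrt (e * (?Q / 2)) = sqrt e * sqrt (?Q / 2)" by (rule real_sqrt_mult)
 ultimately have L: "?L <= sqrt e * sqrt (?Q / 2)" by simp
 have q: "(sqrt (?Q / 2))^2 = ?Q / 2" "(sqrt e)^2 = e" using Qf_nonneg e_nonneg by auto
 have "(sqrt (?Q / 2) - sqrt e)^2 = ?Q / 2 + e - 2 * (sqrt e * sqrt (?Q / 2))" unfolding power2_diff q by simp
 also have "... <= 1 / 4 ^ n" using L ev_l[of n] unfolding ev_def by simp
 finally have "abs (sqrt (?Q / 2) - sqrt e) <= sqrt (1 / 4 ^ n)" by (rule abs_le_of_sq)
 hence "sqrt (?Q / 2) <= sqrt e + sqrt (1 / 4 ^ n)" by simp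
 hence "(sqrt (?Q / 2))^2 <= (sqrt e + sqrt (1 / 4 ^ n))^2" by (rule power_mono) (use Qf_nonneg in simp)
 thus ?thesis by (simp only: q)
qed

text \<open>The weighted sum required by \<open>L2_fast_limit\<close>. \<open>Qf_dl\<close> decays
  like \<open>4 ^ n\<close>, so the weights \<open>2 ^ n\<close> leave a convergent series, and
  \<open>SS\<close> is finite almost everywhere.\<close>

definition SS :: "real => ennreal" where
 "SS t = (\<Sum>n. ennreal (2 ^ n * Gam (mu t) (active (dl n) t)))"

lemma SS_measurable: "(%t. I01 t * SS t) : bm borel"
proof -
 let ?X = "%t. \<Sum>n. ennreal (2 ^ n * (I01 t * Gam (mu t) (active (dl n) t)))"
 have "?X : bm borel" using Gam_active_measurable[OF curve tests_dl] by simp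
 also have "?X = (%t. I01 t * SS t)" by (auto simp: SS_def indicator_def)
 finally show ?thesis .
qed

lemma SS_integral: "nn_integral lborel (%t. I01 t * SS t) < infty"
proof -
 let ?G = "%n t. I01 t * Gam (mu t) (active (dl n) t)"
 have "nn_integral lborel (%t. I01 t * SS t) = nn_integral lborel (%t. (\<Sum>n. ennreal (2 ^ n * ?G n t)))"
  by (intro nn_integral_cong) (auto simp: SS_def indicator_def)
 also have "... = (\<Sum>n. nint lborel (%t. 2 ^ n * ?G n t))" using Gam_active_measurable[OF curve tests_dl] by (intro nn_integral_suminf) simp
 also have "... <= (\<Sum>n. ennreal (8 * (1/2) ^ n))"
 proof (intro suminf_le summableI)
  fix n
  have i: "integrable lborel (%t. 2 ^ n * ?G n t)" by (intro integrable_mult_right Qf_int[OF curve tests_dl])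
  have "nint lborel (%t. 2 ^ n * ?G n t) = ennreal (LINT t|lborel. 2 ^ n * ?G n t)" by (intro nn_integral_eq_integral i) (simp add: Gam_nonneg)
  also have "(LINT t|lborel. 2 ^ n * ?G n t) = 2 ^ n * Qf 0 1 mu (dl n)" by (simp add: Qf_def)
  also have "... <= 2 ^ n * (8 / 4 ^ n)" by (intro mult_left_mono Qf_dl) simp
  also have "2 ^ n * (8 / 4 ^ n) = 8 * (1/2 :: real) ^ n" by (simp add: power_mult_distrib[ symmetric] field_simps)
  finally show "nint lborel (%t. 2 ^ n * ?G n t) <= ennreal (8 * (1/2) ^ n)" by (simp add: ennreal_leI)
 qed
 also have "... = ennreal (\<Sum>n. 8 * (1/2) ^ n)" by (intro suminf_ennreal2) (auto)
 also have "... < infty" by simp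
 finally show ?thesis .
qed

definition Bp :: "real set" where "Bp = {0, 1} Un (UN n. UN q:set (l n). {fst q, fst (snd q)})"

lemma countable_Bp: "countable Bp"
proof -
 have "finite (UN q:set (l n). {fst q, fst (snd q)})" for n by simp
 hence "countable (UN n. UN q:set (l n). {fst q, fst (snd q)})" by (intro countable_UN countableI_type countable_finite)
 thus ?thesis unfolding Bp_def by simp
qed

text \<open>A Borel set of full measure in [0,1]. Finiteness of \<open>SS\<close> gives convergence
  of the gradients; avoiding the countably many break points makes each \<open>active (l n)\<close>
  constant near a good time.\<close>

definition good :: "real set" where "good = {t : {0..1}. t ~: Bp & SS t < infty}"

lemma good_sets: "good : sets borel"
proof -
 have "{t : space borel. I01 t * SS t < infty} : sets borel" using SS_measurable by simp
 moreover have "Bp : sets borel" using null_setsD2[OF countable_imp_null_set_lborel[OF countable_Bp]] by simp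
 moreover have "good = {t : space borel. I01 t * SS t < infty} Int {0..1} - Bp" by (auto simp: good_def)
 ultimately show ?thesis by simp
qed

lemma AE_good: "AE t in lborel. t : {0..1} --> t : good"
proof -
 have "AE t in lborel. I01 t * SS t ~= infty" by (rule nn_integral_PInf_AE) (use SS_measurable SS_integral in simp_all)
 moreover have "AE t in lborel. t ~: Bp" by (rule AE_not_in[OF countable_imp_null_set_lborel[OF countable_Bp]])
 ultimately show ?thesis by (auto simp: good_def less_top)
qed

definition gg :: "nat => real => 'a * 'a => real" where "gg n t = dif (active (l n) t)"

text \<open>The value 0 at bad times lets the statements below hold at every time. Where the
  sequence diverges \<open>lim\<close> is arbitrary, but at good times this concerns only a null set
  of \<open>Th (mu t)\<close>.\<close>

definition vv :: "real => 'a * 'a => real" where "vv t p = (if t : good then lim (%n. gg n t p) else 0)"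

lemma good01: "t : good ==> t : {0..1}" and good_prob: "t : good ==> mu t : PM" using prob by (auto simp: good_def)

lemma gg_measurable: "gg n t : bm borel" unfolding gg_def by (rule dif_bm[OF Ccs_active[OF tests_l]])

lemma vv_measurable: "vv t : bm borel" unfolding vv_def using gg_measurable by simp

lemma vv_close_nn:
 assumes t: "t : good"
 shows "nint (Th (mu t)) (%p. (vv t p - gg n t p)^2) <= ennreal (2 / 2 ^ n) * SS t"
proof -
 note P = good_prob[OF t]
 have m: "gg n t : bm (Th (mu t))" for n by (rule Th_bm[OF P gg_measurable])
 have e: "nint (Th (mu t)) (%p. 2 ^ k * (gg (Suc k) t p - gg k t p)^2) = ennreal (2 ^ k * Gam (mu t) (active (dl k) t))" for k
 proof -
  have d: "gg (Suc k) t p - gg k t p = dif (active (dl k) t) p" for p by (simp add: gg_def dif_def active_dl)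
  have "integrable (Th (mu t)) (%p. (dif (active (dl k) t) p)^2)"
   using dif_prod_integrable[OF P Ccs_active[OF tests_dl] Ccs_active[OF tests_dl]] by (simp add: power2_eq_square)
  thus ?thesis unfolding d Gam_def by (subst nn_integral_eq_integral) auto
 qed
 have "(\<Sum>k. nint (Th (mu t)) (%p. 2 ^ k * (gg (Suc k) t p - gg k t p)^2)) = SS t" unfolding e SS_def ..
 thus ?thesis using L2_fast_limit[where g = "%n. gg n t" and n = n, OF m] t by (simp add: vv_def good_def)
qed

definition ss :: "real => real" where "ss t = enn2real (SS t)"

lemma ss: "t : good ==> SS t = ennreal (ss t)" "ss t >= 0" by (simp_all add: ss_def good_def)

lemma ss_integrable: "integrable lborel (%t. indicator good t * ss t)"
proof (rule integrableI_bounded)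
 have e: "indicator good t * ss t = enn2real (indicator good t * (I01 t * SS t))" for t using good01 by (auto simp: ss_def indicator_def)
 show "(%t. indicator good t * ss t) : bm lborel" unfolding e using SS_measurable good_sets by measurable
 have "nint lborel (%t. norm (indicator good t * ss t)) <= nn_integral lborel (%t. I01 t * SS t)"
  by (intro nn_integral_mono) (use good01 ss in \<open>auto simp: indicator_def\<close>)
 also note SS_integral
 finally show "nint lborel (%t. norm (indicator good t * ss t)) < infty" .
qed

lemma vv_close:
 assumes t: "t : good"
 shows "integrable (Th (mu t)) (%p. (vv t p - gg n t p)^2)" "(LINT p|Th (mu t). (vv t p - gg n t p)^2) <= 2 / 2 ^ n * ss t"
proof -
 let ?X = "%p. (vv t p - gg n t p)^2"
 have le: "nint (Th (mu t)) ?X <= ennreal (2 / 2 ^ n * ss t)"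
  using vv_close_nn[OF t] ss unfolding ss(1)[OF t] by (subst ennreal_mult) simp_all
 have m: "?X : bm (Th (mu t))" by (rule Th_bm[OF good_prob[OF t]]) (use vv_measurable gg_measurable in measurable)
 show i: "integrable (Th (mu t)) ?X"
 proof (rule integrableI_bounded[OF m])
  have "nint (Th (mu t)) (%p. norm ((vv t p - gg n t p)^2)) <= ennreal (2 / 2 ^ n * ss t)" using le by simp
  also have "... < infty" by simp
  finally show "nint (Th (mu t)) (%p. norm ((vv t p - gg n t p)^2)) < infty" .
 qed
 have "ennreal (LINT p|Th (mu t). (vv t p - gg n t p)^2) <= ennreal (2 / 2 ^ n * ss t)"
  using le by (subst nn_integral_eq_integral[symmetric, OF i]) auto
 thus "(LINT p|Th (mu t). (vv t p - gg n t p)^2) <= 2 / 2 ^ n * ss t" using ss by simp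
qed

lemma gg_sq: "t : {0..1} ==> integrable (Th (mu t)) (%p. (gg n t p)^2)"
 using dif_prod_integrable[OF prob Ccs_active[OF tests_l] Ccs_active[OF tests_l]] by (simp add: gg_def power2_eq_square)

lemma vv_sq:
 assumes t: "t : {0..1}"
 shows "integrable (Th (mu t)) (%p. (vv t p)^2)"
  "t : good ==> (LINT p|Th (mu t). (vv t p)^2) <= 4 * ss t + 2 * Gam (mu t) (active (l 0) t)"
proof -
 let ?Y = "%p. (vv t p)^2"
 have m: "?Y : bm (Th (mu t))" by (rule Th_bm[OF prob[OF t]]) (use vv_measurable in measurable)
 let ?X = "LINT p|Th (mu t). (vv t p)^2"
 let ?Z = "active (l 0) t"
 have "integrable (Th (mu t)) ?Y & (t : good --> ?X <= 4 * ss t + 2 * Gam (mu t) ?Z)"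
 proof (cases "t : good")
  case True
  let ?h = "%p. 2 * (vv t p - gg 0 t p)^2 + 2 * (gg 0 t p)^2"
  have i: "integrable (Th (mu t)) ?h" using vv_close[OF True] gg_sq[OF t] by simp
  have le: "(vv t p)^2 <= ?h p" for p using zero_le_power2[of "vv t p - 2 * gg 0 t p"] by (simp add: power2_eq_square algebra_simps)
  have iv: "integrable (Th (mu t)) ?Y" by (rule Bint_bound[OF i m]) (use le in \<open>auto intro: order_trans[OF _ abs_ge_self]\<close>)
  have "?X <= (LINT p|Th (mu t). ?h p)" by (intro integral_mono iv i le)
  also have "... = 2 * (LINT p|Th (mu t). (vv t p - gg 0 t p)^2) + 2 * Gam (mu t) ?Z"
   using vv_close[OF True] gg_sq[OF t] by (simp add: Gam_def gg_def)
  also have "... <= 4 * ss t + 2 * Gam (mu t) ?Z" using vv_close[OF True, of 0] by simp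
  finally show ?thesis using iv by simp
 qed (simp add: vv_def)
 thus "integrable (Th (mu t)) ?Y"
  "t : good ==> ?X <= 4 * ss t + 2 * Gam (mu t) ?Z" by auto
qed

end

text \<open>Young's inequality with a free parameter \<open>tau\<close>, used instead of
  Cauchy-Schwarz so that no square roots of integrals appear.\<close>

lemma L2_product:
 fixes f h :: "'p => real"
 assumes m: "f : bm M" "h : bm M" and i: "integrable M (%p. (f p)^2)" "integrable M (%p. (h p)^2)"
 shows "integrable M (%p. f p * h p)"
  "tau > 0 ==> abs (\<integral>p. f p * h p \<partial>M) <= (tau * (LINT p|M. (f p)^2) + (LINT p|M. (h p)^2) / tau) / 2"
proof -
 have le: "abs (x * y) <= (tau * x^2 + y^2 / tau) / 2" if t: "tau > 0" for tau x y :: real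
 proof -
  have "0 <= (tau * abs x - abs y)^2" by simp
  thus ?thesis using t by (simp add: power2_diff power_mult_distrib abs_mult field_simps power2_eq_square)
 qed
 have i2: "integrable M (%p. (tau * (f p)^2 + (h p)^2 / tau) / 2)" for tau using i by simp
 show ip: "integrable M (%p. f p * h p)"
 proof (rule Bint_bound[OF i2[of 1]])
  show "(%p. f p * h p) : bm M" using m by simp
  show "AE p in M. norm (f p * h p) <= norm ((1 * (f p)^2 + (h p)^2 / 1) / 2)" using le[of 1] by simp
 qed
 assume t: "tau > 0"
 have "abs (\<integral>p. f p * h p \<partial>M) <= (LINT p|M. abs (f p * h p))" by simp
 also have "... <= (LINT p|M. (tau * (f p)^2 + (h p)^2 / tau) / 2)" by (intro integral_mono integrable_abs ip i2 le[OF t])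
 also have "... = (tau * (LINT p|M. (f p)^2) + (LINT p|M. (h p)^2) / tau) / 2" using i by simp
 finally show "abs (\<integral>p. f p * h p \<partial>M) <= (tau * (LINT p|M. (f p)^2) + (LINT p|M. (h p)^2) / tau) / 2" .
qed

context jump_setting begin

lemma kdom_hh2: "kdom (%p. (hh p)^2) 1" unfolding kdom_def kk_eq using kk_bounds by simp

lemma hdom_sq_integrable:
 assumes P: "mu : PM" and g: "g : bm borel" "C >= 0" "!!p. abs (g p) <= C * hh p"
 shows "integrable (Th mu) (%p. (g p)^2)" using Th_int[OF P kdom_prod[OF g(1) g(1) g(2) g(2) g(3) g(3)]] by (simp add: power2_eq_square)

lemma kdom_compact:
 assumes "compact C" "C <= G"
 obtains B where "kdom (indicator C) B"
proof (cases "C = {}")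
 case True
 show ?thesis by (rule that[of 0]) (simp add: kdom_def True)
next
 case False
 have "continuous_on C (%p. kk (fst p) (snd p))" unfolding kk_def by (intro continuous_intros)
 hence "EX p:C. ALL q:C. kk (fst p) (snd p) <= kk (fst q) (snd q)" using assms False by (intro continuous_attains_inf)
 then obtain p where p: "p : C" "!!q. q : C ==> kk (fst p) (snd p) <= kk (fst q) (snd q)" by auto
 let ?m = "kk (fst p) (snd p)"
 have m: "?m > 0" using p assms by (intro kk_pos) (auto simp: G_def)
 have Cb: "C : sets borel" using assms by (simp add: compact_imp_closed)
 have "abs (indicator C q) <= 1 / ?m * kk (fst q) (snd q)" for q using p m kk_bounds by (cases "q : C") (simp_all)
 thus ?thesis using Cb m by (intro that[of "1 / ?m"]) (simp add: kdom_def)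
qed

lemma kdom_Cc:
 assumes f: "cts f" "compact_support_in GG f"
 obtains B where "kdom f B"
proof -
 let ?K = "closure {p. f p ~= 0}"
 have K: "compact ?K" "?K <= G" using f by (auto simp: compact_support_in_def)
 obtain D where D: "kdom (indicator ?K) D" by (rule kdom_compact[OF K])
 have "compact (f ` ?K)" by (rule compact_continuous_image[OF continuous_on_subset[OF f(1)] K(1)]) simp
 hence "bounded (f ` ?K)" by (rule compact_imp_bounded)
 then obtain B where "ALL y:f ` ?K. norm y <= B" unfolding bounded_iff ..
 hence B: "abs (f p) <= B" if "p : ?K" for p using bspec[OF _ that] by simp
 have le: "abs (f p) <= abs B * D * kk (fst p) (snd p)" for p
 proof (cases "p : ?K")
  case True
  have "abs B * 1 <= abs B * (D * kk (fst p) (snd p))" using kdomD(3)[OF D, of p] True by (intro mult_left_mono) auto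
  thus ?thesis using B[OF True] by simp
 next
  case False
  hence "f p = 0" using closure_subset[of "{p. f p ~= 0}"] by auto
  thus ?thesis using kdomD[OF D] kk_bounds by simp
 qed
 show ?thesis by (rule that[of "abs B * D"]) (use le kdomD[OF D] cts_bm[OF f(1)] in \<open>simp add: kdom_def\<close>)
qed

lemma kdom_sq:
 assumes P: "mu : PM" and f: "kdom f B"
 shows "integrable (Th mu) (%p. (f p)^2)" "(LINT p|Th mu. (f p)^2) <= B^2 * KC"
proof -
 have "kdom (%p. (f p)^2) (B^2)" unfolding kdom_def
 proof (intro conjI allI)
  show "(%p. (f p)^2) : bm borel" using kdomD[OF f] by simp
  fix p
  let ?k = "kk (fst p) (snd p)"
  have "(f p)^2 <= (B * ?k)^2" using kdomD[OF f] power_mono[OF _ abs_ge_zero, of "f p" "B * ?k" 2] by simp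
  also have "... <= B^2 * ?k" using kk_bounds unfolding power_mult_distrib by (intro mult_left_mono) (auto simp: power2_eq_square mult_left_le)
  finally show "abs ((f p)^2) <= B^2 * ?k" by simp
 qed simp
 from Th_int[OF P this] show "integrable (Th mu) (%p. (f p)^2)" "(LINT p|Th mu. (f p)^2) <= B^2 * KC" by auto
qed

lemma nn_Th_cG:
 assumes P: "mu : PM" and g: "g : bm borel" "!!p. g p >= 0"
 shows "nint (cG (Lam mu)) (%p. g p * theta (r1 mu p) (r2 mu p)) = nint (Th mu) g"
proof -
 have rL: "radon_on G (cG (Lam mu))" by (rule radon_cG[OF finb_Lam[OF P]])
 note mL = radon_bm[OF radonD(1)[OF rL]]
 show ?thesis by (rule theta_integral_unique[OF P rL mL[OF r12'(1)[OF P]] mL[OF r12'(2)[OF P]] r12'(3,4)[OF P]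
    density_Lam(1)[OF P, symmetric] density_Lam(2)[OF P, symmetric] g])
qed

end

section \<open>The flux of the velocity field as a signed Radon measure\<close>

context finite_energy_curve begin

definition flux :: "real => ('a * 'a => real) => real" where
 "flux t g = (LINT p|Th (mu t). vv t p * g p)"

lemma vv_Th: "t : {0..1} ==> vv t : bm (Th (mu t))" "t : {0..1} ==> gg n t : bm (Th (mu t))"
 by (rule Th_bm[OF prob vv_measurable], simp, rule Th_bm[OF prob gg_measurable])

lemma flux_approx:
 assumes t: "t : good" and g: "g : bm borel" "integrable (Th (mu t)) (%p. (g p)^2)"
 shows "abs (flux t g - (LINT p|Th (mu t). gg n t p * g p)) <= (ss t + (LINT p|Th (mu t). (g p)^2)) / sqrt 2 ^ n"
proof -
 note t01 = good01[OF t]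
 note gm = Th_bm[OF good_prob[OF t] g(1)]
 \<comment> \<open>The squared L^2 distance of \<open>vv\<close> and \<open>gg n\<close> is of order
   \<open>ss t / 2 ^ n\<close>; with this parameter both terms of Young's inequality become of order
   \<open>1 / sqrt 2 ^ n\<close>.\<close>
 let ?tau = "sqrt 2 ^ n :: real"
 have tau: "?tau > 0" "?tau * ?tau = 2 ^ n" by (simp_all add: power_mult_distrib[symmetric])
 have iv: "integrable (Th (mu t)) (%p. vv t p * g p)" "integrable (Th (mu t)) (%p. gg n t p * g p)"
  by (rule L2_product[OF vv_Th(1)[OF t01] gm vv_sq(1)[OF t01] g(2)], rule L2_product[OF vv_Th(2)[OF t01] gm gg_sq[OF t01] g(2)])
 have dm: "(%p. vv t p - gg n t p) : bm (Th (mu t))" using vv_Th[OF t01] by simp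
 let ?X = "LINT p|Th (mu t). (g p)^2"
 have "abs (flux t g - (LINT p|Th (mu t). gg n t p * g p)) <=
  (?tau * (LINT p|Th (mu t). (vv t p - gg n t p)^2) + ?X / ?tau) / 2"
  unfolding flux_def Bint_diff[OF iv, symmetric] using L2_product[OF dm gm vv_close(1)[OF t] g(2)] by (simp add: algebra_simps)
 also have "... <= (?tau * (2 / 2 ^ n * ss t) + ?X / ?tau) / 2"
  using vv_close[OF t] by (intro divide_right_mono add_right_mono mult_left_mono) auto
 also have "... = (2 * ss t + ?X) / ?tau / 2" unfolding tau(2)[symmetric] by (simp add: field_simps)
 also have "... <= (ss t + ?X) / ?tau" by (auto simp: field_simps)
 finally show ?thesis .
qed

lemma sqrt2_tendsto: "(%n. c / sqrt 2 ^ n) ----> (0::real)" by (rule LIMSEQ_divide_realpow_zero) simp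

lemma flux_bad: "t ~: good ==> flux t g = 0" by (simp add: flux_def vv_def)

text \<open>Two limits of \<open>Bf mu (l n) l'\<close> are compared. \<open>flux_approx\<close>
  gives dominated convergence of the time integrands towards the flux, while
  \<open>euler_lagrange_bound\<close> gives the limit \<open>2 * Lf l' mu\<close>.\<close>

lemma euler_lagrange:
 assumes l': "l' : tests 0 1"
 shows "integrable lborel (%t. I01 t * flux t (dif (active l' t)))"
  "(LINT t|lborel. I01 t * flux t (dif (active l' t))) = 2 * Lf l' mu"
proof -
 let ?g = "%t. dif (active l' t)"
 have gm: "?g t : bm borel" for t by (rule dif_bm[OF Ccs_active[OF l']])
 have gi: "integrable (Th (mu t)) (%p. (?g t p)^2)" if "t : {0..1}" for t
  using dif_prod_integrable[OF prob[OF that] Ccs_active[OF l'] Ccs_active[OF l']] by (simp add: power2_eq_square)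
 let ?b = "%n t. \<integral>p. gg n t p * ?g t p \<partial>Th (mu t)"
 have ub: "integrable lborel (%t. I01 t * ?b n t)" for n unfolding gg_def by (rule Bf_integrable[OF curve tests_l l'])
 have e: "indicator good t * (I01 t * ?b n t) = indicator good t * ?b n t" for n t using good01 by (auto simp: indicator_def)
 have u: "integrable lborel (%t. indicator good t * ?b n t)" for n using integrable_mult_indicator[OF _ ub, of good] good_sets by (simp add: e)
 have ap: "abs (I01 t * flux t (?g t) - indicator good t * ?b n t) <= indicator good t * (ss t + Gam (mu t) (active l' t)) / sqrt 2 ^ n" for n t
 proof (cases "t : good")
  case True
  thus ?thesis using flux_approx[OF True gm gi] good01 by (simp add: Gam_def)
 qed (simp add: flux_bad)
 have conv: "(%n. indicator good t * ?b n t) ----> I01 t * flux t (?g t)" for t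
 proof -
  have "(%n. I01 t * flux t (?g t) - indicator good t * ?b n t) ----> 0"
   by (rule Lim_null_comparison[OF always_eventually sqrt2_tendsto[of "indicator good t * (ss t + Gam (mu t) (active l' t))"]])
    (simp only: real_norm_def ap simp_thms)
  from tendsto_diff[OF tendsto_const this, of "I01 t * flux t (?g t)"] show ?thesis by simp
 qed
 have fm: "(%t. I01 t * flux t (?g t)) : bm lborel" by (rule borel_measurable_LIMSEQ_real[OF conv borel_measurable_integrable[OF u]])
 have dom: "integrable lborel (%t. indicator good t * (ss t + Gam (mu t) (active l' t)))"
 proof -
  have eG: "indicator good t * (I01 t * Gam (mu t) (active l' t)) = indicator good t * Gam (mu t) (active l' t)" for t
   using good01 by (auto simp: indicator_def)
  have "integrable lborel (%t. indicator good t * Gam (mu t) (active l' t))"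
   using integrable_mult_indicator[OF _ Qf_int[OF curve l'], of good] good_sets unfolding real_scaleR_def eG by simp
  from Bint_add[OF ss_integrable this] show ?thesis by (simp add: distrib_left)
 qed
 let ?d = "%n t. I01 t * flux t (?g t) - indicator good t * ?b n t"
 have dm: "?d n : bm lborel" for n using fm u by measurable
 have dle: "abs (?d n t) <= indicator good t * (ss t + Gam (mu t) (active l' t))" for n t
 proof -
  have "0 <= indicator good t * (ss t + Gam (mu t) (active l' t))" by (intro mult_nonneg_nonneg add_nonneg_nonneg ss Gam_nonneg) simp
  moreover
  ultimately have "indicator good t * (ss t + Gam (mu t) (active l' t)) / sqrt 2 ^ n <= indicator good t * (ss t + Gam (mu t) (active l' t)) / 1"
   by (intro divide_left_mono) auto
  from order_trans[OF ap this] show ?thesis by simp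
 qed
 have di: "integrable lborel (?d n)" for n by (rule Bint_bound[OF dom dm], rule , unfold real_norm_def, rule order_trans[OF dle abs_ge_self])
 show fi: "integrable lborel (%t. I01 t * flux t (?g t))" using Bint_add[OF di[of 0] u[of 0]] by simp
 let ?X = "LINT t|lborel. I01 t * flux t (?g t)"
 have "(%n. LINT t|lborel. ?d n t) ----> (\<integral>t. 0 \<partial>(lborel :: real measure))"
 proof (rule integral_dominated_convergence[OF _ dm dom])
  show "AE t in lborel. (%n. ?d n t) ----> 0" proof (rule AE_I2)
   show "(%n. ?d n t) ----> 0" for t using tendsto_diff[OF tendsto_const conv, of "I01 t * flux t (?g t)" t] by simp
  qed
  show "AE t in lborel. norm (?d n t) <= indicator good t * (ss t + Gam (mu t) (active l' t))" for n by (rule , unfold real_norm_def, rule dle)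
 qed simp
 moreover have "(LINT t|lborel. ?d n t) = ?X - Bf mu (l n) l'" for n
 proof -
  have "(LINT t|lborel. indicator good t * ?b n t) = Bf mu (l n) l'" unfolding Bf_def gg_def[symmetric]
  proof (rule integral_cong_AE)
   show "AE t in lborel. indicator good t * ?b n t = I01 t * ?b n t" using AE_good
   proof eventually_elim
    case (elim t)
    show ?case
    proof (cases "t : {0..1}")
     case True
     thus ?thesis using elim by simp
    next
     case False
     hence "t ~: good" using good01 by auto
     thus ?thesis using False by simp
    qed
   qed
  qed (use u ub in auto)
  thus ?thesis using Bint_diff[OF fi u] by simp
 qed
 ultimately have "(%n. ?X - Bf mu (l n) l') ----> 0" by simp
 from tendsto_diff[OF tendsto_const this, of "\<integral>t. I01 t * flux t (?g t) \<partial>lborel"]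
 have B1: "(%n. Bf mu (l n) l') ----> ?X" by simp
 have "(%n. 2 * Qf 0 1 mu l' / 4 ^ n) ----> 0" by (rule LIMSEQ_divide_realpow_zero) simp
 from tendsto_real_sqrt[OF this] have "(%n. sqrt (2 * Qf 0 1 mu l' / 4 ^ n)) ----> 0" by simp
 moreover have "norm (2 * Lf l' mu - Bf mu (l n) l') <= sqrt (2 * Qf 0 1 mu l' / 4 ^ n)" for n
  using abs_le_of_sq[OF euler_lagrange_bound[OF l']] by simp
 ultimately have "(%n. 2 * Lf l' mu - Bf mu (l n) l') ----> 0" by (rule Lim_null_comparison[OF always_eventually[OF allI], rotated])
 from tendsto_diff[OF tendsto_const this, of "2 * Lf l' mu"] have "(%n. Bf mu (l n) l') ----> 2 * Lf l' mu" by simp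
 from LIMSEQ_unique[OF B1 this] show "?X = 2 * Lf l' mu" .
qed

definition wt :: "real => 'a * 'a => real" where
 "wt t p = vv t p * theta (r1 (mu t) p) (r2 (mu t) p)"

definition nu :: "real => ('a * 'a) signed_radon" where
 "nu t = (dens (cG (Lam (mu t))) (wt t), dens (cG (Lam (mu t))) (%p. - wt t p))"

lemma radon_Lam: "t : {0..1} ==> radon_on G (cG (Lam (mu t)))" by (rule radon_cG[OF finb_Lam[OF prob]])

lemma wt_measurable: "t : {0..1} ==> wt t : bm borel"
 "t : {0..1} ==> wt t : bm (cG (Lam (mu t)))"
proof -
 assume t: "t : {0..1}"
 show "wt t : bm borel" unfolding wt_def using vv_measurable r12'(7)[OF prob[OF t]] by simp
 thus "wt t : bm (cG (Lam (mu t)))" by (rule radon_bm[OF radonD(1)[OF radon_Lam[OF t]]])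
qed

lemma th_r_nonneg: "t : {0..1} ==> theta (r1 (mu t) p) (r2 (mu t) p) >= 0" using th_nonneg r12'(3,4)[OF prob] by simp

text \<open>On a compact subset of \<open>G\<close> both \<open>vv t\<close> and the indicator are
  square integrable for \<open>Th (mu t)\<close>, hence their product is integrable and the mass is
  finite. The set where the density is positive is a Hahn set.\<close>

lemma nu_signed_radon:
 assumes t: "t : {0..1}"
 shows "nu t : SRM G"
proof -
 let ?L = "cG (Lam (mu t))"
 note rL = radon_Lam[OF t] and P = prob[OF t]
 let ?X = "restrict_space borel G"
 have fin: "radon_on G (dens ?L u)" if u: "u : bm ?L" "!!p. u p <= abs (wt t p)" for u unfolding radon_on_def
 proof (intro conjI allI impI)
  show "sets (dens ?L u) = sets ?X" using radonD[OF rL] by simp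
  fix C :: "('a * 'a) set" assume C: "compact C & C <= G"
  then obtain B where B: "kdom (indicator C) B" using kdom_compact by auto
  have Cs: "C : sets ?L" "C : sets borel" unfolding radonD[OF rL] using C by (auto intro: sets_GI simp: compact_imp_closed)
  have i: "integrable (Th (mu t)) (%p. vv t p * indicator C p)"
   by (rule L2_product[OF vv_Th(1)[OF t] Th_bm[OF P] vv_sq(1)[OF t] kdom_sq(1)[OF P B]]) (use Cs in simp)
  have "emeasure (dens ?L u) C = nn_integral ?L (%p. ennreal (u p) * indicator C p)" by (rule emeasure_density) (use u Cs in auto)
  also have "... <= nint ?L (%p. abs (vv t p * indicator C p) * theta (r1 (mu t) p) (r2 (mu t) p))"
  proof (intro nn_integral_mono)
   fix p
   have "u p <= abs (vv t p) * theta (r1 (mu t) p) (r2 (mu t) p)" using u th_r_nonneg[OF t] by (simp add: wt_def abs_mult)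
   thus "ennreal (u p) * indicator C p <= ennreal (abs (vv t p * indicator C p) * theta (r1 (mu t) p) (r2 (mu t) p))"
    by (cases "p : C") (simp_all add: ennreal_leI)
  qed
  also have "... = nn_integral (Th (mu t)) (%p. ennreal (abs (vv t p * indicator C p)))" by (rule nn_Th_cG[OF P]) (use vv_measurable Cs in auto)
  also have "... < infty" using i by (simp add: integrable_iff_bounded)
  finally show "emeasure (dens ?L u) C < infty" .
 qed
 have wm: "wt t : bm ?L" "(%p. - wt t p) : bm ?L" using wt_measurable[OF t] by auto
 define A where "A = {p : G. 0 < wt t p}"
 have A: "A : sets ?X" "A : sets ?L" "G - A : sets ?L"
 proof -
  have "A : sets borel" using wt_measurable[OF t] unfolding A_def by (simp add: Collect_conj_eq)
  thus "A : sets ?X" by (intro sets_GI) (auto simp: A_def)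
  thus "A : sets ?L" using radonD[OF rL] by simp
  thus "G - A : sets ?L" using sets.compl_sets[of A ?L] radonD[OF rL] by simp
 qed
 have "emeasure (dens ?L (wt t)) (G - A) = 0" "emeasure (dens ?L (%p. - wt t p)) A = 0"
  using A wm by (simp_all add: emeasure_density nn_integral_0_iff_AE)
   (auto intro!: AE_I2 simp: A_def indicator_def ennreal_eq_0_iff)
 thus ?thesis unfolding nu_def signed_radon_measures_def using fin[OF wm(1)] fin[OF wm(2)] A by auto
qed

lemma nu_integral:
 assumes t: "t : {0..1}" and g: "g : bm borel" "integrable (Th (mu t)) (%p. (g p)^2)"
 shows "signed_integral (nu t) g = flux t g"
proof -
 let ?L = "cG (Lam (mu t))"
 note P = prob[OF t]
 have i: "integrable (Th (mu t)) (%p. vv t p * g p)" by (rule L2_product[OF vv_Th(1)[OF t] Th_bm[OF P g(1)] vv_sq(1)[OF t] g(2)])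
 have m: "(%p. vv t p * g p) : bm borel" using vv_measurable g by simp
 have e: "vv t p * g p * theta (r1 (mu t) p) (r2 (mu t) p) = g p * wt t p" for p by (simp add: wt_def)
 have "integrable ?L (%p. g p * wt t p)" using Th_cG[OF P m] i by (simp add: e)
 from signed_integral_density[OF wt_measurable(2)[OF t] radon_bm[OF radonD(1)[OF radon_Lam[OF t]] g(1)] this]
 show ?thesis using Th_cG[OF P m] unfolding nu_def flux_def e by simp
qed

lemma nu_action:
 assumes t: "t : {0..1}"
 shows "action theta J (mu t) (nu t) = ennreal ((LINT p|Th (mu t). (vv t p)^2) / 2)"
proof (rule action_eqI[OF prob[OF t] nu_signed_radon[OF t]])
 let ?L = "cG (Lam (mu t))"
 note P = prob[OF t] and rL = radon_Lam[OF t]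
 note mL = radon_bm[OF radonD(1)[OF rL]]
 let ?X = "%p. action_density theta (wt t p) (r1 (mu t) p) (r2 (mu t) p)"
 \<comment> \<open>Where the mean vanishes so does \<open>wt\<close>, and the action density is then
   0 instead of infinite.\<close>
 have "nn_integral ?L ?X =
  (nint ?L (%p. (vv t p)^2 / 2 * theta (r1 (mu t) p) (r2 (mu t) p)))"
  by (intro nn_integral_cong) (simp add: action_density_def wt_def power2_eq_square mult_ac)
 also have "... = nint (Th (mu t)) (%p. (vv t p)^2 / 2)" by (rule nn_Th_cG[OF P]) (use vv_measurable in auto)
 also have "... = ennreal (LINT p|Th (mu t). (vv t p)^2 / 2)" using vv_sq[OF t] by (intro nn_integral_eq_integral) auto
 finally have e: "ennreal ((LINT p|Th (mu t). (vv t p)^2) / 2) = nn_integral ?L ?X" by simp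
 show "action_value theta J (mu t) (nu t) (ennreal ((LINT p|Th (mu t). (vv t p)^2) / 2))" unfolding action_value_def e
  by (rule , rule , rule , rule , intro conjI)
   (use rL mL[OF r12'(1)[OF P]] mL[OF r12'(2)[OF P]] wt_measurable[OF t] r12'(3,4)[OF P] density_Lam[OF P] in \<open>simp_all add: nu_def\<close>)
qed

lemma nu_varh:
 assumes t: "t : {0..1}"
 shows "varh (nu t) <= ennreal ((KC + (LINT p|Th (mu t). (vv t p)^2)) / 2)"
proof -
 let ?L = "cG (Lam (mu t))"
 note P = prob[OF t] and rL = radon_Lam[OF t]
 have hb: "hh : bm borel" by (rule cts_bm[OF hh_cont])
 have hm: "(%p. ennreal (hh p)) : bm ?L" using radon_bm[OF radonD(1)[OF rL] hb] by simp
 have wm: "(%p. ennreal (wt t p)) : bm ?L" "(%p. ennreal (- wt t p)) : bm ?L" using wt_measurable[OF t] by auto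
 have hi: "integrable (Th (mu t)) (%p. (hh p)^2)" "(LINT p|Th (mu t). (hh p)^2) <= KC" using Th_int[OF P kdom_hh2] by auto
 have vm: "(%p. abs (vv t p)) : bm (Th (mu t))" using vv_Th[OF t] by simp
 have i: "integrable (Th (mu t)) (%p. abs (vv t p) * hh p)" by (rule L2_product[OF vm Th_bm[OF P hb]]) (use vv_sq[OF t] hi in simp_all)
 have "varh (nu t) = nn_integral ?L (%p. ennreal (wt t p) * ennreal (hh p) + ennreal (- wt t p) * ennreal (hh p))"
  unfolding varh_def nu_def using hm wm by (simp add: nn_integral_density nn_integral_add)
 also have "... <= nint ?L (%p. abs (vv t p) * hh p * theta (r1 (mu t) p) (r2 (mu t) p))"
 proof (intro nn_integral_mono)
  fix p
  have "ennreal (wt t p) * ennreal (hh p) + ennreal (- wt t p) * ennreal (hh p) = ennreal (abs (wt t p)) * ennreal (hh p)"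
    by (cases "wt t p >= 0") (auto simp: ennreal_neg)
  also have "... = ennreal (abs (wt t p) * hh p)" by (rule ennreal_mult[symmetric]) simp_all
  also have "abs (wt t p) * hh p = abs (vv t p) * hh p * theta (r1 (mu t) p) (r2 (mu t) p)" using th_r_nonneg[OF t] by (simp add: wt_def abs_mult)
  finally show "ennreal (wt t p) * ennreal (hh p) + ennreal (- wt t p) * ennreal (hh p) <= ennreal (abs (vv t p) * hh p * theta (r1 (mu t) p) (r2 (mu t) p))" by simp
 qed
 also have "... = nint (Th (mu t)) (%p. abs (vv t p) * hh p)" by (rule nn_Th_cG[OF P]) (use vv_measurable hb in auto)
 also have "... = ennreal (LINT p|Th (mu t). abs (vv t p) * hh p)" by (rule nn_integral_eq_integral[OF i]) simp
 also have "... <= ennreal ((KC + (LINT p|Th (mu t). (vv t p)^2)) / 2)"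
 proof (rule ennreal_leI)
  have "abs (\<integral>p. abs (vv t p) * hh p \<partial>Th (mu t)) <= (1 * (LINT p|Th (mu t). abs (vv t p)^2) + (LINT p|Th (mu t). (hh p)^2) / 1) / 2"
   by (rule L2_product[OF vm Th_bm[OF P hb]]) (use vv_sq[OF t] hi in simp_all)
  thus "(LINT p|Th (mu t). abs (vv t p) * hh p) <= (KC + (LINT p|Th (mu t). (vv t p)^2)) / 2" using hi by simp
 qed
 finally show ?thesis .
qed

end

section \<open>Measurability of the flux\<close>

context jump_setting begin

lemma active_locally_constant:
 assumes "!!q. q : set L ==> t0 ~= fst q & t0 ~= fst (snd q)"
 shows "eventually (%t. active L t = active L t0) (nhds t0)" using assms
proof (induction L)
 case (Cons q L)
 obtain s t phi where q: "q = (s, t, phi)" by (cases q)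
 have ne: "t0 ~= s" "t0 ~= t" using Cons.prems[of q] by (auto simp: q)
 have "eventually (%r. (r < c) = (t0 < c)) (nhds t0) & eventually (%r. (c < r) = (c < t0)) (nhds t0)" if "t0 ~= c" for c
 proof (cases "t0 < c")
  case True
  hence "eventually (%r. r < c) (nhds t0)" using eventually_nhds_in_open[of "{..<c}"] by simp
  thus ?thesis using True by (auto elim: eventually_mono)
 next
  case False
  hence "c < t0" using that by simp
  hence "eventually (%r. c < r) (nhds t0)" using eventually_nhds_in_open[of "{c<..}"] by simp
  thus ?thesis using `c < t0` by (auto elim: eventually_mono)
 qed
 hence "eventually (%r. (s < r) = (s < t0)) (nhds t0)" "eventually (%r. (r < t) = (t0 < t)) (nhds t0)" using ne by auto
 moreover have "eventually (%r. active L r = active L t0) (nhds t0)" using Cons.prems by (intro Cons.IH) simp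
 ultimately show ?case
 proof eventually_elim
  case (elim r)
  show ?case using elim by (simp add: q)
 qed
qed (simp add: fun_eq_iff)

lemma kdom_kk: "kdom (%p. kk (fst p) (snd p)) 1" unfolding kdom_def using kk_bounds by simp

lemma wconv_within:
 assumes mu: "wcurve 0 1 mu" and t0: "t0 : {0..1}" and F: "((%t. t) ---> t0) F" "eventually (%t. t : {0..1}) F"
 shows "wconv mu (mu t0) F"
proof (rule wconv_testI)
 show "eventually (%t. finb (mu t)) F" using F(2) by eventually_elim (rule PM_fb[OF wcurveD(1)[OF mu]])
 show "finb (mu t0)" by (rule PM_fb[OF wcurveD(1)[OF mu t0]])
 have "eventually (%t. measure (mu t) UNIV = measure (mu t0) UNIV) F" using F(2) by eventually_elim (simp only: PM_mass[OF wcurveD(1)[OF mu]] t0)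
 thus "((%t. measure (mu t) UNIV) ---> measure (mu t0) UNIV) F" by (rule tendsto_eventually)
 fix phi :: "'a => real" assume "Ccs phi"
 from continuous_on_tendsto_compose[OF wcurveD(2)[OF mu this] F(1) t0 F(2)]
 show "((%t. LINT x|mu t. phi x) ---> (LINT x|mu t0. phi x)) F" .
qed

end

context finite_energy_curve begin

text \<open>Along a filter on which the total mass \<open>\<integral>kk dTh(mu t)\<close> converges, upper semicontinuity of \<open>\<integral>f dTh(mu t)\<close> for
 all \<open>f >= 0\<close> upgrades to convergence, since \<open>f\<close> and \<open>B kk - f\<close> are both upper semicontinuous.\<close>

definition Psi :: "real => real * real" where
 "Psi t = (t, I01 t * (LINT p|Th (mu t). kk (fst p) (snd p)))"

text \<open>The sets increase to \<open>good\<close>; on each of them the error in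
  \<open>flux_approx\<close> is uniform in time.\<close>

definition TN :: "nat => real set" where "TN N = {t : good. ss t <= real N}"

definition nf :: "nat => real => real filter" where
 "nf N t0 = inf (filtercomap Psi (nhds (Psi t0))) (principal (TN N))"

lemma TN_good: "t : TN N ==> t : good" "t : TN N ==> t : {0..1}" using good01 by (auto simp: TN_def)

lemma nf_in: "eventually (%t. t : TN N) (nf N t0)" unfolding nf_def by (rule filter_leD[OF inf_le2]) (simp add: eventually_principal)

lemma nf_in01: "eventually (%t. t : {0..1}) (nf N t0)" using nf_in by eventually_elim (rule TN_good)

lemma nf_Psi: "(Psi ---> Psi t0) (nf N t0)" unfolding nf_def by (rule filterlim_mono[OF filterlim_filtercomap order_refl inf_le1])

lemma nf_id: "((%t. t) ---> t0) (nf N t0)" using tendsto_fst[OF nf_Psi] by (simp add: Psi_def)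

lemma nf_mass:
 assumes t0: "t0 : TN N"
 shows "((%t. LINT p|Th (mu t). kk (fst p) (snd p)) ---> (LINT p|Th (mu t0). kk (fst p) (snd p))) (nf N t0)"
proof -
 have "((%t. I01 t * (LINT p|Th (mu t). kk (fst p) (snd p))) ---> (LINT p|Th (mu t0). kk (fst p) (snd p))) (nf N t0)"
  using tendsto_snd[OF nf_Psi, of t0] TN_good[OF t0] by (simp add: Psi_def)
 thus ?thesis by (rule tendsto_cong[THEN iffD1, rotated]) (rule eventually_mono[OF nf_in01], simp)
qed

lemma Th_tendsto:
 assumes t0: "t0 : TN N" and f: "cts f" "kdom f B"
 shows "((%t. LINT p|Th (mu t). f p) ---> (LINT p|Th (mu t0). f p)) (nf N t0)"
proof (rule tendstoI)
 fix eps :: real assume eps: "eps > 0"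
 let ?k = "%p. kk (fst p) (snd p)"
 let ?Z = "%t. \<integral>p. ?k p \<partial>Th (mu t)" and ?I = "%t. \<integral>p. f p \<partial>Th (mu t)"
 have kc: "cts (%p::'a * 'a. ?k p)" unfolding kk_def by (intro continuous_intros)
 note P0 = prob[OF TN_good(2)[OF t0]]
 have wc: "wconv mu (mu t0) (nf N t0)" by (rule wconv_within[OF curve TN_good(2)[OF t0] nf_id nf_in01])
 have pe: "eventually (%t. mu t : PM) (nf N t0)" using nf_in01 by eventually_elim (rule prob)
 have usc: "eventually (%t. B * ?Z t + c * ?I t < B * ?Z t0 + c * ?I t0 + eps / 2) (nf N t0)" if c: "c = 1 | c = -1" for c
 proof -
  let ?f = "%p. B * ?k p + c * f p"
  have fb: "abs (c * f p) <= B * ?k p" for p using kdomD(3)[OF f(2), of p] c by auto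
  have f0: "?f p >= 0" for p using fb[of p] by simp
  have kd: "kdom ?f (2 * B)" unfolding kdom_def
  proof (intro conjI allI)
   show "?f : bm borel" using kdomD[OF f(2)] by simp
   show "2 * B >= 0" using kdomD[OF f(2)] by simp
   show "abs (?f p) <= 2 * B * ?k p" for p using fb[of p] by simp
  qed
  have fc: "cts ?f" by (intro continuous_on_add continuous_on_mult continuous_on_const kc f)
  have split: "(LINT p|Th (mu t). ?f p) = B * ?Z t + c * ?I t" if "t : {0..1}" for t
   using Th_int[OF prob[OF that] kdom_kk] Th_int[OF prob[OF that] f(2)] by simp
  have "eventually (%t. (LINT p|Th (mu t). ?f p) < (LINT p|Th (mu t0). ?f p) + eps / 2) (nf N t0)"
   by (rule Th_usc[OF pe P0 wc kd f0 fc]) (use eps in simp)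
  thus ?thesis using nf_in01 by eventually_elim (simp only: split[OF TN_good(2)[OF t0]] split)
 qed
 have "((%t. B * ?Z t) ---> B * ?Z t0) (nf N t0)" by (intro tendsto_mult tendsto_const nf_mass t0)
 hence "eventually (%t. dist (B * ?Z t) (B * ?Z t0) < eps / 2) (nf N t0)" by (rule tendstoD) (use eps in simp)
 thus "eventually (%t. dist (?I t) (?I t0) < eps) (nf N t0)" using usc[OF disjI1[OF refl]] usc[OF disjI2[OF refl]]
 proof eventually_elim
  case (elim t)
  hence "abs (B * ?Z t - B * ?Z t0) < eps / 2" "B * ?Z t + ?I t < B * ?Z t0 + ?I t0 + eps / 2" "B * ?Z t - ?I t < B * ?Z t0 - ?I t0 + eps / 2"
   by (simp_all add: dist_real_def)
  hence "abs (?I t - ?I t0) < eps" by linarith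
  thus ?case by (simp add: dist_real_def)
 qed
qed

text \<open>On \<open>TN N\<close> the field may be replaced by \<open>gg n\<close> with an error
  uniform in time. Near \<open>t0\<close>, which is no break point, \<open>gg n\<close> is one fixed
  continuous function, so only the convergence of \<open>Th (mu t)\<close> remains.\<close>

lemma flux_tendsto:
 assumes t0: "t0 : TN N" and f: "cts f" "compact_support_in G f"
 shows "((%t. flux t f) ---> flux t0 f) (nf N t0)"
proof (rule tendstoI)
 fix eps :: real assume eps: "eps > 0"
 obtain B where B: "kdom f B" by (rule kdom_Cc[OF f])
 let ?c = "%n. (real N + B^2 * KC) / sqrt 2 ^ n"
 let ?b = "%n t. \<integral>p. gg n t p * f p \<partial>Th (mu t)"
 have ap: "abs (flux t f - ?b n t) <= ?c n" if t: "t : TN N" for n t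
 proof -
  note P = prob[OF TN_good(2)[OF t]]
  have "abs (flux t f - ?b n t) <= (ss t + (LINT p|Th (mu t). (f p)^2)) / sqrt 2 ^ n"
   by (rule flux_approx[OF TN_good(1)[OF t] kdomD(1)[OF B] kdom_sq(1)[OF P B]])
  also have "... <= ?c n" using kdom_sq[OF P B] t by (intro divide_right_mono) (auto simp: TN_def)
  finally show ?thesis .
 qed
 from order_tendstoD(2)[OF sqrt2_tendsto[of "real N + B^2 * KC"], of "eps / 3"] eps
 have "EX n. ?c n < eps / 3" by (intro eventually_happens'[OF sequentially_bot]) simp
 then obtain n where n: "?c n < eps / 3" ..
 have "t0 ~: Bp" using TN_good[OF t0] by (simp add: good_def)
 hence "eventually (%t. active (l n) t = active (l n) t0) (nhds t0)" by (intro active_locally_constant) (auto simp: Bp_def)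
 hence ev: "eventually (%t. active (l n) t = active (l n) t0) (nf N t0)" using nf_id unfolding filterlim_iff by simp
 obtain C where C: "C >= 0" "!!p. abs (gg n t0 p) <= C * hh p" unfolding gg_def by (rule dif_bound[OF Ccs_active[OF tests_l]]) blast
 have kd: "kdom (%p. gg n t0 p * f p) (C * B)" unfolding kdom_def
 proof (intro conjI allI)
  show "(%p. gg n t0 p * f p) : bm borel" using gg_measurable kdomD[OF B] by simp
  show "0 <= C * B" using C kdomD[OF B] by simp
  fix p
  have "C * hh p <= C * 1" using C by (intro mult_left_mono) auto
  hence "abs (gg n t0 p) * abs (f p) <= C * (B * kk (fst p) (snd p))" using C(2)[of p] using kdomD[OF B] by (intro mult_mono) auto
  thus "abs (gg n t0 p * f p) <= C * B * kk (fst p) (snd p)" by (simp add: abs_mult)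
 qed
 have gc: "cts (%p. gg n t0 p * f p)" unfolding gg_def by (intro continuous_on_mult dif_continuous Ccs_continuous[OF Ccs_active[OF tests_l]] f)
 have "eventually (%t. dist (LINT p|Th (mu t). gg n t0 p * f p) (?b n t0) < eps / 3) (nf N t0)"
  by (rule tendstoD[OF Th_tendsto[OF t0 gc kd]]) (use eps in simp)
 thus "eventually (%t. dist (flux t f) (flux t0 f) < eps) (nf N t0)" using ev nf_in
 proof eventually_elim
  case (elim t)
  have "abs (?b n t - ?b n t0) < eps / 3" using elim by (simp add: gg_def dist_real_def)
  moreover have "abs (flux t f - ?b n t) < eps / 3" using ap[OF elim(3), of n] n by linarith
  moreover have "abs (flux t0 f - ?b n t0) < eps / 3" using ap[OF t0, of n] n by linarith
  ultimately have "abs (flux t f - flux t0 f) < eps" by linarith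
  thus ?case by (simp add: dist_real_def)
 qed
qed

lemma nu_Cc:
 assumes t: "t : {0..1}" and f: "cts f" "compact_support_in G f"
 shows "signed_integral (nu t) f = flux t f"
proof -
 obtain B where B: "kdom f B" by (rule kdom_Cc[OF f])
 show ?thesis by (rule nu_integral[OF t kdomD(1)[OF B] kdom_sq(1)[OF prob[OF t] B]])
qed

text \<open>The Borel sets of the weak* topology are generated by all its open sets, arbitrary
  unions of finite intersections of subbasic ones. Measurability is therefore derived from
  continuity into the full topology, for a topology on \<open>TN N\<close> whose open sets are
  traces of preimages of open sets of the plane under the Borel map \<open>Psi\<close>.\<close>

lemma nu_continuous_map: "continuous_map (pullback_topology (TN N) Psi euclidean) (weak_star_topology G) nu"
 unfolding weak_star_topology_def continuous_on_generated_topo_iff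
proof (intro conjI allI impI)
 let ?X = "pullback_topology (TN N) Psi euclidean"
 have ts: "topspace ?X = TN N" by (simp add: topspace_pullback_topology)
 fix U :: "('a * 'a) signed_radon set"
 assume "U : {{nu : SRM G. signed_integral nu f : V} | f V.
    cts f & compact_support_in G f & open (V :: real set)}"
 then obtain f V where U: "U = {nu : SRM G. signed_integral nu f : V}"
  and f: "cts f" "compact_support_in G f" and V: "open (V :: real set)" by auto
 let ?z0 = "{t : TN N. flux t f : V}"
 have eq: "nu -` U Int topspace ?X = ?z0" unfolding U ts using nu_signed_radon nu_Cc[OF _ f] TN_good by auto
 let ?O = "\<Union>{S. open S & (ALL t:TN N. Psi t : S --> flux t f : V)}"
 have "?z0 = Psi -` ?O Int TN N"
 proof (intro equalityI subsetI)
  fix t0 assume "t0 : ?z0"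
  hence t0: "t0 : TN N" "flux t0 f : V" by auto
  from topological_tendstoD[OF flux_tendsto[OF t0(1) f] V t0(2)]
  have "eventually (%t. t : TN N --> flux t f : V) (filtercomap Psi (nhds (Psi t0)))" unfolding nf_def eventually_inf_principal .
  then obtain S where "open S" "Psi t0 : S" "!!t. Psi t : S ==> t : TN N --> flux t f : V" unfolding eventually_filtercomap_nhds by auto
  thus "t0 : Psi -` ?O Int TN N" using t0 by auto
 qed blast
 moreover have "open ?O" by auto
 ultimately show "openin ?X (nu -` U Int topspace ?X)" unfolding eq openin_pullback_topology by auto
next
 have "weak_star_topology G = topology_generated_by {{nu : SRM GG. signed_integral nu f : V} | f V.
    cts f & compact_support_in G f & open (V :: real set)}" by (simp add: weak_star_topology_def)
 with topspace_weak_star show "nu ` topspace (pullback_topology (TN N) Psi euclidean) <= \<Union>{{nu : SRM G. signed_integral nu f : V} | f V.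
    cts f & compact_support_in G f & open (V :: real set)}"
  using nu_signed_radon TN_good by (auto simp: topspace_pullback_topology)

qed

lemma Psi_measurable: "Psi : bm borel"
proof -
 have "cts (%p::'a * 'a. kk (fst p) (snd p))" unfolding kk_def by (intro continuous_intros)
 from Th_field_measurable[OF curve kdom_kk _ this] kk_bounds(1)
 show ?thesis unfolding Psi_def by simp

qed

lemma TN_sets: "TN N : sets borel"
proof -
 let ?X = "{t : space borel. indicator good t * ss t <= real N}"
 have "?X : sets borel" using borel_measurable_integrable[OF ss_integrable] by simp
 moreover have "TN N = good Int ?X" by (auto simp: TN_def)
 ultimately show ?thesis using good_sets by simp
qed

lemma nu_bad:
 assumes "t : {0..1} - good" "t' : {0..1} - good"
 shows "nu t = nu t'"
proof -
 have "density (cG (Lam (mu t))) (%p. 0) = density (cG (Lam (mu t'))) (%p. 0)"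
 proof (rule measure_eqI)
  note s = radonD(1)[OF radon_Lam]
  let ?X = "density (cG (Lam (mu t))) (%p. 0)"
  show "sets ?X = sets (density (cG (Lam (mu t'))) (%p. 0))" using s assms by simp
  fix A assume "A : sets ?X"
  thus "emeasure ?X A = emeasure (density (cG (Lam (mu t'))) (%p. 0)) A" using s assms
    by (simp add: emeasure_density)
 qed
 moreover have "wt t = (%p. 0)" "wt t' = (%p. 0)" using assms by (auto simp: wt_def vv_def)
 ultimately show ?thesis by (simp add: nu_def)
qed

text \<open>[0,1] is split into the countably many sets \<open>TN N\<close>, on which continuity
  yields Borel preimages, and the bad times, on which \<open>nu\<close> is constant.\<close>

lemma nu_measurable: "nu : measurable (restrict_space borel {0..1}) (borel_of_topology (weak_star_topology G))" unfolding borel_of_topology_def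
proof (rule measurable_measure_of)
 let ?X = "weak_star_topology G"
 show "{U. openin ?X U} <= Pow (topspace (weak_star_topology GG))" using openin_subset by auto
 let ?Y = "restrict_space borel {0..1}"
 show "nu : space ?Y \<rightarrow> topspace ?X"
  unfolding topspace_weak_star using nu_signed_radon by simp
 fix U :: "('a * 'a) signed_radon set" assume "U : {U. openin ?X U}"
 hence U: "openin ?X U" by simp
 have g: "nu -` U Int TN N : sets borel" for N
 proof -
  have ts: "topspace (pullback_topology (TN N) Psi euclidean) = TN N" by (simp add: topspace_pullback_topology)
  have "openin (pullback_topology (TN N) Psi euclidean) {t : TN N. nu t : U}"
   using openin_continuous_map_preimage[OF nu_continuous_map U, of N] unfolding ts .
  then obtain S where S: "open S" "{t : TN N. nu t : U} = Psi -` S Int TN N" unfolding openin_pullback_topology by auto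
  have "nu -` U Int TN N = Psi -` S Int TN N" unfolding S(2)[symmetric] by auto
  moreover have "Psi -` S : sets borel" using measurable_sets[OF Psi_measurable] S by simp
  ultimately show ?thesis using TN_sets by simp
 qed
 have "nu -` U Int ({0..1} - good) = {} | nu -` U Int ({0..1} - good) = {0..1} - good" using nu_bad by blast
 hence b: "nu -` U Int ({0..1} - good) : sets borel" using good_sets by auto
 have "nu -` U Int {0..1} = (UN N. nu -` U Int TN N) Un (nu -` U Int ({0..1} - good))" using real_arch_simple using good01 by (force simp: TN_def)
 moreover have "... : sets borel" using g b by blast
 ultimately show "nu -` U Int space ?Y : sets ?Y"
   by (auto simp: sets_restrict_space_iff)

qed

text \<open>The weights \<open>1 + 1 / r\<close> and \<open>1 + r\<close> make the constant in front
  of \<open>Gam\<close> tend to 1 as \<open>n\<close> grows, while the factor of \<open>ss t\<close>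
  is of order \<open>1 / r\<close> and tends to 0. A fixed splitting of the square would lose a
  factor in the final action bound.\<close>

lemma vv_energy_bound:
 assumes t: "t : good" and r: "r > 0" "r * r = 2 ^ n"
 shows "(LINT p|Th (mu t). (vv t p)^2) <= (1 + 1 / r) * Gam (mu t) (active (l n) t) + (1 + r) * (2 / (r * r)) * ss t"
proof -
 note t01 = good01[OF t]
 have le: "(vv t p)^2 <= (1 + 1 / r) * (gg n t p)^2 + (1 + r) * (vv t p - gg n t p)^2" for p
 proof -
  have "(a + b)^2 <= (1 + 1 / r) * a^2 + (1 + r) * b^2" for a b :: real
  proof -
   have "0 <= (a - r * b)^2 / r" using r by simp
   also have "... = (1 + 1 / r) * a^2 + (1 + r) * b^2 - (a + b)^2" using r by (simp add: power2_eq_square field_simps)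
   finally show ?thesis by simp
  qed
  from this[of "gg n t p" "vv t p - gg n t p"] show ?thesis by simp
 qed
 have "(LINT p|Th (mu t). (vv t p)^2) <= (LINT p|Th (mu t). (1 + 1 / r) * (gg n t p)^2 + (1 + r) * (vv t p - gg n t p)^2)"
  by (intro integral_mono vv_sq[OF t01] Bint_add integrable_mult_right gg_sq[OF t01] vv_close[OF t] le)
 also have "... = (1 + 1 / r) * Gam (mu t) (active (l n) t) + (1 + r) * (LINT p|Th (mu t). (vv t p - gg n t p)^2)"
  using gg_sq[OF t01] vv_close[OF t] by (simp add: Gam_def gg_def)
 also have "... <= (1 + 1 / r) * Gam (mu t) (active (l n) t) + (1 + r) * (2 / (r * r) * ss t)"
  using vv_close[OF t] r by (intro add_left_mono mult_left_mono) auto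
 finally show ?thesis by (simp only:)
qed

lemma nu_action_le: "(Act mu nu) <= ennreal e"
proof -
 define S0 where "S0 = (LINT t|lborel. indicator good t * ss t)"
 define r where "r n = (sqrt 2 ^ n :: real)" for n
 have r: "r n > 0" "r n * r n = 2 ^ n" for n by (simp_all add: r_def power_mult_distrib[symmetric])
 let ?c = "%n. (1 + 1 / r n) * (sqrt e + sqrt (1 / 4 ^ n))^2 + (1 / (r n * r n) + 1 / r n) * S0"
 let ?X = "(1 + 0) * (sqrt e + sqrt 0)^2 + (0 + 0) * S0"
 have "(Act mu nu) <= ennreal (?c n)" for n
 proof -
  let ?h = "%t. (1 + 1 / r n) / 2 * (I01 t * Gam (mu t) (active (l n) t)) + (1 + r n) * (1 / (r n * r n)) * (indicator good t * ss t)"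
  have hi: "integrable lborel ?h" by (intro Bint_add integrable_mult_right Qf_int[OF curve tests_l] ss_integrable)
  have h0: "?h t >= 0" for t using r[of n] ss Gam_nonneg by simp
  have "(Act mu nu) <= nint lborel ?h"
  proof (rule nn_integral_mono_AE)
   show "AE t in lborel. action theta J (mu t) (nu t) * I01 t <= ennreal (?h t)" using AE_good
   proof eventually_elim
    case (elim t)
    show ?case
    proof (cases "t : {0..1}")
     case True
     hence t: "t : good" using elim by simp
     have "x / 2 <= c / 2 * (1 * g) + d * (1 / q) * (1 * s)" if "x <= c * g + d * (2 / q) * s" for x c g d q s :: real
      using divide_right_mono[OF that, of 2] by (simp add: add_divide_distrib)
     from this[OF vv_energy_bound[OF t r]] show ?thesis
      using t True using True by (simp add: nu_action ennreal_leI)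
    qed simp
   qed
  qed
  also have "... = ennreal (LINT t|lborel. ?h t)" by (rule nn_integral_eq_integral[OF hi]) (simp only: h0 AE_I2)
  also have "(LINT t|lborel. ?h t) = (1 + 1 / r n) * (Qf 0 1 mu (l n) / 2) + (1 + r n) * (1 / (r n * r n)) * S0"
   using Qf_int[OF curve tests_l] ss_integrable by (simp add: Qf_def S0_def)
  also have "... <= (1 + 1 / r n) * (sqrt e + sqrt (1 / 4 ^ n))^2 + (1 + r n) * (1 / (r n * r n)) * S0"
   using r[of n] by (intro add_right_mono mult_left_mono Qf_l) simp
  also have "(1 + r n) * (1 / (r n * r n)) = 1 / (r n * r n) + 1 / r n" using r[of n] by (simp add: field_simps)
  finally show ?thesis by (simp add: ennreal_leI)
 qed
 moreover have "(%n. ennreal (?c n)) ----> ennreal ?X"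
 proof -
  have a: "(%n. 1 / r n) ----> 0" unfolding r_def by (rule sqrt2_tendsto)
  have b: "(%n. 1 / (r n * r n)) ----> 0" unfolding r by (rule LIMSEQ_divide_realpow_zero) simp
  have c: "(%n. 1 / 4 ^ n) ----> (0::real)" by (rule LIMSEQ_divide_realpow_zero) simp
  show ?thesis by (intro tendsto_ennrealI tendsto_add tendsto_mult tendsto_power tendsto_real_sqrt tendsto_const a b c)
 qed
 ultimately have "(Act mu nu) <= ennreal ?X" by (intro LIMSEQ_le_const) blast+
 thus ?thesis using e_nonneg by simp
qed

end

section \<open>The continuity equation of the flux\<close>

text \<open>On each interval of the partition the second argument is frozen at the left end
  (\<open>j = 0\<close>) or the right end (\<open>j = 1\<close>). Continuity in that argument and
  the majorant \<open>w\<close> give convergence to the integral over the diagonal, with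
  measurability assumed for frozen arguments only.\<close>

lemma riemann_diagonal:
 fixes m :: "real => real => real" and w :: "real => real" and j :: nat
 assumes meas: "!!a. a : {0..1} ==> (%r. I01 r * m r a) : bm borel"
  and bound: "!!r a. r : {0..1} ==> a : {0..1} ==> abs (m r a) <= w r" and w: "integrable lborel (%r. I01 r * w r)"
  and cont: "!!r. r : {0..1} ==> continuous_on {0..1} (m r)" and j: "j <= 1"
 shows "(%n. SUM i<Suc n. LINT r|lborel. indicator {i / Suc n..<Suc i / Suc n} r * m r ((i + j) / Suc n)) ---->
  (LINT r|lborel. I01 r * m r r)"
proof -
 define a where "a n r = (real (nat \<lfloor>real (Suc n) * r\<rfloor>) + real j) / real (Suc n)" for n r
 define f where "f n r = (SUM i<Suc n. indicator {i / Suc n..<Suc i / Suc n} r * m r ((i + j) / Suc n))" for n r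
 have pt: "(real i + real j) / real (Suc n) : {0..1}" if "i < Suc n" for i n using that j by simp
 have sub: "{real i / real (Suc n)..<real (Suc i) / real (Suc n)} <= {0..1}" if "i < Suc n" for i n
 proof
  fix r assume r: "r : {real i / real (Suc n)..<real (Suc i) / real (Suc n)}"
  have "real (Suc i) / real (Suc n) <= 1" using that by simp
  moreover have "0 <= real i / real (Suc n)" by simp
  ultimately show "r : {0..1}" using r unfolding atLeastLessThan_iff atLeastAtMost_iff by linarith
 qed
 have e: "indicator {real i / real (Suc n)..<real (Suc i) / real (Suc n)} r * m r b =
  indicator {real i / real (Suc n)..<real (Suc i) / real (Suc n)} r * (I01 r * m r b)" if "i < Suc n" for i n r b
  using sub[OF that] by (auto simp: indicator_def)
 have fm1: "(%r. indicator {real i / real (Suc n)..<real (Suc i) / real (Suc n)} r * m r ((real i + real j) / real (Suc n))) : bm borel"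
  if "i < Suc n" for i n unfolding e[OF that] using meas[OF pt[OF that]] by simp
 have fi1: "integrable lborel (%r. indicator {real i / real (Suc n)..<real (Suc i) / real (Suc n)} r * m r ((real i + real j) / real (Suc n)))"
  if "i < Suc n" for i n
 proof (rule Bint_bound[OF w])
  show "AE r in lborel. norm (indicator {real i / real (Suc n)..<real (Suc i) / real (Suc n)} r * m r ((real i + real j) / real (Suc n))) <= norm (I01 r * w r)"
  proof (rule AE_I2)
   fix r
   show "norm (indicator {real i / real (Suc n)..<real (Suc i) / real (Suc n)} r * m r ((real i + real j) / real (Suc n))) <= norm (I01 r * w r)"
   proof (cases "r : {real i / real (Suc n)..<real (Suc i) / real (Suc n)}")
    case True
    hence "r : {0..1}" using sub[OF that] by auto
    thus ?thesis using bound[OF _ pt[OF that]] True by force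
   qed simp
  qed
 qed (use fm1[OF that] in simp)
 have int: "(LINT r|lborel. f n r) = (SUM i<Suc n. LINT r|lborel. indicator {i / Suc n..<Suc i / Suc n} r * m r ((i + j) / Suc n))" for n
  unfolding f_def using fi1 by (subst Bochner_Integration.integral_sum) auto
 have f_eq: "f n r = m r (a n r)" "a n r : {0..1}" "abs (a n r - r) <= 1 / real (Suc n)" if r: "0 <= r" "r < 1" for n r
 proof -
  let ?N = "real (Suc n)"
  define k where "k = nat \<lfloor>?N * r\<rfloor>"
  have k: "real k <= ?N * r" "?N * r < real k + 1" using r by (auto simp: k_def)
  have "?N * r < ?N * 1" using r by simp
  hence "real k < ?N" using k(1) unfolding mult_1_right by (rule le_less_trans[rotated])
  hence kn: "k < Suc n" by simp
  have ind: "indicator {real i / ?N..<real (Suc i) / ?N} r = (if i = k then 1 else 0 :: real)" for i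
  proof -
   have "r : {real i / ?N..<real (Suc i) / ?N} \<longleftrightarrow> real i <= ?N * r & ?N * r < real i + 1"
    by (simp add: pos_divide_le_eq pos_less_divide_eq mult.commute add.commute)
   also have "... \<longleftrightarrow> i = k" using k by auto
   finally show ?thesis by auto
  qed
  have "f n r = (SUM i<Suc n. if i = k then m r ((real k + real j) / ?N) else 0)" unfolding f_def by (rule sum.cong) (simp_all only: ind , simp_all)
  also have "... = m r (a n r)" using kn by (simp add: a_def k_def)
  finally show "f n r = m r (a n r)" .
  show "a n r : {0..1}" unfolding a_def k_def[symmetric] by (rule pt[OF kn])
  have "abs (real k + real j - ?N * r) / ?N <= 1 / ?N" using k j by (intro divide_right_mono) auto
  moreover have "a n r - r = (real k + real j - ?N * r) / ?N" unfolding a_def k_def by (simp add: field_simps)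
  ultimately show "abs (a n r - r) <= 1 / ?N" by simp
 qed
 have f0: "f n r = 0" if "~ (0 <= r & r < 1)" for n r unfolding f_def
 proof (rule sum.neutral, rule ballI)
  fix i assume "i : {..<Suc n}"
  hence "real (Suc i) / real (Suc n) <= 1" "0 <= real i / real (Suc n)" by auto
  hence "r ~: {real i / real (Suc n)..<real (Suc i) / real (Suc n)}" using that unfolding atLeastLessThan_iff by linarith
  thus "indicator {real i / real (Suc n)..<real (Suc i) / real (Suc n)} r * m r (real (i + j) / real (Suc n)) = 0" by simp
 qed
 have lim: "(%n. f n r) ----> indicator {0..<1} r * m r r" for r
 proof (cases "0 <= r & r < 1")
  case True
  hence r: "0 <= r" "r < 1" by auto
  have "(%n. a n r - r) ----> 0" by (rule Lim_null_comparison[OF always_eventually lim_1_over_n[THEN LIMSEQ_Suc]]) (use f_eq[OF r] in simp)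
  hence "(%n. a n r) ----> r" by (rule LIM_zero_cancel)
  hence "(%n. m r (a n r)) ----> m r r" using r by (intro continuous_on_tendsto_compose[OF cont] always_eventually allI f_eq) auto
  thus ?thesis using r by (simp add: f_eq)
 next
  case False
  thus ?thesis by (simp add: f0)
 qed
 have fmb: "f n : bm lborel" for n unfolding f_def using fm1 by (intro borel_measurable_sum) simp
 have "(%n. LINT r|lborel. f n r) ----> (LINT r|lborel. indicator {0..<1} r * m r r)"
 proof (rule integral_dominated_convergence[OF borel_measurable_LIMSEQ_real[OF lim fmb] fmb w])
  show "AE r in lborel. (%n. f n r) ----> indicator {0..<1} r * m r r" by (rule , rule lim)
  show "AE r in lborel. norm (f n r) <= I01 r * w r" for n
  proof (rule AE_I2)
   fix r
   show "norm (f n r) <= I01 r * w r"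
   proof (cases "0 <= r & r < 1")
    case True
    thus ?thesis using f_eq bound by simp
   next
    case False
    have "0 <= I01 r * w r" using bound[of r 0] by (cases "r : {0..1}") auto
    thus ?thesis by (simp add: f0[OF False])
   qed
  qed
 qed
 moreover have "(LINT r|lborel. indicator {0..<1} r * m r r) = (LINT r|lborel. I01 r * m r r)"
 proof (rule integral_cong_AE)
  have mb: "(%r. indicator {0..<1} r * m r r) : bm lborel" by (rule borel_measurable_LIMSEQ_real[OF lim fmb])
  thus "(%r. indicator {0..<1} r * m r r) : bm lborel" .
  have "(%r. indicator {0..<1} r * m r r + indicator {1} r * m 1 1) : bm lborel" using mb by simp
  moreover have "indicator {0..<1} r * m r r + indicator {1} r * m 1 1 = I01 r * m r r" for r :: real by (auto simp: indicator_def)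
  ultimately show "(%r. I01 r * m r r) : bm lborel" by (simp only:)
  show "AE r in lborel. indicator {0..<1} r * m r r = I01 r * m r r" using AE_lborel_singleton by eventually_elim (auto simp: indicator_def)
 qed
 ultimately show ?thesis unfolding int by (simp only:)
qed

lemma integral_half_open:
 fixes h :: "real => real"
 assumes "(%r. I01 r * h r) : bm borel" "0 <= s" "t <= 1"
 shows "(LINT r|lborel. indicator {s<..<t} r * h r) = (LINT r|lborel. indicator {s..<t} r * h r)"
  "(LINT r|lborel. indicator {s..t} r * h r) = (LINT r|lborel. indicator {s..<t} r * h r)"
proof -
 have e: "indicator A r * h r = indicator A r * (I01 r * h r)" if "A <= {0..1}" for A r using that by (auto simp: indicator_def)
 have m: "(%r. indicator A r * h r) : bm lborel" if "A <= {0..1}" "A : sets borel" for A unfolding e[OF that(1)] using assms(1) that(2) by simp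
 have A: "{s<..<t} <= {0..1}" "{s..<t} <= {0..1}" "{s..t} <= {0..1}" using assms by auto
 show "(LINT r|lborel. indicator {s<..<t} r * h r) = (LINT r|lborel. indicator {s..<t} r * h r)"
 proof (rule integral_cong_AE)
  show "AE r in lborel. indicator {s<..<t} r * h r = indicator {s..<t} r * h r"
   using AE_lborel_singleton by eventually_elim (auto simp: indicator_def)
 qed (use m A in auto)
 show "(LINT r|lborel. indicator {s..t} r * h r) = (LINT r|lborel. indicator {s..<t} r * h r)"
 proof (rule integral_cong_AE)
  show "AE r in lborel. indicator {s..t} r * h r = indicator {s..<t} r * h r" using AE_lborel_singleton by eventually_elim (auto simp: indicator_def)
 qed (use m A in auto)
qed

locale test_fun =
 fixes Phi :: "real * 'a::euclidean_space => real"
 assumes test: "test_function 1 Phi"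
begin

lemma Ck: "Ck_on k UNIV Phi" using test by (simp add: test_function_def)

lemma Cc: "Ccs Phi" using test by (simp add: test_function_def Ccs_def smooth_def compact_support_in_def)

lemma zero_outside: "t ~: {0<..<1} ==> Phi (t, x) = 0"
proof (rule ccontr)
 assume t: "t ~: {0<..<1}" and "Phi (t, x) ~= 0"
 hence "(t, x) : closure {p. Phi p ~= 0}" using closure_subset[of "{p. Phi p ~= 0}"] by auto
 moreover have "closure {p. Phi p ~= 0} <= {0<..<1} \<times> UNIV" using test by (simp add: test_function_def compact_support_in_def)
 ultimately show False using t by auto
qed

definition slice :: "real => 'a => real" where "slice a x = Phi (a, x)"

definition dt :: "real * 'a => real" where "dt p = frechet_derivative Phi (at p) (1, 0)"

lemma slice_Cc: "Ccs (slice a)" unfolding Ccs_alt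
proof
 have "bounded_linear (%x::'a. (0::real, x))" by (intro bounded_linear_Pair bounded_linear_zero bounded_linear_ident)
 from smooth_compose_affine[OF this, of Phi "(a, 0)"] show "smooth (slice a)" using Cc unfolding slice_def by (simp add: Ccs_def)
 obtain R where R: "!!p. norm p > R ==> Phi p = 0" using Cc unfolding Ccs_alt by auto
 show "EX R. ALL x. norm x > R --> slice a x = 0"
 proof (intro exI[of _ R] allI impI)
  fix x :: 'a assume "norm x > R"
  thus "slice a x = 0" unfolding slice_def by (intro R less_le_trans[OF _ norm_snd_le])
 qed
qed

lemma dt_deriv: "((%s. Phi (s, x)) has_real_derivative dt (t, x)) (at t)"
proof -
 note d = Ck_SucD(1)[OF Ck, of "(t, x)"]
 have h: "((%s. (s, x)) has_derivative (%h. (h, 0))) (at t)" by (intro has_derivative_Pair has_derivative_ident has_derivative_const)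
 from has_derivative_compose[OF h d] have "((%s. Phi (s, x)) has_derivative (%h. frechet_derivative Phi (at (t, x)) (h, 0))) (at t)" .
 moreover have "frechet_derivative Phi (at (t, x)) (h, 0) = dt (t, x) * h" for h
 proof -
  have "frechet_derivative Phi (at (t, x)) (h *\<^sub>R (1, 0)) = h *\<^sub>R frechet_derivative Phi (at (t, x)) (1, 0)"
   by (rule linear_scale[OF has_derivative_linear[OF d]])
  thus ?thesis by (simp add: dt_def)
 qed
 ultimately show ?thesis by (simp add: has_field_derivative_def)
qed

lemma dt_continuous: "cts dt" using Ck_SucD[OF Ck, of 0] unfolding dt_def by simp

lemma bounds:
 obtains C where "C >= 0" "!!a p. abs (slice a (snd p) - slice a (fst p)) <= C * min 1 (norm (fst p - snd p))"
  "!!a b x. abs (slice a x - slice b x) <= C * abs (a - b)" "!!p. abs (dt p) <= C"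
proof -
 obtain C where C: "C >= 0" "!!x y. abs (Phi y - Phi x) <= C * min 1 (norm (x - y))" by (rule Ccs_bounds[OF Cc]) blast
 have lip: "abs (slice a x - slice b x) <= C * abs (a - b)" for a b x
 proof -
  have "abs (slice a x - slice b x) <= C * min 1 (norm ((b, x) - (a, x)))" unfolding slice_def by (rule C)
  also have "... <= C * abs (a - b)" using C by (intro mult_left_mono) (auto)
  finally show ?thesis .
 qed
 show ?thesis
 proof (rule that[OF C(1)])
  show "abs (slice a x - slice b x) <= C * abs (a - b)" for a b x by (rule lip)
  show "abs (slice a (snd p) - slice a (fst p)) <= C * min 1 (norm (fst p - snd p))" for a p
   using C(2)[of "(a, snd p)" "(a, fst p)"] unfolding slice_def by simp
  show "abs (dt p) <= C" for p
  proof -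
   obtain t x where p: "p = (t, x)" by force
   have "((%y. abs ((Phi (y, x) - Phi (t, x)) / (y - t))) ---> abs (dt p)) (at t)"
    using dt_deriv[of x t] unfolding p has_field_derivative_iff by (rule tendsto_rabs)
   moreover have "abs ((Phi (y, x) - Phi (t, x)) / (y - t)) <= C" for y using lip C by (auto simp: slice_def divide_le_eq)
   ultimately show ?thesis by (intro tendsto_upperbound) auto
  qed
 qed
qed

end

context finite_energy_curve begin

lemma two_interval_flux:
 assumes phi: "Ccs phi" and st: "0 <= s" "s <= t" "t <= 1"
 shows "2 * ((LINT x|mu t. phi x) - (LINT x|mu s. phi x)) = (LINT r|lborel. indicator {s<..<t} r * flux r (dif phi))"
proof -
 have l: "[(s, t, phi)] : tests 0 1" using assms by simp
 have "I01 r * flux r (dif (active [(s, t, phi)] r)) = indicator {s<..<t} r * flux r (dif phi)" for r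
 proof (cases "r : {s<..<t}")
  case True
  hence "active [(s, t, phi)] r = phi" by auto
  thus ?thesis using True st by simp
 next
  case False
  hence "dif (active [(s, t, phi)] r) = (%p. 0)" by (auto simp: dif_def fun_eq_iff)
  thus ?thesis using False by (simp add: flux_def)
 qed
 with euler_lagrange(2)[OF l] show ?thesis by simp
qed

lemma flux_measurable:
 assumes phi: "Ccs phi"
 shows "(%r. I01 r * flux r (dif phi)) : bm borel"
proof -
 have l: "[(0, 1, phi)] : tests 0 1" using phi by simp
 have "I01 r * flux r (dif (active [(0, 1, phi)] r)) = I01 r * flux r (dif phi)" for r
 proof (cases "r : {0<..<1}")
  case True
  hence "active [(0, 1, phi)] r = phi" by auto
  thus ?thesis by simp
 next
  case False
  thus ?thesis by (auto simp: good_def Bp_def flux_bad)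
 qed
 with borel_measurable_integrable[OF euler_lagrange(1)[OF l]] show ?thesis by simp
qed

text \<open>An integrable majorant in time for the flux; \<open>c\<close> accounts for the weighted
  square integral of the test gradient.\<close>

definition domf :: "real => real => real" where
 "domf c t = indicator good t * (4 * ss t + 2 * Gam (mu t) (active (l 0) t) + c) / 2"

lemma domf_integrable: "integrable lborel (domf c)"
proof -
 have e: "domf c t = (4 * (indicator good t * ss t) + 2 * (indicator good t *\<^sub>R (I01 t * Gam (mu t) (active (l 0) t))) + c * indicator good t) / 2" for t
  using good01 by (auto simp: domf_def indicator_def)
 have "emeasure lborel good <= emeasure lborel {0..1::real}" by (rule emeasure_mono) (use good01 in auto)
 hence "emeasure lborel good < infty" by (simp add: le_less_trans)
 thus ?thesis unfolding e using good_sets by (intro integrable_divide Bint_add integrable_mult_right ss_integrable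
   integrable_mult_indicator Qf_int[OF curve tests_l]) auto
qed

lemma flux_bound:
 assumes t: "t : {0..1}" and g: "g : bm borel" "C >= 0" "!!p. abs (g p) <= C * hh p"
 shows "abs (flux t g) <= domf (C^2 * KC) t"
proof (cases "t : good")
 case True
 note P = prob[OF t]
 have "abs (flux t g) <= (1 * (LINT p|Th (mu t). (vv t p)^2) + (LINT p|Th (mu t). (g p)^2) / 1) / 2" unfolding flux_def
  by (rule L2_product[OF vv_Th(1)[OF t] Th_bm[OF P g(1)] vv_sq(1)[OF t] hdom_sq_integrable[OF P g]]) simp
 moreover have "(LINT p|Th (mu t). (g p)^2) <= C^2 * KC"
  using Th_int[OF P kdom_prod[OF g(1) g(1) g(2) g(2) g(3) g(3)]] by (simp add: power2_eq_square)
 ultimately show ?thesis using vv_sq[OF t] True by (simp add: domf_def)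
next
 case False
 thus ?thesis by (simp add: flux_bad domf_def)
qed

lemma weak_continuity:
 assumes "cts f" "bounded (range f)"
 shows "continuous_on {0..1} (%t. \<integral>x. f x \<partial>mu t :: real)" unfolding continuous_on_def
 using wcurve_wconv[OF curve] assms unfolding wconv_def by simp

text \<open>Over one interval of a partition the integral of Phi(t, .) against \<open>mu t\<close>
  changes in two ways: the test function moves while the measure is frozen at the right end, and the
  measure moves while the test function is frozen at the left end. The first change is a time
  integral of \<open>T.dt\<close>, the second half a flux integral. The sums telescope to 0, as
  \<open>Phi\<close> vanishes at times 0 and 1, and converge by
  \<open>riemann_diagonal\<close>.\<close>

lemma nu_continuity_equation:
 assumes Phi: "test_function 1 Phi"
 shows "(LINT t:{0..1}|lborel. (LINT x|(mu t). deriv (%s. Phi (s, x)) t)) +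
    1 / 2 * (LINT t:{0..1}|lborel. signed_integral (nu t) (%(x, y). Phi (t, y) - Phi (t, x))) = 0"
proof -
 interpret T: test_fun Phi by unfold_locales (rule Phi)
 obtain C where C: "C >= 0" "!!a p. abs (dif (T.slice a) p) <= C * hh p" "!!a b x. abs (T.slice a x - T.slice b x) <= C * abs (a - b)"
  "!!p. abs (T.dt p) <= C" unfolding dif_def by (rule T.bounds) blast
 have dm: "dif (T.slice a) : bm borel" for a by (rule dif_bm[OF T.slice_Cc])
 let ?m = "%r a. flux r (dif (T.slice a))" and ?H = "%r b. \<integral>x. T.dt (r, x) \<partial>mu b"
 let ?A = "%a b. \<integral>x. T.slice a x \<partial>mu b"
 have dtb: "T.dt : bm borel" by (rule cts_bm[OF T.dt_continuous])
 have dtx: "cts (%x. T.dt (r, x))" for r by (rule continuous_on_compose2[OF T.dt_continuous]) (auto intro: continuous_intros)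
 have dtr: "bounded (range (%x. T.dt (r, x)))" for r using C(4) unfolding bounded_iff by auto
 have pairm: "(%p. indicator A (fst p) * T.dt p) : bm (lborel \<Otimes>\<^sub>M mu b)" if "b : {0..1}" "A : sets borel" for b A
 proof -
  have "sets (lborel \<Otimes>\<^sub>M mu b) = sets (borel \<Otimes>\<^sub>M borel)" by (simp_all add: PMD[OF prob[OF that(1)]])
  hence s: "sets (lborel \<Otimes>\<^sub>M mu b) = sets (borel :: (real * 'a) measure)" by (simp only: borel_prod)
  have "(fst :: real * 'a => real) : bm borel" by (intro cts_bm continuous_on_fst continuous_on_id)
  from borel_measurable_times[OF measurable_compose[OF this borel_measurable_indicator[OF that(2)]] dtb]
  show ?thesis by (simp add: measurable_cong_sets[OF s])
 qed
 have Hm: "(%r. I01 r * ?H r b) : bm borel" if b: "b : {0..1}" for b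
 proof -
  interpret prob_space "mu b" by (rule PMD[OF prob[OF b]])
  have "(%(r, x). I01 r * T.dt (r, x)) : bm (lborel \<Otimes>\<^sub>M mu b)" using pairm[OF b] by (simp add: split_beta')
  from borel_measurable_lebesgue_integral[OF this] show ?thesis by simp
 qed
 have Hbd: "abs (?H r b) <= C" if "b : {0..1}" for r b
 proof -
  interpret prob_space "mu b" by (rule PMD[OF prob[OF that]])
  have i: "integrable (mu b) (%x. T.dt (r, x))" by (rule finb_integrable[OF PM_fb[OF prob[OF that]] cts_bm[OF dtx] C(4)])
  have "abs (?H r b) <= (LINT x|mu b. abs (T.dt (r, x)))" by simp
  also have "... <= (LINT x|mu b. C)" using i C by (intro integral_mono) auto
  finally show ?thesis by (simp add: prob_space)
 qed
 let ?X = "LINT r|lborel. I01 r * ?H r r"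
 have limH: "(%n. SUM i<Suc n. LINT r|lborel. indicator {i / Suc n..<Suc i / Suc n} r * ?H r ((i + 1) / Suc n)) ---->
  ?X"
 proof -
  have w: "integrable lborel (%r::real. I01 r * C)" by simp
  from riemann_diagonal[of ?H "%_. C" 1, OF Hm Hbd w weak_continuity[OF dtx dtr]]
  show ?thesis by simp
 qed
 have mcont: "continuous_on {0..1} (?m r)" if r: "r : {0..1}" for r unfolding continuous_on_sequentially
 proof (intro ballI allI impI)
  fix b and a :: "nat => real" assume "b : {0..1}" and a: "(ALL n. a n : {0..1}) & a ----> b"
  note P = prob[OF r]
  have hb: "hh : bm borel" by (rule cts_bm[OF hh_cont])
  have hi: "integrable (Th (mu r)) (%p. (hh p)^2)" using Th_int[OF P kdom_hh2] by auto
  have vm: "(%p. abs (vv r p)) : bm (Th (mu r))" using vv_Th[OF r] by simp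
  have i: "integrable (Th (mu r)) (%p. abs (vv r p) * hh p)" by (rule L2_product[OF vm Th_bm[OF P hb]]) (use vv_sq[OF r] hi in simp_all)
  have "(%n. LINT p|Th (mu r). vv r p * dif (T.slice (a n)) p) ----> (LINT p|Th (mu r). vv r p * dif (T.slice b) p)"
  proof (rule integral_dominated_convergence)
   show "(%p. vv r p * dif (T.slice c) p) : bm (Th (mu r))" for c using vv_Th[OF r] Th_bm[OF P dm] by simp
   thus "(%p. vv r p * dif (T.slice (a n)) p) : bm (Th (mu r))" for n .
   show "integrable (Th (mu r)) (%p. C * (abs (vv r p) * hh p))" by (rule integrable_mult_right[OF i])
   have sl: "(%n. T.slice (a n) x) ----> T.slice b x" for x
   proof -
    have "(%n. C * abs (a n - b)) ----> C * abs (b - b)" using a by (intro tendsto_intros) auto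
    hence z: "(%n. C * abs (a n - b)) ----> 0" by simp
    have "(%n. T.slice (a n) x - T.slice b x) ----> 0" by (rule Lim_null_comparison[OF always_eventually z]) (simp add: C)
    thus ?thesis by (rule LIM_zero_cancel)
   qed
   show "AE p in Th (mu r). (%n. vv r p * dif (T.slice (a n)) p) ----> vv r p * dif (T.slice b) p"
    unfolding dif_def by (intro AE_I2 tendsto_mult tendsto_const tendsto_diff sl)
   show "AE p in Th (mu r). norm (vv r p * dif (T.slice (a n)) p) <= C * (abs (vv r p) * hh p)" for n
   proof (rule AE_I2)
    fix p
    have "abs (vv r p) * abs (dif (T.slice (a n)) p) <= abs (vv r p) * (C * hh p)" by (intro mult_left_mono C) simp
    thus "norm (vv r p * dif (T.slice (a n)) p) <= C * (abs (vv r p) * hh p)" by (simp add: abs_mult mult_ac)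
   qed
  qed
  thus "(?m r o a) ----> ?m r b" by (simp add: flux_def o_def)
 qed
 let ?Y = "LINT r|lborel. I01 r * ?m r r"
 have limm: "(%n. SUM i<Suc n. LINT r|lborel. indicator {i / Suc n..<Suc i / Suc n} r * ?m r ((i + 0) / Suc n)) ---->
  ?Y"
 proof -
  have e: "I01 r * domf (C^2 * KC) r = domf (C^2 * KC) r" for r using good01 by (auto simp: domf_def indicator_def)
  have w: "integrable lborel (%r. I01 r * domf (C^2 * KC) r)" unfolding e by (rule domf_integrable)
  from riemann_diagonal[of ?m "domf (C^2 * KC)" 0, OF flux_measurable[OF T.slice_Cc] flux_bound[OF _ dm C(1,2)] w mcont]
  show ?thesis by simp
 qed
 have stepH: "?A a' b - ?A a b = (LINT r|lborel. indicator {a..<a'} r * ?H r b)"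
  if a: "0 <= a" "a <= a'" "a' <= 1" and b: "b : {0..1}" for a a' b
 proof -
  interpret Pb: prob_space "mu b" by (rule PMD[OF prob[OF b]])
  interpret pair_sigma_finite lborel "mu b" by unfold_locales
  have fb: "finb (mu b)" by (rule PM_fb[OF prob[OF b]])
  have si: "integrable (mu b) (T.slice a)" for a
  proof -
   obtain B where "!!x. abs (T.slice a x) <= B" by (rule Ccs_bounds[OF T.slice_Cc]) blast
   thus ?thesis by (rule finb_integrable[OF fb Ccs_measurable[OF T.slice_Cc]])
  qed
  have ftc: "(LINT r|lborel. indicator {a..a'} r * T.dt (r, x)) = T.slice a' x - T.slice a x" for x
  proof -
   have "cts (%r. T.dt (r, x))" by (rule continuous_on_compose2[OF T.dt_continuous]) (auto intro: continuous_intros)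
   hence "(LINT r|lborel. T.dt (r, x) * indicator {a..a'} r) = T.slice a' x - T.slice a x" using a T.dt_deriv unfolding T.slice_def
    by (intro integral_FTC_Icc_real) (auto simp: continuous_on_eq_continuous_at)
   thus ?thesis by (simp add: mult.commute)
  qed
  let ?f = "%r x. indicator {a..a'} r * T.dt (r, x)"
  have fi: "integrable (lborel \<Otimes>\<^sub>M mu b) (case_prod ?f)"
  proof (rule Bint_bound)
   show "integrable (lborel \<Otimes>\<^sub>M mu b) (%p. indicator ({a..a'} \<times> UNIV) p * C)"
   proof (intro integrable_mult_left integrable_real_indicator)
    have U: "UNIV : sets (mu b)" using PMD[OF prob[OF b]] by simp
    thus "{a..a'} \<times> UNIV : sets (lborel \<Otimes>\<^sub>M mu b)" by simp
    have "emeasure (lborel \<Otimes>\<^sub>M mu b) ({a..a'} \<times> UNIV) = emeasure lborel {a..a'} * emeasure (mu b) UNIV"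
     using Pb.emeasure_pair_measure_Times[of "{a..a'}" , OF _ U] by simp
    also have "... < infty" using Pb.emeasure_space_1 by (simp add: PMD[OF prob[OF b]] emeasure_lborel_Icc_eq)
    finally show "emeasure (lborel \<Otimes>\<^sub>M mu b) ({a..a'} \<times> UNIV) < infty" .
   qed
   show "case_prod ?f : bm (lborel \<Otimes>\<^sub>M mu b)" using pairm[OF b] by (simp add: split_beta')
   show "AE p in lborel \<Otimes>\<^sub>M mu b. norm (case_prod ?f p) <= norm (indicator ({a..a'} \<times> UNIV) p * C)"
    using C(1,4) by (auto simp: indicator_def)
  qed
  have "?A a' b - ?A a b = (LINT x|mu b. T.slice a' x - T.slice a x)" by (rule Bint_diff[symmetric, OF si si])
  also have "... = (LINT x|mu b. (LINT r|lborel. ?f r x))" by (simp only: ftc)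
  also have "... = (LINT r|lborel. (LINT x|mu b. ?f r x))" by (rule Fubini_integral[OF fi])
  also have "... = (LINT r|lborel. indicator {a..a'} r * ?H r b)" by simp
  also have "... = (LINT r|lborel. indicator {a..<a'} r * ?H r b)" by (rule integral_half_open[OF Hm[OF b] a(1,3)])
  finally show ?thesis .
 qed
 have stepm: "2 * (?A a t - ?A a s) = (LINT r|lborel. indicator {s..<t} r * ?m r a)"
  if "0 <= s" "s <= t" "t <= 1" for a s t
  using two_interval_flux[OF T.slice_Cc that] integral_half_open[OF flux_measurable[OF T.slice_Cc] that(1,3)] by simp
 have zero: "(SUM i<Suc n. LINT r|lborel. indicator {i / Suc n..<Suc i / Suc n} r * ?H r ((i + 1) / Suc n)) +
  (SUM i<Suc n. LINT r|lborel. indicator {i / Suc n..<Suc i / Suc n} r * ?m r ((i + 0) / Suc n)) / 2 = 0" for n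
 proof -
  let ?N = "real (Suc n)"
  have tm: "(LINT r|lborel. indicator {real i / ?N..<real (Suc i) / ?N} r * ?H r (real (i + 1) / ?N)) +
   (LINT r|lborel. indicator {real i / ?N..<real (Suc i) / ?N} r * ?m r (real (i + 0) / ?N)) / 2 =
   ?A (real (Suc i) / ?N) (real (Suc i) / ?N) - ?A (real i / ?N) (real i / ?N)" if i: "i < Suc n" for i
  proof -
   have b: "0 <= real i / ?N" "real i / ?N <= real (Suc i) / ?N" "real (Suc i) / ?N <= 1" using i by (auto intro!: divide_right_mono)
   have "real (Suc i) / ?N : {0..1}" using b by auto
   from stepH[OF b this] stepm[OF b, of "real i / ?N"] show ?thesis by simp
  qed
  have "(SUM i<Suc n. LINT r|lborel. indicator {real i / ?N..<real (Suc i) / ?N} r * ?H r (real (i + 1) / ?N)) +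
   (SUM i<Suc n. LINT r|lborel. indicator {real i / ?N..<real (Suc i) / ?N} r * ?m r (real (i + 0) / ?N)) / 2 =
   (SUM i<Suc n. ?A (real (Suc i) / ?N) (real (Suc i) / ?N) - ?A (real i / ?N) (real i / ?N))"
   unfolding sum_divide_distrib sum.distrib[symmetric] by (rule sum.cong[OF refl tm]) simp
  also have "... = ?A (real (Suc n) / ?N) (real (Suc n) / ?N) - ?A (real 0 / ?N) (real 0 / ?N)" by (rule sum_lessThan_telescope)
  also have "... = 0" by (simp add: T.slice_def T.zero_outside)
  finally show ?thesis .
 qed
 have "(%n. 0) ----> ?X + ?Y / 2"
  using tendsto_add[OF limH tendsto_divide[OF limm tendsto_const, of 2]] unfolding zero by simp
 hence 0: "?X + ?Y / 2 = 0" by (rule LIMSEQ_unique[OF _ tendsto_const])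
 have "(LINT t:{0..1}|lborel. (LINT x|(mu t). deriv (%s. Phi (s, x)) t)) = ?X"
  unfolding set_lebesgue_integral_def by (simp add: DERIV_imp_deriv[OF T.dt_deriv])
 moreover have "(LINT t:{0..1}|lborel. signed_integral (nu t) (%(x, y). Phi (t, y) - Phi (t, x))) = ?Y"
  unfolding set_lebesgue_integral_def
 proof (rule Bint_cong)
  fix t :: real
  have e: "(%(x, y). Phi (t, y) - Phi (t, x)) = dif (T.slice t)" by (auto simp: dif_def T.slice_def)
  show "I01 t *\<^sub>R signed_integral (nu t) (%(x, y). Phi (t, y) - Phi (t, x)) = I01 t * ?m t t"
  proof (cases "t : {0..1}")
   case True
   thus ?thesis unfolding e using nu_integral[OF True dm hdom_sq_integrable[OF prob dm C(1,2)]] by simp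
  qed simp
 qed simp
 ultimately show ?thesis using 0 by simp
qed

lemma nu_CE: "(mu, nu) : CE 1 (mu 0) (mu 1)" unfolding CE_def
proof (rule CollectI, unfold prod.case, intro conjI allI impI ballI refl)
 show "mu t : PM" if "t : {0..1}" for t by (rule prob[OF that])
 let ?Y = "top_of_set {0..1}"
 show "continuous_map ?Y weak_topology mu" unfolding weak_topology_def continuous_on_generated_topo_iff
 proof (intro conjI allI impI)
  fix U :: "'a measure set" assume "U : {{mu : PM. (LINT x|mu. f x) : U} | f U.
    cts f & bounded (range f) & open (U :: real set)}"
  then obtain f V where U: "U = {mu : PM. (LINT x|mu. f x) : V}" and f: "cts f" "bounded (range f)"
   and V: "open (V :: real set)" by auto
  have "openin ?Y ({0..1} Int (%t. LINT x|mu t. f x) -` V)"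
   using weak_continuity[OF f] V unfolding continuous_openin_preimage_eq by simp
  moreover have "{0..1} Int (%t. LINT x|mu t. f x) -` V = mu -` U Int topspace ?Y" using prob by (auto simp: U)
  ultimately show "openin ?Y (mu -` U Int topspace ?Y)" by simp
 next
  have "PM <= \<Union>{{mu : PM. (LINT x|mu. f (x :: 'a)) : U} | f U.
    cts f & bounded (range f) & open (U :: real set)}" by auto
  thus "mu ` topspace ?Y <= \<Union>{{mu : PM. (LINT x|mu. f x) : U} | f U.
    cts f & bounded (range f) & open (U :: real set)}" using prob by auto
 qed
 show "nu : measurable (restrict_space borel {0..1}) (borel_of_topology (weak_star_topology G))" by (rule nu_measurable)
 let ?X = "\<integral>\<^sup>+t\<in>{0..1}. nn_integral (total_variation (nu t)) (%(x, y). ennreal (min 1 (norm (x - y)))) \<partial>lborel"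
 show "?X < infty"
 proof -
  let ?h = "%t. domf 0 t + I01 t * (KC / 2)"
  have hi: "integrable lborel ?h" by (intro Bint_add domf_integrable) (simp_all)
  have d0: "domf 0 t >= 0" for t using ss Gam_nonneg by (simp add: domf_def)
  have h0: "?h t >= 0" for t using d0 KC by simp
  have "?X <= nint lborel ?h"
  proof (intro nn_integral_mono)
   fix t :: real
   show "nn_integral (total_variation (nu t)) (%(x, y). ennreal (min 1 (norm (x - y)))) * I01 t <= ennreal (?h t)"
   proof (cases "t : {0..1}")
    case True
    have "(KC + (LINT p|Th (mu t). (vv t p)^2)) / 2 <= ?h t"
     using vv_sq[OF True] using True by (cases "t : good") (simp_all add: domf_def vv_def)
    from order_trans[OF nu_varh[OF True] ennreal_leI[OF this]] show ?thesis using True by (simp add: nn_integral_total_variation[OF nu_signed_radon])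
   qed simp
  qed
  also have "... = ennreal (LINT t|lborel. ?h t)" by (rule nn_integral_eq_integral[OF hi]) (simp only: h0 AE_I2)
  also have "... < infty" by simp
  finally show ?thesis .
 qed
qed (rule nu_continuity_equation)

end

section \<open>Identification of the two distances and conclusion\<close>

context jump_setting begin

lemma finite_energy_CE:
 assumes w: "wcurve 0 1 mu" and fin: "energy 0 1 mu < infty"
 obtains nu where "(mu, nu) : CE 1 (mu 0) (mu 1)" "(Act mu nu) <= energy 0 1 mu"
proof -
 define e where "e = enn2real (energy 0 1 mu)"
 have e: "energy 0 1 mu = ennreal e" "e >= 0" using fin by (simp_all add: e_def)
 have ev: "ev 0 1 mu l <= e" if "l : tests 0 1" for l using energy_upper[OF that, of mu] e by simp
 have ex: "EX l. l : tests 0 1 & ev 0 1 mu l >= e - 1 / 4 ^ n" for n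
 proof (rule ccontr)
  assume no: "~ ?thesis"
  have "energy 0 1 mu <= ennreal (max 0 (e - 1 / 4 ^ n))"
   by (rule energy_least, rule ennreal_leI) (use no in \<open>auto simp: not_le intro: less_imp_le\<close>)
  hence m: "e <= max 0 (e - 1 / 4 ^ n)" unfolding e by (rule ennreal_le_iff[THEN iffD1, rotated]) simp
  have L: "e - d <= 0" if "e <= max 0 (e - d)" "d > 0" for d :: real using that by simp
  \<comment> \<open>Since no list reaches \<open>e - 1 / 4 ^ n\<close>, the supremum
    \<open>e\<close> can exceed this number only through the truncation at 0. But then the empty
    list, with value 0, reaches it.\<close>
  have "e - 1 / 4 ^ n <= 0" by (rule L[OF m]) simp
  moreover have "ev 0 1 mu [] = 0"
  proof -
   have "active [] r = (%x. 0)" for r :: real by auto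
   thus ?thesis by (simp add: ev_def Qf_def Gam_zero)
  qed
  ultimately have "[] : tests 0 1 & ev 0 1 mu [] >= e - 1 / 4 ^ n" by simp
  thus False using no by simp
 qed
 from choice[OF allI[OF ex]] obtain l where l: "ALL n. l n : tests 0 1 & ev 0 1 mu (l n) >= e - 1 / 4 ^ n" ..
 interpret finite_energy_curve J theta mu e l by unfold_locales (use w e ev l in auto)
 show ?thesis by (rule that[OF nu_CE]) (use nu_action_le e in simp)
qed

lemma W_eq_dW: "W theta J x y = dW x y"
proof -
 let ?S = "{Act mu nu | mu nu. (mu, nu) : CE 1 x y}"
 have "Inf ?S = E2 x y"
 proof (rule antisym)
  show "Inf ?S <= E2 x y" unfolding E2_def
  proof (rule INF_greatest)
   fix mu assume "mu : curves x y"
   hence mu: "wcurve 0 1 mu" "mu 0 = x" "mu 1 = y" by (auto simp: curves_def)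
   show "Inf ?S <= energy 0 1 mu"
   proof (cases "energy 0 1 mu < infty")
    case True
    obtain nu where nu: "(mu, nu) : CE 1 (mu 0) (mu 1)" "(Act mu nu) <= energy 0 1 mu" by (rule finite_energy_CE[OF mu(1) True])
    have "(Act mu nu) : ?S" using nu mu by auto
    from order_trans[OF Inf_lower[OF this] nu(2)] show ?thesis .
   qed (simp add: less_top[symmetric])
  qed
  show "E2 x y <= Inf ?S"
  proof (rule Inf_greatest)
   fix a assume "a : ?S"
   then obtain mu nu where a: "a = (Act mu nu)" and ce: "(mu, nu) : CE 1 x y" by auto
   have "E2 x y <= energy 0 1 mu" by (rule E2_le[OF CE_energy_le(1)[OF ce] CE_D(3,4)[OF ce]])
   also have "... <= a" unfolding a by (rule CE_energy_le[OF ce])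
   finally show "E2 x y <= a" .
  qed
 qed
 thus ?thesis unfolding W_def dW_def by simp
qed

text \<open>The identity is shown to be continuous into the weak topology, for which only the
  generating sets have to be checked.\<close>

lemma weak_open_metric_open:
 assumes "openin weak_topology U"
 shows "openin (WT) U"
proof -
 let ?S = "{{mu : PM. (LINT x|mu. f x) : U} | f U.
    cts (f :: 'a => real) & bounded (range f) & open (U :: real set)}"
 have "continuous_map (WT) (topology_generated_by ?S) (%x. x)" unfolding continuous_on_generated_topo_iff
 proof (intro conjI allI impI)
  have op: "openin (WT) PM" unfolding openin_extended_metric_topology by (auto intro!: exI[of _ 1])
  have "topspace (WT) <= PM" unfolding topspace_def openin_extended_metric_topology by auto
  with op have ts: "topspace (WT) = PM" using openin_subset by auto
  fix V assume "V : ?S"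
  then obtain f T where V: "V = {mu : PM. (LINT x|mu. f x) : T}"
   and f: "cts (f :: 'a => real)" "bounded (range f)" and T: "open (T :: real set)" by auto
  have "EX e>0. ALL y:PM. W theta J x y < e --> y : V" if x: "x : V" for x
  proof -
   have x': "x : PM" "(LINT z|x. f z) : T" using x by (auto simp: V)
   obtain e where "e > 0" "!!y. y : PM ==> dW x y < e ==> (LINT z|y. f z) : T" by (rule dW_weak_nhd[OF x'(1) f T x'(2)]) blast
   thus ?thesis unfolding W_eq_dW V by auto
  qed
  hence "openin (WT) V" unfolding openin_extended_metric_topology by (auto simp: V)
  moreover have "(%x. x) -` V Int topspace (WT) = V" unfolding ts by (auto simp: V)
  ultimately show "openin (WT) ((%x. x) -` V Int topspace (WT))" by simp
 next
  have "topspace (WT) <= PM" unfolding topspace_def openin_extended_metric_topology by auto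
  also have "... <= \<Union>?S" by auto
  finally show "(%x. x) ` topspace (WT) <= \<Union>?S" by simp
 qed
 from openin_continuous_map_preimage[OF this[folded weak_topology_def] assms]
 have "openin (WT) {x : topspace (WT). x : U}" .
 moreover have "U <= topspace (WT)"
 proof -
  have "openin (WT) PM" unfolding openin_extended_metric_topology by (auto intro!: exI[of _ 1])
  moreover have "U <= PM" using openin_subset[OF assms] unfolding weak_topology_def by auto
  ultimately show ?thesis using openin_subset by auto
 qed
 moreover have "{x : topspace (WT). x : U} = U" using calculation by auto
 ultimately show ?thesis by simp
qed

lemma W_extended_metric: "extended_metric_on PM (W theta J)" unfolding extended_metric_on_def W_eq_dW using dW_eq_0 dW_refl dW_sym dW_triangle by auto

context
 fixes tau :: "'a measure"
 assumes tau: "tau : PM"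
begin

lemma comp_PM: "x : fcomp tau ==> x : PM"
 and component_tau: "x : fcomp tau ==> dW x tau < infty" by (simp_all add: finite_component_def W_eq_dW)

lemma component_finite:
 assumes "x : fcomp tau" "y : fcomp tau"
 shows "dW x y < infty"
proof -
 have "dW x y <= dW x tau + dW tau y" by (rule dW_triangle[OF comp_PM[OF assms(1)] tau comp_PM[OF assms(2)]])
 also have "... < infty" using component_tau[OF assms(1)] component_tau[OF assms(2)] dW_sym by simp
 finally show ?thesis .
qed

lemma componentI: "x : fcomp tau ==> y : PM ==> dW x y < infty ==> y : fcomp tau"
proof -
 assume x: "x : fcomp tau" and y: "y : PM" and f: "dW x y < infty"
 have "dW y tau <= dW y x + dW x tau" by (rule dW_triangle[OF y comp_PM[OF x] tau])
 also have "... < infty" using component_tau[OF x] f dW_sym by simp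
 finally show ?thesis using y by (simp add: finite_component_def W_eq_dW)
qed

lemma component_real:
 assumes "x : fcomp tau" "y : fcomp tau"
 shows "ennreal (enn2real (dW x y)) = dW x y" using component_finite[OF assms] by simp

lemma component_metric: "Metric_space (fcomp tau) (%x y. enn2real (dW x y))"
proof
 show "0 <= enn2real (dW x y)" for x y by simp
 show "enn2real (dW x y) = enn2real (dW y x)" for x y by (simp add: dW_sym)
 show "(enn2real (dW x y) = 0) = (x = y)" if "x : fcomp tau" "y : fcomp tau" for x y
 proof
  assume "enn2real (dW x y) = 0"
  hence "dW x y = 0" using component_real[OF that] by simp
  thus "x = y" by (rule dW_eq_0[OF comp_PM[OF that(1)] comp_PM[OF that(2)]])
 next
  assume "x = y"
  thus "enn2real (dW x y) = 0" using dW_refl[OF comp_PM[OF that(1)]] by simp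
 qed
 show "enn2real (dW x z) <= enn2real (dW x y) + enn2real (dW y z)"
  if m: "x : fcomp tau" "y : fcomp tau" "z : fcomp tau" for x y z
 proof -
  have "ennreal (enn2real (dW x z)) <= ennreal (enn2real (dW x y)) + ennreal (enn2real (dW y z))"
   unfolding component_real[OF m(1,3)] component_real[OF m(1,2)] component_real[OF m(2,3)]
   by (rule dW_triangle[OF comp_PM[OF m(1)] comp_PM[OF m(2)] comp_PM[OF m(3)]])
  also have "... = ennreal (enn2real (dW x y) + enn2real (dW y z))" by simp
  finally show ?thesis by (rule ennreal_le_iff[THEN iffD1, rotated]) simp
 qed
qed

lemma component_complete: "Metric_space.mcomplete (fcomp tau) (%x y. enn2real (dW x y))"
proof -
 interpret Metric_space "fcomp tau" "%x y. enn2real (dW x y)" by (rule component_metric)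
 show ?thesis unfolding mcomplete_def
 proof (intro allI impI)
  fix sg assume sg: "MCauchy sg"
  hence mem: "sg n : fcomp tau" for n unfolding MCauchy_def by auto
  have cau: "EX N. ALL n>=N. ALL m>=N. dW (sg n) (sg m) < ennreal e" if e: "e > 0" for e
  proof -
   obtain N where N: "!!n m. N <= n ==> N <= m ==> enn2real (dW (sg n) (sg m)) < e" using sg e unfolding MCauchy_def by blast
   have "dW (sg n) (sg m) < ennreal e" if "N <= n" "N <= m" for n m
   proof -
    have "ennreal (enn2real (dW (sg n) (sg m))) < ennreal e" using N[OF that] by (intro ennreal_lessI e)
    thus ?thesis unfolding component_real[OF mem mem] .
   qed
   thus ?thesis by auto
  qed
  obtain z where z: "z : PM" "ALL e>0. EX N. ALL n>=N. dW (sg n) z <= ennreal e"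
  proof (rule dW_complete[OF comp_PM[OF mem] cau])
   fix z assume "z : PM" and "!!e. e > 0 ==> EX N. ALL n>=N. dW (sg n) z <= ennreal e"
   thus thesis by (intro that allI impI)
  qed
  obtain N where "ALL n>=N. dW (sg n) z <= ennreal 1" using z zero_less_one by blast
  hence "dW (sg N) z < infty" by (auto intro: le_less_trans)
  from componentI[OF mem z(1) this] have zc: "z : fcomp tau" .
  have "limitin mtopology sg z sequentially" unfolding limitin_metric eventually_sequentially
  proof (intro conjI zc allI impI)
   fix e :: real assume "e > 0"
   hence "e / 2 > 0" by simp
   with z(2) obtain N where N: "ALL n>=N. dW (sg n) z <= ennreal (e / 2)" by blast
   have "enn2real (dW (sg n) z) < e" if "n >= N" for n
   proof -
    have "ennreal (enn2real (dW (sg n) z)) <= ennreal (e / 2)" unfolding component_real[OF mem zc] using N that by simp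
    thus ?thesis using `e > 0` by simp
   qed
   thus "EX N. ALL n>=N. sg n : fcomp tau & enn2real (dW (sg n) z) < e" using mem by auto
  qed
  thus "EX x. limitin mtopology sg x sequentially" by auto
 qed
qed

lemma component_geodesic: "geodesic_space (fcomp tau) (%x y. enn2real (dW x y))" unfolding geodesic_space_def
proof (intro ballI)
 fix x y assume x: "x : fcomp tau" and y: "y : fcomp tau"
 define a where "a = enn2real (dW x y)"
 have a: "a >= 0" "dW x y = ennreal a" using component_real[OF x y] by (simp_all add: a_def)
 obtain mu where mu: "wcurve 0 1 mu" "mu 0 = x" "mu 1 = y"
  "!!s t. s : {0..1} ==> t : {0..1} ==> dW (mu s) (mu t) = ennreal (abs (t - s) * a)" by (rule dW_geodesic[OF comp_PM[OF x] comp_PM[OF y] a]) blast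
 have "mu t : fcomp tau" if t: "t : {0..1}" for t by (rule componentI[OF x wcurveD(1)[OF mu(1) t]]) (use mu(4)[of 0] t mu in simp)
 moreover have "enn2real (dW (mu s) (mu t)) = abs (t - s) * a" if "s : {0..1}" "t : {0..1}" for s t unfolding mu(4)[OF that] using a by simp
 ultimately show "EX c. (ALL t:{0..1}. c t : fcomp tau) & c 0 = x & c 1 = y &
   (ALL s:{0..1}. ALL t:{0..1}. enn2real (dW (c s) (c t)) = abs (t - s) * enn2real (dW x y))" using mu unfolding a_def by blast
qed

end

end

theorem theorem1p2:
  fixes J :: "'a::euclidean_space \<Rightarrow> 'a measure" and m :: "'a measure"
    and \<theta> :: "real \<Rightarrow> real \<Rightarrow> real"
  assumes "jump_kernel J" and "radon_on UNIV m" and "reversible J m" and "mean_function \<theta>"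
  shows "extended_metric_on prob_measures (W \<theta> J) \<and>
    (\<forall>U. openin weak_topology U \<longrightarrow> openin (extended_metric_topology prob_measures (W \<theta> J)) U) \<and>
    (\<forall>\<tau>\<in>prob_measures.
       (\<forall>\<mu>\<in>finite_component \<theta> J \<tau>. \<forall>\<nu>\<in>finite_component \<theta> J \<tau>. W \<theta> J \<mu> \<nu> < \<infinity>) \<and>
       Metric_space (finite_component \<theta> J \<tau>) (\<lambda>\<mu> \<nu>. enn2real (W \<theta> J \<mu> \<nu>)) \<and>
       Metric_space.mcomplete (finite_component \<theta> J \<tau>) (\<lambda>\<mu> \<nu>. enn2real (W \<theta> J \<mu> \<nu>)) \<and>
       geodesic_space (finite_component \<theta> J \<tau>) (\<lambda>\<mu> \<nu>. enn2real (W \<theta> J \<mu> \<nu>)))"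
proof -
  interpret jump_setting J \<theta> by unfold_locales (rule assms)+
  show ?thesis
  proof (intro conjI allI impI ballI)
    show "extended_metric_on prob_measures (W \<theta> J)" by (rule W_extended_metric)
    show "openin (extended_metric_topology prob_measures (W \<theta> J)) U" if "openin weak_topology U" for U
      by (rule weak_open_metric_open[OF that])
    fix \<tau> :: "'a measure" assume \<tau>: "\<tau> \<in> prob_measures"
    show "W \<theta> J \<mu> \<nu> < \<infinity>" if "\<mu> \<in> finite_component \<theta> J \<tau>" "\<nu> \<in> finite_component \<theta> J \<tau>" for \<mu> \<nu>
      unfolding W_eq_dW by (rule component_finite[OF \<tau> that])
    show "Metric_space (finite_component \<theta> J \<tau>) (\<lambda>\<mu> \<nu>. enn2real (W \<theta> J \<mu> \<nu>))"
      unfolding W_eq_dW by (rule component_metric[OF \<tau>])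
    show "Metric_space.mcomplete (finite_component \<theta> J \<tau>) (\<lambda>\<mu> \<nu>. enn2real (W \<theta> J \<mu> \<nu>))"
      unfolding W_eq_dW by (rule component_complete[OF \<tau>])
    show "geodesic_space (finite_component \<theta> J \<tau>) (\<lambda>\<mu> \<nu>. enn2real (W \<theta> J \<mu> \<nu>))"
      unfolding W_eq_dW by (rule component_geodesic[OF \<tau>])
  qed
qed

end
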